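(* Let $(\mathcal A_i)_{i\in I}$ be a family of unital $*$-algebras. Let $\{\phi^{(k)}_i\mid i\in I\}$ ($k\in\mathbb N$) be a sequence of families of states, each $\phi^{(k)}_i$ being a state on $\mathcal A_i$. Assume that we have states $\phi_i$ on $\mathcal A_i$ such that, for each $i\in I$, $\phi^{(k)}_i\stackrel{s}{\to}\phi_i$ (strong convergence) when $k\to\infty$. Then $$\ast_{i\in I}\phi^{(k)}_i\ \stackrel{s}{\to}\ \ast_{i\in I}\phi_i \qquad (k\to\infty),$$ as states on the algebraic unital free product $\mathcal A=\ast_{i\in I}\mathcal A_i$.
   Context: Conventions. Inner products are linear in the second variable. Every unital $*$-algebra $\mathcal A$ is assumed to be a unital $*$-subalgebra of some unital $C^*$-algebra. A state on $\mathcal A$ is a linear functional $\phi$ with $\phi(1)=1$ and $\phi(x^*x)\ge 0$ for all $x\in\mathcal A$; it is understood that the associated GNS representation acts by bounded operators. The GNS construction gives a Hilbert space $L_2(\phi)$, a $*$-homomorphism $\pi_\phi:\mathcal A\to B(L_2(\phi))$ and a cyclic unit vector $\xi_\phi$ with $\phi(c)=\langle \xi_\phi,\pi_\phi(c)\xi_\phi\rangle$ for all $c\in\mathcal A$ ($\pi_\phi$ need not be injective). Strong convergence. For states $\phi,\phi^{(k)}$ ($k\in\mathbb N$) on $\mathcal A$, write $\phi^{(k)}\stackrel{s}{\to}\phi$ if $\phi^{(k)}(c)\to\phi(c)$ and $\|\pi_{\phi^{(k)}}(c)\|\to\|\pi_\phi(c)\|$ for every $c\in\mathcal A$. Free product of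 states. Let $\phi_i$ be a state on $\mathcal A_i$ ($i\in I$), $H_i=L_2(\phi_i)$, $\xi_i=\xi_{\phi_i}$, $\pi_i=\pi_{\phi_i}$. Let $\mathcal A=\ast_{i\in I}\mathcal A_i$ be the algebraic free product of unital $*$-algebras (units identified). Put $H_i^\circ=H_i\ominus\mathbb C\xi_i$. The free product Hilbert space (Voiculescu) is $$H=\mathbb C\xi\oplus\bigoplus_{d\ge1}\ \bigoplus_{i_1\ne i_2\ne\cdots\ne i_d}H_{i_1}^\circ\otimes_2\cdots\otimes_2 H_{i_d}^\circ ,$$ with unit vector $\xi$ (the condition $i_1\ne i_2\ne\cdots\ne i_d$ means that consecutive indices differ). For each $i$ let $H(i)\subset H$ be the closed subspace spanned by $\xi$ and the summands with $i_1\neq i$; there is a canonical unitary $U_i:H_i\otimes_2 H(i)\to H$ given by $\xi_i\otimes\xi\mapsto\xi$, $h\otimes\xi\mapsto h$, $\xi_i\otimes w\mapsto w$, $h\otimes w\mapsto h\otimes w$ (for $h\in H_i^\circ$ and $w$ in a summand with $i_1\ne i$). Let $\pi:\mathcal A\to B(H)$ be the unique unital $*$-homomorphism with $\pi(a)=U_i(\pi_i(a)\otimes 1)U_i^*$ for $a\in\mathcal A_i$. The free product state $\ast_{i\in I}\phi_i$ on $\mathcal A$ is $b\mapsto\langle\xi,\pi(b)\xi\rangle$. *)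

theory Defs
  imports "HOL-Analysis.Analysis" "HOL-Algebra.QuotRing" "HOL-Algebra.Module"
begin

section \<open>Unital star-algebras and C*-algebras\<close>

definition complex_ring :: "complex ring" where
  "complex_ring = \<lparr>carrier = UNIV, mult = (*), one = 1, zero = 0, add = (+)\<rparr>"

record 'a star_algebra = "(complex, 'a) module" +
  star :: "'a \<Rightarrow> 'a"

locale unital_star_algebra = Ring.ring A + Module.module complex_ring A
  for A :: "('a, 'm) star_algebra_scheme" (structure) +
  assumes smult_mult_left:
      "\<lbrakk>x \<in> carrier A; y \<in> carrier A\<rbrakk> \<Longrightarrow> (c \<odot> x) \<otimes> y = c \<odot> (x \<otimes> y)"
    and smult_mult_right:
      "\<lbrakk>x \<in> carrier A; y \<in> carrier A\<rbrakk> \<Longrightarrow> x \<otimes> (c \<odot> y) = c \<odot> (x \<otimes> y)"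
    and star_closed: "x \<in> carrier A \<Longrightarrow> star A x \<in> carrier A"
    and star_star: "x \<in> carrier A \<Longrightarrow> star A (star A x) = x"
    and star_add:
      "\<lbrakk>x \<in> carrier A; y \<in> carrier A\<rbrakk> \<Longrightarrow> star A (x \<oplus> y) = star A x \<oplus> star A y"
    and star_smult: "x \<in> carrier A \<Longrightarrow> star A (c \<odot> x) = cnj c \<odot> star A x"
    and star_mult:
      "\<lbrakk>x \<in> carrier A; y \<in> carrier A\<rbrakk> \<Longrightarrow> star A (x \<otimes> y) = star A y \<otimes> star A x"

definition unital_star_hom ::
  "('a, 'm) star_algebra_scheme \<Rightarrow> ('b, 'n) star_algebra_scheme \<Rightarrow> ('a \<Rightarrow> 'b) \<Rightarrow> bool" where
  "unital_star_hom A B f \<longleftrightarrow>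
     f \<in> ring_hom A B \<and>
     (\<forall>c. \<forall>x\<in>carrier A. f (c \<odot>\<^bsub>A\<^esub> x) = c \<odot>\<^bsub>B\<^esub> f x) \<and>
     (\<forall>x\<in>carrier A. f (star A x) = star B (f x))"

record 'a normed_star_algebra = "'a star_algebra" +
  alg_norm :: "'a \<Rightarrow> real"

locale unital_cstar_algebra = unital_star_algebra B
  for B :: "('a, 'm) normed_star_algebra_scheme" (structure) +
  assumes alg_norm_eq_0: "x \<in> carrier B \<Longrightarrow> alg_norm B x = 0 \<longleftrightarrow> x = \<zero>"
    and alg_norm_triangle:
      "\<lbrakk>x \<in> carrier B; y \<in> carrier B\<rbrakk> \<Longrightarrow> alg_norm B (x \<oplus> y) \<le> alg_norm B x + alg_norm B y"
    and alg_norm_smult: "x \<in> carrier B \<Longrightarrow> alg_norm B (c \<odot> x) = cmod c * alg_norm B x"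
    and alg_norm_mult:
      "\<lbrakk>x \<in> carrier B; y \<in> carrier B\<rbrakk> \<Longrightarrow> alg_norm B (x \<otimes> y) \<le> alg_norm B x * alg_norm B y"
    and cstar_identity: "x \<in> carrier B \<Longrightarrow> alg_norm B (star B x \<otimes> x) = (alg_norm B x)\<^sup>2"
    and complete:
      "\<lbrakk>\<And>n. s n \<in> carrier B;
        \<And>e. e > 0 \<Longrightarrow> \<exists>N. \<forall>m\<ge>N. \<forall>n\<ge>N. alg_norm B (s m \<ominus> s n) < e\<rbrakk>
       \<Longrightarrow> \<exists>l\<in>carrier B. (\<lambda>n. alg_norm B (s n \<ominus> l)) \<longlonglongrightarrow> 0"


section \<open>Hilbert spaces as completions\<close>

text \<open>Hilbert spaces have explicit carriers. The fields \<open>mult\<close> and \<open>one\<close> inherited from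
  the record \<open>module\<close> play no role. Inner products are linear in the second variable.\<close>

record 'h inner_space = "(complex, 'h) module" +
  ip :: "'h \<Rightarrow> 'h \<Rightarrow> complex"

definition ip_norm :: "('h, 'm) inner_space_scheme \<Rightarrow> 'h \<Rightarrow> real" where
  "ip_norm H x = sqrt (Re (ip H x x))"

text \<open>The separated completion of a complex vector space \<open>V\<close> with respect to a positive
  semidefinite sesquilinear form \<open>q\<close>: Cauchy sequences modulo sequences at distance tending
  to 0. This divides out the null vectors of \<open>q\<close> and completes in one step.\<close>

definition form_norm :: "('v \<Rightarrow> 'v \<Rightarrow> complex) \<Rightarrow> 'v \<Rightarrow> real" where
  "form_norm q v = sqrt (Re (q v v))"

definition cauchy_seqs ::
  "(complex, 'v, 'm) module_scheme \<Rightarrow> ('v \<Rightarrow> 'v \<Rightarrow> complex) \<Rightarrow> (nat \<Rightarrow> 'v) set" where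
  "cauchy_seqs V q =
     {s. (\<forall>n. s n \<in> carrier V) \<and>
         (\<forall>e>0. \<exists>N. \<forall>m\<ge>N. \<forall>n\<ge>N. form_norm q (s m \<ominus>\<^bsub>V\<^esub> s n) < e)}"

definition cauchy_class ::
  "(complex, 'v, 'm) module_scheme \<Rightarrow> ('v \<Rightarrow> 'v \<Rightarrow> complex) \<Rightarrow> (nat \<Rightarrow> 'v) \<Rightarrow> (nat \<Rightarrow> 'v) set" where
  "cauchy_class V q s =
     {t \<in> cauchy_seqs V q. (\<lambda>n. form_norm q (s n \<ominus>\<^bsub>V\<^esub> t n)) \<longlonglongrightarrow> 0}"

definition rep :: "(nat \<Rightarrow> 'v) set \<Rightarrow> nat \<Rightarrow> 'v" where
  "rep X = (SOME s. s \<in> X)"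

definition completion ::
  "(complex, 'v, 'm) module_scheme \<Rightarrow> ('v \<Rightarrow> 'v \<Rightarrow> complex) \<Rightarrow> (nat \<Rightarrow> 'v) set inner_space" where
  "completion V q =
     \<lparr>carrier = cauchy_class V q ` cauchy_seqs V q,
      mult = undefined,
      one = undefined,
      zero = cauchy_class V q (\<lambda>n. \<zero>\<^bsub>V\<^esub>),
      add = (\<lambda>X Y. cauchy_class V q (\<lambda>n. rep X n \<oplus>\<^bsub>V\<^esub> rep Y n)),
      smult = (\<lambda>c X. cauchy_class V q (\<lambda>n. c \<odot>\<^bsub>V\<^esub> rep X n)),
      ip = (\<lambda>X Y. lim (\<lambda>n. q (rep X n) (rep Y n)))\<rparr>"

definition completion_embed ::
  "(complex, 'v, 'm) module_scheme \<Rightarrow> ('v \<Rightarrow> 'v \<Rightarrow> complex) \<Rightarrow> 'v \<Rightarrow> (nat \<Rightarrow> 'v) set" where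
  "completion_embed V q v = cauchy_class V q (\<lambda>n. v)"


section \<open>Bounded operators\<close>

text \<open>Operators are extensional functions, i.e. \<open>undefined\<close> off the carrier of their domain.\<close>

definition bounded_ops ::
  "('h, 'm) inner_space_scheme \<Rightarrow> ('k, 'n) inner_space_scheme \<Rightarrow> ('h \<Rightarrow> 'k) set" where
  "bounded_ops H K =
     {T \<in> carrier H \<rightarrow>\<^sub>E carrier K.
        (\<forall>x\<in>carrier H. \<forall>y\<in>carrier H. T (x \<oplus>\<^bsub>H\<^esub> y) = T x \<oplus>\<^bsub>K\<^esub> T y) \<and>
        (\<forall>c. \<forall>x\<in>carrier H. T (c \<odot>\<^bsub>H\<^esub> x) = c \<odot>\<^bsub>K\<^esub> T x) \<and>
        (\<exists>C. \<forall>x\<in>carrier H. ip_norm K (T x) \<le> C * ip_norm H x)}"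

definition adjoint ::
  "('h, 'm) inner_space_scheme \<Rightarrow> ('k, 'n) inner_space_scheme \<Rightarrow> ('h \<Rightarrow> 'k) \<Rightarrow> 'k \<Rightarrow> 'h" where
  "adjoint H K T =
     (THE S. S \<in> bounded_ops K H \<and>
        (\<forall>x\<in>carrier H. \<forall>y\<in>carrier K. ip H (S y) x = ip K y (T x)))"

definition unitary_op ::
  "('h, 'm) inner_space_scheme \<Rightarrow> ('k, 'n) inner_space_scheme \<Rightarrow> ('h \<Rightarrow> 'k) \<Rightarrow> bool" where
  "unitary_op H K U \<longleftrightarrow>
     U \<in> bounded_ops H K \<and> U ` carrier H = carrier K \<and>
     (\<forall>x\<in>carrier H. \<forall>y\<in>carrier H. ip K (U x) (U y) = ip H x y)"

definition op_algebra :: "('h, 'm) inner_space_scheme \<Rightarrow> ('h \<Rightarrow> 'h) star_algebra" where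
  "op_algebra H =
     \<lparr>carrier = bounded_ops H H,
      mult = (\<lambda>S T. compose (carrier H) S T),
      one = (\<lambda>x\<in>carrier H. x),
      zero = (\<lambda>x\<in>carrier H. \<zero>\<^bsub>H\<^esub>),
      add = (\<lambda>S T. \<lambda>x\<in>carrier H. S x \<oplus>\<^bsub>H\<^esub> T x),
      smult = (\<lambda>c T. \<lambda>x\<in>carrier H. c \<odot>\<^bsub>H\<^esub> T x),
      star = adjoint H H\<rparr>"

definition op_norm :: "('h, 'm) inner_space_scheme \<Rightarrow> ('h \<Rightarrow> 'h) \<Rightarrow> real" where
  "op_norm H T = (SUP x\<in>{x \<in> carrier H. ip_norm H x \<le> 1}. ip_norm H (T x))"


section \<open>States, the GNS construction and strong convergence\<close>

text \<open>The last clause says that left multiplications are bounded for the seminorm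
  \<open>x \<mapsto> \<phi> (x\<^sup>* x)\<^sup>1\<^sup>/\<^sup>2\<close>, i.e. that the GNS representation acts by bounded operators.\<close>

definition state :: "('a, 'm) star_algebra_scheme \<Rightarrow> ('a \<Rightarrow> complex) \<Rightarrow> bool" where
  "state A \<phi> \<longleftrightarrow>
     (\<forall>x\<in>carrier A. \<forall>y\<in>carrier A. \<phi> (x \<oplus>\<^bsub>A\<^esub> y) = \<phi> x + \<phi> y) \<and>
     (\<forall>c. \<forall>x\<in>carrier A. \<phi> (c \<odot>\<^bsub>A\<^esub> x) = c * \<phi> x) \<and>
     \<phi> \<one>\<^bsub>A\<^esub> = 1 \<and>
     (\<forall>x\<in>carrier A. \<phi> (star A x \<otimes>\<^bsub>A\<^esub> x) \<in> \<real>\<^sub>\<ge>\<^sub>0) \<and>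
     (\<forall>a\<in>carrier A. \<exists>C. \<forall>x\<in>carrier A.
        Re (\<phi> (star A (a \<otimes>\<^bsub>A\<^esub> x) \<otimes>\<^bsub>A\<^esub> (a \<otimes>\<^bsub>A\<^esub> x))) \<le> C * Re (\<phi> (star A x \<otimes>\<^bsub>A\<^esub> x)))"

definition gns_form ::
  "('a, 'm) star_algebra_scheme \<Rightarrow> ('a \<Rightarrow> complex) \<Rightarrow> 'a \<Rightarrow> 'a \<Rightarrow> complex" where
  "gns_form A \<phi> x y = \<phi> (star A x \<otimes>\<^bsub>A\<^esub> y)"

definition gns_space ::
  "('a, 'm) star_algebra_scheme \<Rightarrow> ('a \<Rightarrow> complex) \<Rightarrow> (nat \<Rightarrow> 'a) set inner_space" where
  "gns_space A \<phi> = completion A (gns_form A \<phi>)"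

definition gns_vec ::
  "('a, 'm) star_algebra_scheme \<Rightarrow> ('a \<Rightarrow> complex) \<Rightarrow> (nat \<Rightarrow> 'a) set" where
  "gns_vec A \<phi> = completion_embed A (gns_form A \<phi>) \<one>\<^bsub>A\<^esub>"

definition gns_rep ::
  "('a, 'm) star_algebra_scheme \<Rightarrow> ('a \<Rightarrow> complex) \<Rightarrow> 'a \<Rightarrow> (nat \<Rightarrow> 'a) set \<Rightarrow> (nat \<Rightarrow> 'a) set" where
  "gns_rep A \<phi> a =
     (\<lambda>X\<in>carrier (gns_space A \<phi>). cauchy_class A (gns_form A \<phi>) (\<lambda>n. a \<otimes>\<^bsub>A\<^esub> rep X n))"

definition strongly_converges ::
  "('a, 'm) star_algebra_scheme \<Rightarrow> (nat \<Rightarrow> 'a \<Rightarrow> complex) \<Rightarrow> ('a \<Rightarrow> complex) \<Rightarrow> bool" where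
  "strongly_converges A \<phi>k \<phi> \<longleftrightarrow>
     (\<forall>k. state A (\<phi>k k)) \<and> state A \<phi> \<and>
     (\<forall>c\<in>carrier A.
        (\<lambda>k. \<phi>k k c) \<longlonglongrightarrow> \<phi> c \<and>
        (\<lambda>k. op_norm (gns_space A (\<phi>k k)) (gns_rep A (\<phi>k k) c))
          \<longlonglongrightarrow> op_norm (gns_space A \<phi>) (gns_rep A \<phi> c))"


section \<open>Hilbert space tensor products and direct sums\<close>

definition delta :: "'s \<Rightarrow> 's \<Rightarrow> complex" where
  "delta s = (\<lambda>t. if t = s then 1 else 0)"

definition free_module :: "'s set \<Rightarrow> (complex, 's \<Rightarrow> complex) module" where
  "free_module S =
     \<lparr>carrier = {f. finite {s. f s \<noteq> 0} \<and> {s. f s \<noteq> 0} \<subseteq> S},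
      mult = undefined,
      one = undefined,
      zero = (\<lambda>s. 0),
      add = (\<lambda>f g s. f s + g s),
      smult = (\<lambda>c f s. c * f s)\<rparr>"

text \<open>The sesquilinear form on a free vector space with prescribed values \<open>K s t\<close> on pairs
  of basis vectors.\<close>

definition kernel_form ::
  "('s \<Rightarrow> 's \<Rightarrow> complex) \<Rightarrow> ('s \<Rightarrow> complex) \<Rightarrow> ('s \<Rightarrow> complex) \<Rightarrow> complex" where
  "kernel_form K f g = (\<Sum>s | f s \<noteq> 0. \<Sum>t | g t \<noteq> 0. cnj (f s) * g t * K s t)"

text \<open>Hilbert tensor products are obtained from formal combinations of elementary tensors and
  the form \<open>\<langle>h \<otimes> k, h' \<otimes> k'\<rangle> = \<langle>h, h'\<rangle> \<langle>k, k'\<rangle>\<close>; the bilinearity relations are null vectors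
  of this form.\<close>

definition tensor_kernel ::
  "('h, 'm) inner_space_scheme \<Rightarrow> ('k, 'n) inner_space_scheme \<Rightarrow> 'h \<times> 'k \<Rightarrow> 'h \<times> 'k \<Rightarrow> complex" where
  "tensor_kernel H K p q = ip H (fst p) (fst q) * ip K (snd p) (snd q)"

definition tensor_space ::
  "('h, 'm) inner_space_scheme \<Rightarrow> ('k, 'n) inner_space_scheme \<Rightarrow>
   (nat \<Rightarrow> 'h \<times> 'k \<Rightarrow> complex) set inner_space" where
  "tensor_space H K =
     completion (free_module (carrier H \<times> carrier K)) (kernel_form (tensor_kernel H K))"

definition tensor_elem ::
  "('h, 'm) inner_space_scheme \<Rightarrow> ('k, 'n) inner_space_scheme \<Rightarrow> 'h \<Rightarrow> 'k \<Rightarrow>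
   (nat \<Rightarrow> 'h \<times> 'k \<Rightarrow> complex) set" where
  "tensor_elem H K h k =
     completion_embed (free_module (carrier H \<times> carrier K)) (kernel_form (tensor_kernel H K))
       (delta (h, k))"

definition tensor_op ::
  "('h, 'm) inner_space_scheme \<Rightarrow> ('k, 'n) inner_space_scheme \<Rightarrow> ('h \<Rightarrow> 'h) \<Rightarrow> ('k \<Rightarrow> 'k) \<Rightarrow>
   (nat \<Rightarrow> 'h \<times> 'k \<Rightarrow> complex) set \<Rightarrow> (nat \<Rightarrow> 'h \<times> 'k \<Rightarrow> complex) set" where
  "tensor_op H K S T =
     (THE R. R \<in> bounded_ops (tensor_space H K) (tensor_space H K) \<and>
        (\<forall>h\<in>carrier H. \<forall>k\<in>carrier K.
           R (tensor_elem H K h k) = tensor_elem H K (S h) (T k)))"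

text \<open>The tensor product of a finite list of Hilbert spaces; the empty product is
  one-dimensional and spanned by the unit vector given by the empty list.\<close>

definition tensor_list_kernel ::
  "('h, 'm) inner_space_scheme list \<Rightarrow> 'h list \<Rightarrow> 'h list \<Rightarrow> complex" where
  "tensor_list_kernel Hs hs hs' = (\<Prod>j<length Hs. ip (Hs ! j) (hs ! j) (hs' ! j))"

definition tensor_list_space ::
  "('h, 'm) inner_space_scheme list \<Rightarrow> (nat \<Rightarrow> 'h list \<Rightarrow> complex) set inner_space" where
  "tensor_list_space Hs =
     completion (free_module (listset (map carrier Hs))) (kernel_form (tensor_list_kernel Hs))"

definition tensor_list_elem ::
  "('h, 'm) inner_space_scheme list \<Rightarrow> 'h list \<Rightarrow> (nat \<Rightarrow> 'h list \<Rightarrow> complex) set" where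
  "tensor_list_elem Hs hs =
     completion_embed (free_module (listset (map carrier Hs)))
       (kernel_form (tensor_list_kernel Hs)) (delta hs)"

definition hilbert_sum ::
  "'j set \<Rightarrow> ('j \<Rightarrow> ('h, 'm) inner_space_scheme) \<Rightarrow> ('j \<Rightarrow> 'h) inner_space" where
  "hilbert_sum J H =
     \<lparr>carrier = {v \<in> Pi\<^sub>E J (\<lambda>j. carrier (H j)). (\<lambda>j. (ip_norm (H j) (v j))\<^sup>2) summable_on J},
      mult = undefined,
      one = undefined,
      zero = (\<lambda>j\<in>J. \<zero>\<^bsub>H j\<^esub>),
      add = (\<lambda>v w. \<lambda>j\<in>J. v j \<oplus>\<^bsub>H j\<^esub> w j),
      smult = (\<lambda>c v. \<lambda>j\<in>J. c \<odot>\<^bsub>H j\<^esub> v j),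
      ip = (\<lambda>v w. \<Sum>\<^sub>\<infinity>j\<in>J. ip (H j) (v j) (w j))\<rparr>"


section \<open>The free product of Hilbert spaces with unit vectors\<close>

definition circ :: "'h inner_space \<Rightarrow> 'h \<Rightarrow> 'h inner_space" where
  "circ H \<xi> = H\<lparr>carrier := {h \<in> carrier H. ip H \<xi> h = 0}\<rparr>"

definition alternating :: "'i set \<Rightarrow> 'i list set" where
  "alternating I = {js. set js \<subseteq> I \<and> distinct_adj js}"

definition circ_list :: "('i \<Rightarrow> 'h inner_space) \<Rightarrow> ('i \<Rightarrow> 'h) \<Rightarrow> 'i list \<Rightarrow> 'h inner_space list" where
  "circ_list H \<xi> js = map (\<lambda>j. circ (H j) (\<xi> j)) js"

type_synonym ('i, 'h) fp_vector = "'i list \<Rightarrow> (nat \<Rightarrow> 'h list \<Rightarrow> complex) set"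

definition fp_space ::
  "'i set \<Rightarrow> ('i \<Rightarrow> 'h inner_space) \<Rightarrow> ('i \<Rightarrow> 'h) \<Rightarrow> ('i, 'h) fp_vector inner_space" where
  "fp_space I H \<xi> = hilbert_sum (alternating I) (\<lambda>js. tensor_list_space (circ_list H \<xi> js))"

text \<open>The elementary tensor \<open>h\<^sub>1 \<otimes> \<dots> \<otimes> h\<^sub>d\<close> in the summand with index word \<open>js\<close>,
  as a vector of the free product space.\<close>

definition fp_elem ::
  "'i set \<Rightarrow> ('i \<Rightarrow> 'h inner_space) \<Rightarrow> ('i \<Rightarrow> 'h) \<Rightarrow> 'i list \<Rightarrow> 'h list \<Rightarrow> ('i, 'h) fp_vector" where
  "fp_elem I H \<xi> js hs =
     (\<lambda>ks\<in>alternating I. if ks = js then tensor_list_elem (circ_list H \<xi> js) hs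
        else \<zero>\<^bsub>tensor_list_space (circ_list H \<xi> ks)\<^esub>)"

definition fp_vac ::
  "'i set \<Rightarrow> ('i \<Rightarrow> 'h inner_space) \<Rightarrow> ('i \<Rightarrow> 'h) \<Rightarrow> ('i, 'h) fp_vector" where
  "fp_vac I H \<xi> = fp_elem I H \<xi> [] []"

definition not_starting :: "'i set \<Rightarrow> 'i \<Rightarrow> 'i list set" where
  "not_starting I i = {js \<in> alternating I. js = [] \<or> hd js \<noteq> i}"

text \<open>\<open>H(i)\<close>: the closed span of a family of orthogonal summands consists of the vectors
  whose other components vanish.\<close>

definition fp_subspace ::
  "'i set \<Rightarrow> ('i \<Rightarrow> 'h inner_space) \<Rightarrow> ('i \<Rightarrow> 'h) \<Rightarrow> 'i \<Rightarrow> ('i, 'h) fp_vector inner_space" where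
  "fp_subspace I H \<xi> i = (fp_space I H \<xi>)
     \<lparr>carrier := {v \<in> carrier (fp_space I H \<xi>). \<forall>js \<in> alternating I - not_starting I i.
        v js = \<zero>\<^bsub>tensor_list_space (circ_list H \<xi> js)\<^esub>}\<rparr>"

text \<open>The canonical unitary \<open>U\<^sub>i : H\<^sub>i \<otimes> H(i) \<rightarrow> H\<close>. It is determined by its values on
  \<open>\<xi>\<^sub>i \<otimes> w\<close> and \<open>h \<otimes> w\<close> for elementary tensors \<open>w\<close>; the case \<open>js = []\<close>, \<open>w = \<xi>\<close> gives
  \<open>\<xi>\<^sub>i \<otimes> \<xi> \<mapsto> \<xi>\<close> and \<open>h \<otimes> \<xi> \<mapsto> h\<close>.\<close>

definition fp_unitary ::
  "'i set \<Rightarrow> ('i \<Rightarrow> 'h inner_space) \<Rightarrow> ('i \<Rightarrow> 'h) \<Rightarrow> 'i \<Rightarrow>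
   (nat \<Rightarrow> 'h \<times> ('i, 'h) fp_vector \<Rightarrow> complex) set \<Rightarrow> ('i, 'h) fp_vector" where
  "fp_unitary I H \<xi> i =
     (THE U. unitary_op (tensor_space (H i) (fp_subspace I H \<xi> i)) (fp_space I H \<xi>) U \<and>
        (\<forall>js\<in>not_starting I i. \<forall>hs\<in>listset (map carrier (circ_list H \<xi> js)).
           U (tensor_elem (H i) (fp_subspace I H \<xi> i) (\<xi> i) (fp_elem I H \<xi> js hs))
             = fp_elem I H \<xi> js hs \<and>
           (\<forall>h\<in>carrier (circ (H i) (\<xi> i)).
              U (tensor_elem (H i) (fp_subspace I H \<xi> i) h (fp_elem I H \<xi> js hs))
                = fp_elem I H \<xi> (i # js) (h # hs))))"

text \<open>\<open>T \<mapsto> U\<^sub>i (T \<otimes> 1) U\<^sub>i\<^sup>*\<close>\<close>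

definition fp_ampliation ::
  "'i set \<Rightarrow> ('i \<Rightarrow> 'h inner_space) \<Rightarrow> ('i \<Rightarrow> 'h) \<Rightarrow> 'i \<Rightarrow> ('h \<Rightarrow> 'h) \<Rightarrow>
   ('i, 'h) fp_vector \<Rightarrow> ('i, 'h) fp_vector" where
  "fp_ampliation I H \<xi> i T =
     (let F = fp_space I H \<xi>; F\<^sub>i = fp_subspace I H \<xi> i; U = fp_unitary I H \<xi> i in
      (\<lambda>v\<in>carrier F. U (tensor_op (H i) F\<^sub>i T (\<lambda>w\<in>carrier F\<^sub>i. w)
                      (adjoint (tensor_space (H i) F\<^sub>i) F U v))))"


section \<open>The algebraic free product\<close>

text \<open>The free unital star-algebra on the disjoint union of the carriers: finitely supported
  functions on words, with convolution as product. The letter \<open>(i, a)\<close> stands for \<open>a\<close> viewed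
  in the \<open>i\<close>-th algebra, and \<open>(i, a)\<^sup>* = (i, a\<^sup>*)\<close>.\<close>

definition fp_words :: "'i set \<Rightarrow> ('i \<Rightarrow> 'a star_algebra) \<Rightarrow> ('i \<times> 'a) list set" where
  "fp_words I A = lists (SIGMA i:I. carrier (A i))"

definition word_star :: "('i \<Rightarrow> 'a star_algebra) \<Rightarrow> ('i \<times> 'a) list \<Rightarrow> ('i \<times> 'a) list" where
  "word_star A w = rev (map (\<lambda>(i, a). (i, star (A i) a)) w)"

definition free_star_algebra ::
  "'i set \<Rightarrow> ('i \<Rightarrow> 'a star_algebra) \<Rightarrow> (('i \<times> 'a) list \<Rightarrow> complex) star_algebra" where
  "free_star_algebra I A =
     \<lparr>carrier = {f. finite {w. f w \<noteq> 0} \<and> {w. f w \<noteq> 0} \<subseteq> fp_words I A},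
      mult = (\<lambda>f g w. \<Sum>n\<le>length w. f (take n w) * g (drop n w)),
      one = delta [],
      zero = (\<lambda>w. 0),
      add = (\<lambda>f g w. f w + g w),
      smult = (\<lambda>c f w. c * f w),
      star = (\<lambda>f w. if w \<in> fp_words I A then cnj (f (word_star A w)) else 0)\<rparr>"

definition fp_relations ::
  "'i set \<Rightarrow> ('i \<Rightarrow> 'a star_algebra) \<Rightarrow> (('i \<times> 'a) list \<Rightarrow> complex) set" where
  "fp_relations I A =
     (let F = free_star_algebra I A; x = (\<lambda>i a. delta [(i, a)]) in
      {x i (a \<oplus>\<^bsub>A i\<^esub> b) \<ominus>\<^bsub>F\<^esub> (x i a \<oplus>\<^bsub>F\<^esub> x i b) | i a b.
         i \<in> I \<and> a \<in> carrier (A i) \<and> b \<in> carrier (A i)} \<union>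
      {x i (c \<odot>\<^bsub>A i\<^esub> a) \<ominus>\<^bsub>F\<^esub> c \<odot>\<^bsub>F\<^esub> x i a | i c a. i \<in> I \<and> a \<in> carrier (A i)} \<union>
      {x i (a \<otimes>\<^bsub>A i\<^esub> b) \<ominus>\<^bsub>F\<^esub> (x i a \<otimes>\<^bsub>F\<^esub> x i b) | i a b.
         i \<in> I \<and> a \<in> carrier (A i) \<and> b \<in> carrier (A i)} \<union>
      {x i \<one>\<^bsub>A i\<^esub> \<ominus>\<^bsub>F\<^esub> \<one>\<^bsub>F\<^esub> | i. i \<in> I})"

definition fp_ideal ::
  "'i set \<Rightarrow> ('i \<Rightarrow> 'a star_algebra) \<Rightarrow> (('i \<times> 'a) list \<Rightarrow> complex) set" where
  "fp_ideal I A = genideal (free_star_algebra I A) (fp_relations I A)"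

definition fp_class ::
  "'i set \<Rightarrow> ('i \<Rightarrow> 'a star_algebra) \<Rightarrow> (('i \<times> 'a) list \<Rightarrow> complex) \<Rightarrow>
   (('i \<times> 'a) list \<Rightarrow> complex) set" where
  "fp_class I A f = fp_ideal I A +>\<^bsub>free_star_algebra I A\<^esub> f"

definition fp_algebra ::
  "'i set \<Rightarrow> ('i \<Rightarrow> 'a star_algebra) \<Rightarrow> (('i \<times> 'a) list \<Rightarrow> complex) set star_algebra" where
  "fp_algebra I A =
     (let F = free_star_algebra I A; Q = F Quot fp_ideal I A in
      \<lparr>carrier = carrier Q, mult = mult Q, one = one Q, zero = zero Q, add = add Q,
       smult = (\<lambda>c X. \<Union>f\<in>X. fp_class I A (c \<odot>\<^bsub>F\<^esub> f)),
       star = (\<lambda>X. \<Union>f\<in>X. fp_class I A (star F f))\<rparr>)"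

definition fp_incl ::
  "'i set \<Rightarrow> ('i \<Rightarrow> 'a star_algebra) \<Rightarrow> 'i \<Rightarrow> 'a \<Rightarrow> (('i \<times> 'a) list \<Rightarrow> complex) set" where
  "fp_incl I A i a = fp_class I A (delta [(i, a)])"


section \<open>The free product of states\<close>

definition fp_rep ::
  "'i set \<Rightarrow> ('i \<Rightarrow> 'a star_algebra) \<Rightarrow> ('i \<Rightarrow> 'a \<Rightarrow> complex) \<Rightarrow>
   (('i \<times> 'a) list \<Rightarrow> complex) set \<Rightarrow>
   ('i, (nat \<Rightarrow> 'a) set) fp_vector \<Rightarrow> ('i, (nat \<Rightarrow> 'a) set) fp_vector" where
  "fp_rep I A \<phi> =
     (let H = (\<lambda>i. gns_space (A i) (\<phi> i)); \<xi> = (\<lambda>i. gns_vec (A i) (\<phi> i)) in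
      THE \<pi>. \<pi> \<in> extensional (carrier (fp_algebra I A)) \<and>
        unital_star_hom (fp_algebra I A) (op_algebra (fp_space I H \<xi>)) \<pi> \<and>
        (\<forall>i\<in>I. \<forall>a\<in>carrier (A i).
           \<pi> (fp_incl I A i a) = fp_ampliation I H \<xi> i (gns_rep (A i) (\<phi> i) a)))"

definition fp_state ::
  "'i set \<Rightarrow> ('i \<Rightarrow> 'a star_algebra) \<Rightarrow> ('i \<Rightarrow> 'a \<Rightarrow> complex) \<Rightarrow>
   (('i \<times> 'a) list \<Rightarrow> complex) set \<Rightarrow> complex" where
  "fp_state I A \<phi> b =
     (let H = (\<lambda>i. gns_space (A i) (\<phi> i)); \<xi> = (\<lambda>i. gns_vec (A i) (\<phi> i)) in
      ip (fp_space I H \<xi>) (fp_vac I H \<xi>) (fp_rep I A \<phi> b (fp_vac I H \<xi>)))"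

end

(* Moments of a free product depend continuously on the moments of the factors; this gives convergence of the states
and the lower bound for the norms. For the upper bound, a vector of the free product space is split according to which
letters an element x of word length at most n can reach. Up to a factor polynomial in n, this bounds the norm of x by its
norm on right modules spanned by finitely many words. After orthonormalisation, such a norm is that of a finite matrix over
one factor (by a conditional expectation), where strong convergence of the factors applies. Applying the estimate to
(x* x)^(2^m) and taking roots removes the polynomial factor. *)

theory Submission
  imports Defs
begin

text \<open>The letters of a factor fill an infinite-dimensional space, and no finite part of it is
  preserved by the generators. Each factor is therefore given an increasing chain of finite
  orthonormal families, starting with the unit, such that the adjoint of a generator maps one family
  into the closed span of the next. A letter orthogonal to the N-th family then stays orthogonal to
  the unit under N generators, so nothing to its right is ever touched: a short word acts on the
  left factor alone. The chain is exact only in the limit state. Along the sequence the inclusion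
  into the next span fails by a residual of vanishing norm, and a finite rank correction of every
  generator repairs it. The right factor is removed by the Schur product theorem, after sorting the
  image by the length of the left factor, because inner products factor only for left factors of
  equal length. Matrices are controlled through the entries of their high powers, since strong
  convergence speaks about the norms of single elements only.\<close>

abbreviation (input) mem_carrier (infix "@:" 50) where "x @: H \<equiv> x \<in> carrier H"
abbreviation (input) add_in ("_ +[_] _" [65, 0, 66] 65) where "x +[H] y \<equiv> x \<oplus>\<^bsub>H\<^esub> y"
abbreviation (input) smult_in ("_ *[_] _" [70, 0, 71] 70) where "c *[H] x \<equiv> c \<odot>\<^bsub>H\<^esub> x"
abbreviation (input) mult_in ("_ .[_] _" [70, 0, 71] 70) where "x .[H] y \<equiv> x \<otimes>\<^bsub>H\<^esub> y"
abbreviation (input) zero_in ("0[_]") where "0[H] \<equiv> \<zero>\<^bsub>H\<^esub>"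
abbreviation (input) one_in ("1[_]") where "1[H] \<equiv> \<one>\<^bsub>H\<^esub>"
notation (input) LIMSEQ (infix "---->" 60)


section \<open>Inner products on explicit carriers\<close>

definition vdist :: "(complex, 'v, 'm) module_scheme => ('v => 'v => complex) => 'v => 'v => real" where
 "vdist V q x y = form_norm q (x +[V] (- 1) *[V] y)"

lemma of_real_cmod_sq: "(complex_of_real (cmod c))^2 = c * cnj c" using complex_norm_square[of c] by simp

text \<open>Vectors of a semidefinite space are compared only through the values of
  \<open>q\<close>, so the axioms consist of closure and of properties of \<open>q\<close>.
  Differences are formed with the scalar -1, which keeps negation out of the axioms.\<close>

locale semi_ip =
 fixes V :: "(complex, 'v, 'm) module_scheme" (structure) and q :: "'v => 'v => complex"
 assumes zeroC [simp, intro]: "\<zero> : carrier V" and addC [simp, intro]: "[|x @: V; y @: V|] ==> x \<oplus> y @: V"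
 and smultC [simp, intro]: "x @: V ==> c \<odot> x @: V" and q_add: "[|x @: V; y @: V; z @: V|] ==> q z (x \<oplus> y) = q z x + q z y"
 and q_smult: "[|x @: V; z @: V|] ==> q z (c \<odot> x) = c * q z x" and q_sym: "[|x @: V; y @: V|] ==> q x y = cnj (q y x)"
 and q_pos: "x @: V ==> 0 <= Re (q x x)" and q_zero: "z @: V ==> q z \<zero> = 0"
begin

lemma q_add_left: "[|x @: V; y @: V; z @: V|] ==> q (x \<oplus> y) z = q x z + q y z"
 using q_sym[of "x \<oplus> y" z] q_sym[of x z] q_sym[of y z] by (simp add: q_add)

lemma q_smult_left: "[|x @: V; z @: V|] ==> q (c \<odot> x) z = cnj c * q x z" using q_sym[of "c \<odot> x" z] q_sym[of x z] by (simp add: q_smult)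

lemma q_zero_left: "z @: V ==> q \<zero> z = 0" using q_sym[of \<zero> z] by (simp add: q_zero)

lemmas q_simps = q_add q_smult q_add_left q_smult_left q_zero q_zero_left

lemma q_self_real: "x @: V ==> q x x = of_real (Re (q x x))" by (metis Reals_cnj_iff of_real_Re q_sym)

lemma fn_ge0 [simp, intro]: "x @: V ==> 0 <= form_norm q x" by (simp add: form_norm_def q_pos)

lemma fn_sq: "x @: V ==> (form_norm q x)^2 = Re (q x x)" by (simp add: form_norm_def q_pos)

lemma q_self: "x @: V ==> q x x = of_real ((form_norm q x)^2)" using fn_sq q_self_real by simp

text \<open>The form is evaluated at x + t y with t a real multiple of - cnj (q x y). All cross
  terms become real and a quadratic inequality in the multiplier s remains. If y is a null vector it
  is affine in s, and a large s forces q x y = 0.\<close>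

lemma CS_sq:
 assumes x: "x @: V" and y: "y @: V" shows "(cmod (q x y))^2 <= Re (q x x) * Re (q y y)"
proof -
 define a where "a = Re (q x x)"
 define b where "b = Re (q y y)"
 define c where "c = q x y"
 have pos: "0 <= a - 2 * s * (cmod c)^2 + s^2 * (cmod c)^2 * b" for s :: real
 proof -
 define t where "t = - of_real s * cnj c"
 have "q (x \<oplus> t \<odot> y) (x \<oplus> t \<odot> y) = q x x + t * q x y + cnj t * q y x + cnj t * t * q y y"
 using x y by (simp add: q_simps algebra_simps)
 moreover have "q y x = cnj c" using q_sym[OF y x] by (simp add: c_def)
 moreover have "t * c = - of_real s * of_real ((cmod c)^2)" by (simp add: t_def of_real_cmod_sq mult_ac)
 moreover have "cnj t * cnj c = - of_real s * of_real ((cmod c)^2)" by (simp add: t_def of_real_cmod_sq mult_ac)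
 moreover have "cnj t * t = of_real (s^2 * (cmod c)^2)" by (simp add: t_def power2_eq_square of_real_cmod_sq[unfolded power2_eq_square] mult_ac)
 moreover have "q y y = of_real b" using q_self_real[OF y] by (simp add: b_def)
 ultimately have "q (x \<oplus> t \<odot> y) (x \<oplus> t \<odot> y)
 = q x x - of_real s * of_real ((cmod c)^2) - of_real s * of_real ((cmod c)^2)
 + of_real (s^2 * (cmod c)^2) * of_real b" unfolding c_def by (simp add: algebra_simps)
 then have "Re (q (x \<oplus> t \<odot> y) (x \<oplus> t \<odot> y)) = a - 2 * s * (cmod c)^2 + s^2 * (cmod c)^2 * b" by (simp add: a_def flip: of_real_mult)
 then show ?thesis using q_pos[of "x \<oplus> t \<odot> y"] x y by simp
 qed
 have b0: "0 <= b" using q_pos[OF y] b_def by simp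
 have a0: "0 <= a" using q_pos[OF x] a_def by simp
 show ?thesis
 proof (cases "b = 0")
 case True
 have "cmod c = 0"
 proof (rule ccontr)
 assume "cmod c ~= 0"
 then have "(cmod c)^2 > 0" by simp
 then show False using pos[of "(a + 1) / (cmod c)^2"] True a0 by (simp add: divide_simps split: if_splits)
 qed
 then show ?thesis using True a_def b_def c_def by simp
 next
 case False
 with b0 have "b > 0" by simp
 with pos[of "1 / b"] have "(cmod c)^2 <= a * b" by (simp add: divide_simps power2_eq_square split: if_splits)
 then show ?thesis by (simp add: a_def b_def c_def)
 qed
qed

lemma CS:
 assumes x: "x @: V" and y: "y @: V" shows "cmod (q x y) <= form_norm q x * form_norm q y"
 by (rule power2_le_imp_le) (use CS_sq[OF x y] x y in \<open>simp_all add: power_mult_distrib fn_sq\<close>)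

lemma fn_triangle:
 assumes x: "x @: V" and y: "y @: V" shows "form_norm q (x \<oplus> y) <= form_norm q x + form_norm q y"
proof (rule power2_le_imp_le)
 have "q (x \<oplus> y) (x \<oplus> y) = q x x + q y y + (q x y + cnj (q x y))" using x y q_sym[OF y x] by (simp add: q_simps algebra_simps)
 then have "(form_norm q (x \<oplus> y))^2 = Re (q x x) + Re (q y y) + 2 * Re (q x y)" using x y by (simp add: fn_sq)
 also have "... <= Re (q x x) + Re (q y y) + 2 * (form_norm q x * form_norm q y)" using CS[OF x y] complex_Re_le_cmod[of "q x y"] by linarith
 also have "... = (form_norm q x + form_norm q y)^2" using x y by (simp add: power2_sum fn_sq)
 finally show "(form_norm q (x \<oplus> y))^2 <= (form_norm q x + form_norm q y)^2" .
qed (use x y in auto)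

lemma fn_smult: "x @: V ==> form_norm q (c \<odot> x) = cmod c * form_norm q x"
proof -
 assume x: "x @: V"
 have "q (c \<odot> x) (c \<odot> x) = of_real ((cmod c)^2) * q x x" using x by (simp add: q_simps of_real_cmod_sq mult_ac)
 then have "Re (q (c \<odot> x) (c \<odot> x)) = (cmod c)^2 * Re (q x x)" by simp
 then show ?thesis by (simp add: form_norm_def real_sqrt_mult)
qed

lemma fn_zero [simp]: "form_norm q \<zero> = 0" by (simp add: form_norm_def q_zero)

text \<open>Stands in for equality of vectors, which a semidefinite form cannot detect.\<close>

lemma fn_cong:
 assumes "x @: V" "y @: V" "!!z. z @: V ==> q z x = q z y" shows "form_norm q x = form_norm q y"
proof -
 have "q x x = q y y" using assms by (metis q_sym)
 then show ?thesis by (simp add: form_norm_def)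
qed

lemma vd_nonneg [simp, intro]: "[|x @: V; y @: V|] ==> 0 <= vdist V q x y" by (simp add: vdist_def)

lemma vd_self [simp]: "x @: V ==> vdist V q x x = 0" unfolding vdist_def by (subst fn_cong[where y = \<zero>]) (auto simp: q_simps)

lemma vd_zero [simp]: "x @: V ==> vdist V q x \<zero> = form_norm q x" unfolding vdist_def by (rule fn_cong) (auto simp: q_simps)

lemma vd_sym: "[|x @: V; y @: V|] ==> vdist V q x y = vdist V q y x" unfolding vdist_def
 by (subst fn_cong[where x = "x \<oplus> (- 1) \<odot> y" and y = "(- 1) \<odot> (y \<oplus> (- 1) \<odot> x)"]) (auto simp: q_simps fn_smult algebra_simps)

lemma vd_triangle:
 assumes "x @: V" "y @: V" "z @: V" shows "vdist V q x z <= vdist V q x y + vdist V q y z"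
proof -
 have "vdist V q x z = form_norm q ((x \<oplus> (- 1) \<odot> y) \<oplus> (y \<oplus> (- 1) \<odot> z))"
 unfolding vdist_def using assms by (intro fn_cong) (auto simp: q_simps)
 also have "... <= vdist V q x y + vdist V q y z" unfolding vdist_def using assms by (intro fn_triangle) auto
 finally show ?thesis .
qed

lemma vd_add:
 assumes "x @: V" "y @: V" "x' @: V" "y' @: V" shows "vdist V q (x \<oplus> y) (x' \<oplus> y') <= vdist V q x x' + vdist V q y y'"
proof -
 have "vdist V q (x \<oplus> y) (x' \<oplus> y') = form_norm q ((x \<oplus> (- 1) \<odot> x') \<oplus> (y \<oplus> (- 1) \<odot> y'))"
 unfolding vdist_def using assms by (intro fn_cong) (auto simp: q_simps algebra_simps)
 also have "... <= vdist V q x x' + vdist V q y y'" unfolding vdist_def using assms by (intro fn_triangle) auto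
 finally show ?thesis .
qed

lemma vd_smult:
 assumes "x @: V" "y @: V" shows "vdist V q (c \<odot> x) (c \<odot> y) = cmod c * vdist V q x y"
proof -
 have "vdist V q (c \<odot> x) (c \<odot> y) = form_norm q (c \<odot> (x \<oplus> (- 1) \<odot> y))"
 unfolding vdist_def using assms by (intro fn_cong) (auto simp: q_simps algebra_simps)
 then show ?thesis using assms by (simp add: fn_smult vdist_def)
qed

lemma fn_le_vd:
 assumes "x @: V" "y @: V" shows "form_norm q x <= form_norm q y + vdist V q x y" using vd_triangle[of x y \<zero>] assms by simp

lemma q_diff_le:
 assumes "x @: V" "y @: V" "x' @: V" "y' @: V" shows "cmod (q x y - q x' y') <= form_norm q x * vdist V q y y' + vdist V q x x' * form_norm q y'"
proof -
 have "q x y - q x' y' = q x (y \<oplus> (- 1) \<odot> y') + q (x \<oplus> (- 1) \<odot> x') y'" using assms by (simp add: q_simps)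
 also have "cmod ... <= cmod (q x (y \<oplus> (- 1) \<odot> y')) + cmod (q (x \<oplus> (- 1) \<odot> x') y')" by (rule norm_triangle_ineq)
 also have "... <= form_norm q x * vdist V q y y' + vdist V q x x' * form_norm q y'" unfolding vdist_def using assms by (intro add_mono CS) auto
 finally show ?thesis .
qed

lemma fn_tendsto:
 assumes "!!n. s n @: V" "x @: V" "(%n. vdist V q (s n) x) ----> 0" shows "(%n. form_norm q (s n)) ----> form_norm q x"
proof -
 have "\<bar>form_norm q (s n) - form_norm q x\<bar> <= vdist V q (s n) x" for n
 using fn_le_vd[of "s n" x] fn_le_vd[of x "s n"] assms vd_sym[of "s n" x] by (simp add: abs_le_iff)
 then have "(%n. form_norm q (s n) - form_norm q x) ----> 0" by (intro Lim_null_comparison[OF _ assms(3)]) auto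
 then show ?thesis by (simp add: LIM_zero_iff)
qed

lemma q_tendsto:
 assumes "!!n. s n @: V" "x @: V" "(%n. vdist V q (s n) x) ----> 0" and "!!n. t n @: V" "y @: V" "(%n. vdist V q (t n) y) ----> 0"
 shows "(%n. q (s n) (t n)) ----> q x y"
proof -
 have "(%n. form_norm q (s n) * vdist V q (t n) y + vdist V q (s n) x * form_norm q y) ----> form_norm q x * 0 + 0 * form_norm q y"
 by (intro tendsto_intros fn_tendsto assms)
 then have g: "(%n. form_norm q (s n) * vdist V q (t n) y + vdist V q (s n) x * form_norm q y) ----> 0" by simp
 have "ALL n. norm (q (s n) (t n) - q x y) <= form_norm q (s n) * vdist V q (t n) y + vdist V q (s n) x * form_norm q y" using assms by (simp add: q_diff_le)
 then have "(%n. q (s n) (t n) - q x y) ----> 0" by (rule Lim_null_comparison[OF always_eventually g])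
 then show ?thesis by (simp add: LIM_zero_iff)
qed

end

abbreviation hnorm :: "('h, 'm) inner_space_scheme => 'h => real" where
 "hnorm H == form_norm (ip H)"

abbreviation hdist :: "('h, 'm) inner_space_scheme => 'h => 'h => real" where
 "hdist H == vdist H (ip H)"

lemma ip_norm_eq: "ip_norm H = hnorm H" by (rule ext) (simp add: ip_norm_def form_norm_def)

text \<open>Separation turns identities between pairings into identities between vectors; the vector
  space laws, such as \<open>one_smult\<close> and \<open>add_zero\<close>, are derived in this
  way.\<close>

locale ip_space = semi_ip H "ip H" for H :: "('h, 'm) inner_space_scheme" (structure) +
 assumes sep: "[|x @: H; y @: H; !!z. z @: H ==> ip H z x = ip H z y|] ==> x = y"
begin

lemma hdist_eq_0:
 assumes x: "x @: H" and y: "y @: H" and d: "hdist H x y = 0" shows "x = y"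
proof (rule sep[OF x y])
 fix z assume z: "z @: H"
 have "cmod (ip H z x - ip H z y) <= 0" using q_diff_le[OF z x z y] x y z d by simp
 then show "ip H z x = ip H z y" by simp
qed

lemma lim_unique:
 assumes "!!n. s n @: H" "x @: H" "y @: H"
 "(%n. hdist H (s n) x) ----> 0" "(%n. hdist H (s n) y) ----> 0" shows "x = y"
proof -
 have "(%n. hdist H (s n) x + hdist H (s n) y) ----> 0 + 0" by (intro tendsto_intros assms)
 moreover have "hdist H x y <= hdist H (s n) x + hdist H (s n) y" for n using vd_triangle[of x "s n" y] vd_sym[of x "s n"] assms by simp
 ultimately have "hdist H x y <= 0" by (intro LIMSEQ_le_const[where X = "%n. hdist H (s n) x + hdist H (s n) y"]) auto
 then show ?thesis using assms vd_nonneg[of x y] by (intro hdist_eq_0) linarith+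
qed

end

locale hilb = ip_space +
 assumes complete: "[|!!n. s n @: H; !!e. e > 0 ==> EX N. ALL m>=N. ALL n>=N. hdist H (s m) (s n) < e|]
 ==> EX l:carrier H. (%n. hdist H (s n) l) ----> 0"

subsection \<open>Finite linear combinations\<close>

text \<open>The finite sum of the vectors c s times g s, fixed by its inner products: existence is
  an induction over S, uniqueness is separation.\<close>

definition lc :: "('h, 'm) inner_space_scheme => ('s => complex) => ('s => 'h) => 's set => 'h" where
 "lc H c g S = (THE u. u @: H & (ALL z:carrier H. ip H z u = (SUM s:S. c s * ip H z (g s))))"

context ip_space
begin

lemma lc_ex1:
 assumes "finite S" "g ` S <= carrier H" shows "EX! u. u @: H & (ALL z:carrier H. ip H z u = (SUM s:S. c s * ip H z (g s)))"
proof -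
 have "EX u. u @: H & (ALL z:carrier H. ip H z u = (SUM s:S. c s * ip H z (g s)))" using assms
 proof (induction S)
 case empty
 show ?case by (rule exI[of _ \<zero>]) (simp add: q_zero)
 next
 case (insert a S)
 then obtain u where "u @: H" "ALL z:carrier H. ip H z u = (SUM s:S. c s * ip H z (g s))" by auto
 with insert show ?case by (intro exI[of _ "c a \<odot> g a \<oplus> u"]) (simp add: q_simps)
 qed
 moreover have "u = v" if "u @: H & (ALL z:carrier H. ip H z u = (SUM s:S. c s * ip H z (g s)))"
 "v @: H & (ALL z:carrier H. ip H z v = (SUM s:S. c s * ip H z (g s)))" for u v using that by (intro sep) auto
 ultimately show ?thesis by blast
qed

lemma lc_spec:
 assumes "finite S" "g ` S <= carrier H" shows "lc H c g S @: H & (ALL z:carrier H. ip H z (lc H c g S) = (SUM s:S. c s * ip H z (g s)))"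
 unfolding lc_def by (rule theI'[OF lc_ex1[OF assms]])

lemma lc_closed [simp, intro]: "[|finite S; g ` S <= carrier H|] ==> lc H c g S @: H" using lc_spec by blast

lemma ip_lc: "[|finite S; g ` S <= carrier H; z @: H|] ==> ip H z (lc H c g S) = (SUM s:S. c s * ip H z (g s))" using lc_spec by blast

lemma ip_lc_left:
 assumes "finite S" "g ` S <= carrier H" "z @: H" shows "ip H (lc H c g S) z = (SUM s:S. cnj (c s) * ip H (g s) z)"
proof -
 have "ip H (lc H c g S) z = cnj (ip H z (lc H c g S))" using assms by (intro q_sym) auto
 also have "... = (SUM s:S. cnj (c s) * cnj (ip H z (g s)))" using assms by (simp add: ip_lc)
 also have "... = (SUM s:S. cnj (c s) * ip H (g s) z)" using assms by (intro sum.cong refl arg_cong2[where f = "(*)"] q_sym[symmetric]) auto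
 finally show ?thesis .
qed

lemma ip_lc_lc:
 assumes "finite S" "g ` S <= carrier H" "finite T" "h ` T <= carrier H"
 shows "ip H (lc H c g S) (lc H d h T) = (SUM s:S. SUM t:T. cnj (c s) * d t * ip H (g s) (h t))"
proof -
 have "ip H (g s) (lc H d h T) = (SUM t:T. d t * ip H (g s) (h t))" if "s : S" for s using assms that by (intro ip_lc) auto
 then show ?thesis using assms by (simp add: ip_lc_left sum_distrib_left mult.assoc)
qed

lemma lc_eqI:
 assumes "finite S" "g ` S <= carrier H" "x @: H"
 "!!z. z @: H ==> ip H z x = (SUM s:S. c s * ip H z (g s))" shows "lc H c g S = x" using assms by (intro sep) (auto simp: ip_lc)

lemma lc_empty [simp]: "lc H c g {} = \<zero>" by (rule lc_eqI) (auto simp: q_zero)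

lemma lc_insert:
 assumes "finite S" "a \<notin> S" "g ` insert a S <= carrier H" shows "lc H c g (insert a S) = c a \<odot> g a \<oplus> lc H c g S"
 using assms by (intro lc_eqI) (auto simp: q_simps ip_lc)

lemma lc_sing: "g a @: H ==> lc H (%_. 1) g {a} = g a" by (rule lc_eqI) auto

lemma lc_add:
 assumes "finite S" "g ` S <= carrier H" shows "lc H c g S \<oplus> lc H d g S = lc H (%s. c s + d s) g S"
 using assms by (intro lc_eqI[symmetric]) (auto simp: q_simps ip_lc sum.distrib algebra_simps)

lemma lc_smult:
 assumes "finite S" "g ` S <= carrier H" shows "a \<odot> lc H c g S = lc H (%s. a * c s) g S"
 using assms by (intro lc_eqI[symmetric]) (auto simp: q_simps ip_lc sum_distrib_left algebra_simps)

lemma lc_extend: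
 assumes "finite T" "g ` T <= carrier H" "S <= T" shows "lc H c g S = lc H (%s. if s : S then c s else 0) g T"
proof (rule lc_eqI)
 fix z assume z: "z @: H"
 have "(SUM s:T. (if s : S then c s else 0) * ip H z (g s)) = (SUM s:S. c s * ip H z (g s))" by (rule sum.mono_neutral_cong_right) (use assms in auto)
 then show "ip H z (lc H (%s. if s : S then c s else 0) g T) = (SUM s:S. c s * ip H z (g s))" using assms z by (simp add: ip_lc)
qed (use assms finite_subset in auto)

lemma lc_two:
 assumes "finite S" "g ` S <= carrier H" "finite T" "g ` T <= carrier H" shows "a \<odot> lc H c g S \<oplus> b \<odot> lc H d g T
 = lc H (%s. a * (if s : S then c s else 0) + b * (if s : T then d s else 0)) g (S \<union> T)"
proof -
 have fin: "finite (S \<union> T)" "g ` (S \<union> T) <= carrier H" using assms by auto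
 have "lc H c g S = lc H (%s. if s : S then c s else 0) g (S \<union> T)" by (rule lc_extend) (use fin in auto)
 moreover have "lc H d g T = lc H (%s. if s : T then d s else 0) g (S \<union> T)" by (rule lc_extend) (use fin in auto)
 ultimately show ?thesis by (simp only: lc_smult[OF fin] lc_add[OF fin])
qed

lemma one_smult: "x @: H ==> 1 \<odot> x = x" by (rule sep) (auto simp: q_simps)

lemma add_zero: "x @: H ==> x \<oplus> \<zero> = x" "x @: H ==> \<zero> \<oplus> x = x" by (rule sep; auto simp: q_simps)+

lemma smult_zero: "c \<odot> \<zero> = \<zero>" "x @: H ==> 0 \<odot> x = \<zero>" by (rule sep; auto simp: q_simps)+

end

subsection \<open>Closed subspaces and total sets\<close>

definition closed_sub :: "('h, 'm) inner_space_scheme => 'h set => bool" where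
 "closed_sub H M \<longleftrightarrow> M <= carrier H & 0[H] : M & (ALL x:M. ALL y:M. x +[H] y : M) & (ALL c. ALL x:M. c *[H] x : M) &
 (ALL s l. (ALL n. s n : M) & l @: H & (%n::nat. hdist H (s n) l) ----> 0 --> l : M)"

text \<open>Density of the linear span of E, phrased as an induction principle: a property that cuts
  out a closed subspace need only be checked on E.\<close>

definition total :: "('h, 'm) inner_space_scheme => 'h set => bool" where
 "total H E \<longleftrightarrow> E <= carrier H & (ALL M. closed_sub H M & E <= M --> carrier H <= M)"

lemma total_sub: "total H E ==> E <= carrier H" by (simp add: total_def)

lemma totalD: "[|total H E; closed_sub H M; E <= M; x @: H|] ==> x : M" unfolding total_def by blast

lemma totalI: "[|E <= carrier H; !!M x. [|closed_sub H M; E <= M; x @: H|] ==> x : M|] ==> total H E" unfolding total_def by blast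

lemma closed_subI:
 assumes "M <= carrier H" "0[H] : M" "!!x y. x : M ==> y : M ==> x +[H] y : M"
 "!!c x. x : M ==> c *[H] x : M"
 "!!s l. [|!!n::nat. s n : M; l @: H; (%n. hdist H (s n) l) ----> 0|] ==> l : M" shows "closed_sub H M" using assms unfolding closed_sub_def by blast

lemma closed_subD:
 assumes "closed_sub H M" shows "M <= carrier H" "0[H] : M" "!!x y. x : M ==> y : M ==> x +[H] y : M"
 "!!c x. x : M ==> c *[H] x : M"
 "!!s l. [|!!n::nat. s n : M; l @: H; (%n. hdist H (s n) l) ----> 0|] ==> l : M" using assms unfolding closed_sub_def by blast+

context ip_space
begin

lemma closed_sub_lc:
 assumes "closed_sub H M" "finite S" "g ` S <= M" shows "lc H c g S : M" using assms(2,3)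
proof (induction S)
 case empty
 show ?case using closed_subD(2)[OF assms(1)] by simp
next
 case (insert a S)
 have sub: "g ` insert a S <= carrier H" using insert closed_subD(1)[OF assms(1)] by blast
 show ?case unfolding lc_insert[OF insert(1,2) sub] using insert by (auto intro!: closed_subD(3,4)[OF assms(1)])
qed

lemma closed_sub_ip:
 assumes "x @: H" "y @: H" shows "closed_sub H {z : carrier H. ip H x z = ip H y z}"
proof (rule closed_subI)
 fix s and l assume s: "!!n::nat. s n : {z : carrier H. ip H x z = ip H y z}" "l @: H" and lim: "(%n. hdist H (s n) l) ----> 0"
 have "(%n. ip H x (s n)) ----> ip H x l" "(%n. ip H y (s n)) ----> ip H y l" using s assms by (intro q_tendsto lim; auto)+
 moreover have "(%n. ip H x (s n)) = (%n. ip H y (s n))" using s by auto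
 ultimately have "ip H x l = ip H y l" by (metis LIMSEQ_unique)
 then show "l : {z : carrier H. ip H x z = ip H y z}" using s by simp
qed (use assms in \<open>auto simp: q_simps\<close>)

lemma sep_total:
 assumes "total H E" "x @: H" "y @: H" "!!e. e : E ==> ip H e x = ip H e y" shows "x = y"
proof (rule sep[OF assms(2,3)])
 fix z assume z: "z @: H"
 have E: "E <= carrier H" by (rule total_sub[OF assms(1)])
 have "ip H x e = ip H y e" if "e : E" for e using q_sym[of x e] q_sym[of y e] assms that E by auto
 then have "z : {z : carrier H. ip H x z = ip H y z}" using E by (intro totalD[OF assms(1) closed_sub_ip[OF assms(2,3)] _ z]) auto
 then show "ip H z x = ip H z y" using q_sym[of z x] q_sym[of z y] assms z by simp
qed

lemma closed_sub_closure:
 assumes D: "D <= carrier H" "\<zero> : D" "!!x y. x : D ==> y : D ==> x \<oplus> y : D" "!!c x. x : D ==> c \<odot> x : D"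
 shows "closed_sub H {x : carrier H. ALL d>0. EX y:D. hdist H x y < d}"
proof (rule closed_subI)
 let ?M = "{x : carrier H. ALL d>0. EX y:D. hdist H x y < d}"
 show "\<zero> : ?M" using D(2) by (auto intro!: bexI[of _ \<zero>])
 show "x \<oplus> y : ?M" if xy: "x : ?M" "y : ?M" for x y
 proof (intro CollectI conjI allI impI)
 fix d :: real assume d: "d > 0"
 obtain u v where "u : D" "hdist H x u < d/2" "v : D" "hdist H y v < d/2" using xy half_gt_zero[OF d] by blast
 then show "EX z:D. hdist H (x \<oplus> y) z < d" using D(3) subsetD[OF D(1)] xy vd_add[of x y u v] by (intro bexI[of _ "u \<oplus> v"]) auto
 qed (use xy in auto)
 show "a \<odot> x : ?M" if x: "x : ?M" for a x
 proof (intro CollectI conjI allI impI)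
 fix d :: real assume d: "d > 0"
 then have "d / (cmod a + 1) > 0" by (simp add: add_nonneg_pos)
 then obtain u where u: "u : D" "hdist H x u < d / (cmod a + 1)" using x by blast
 have "cmod a * hdist H x u <= cmod a * (d / (cmod a + 1))" using u by (intro mult_left_mono) auto
 also have "... < d" using d by (simp add: divide_simps add_pos_nonneg add_nonneg_pos algebra_simps)
 finally show "EX z:D. hdist H (a \<odot> x) z < d" using u D(4) subsetD[OF D(1)] x vd_smult[of x u a] by (intro bexI[of _ "a \<odot> u"]) auto
 qed (use x in auto)
 fix s l assume s: "!!n::nat. s n : ?M" and l: "l @: H" and lim: "(%n. hdist H (s n) l) ----> 0"
 show "l : ?M"
 proof (intro CollectI conjI allI impI l)
 fix d :: real assume d: "d > 0"
 obtain n where n: "hdist H (s n) l < d/2" using order_tendstoD(2)[OF lim, of "d/2"] d by (auto simp: eventually_sequentially)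
 obtain u where u: "u : D" "hdist H (s n) u < d/2" using s[of n] half_gt_zero[OF d] by blast
 have "hdist H l u <= hdist H (s n) l + hdist H (s n) u" using vd_triangle[of l "s n" u] vd_sym[of l "s n"] s[of n] l u subsetD[OF D(1)] by auto
 then show "EX u:D. hdist H l u < d" using u n by (intro bexI[of _ u]) auto
 qed
qed auto

text \<open>The vectors that finite combinations approximate form a closed subspace containing the
  generators, so totality applies to it.\<close>

lemma total_approx:
 assumes tot: "total H (e ` S)" and x: "x @: H" and eps: "\<epsilon> > 0" shows "EX c F. finite F & F <= S & hdist H x (lc H c e F) < \<epsilon>"
proof -
 define D where "D = {lc H c e F | c F. finite F & F <= S}"
 have eC: "e ` F <= carrier H" if "F <= S" for F using that total_sub[OF tot] by auto
 have lin: "a \<odot> x \<oplus> b \<odot> y : D" if xy: "x : D" "y : D" for x y a b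
 proof -
 obtain c F d G where "finite F" "F <= S" "finite G" "G <= S" "x = lc H c e F" "y = lc H d e G" using xy by (auto simp: D_def)
 then show ?thesis using lc_two[of F e G a c b d] eC unfolding D_def by (intro CollectI exI[of _ "F \<union> G"] exI) auto
 qed
 have D: "D <= carrier H" using eC by (auto simp: D_def)
 have "closed_sub H {x : carrier H. ALL d>0. EX y:D. hdist H x y < d}"
 proof (rule closed_sub_closure[OF D])
 have "lc H (%_. 0) e {} : D" unfolding D_def by blast
 then show "\<zero> : D" by simp
 show "x \<oplus> y : D" if "x : D" "y : D" for x y using lin[OF that, of 1 1] subsetD[OF D] that by (simp add: one_smult)
 show "c \<odot> x : D" if "x : D" for c x using lin[OF that that, of c 0] subsetD[OF D that] by (simp add: smult_zero add_zero)
 qed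
 moreover have "e s : D" if "s : S" for s unfolding D_def using that eC[of "{s}"] by (intro CollectI exI[of _ "%_. 1"] exI[of _ "{s}"]) (simp add: lc_sing)
 then have "e ` S <= {x : carrier H. ALL d>0. EX y:D. hdist H x y < d}" using subsetD[OF D] by (fastforce intro: bexI[rotated])
 ultimately have "x : {x : carrier H. ALL d>0. EX y:D. hdist H x y < d}" by (rule totalD[OF tot _ _ x])
 then show ?thesis using eps unfolding D_def by blast
qed

end

subsection \<open>Bounded operators\<close>

text \<open>\<open>bounded_ops\<close> without extensionality, so that sums and composites written
  as lambda terms qualify.\<close>

definition blin :: "('h, 'm) inner_space_scheme => ('k, 'n) inner_space_scheme => ('h => 'k) => bool" where
 "blin H K T \<longleftrightarrow> T ` carrier H <= carrier K & (ALL x:carrier H. ALL y:carrier H. T (x +[H] y) = T x +[K] T y) &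
 (ALL c. ALL x:carrier H. T (c *[H] x) = c *[K] T x) & (EX C. ALL x:carrier H. hnorm K (T x) <= C * hnorm H x)"

lemma bounded_ops_iff: "T : bounded_ops H K \<longleftrightarrow> T : extensional (carrier H) & blin H K T"
 unfolding bounded_ops_def blin_def ip_norm_eq PiE_def Pi_def by (auto simp: image_subset_iff)

lemma bounded_ops_blin: "T : bounded_ops H K ==> blin H K T" by (simp add: bounded_ops_iff)

lemma blinD:
 assumes "blin H K T" shows "x @: H ==> T x @: K"
 "[|x @: H; y @: H|] ==> T (x +[H] y) = T x +[K] T y"
 "x @: H ==> T (c *[H] x) = c *[K] T x" using assms unfolding blin_def by auto

locale ip_space2 = H: ip_space H + K: ip_space K for H :: "('h, 'm) inner_space_scheme" and K :: "('k, 'n) inner_space_scheme"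
begin

lemma blin_bound:
 assumes "blin H K T" shows "EX C>=0. ALL x:carrier H. hnorm K (T x) <= C * hnorm H x"
proof -
 obtain C where C: "ALL x:carrier H. hnorm K (T x) <= C * hnorm H x" using assms by (auto simp: blin_def)
 have "hnorm K (T x) <= \<bar>C\<bar> * hnorm H x" if "x @: H" for x
 using bspec[OF C that] mult_right_mono[of C "\<bar>C\<bar>" "hnorm H x"] H.fn_ge0[OF that] by linarith
 then show ?thesis by (intro exI[of _ "\<bar>C\<bar>"]) auto
qed

lemma blin_zero: "blin H K T ==> T 0[H] = 0[K]" using blinD(3)[of H K T "0[H]" 0] blinD(1)[of H K T "0[H]"] by (simp add: H.smult_zero K.smult_zero)

lemma blin_dist:
 assumes T: "blin H K T" and C: "!!x. x @: H ==> hnorm K (T x) <= C * hnorm H x" and xy: "x @: H" "y @: H" shows "hdist K (T x) (T y) <= C * hdist H x y"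
proof -
 have "T x +[K] (- 1) *[K] T y = T (x +[H] (- 1) *[H] y)" using xy by (simp add: blinD[OF T])
 then show ?thesis unfolding vdist_def using xy by (simp add: C)
qed

lemma blin_tendsto:
 assumes T: "blin H K T" and s: "!!n. s n @: H" "x @: H" and lim: "(%n. hdist H (s n) x) ----> 0" shows "(%n. hdist K (T (s n)) (T x)) ----> 0"
proof -
 obtain C where C: "C >= 0" "!!x. x @: H ==> hnorm K (T x) <= C * hnorm H x" using blin_bound[OF T] by blast
 have g: "(%n. C * hdist H (s n) x) ----> 0" using tendsto_mult_right_zero[OF lim] by simp
 have "ALL n. norm (hdist K (T (s n)) (T x)) <= C * hdist H (s n) x" using blin_dist[OF T C(2)] s by (simp add: blinD(1)[OF T])
 then show ?thesis by (rule Lim_null_comparison[OF always_eventually g])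
qed

lemma blin_lc:
 assumes T: "blin H K T" and F: "finite F" "g ` F <= carrier H" shows "T (lc H c g F) = lc K c (%s. T (g s)) F" using F
proof (induction F)
 case empty
 show ?case using blin_zero[OF T] by simp
next
 case (insert a F)
 have "(%s. T (g s)) ` insert a F <= carrier K" using insert(4) blinD(1)[OF T] by auto
 then show ?case using insert by (simp add: H.lc_insert K.lc_insert blinD[OF T])
qed

lemma closed_sub_eq:
 assumes S: "blin H K S" and T: "blin H K T" shows "closed_sub H {x : carrier H. S x = T x}"
proof (rule closed_subI)
 fix s l assume s: "!!n::nat. s n : {x : carrier H. S x = T x}" "l @: H" and lim: "(%n. hdist H (s n) l) ----> 0"
 have C: "s n @: H" and eq: "T (s n) = S (s n)" for n using s(1)[of n] by auto
 have 1: "(%n. hdist K (S (s n)) (S l)) ----> 0" by (rule blin_tendsto[OF S C s(2) lim])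
 have 2: "(%n. hdist K (S (s n)) (T l)) ----> 0" using blin_tendsto[OF T C s(2) lim] by (simp add: eq)
 have "S l = T l" by (rule K.lim_unique[OF blinD(1)[OF S C] blinD(1)[OF S s(2)] blinD(1)[OF T s(2)] 1 2])
 then show "l : {x : carrier H. S x = T x}" using s by simp
qed (use blinD[OF S] blinD[OF T] blin_zero[OF S] blin_zero[OF T] in auto)

lemma closed_sub_vimage:
 assumes T: "blin H K T" and M: "closed_sub K M" shows "closed_sub H {x : carrier H. T x : M}"
proof (rule closed_subI)
 fix s l assume s: "!!n::nat. s n : {x : carrier H. T x : M}" "l @: H" and lim: "(%n. hdist H (s n) l) ----> 0"
 have C: "s n @: H" and TM: "T (s n) : M" for n using s(1)[of n] by auto
 have "T l : M" by (rule closed_subD(5)[OF M TM blinD(1)[OF T s(2)] blin_tendsto[OF T C s(2) lim]])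
 then show "l : {x : carrier H. T x : M}" using s by simp
qed (use blinD[OF T] blin_zero[OF T] closed_subD(2,3,4)[OF M] in auto)

lemma blin_eq_total:
 assumes "blin H K S" "blin H K T" "total H E" "!!x. x : E ==> S x = T x" "x @: H" shows "S x = T x"
 using totalD[OF assms(3) closed_sub_eq[OF assms(1,2)] _ assms(5)] assms(4) total_sub[OF assms(3)] by auto

lemma bounded_ops_eqI:
 assumes "S : bounded_ops H K" "T : bounded_ops H K" "total H E" "!!x. x : E ==> S x = T x" shows "S = T"
 using assms blin_eq_total[of S T E] unfolding bounded_ops_iff by (intro extensionalityI[of S "carrier H"]) auto

end

lemma blin_comp:
 assumes "ip_space H" "ip_space K" "ip_space L" and S: "blin K L S" and T: "blin H K T" shows "blin H L (%x. S (T x))"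
proof -
 interpret HK: ip_space2 H K by (rule ip_space2.intro) fact+
 interpret KL: ip_space2 K L by (rule ip_space2.intro) fact+
 obtain C where C: "C >= 0" "!!x. x @: K ==> hnorm L (S x) <= C * hnorm K x" using KL.blin_bound[OF S] by blast
 obtain D where D: "!!x. x @: H ==> hnorm K (T x) <= D * hnorm H x" using HK.blin_bound[OF T] by blast
 have "hnorm L (S (T x)) <= C * D * hnorm H x" if "x @: H" for x using C(2)[OF blinD(1)[OF T that]] mult_left_mono[OF D[OF that] C(1)] by (simp add: mult.assoc)
 then show ?thesis unfolding blin_def using blinD[OF S] blinD[OF T] by auto
qed

lemma blin_add:
 assumes "ip_space H" "ip_space K" and S: "blin H K S" and T: "blin H K T" shows "blin H K (%x. S x +[K] T x)"
proof -
 interpret HK: ip_space2 H K by (rule ip_space2.intro) fact+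
 obtain C where C: "!!x. x @: H ==> hnorm K (S x) <= C * hnorm H x" using HK.blin_bound[OF S] by blast
 obtain D where D: "!!x. x @: H ==> hnorm K (T x) <= D * hnorm H x" using HK.blin_bound[OF T] by blast
 have "hnorm K (S x +[K] T x) <= (C + D) * hnorm H x" if "x @: H" for x
 using HK.K.fn_triangle[of "S x" "T x"] C[OF that] D[OF that] blinD(1)[OF S that] blinD(1)[OF T that] by (simp add: distrib_right)
 moreover have "S (x +[H] y) +[K] T (x +[H] y) = (S x +[K] T x) +[K] (S y +[K] T y)" if "x @: H" "y @: H" for x y using that blinD(1)[OF S] blinD(1)[OF T]
 by (intro HK.K.sep) (auto simp: blinD(2)[OF S] blinD(2)[OF T] HK.K.q_simps)
 moreover have "S (c *[H] x) +[K] T (c *[H] x) = c *[K] (S x +[K] T x)" if "x @: H" for c x using that blinD(1)[OF S] blinD(1)[OF T]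
 by (intro HK.K.sep) (auto simp: blinD(3)[OF S] blinD(3)[OF T] HK.K.q_simps algebra_simps)
 ultimately show ?thesis unfolding blin_def using blinD(1)[OF S] blinD(1)[OF T] by auto
qed

lemma blin_smult:
 assumes "ip_space H" "ip_space K" and S: "blin H K S" shows "blin H K (%x. a *[K] S x)"
proof -
 interpret HK: ip_space2 H K by (rule ip_space2.intro) fact+
 obtain C where C: "!!x. x @: H ==> hnorm K (S x) <= C * hnorm H x" using HK.blin_bound[OF S] by blast
 have "hnorm K (a *[K] S x) <= (cmod a * C) * hnorm H x" if "x @: H" for x
 using C[OF that] blinD(1)[OF S that] by (simp add: HK.K.fn_smult mult.assoc mult_left_mono)
 moreover have "a *[K] S (x +[H] y) = a *[K] S x +[K] a *[K] S y" if "x @: H" "y @: H" for x y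
 using that blinD(1)[OF S] by (intro HK.K.sep) (auto simp: blinD(2)[OF S] HK.K.q_simps algebra_simps)
 moreover have "a *[K] S (c *[H] x) = c *[K] (a *[K] S x)" if "x @: H" for c x
 using that blinD(1)[OF S] by (intro HK.K.sep) (auto simp: blinD(3)[OF S] HK.K.q_simps)
 ultimately show ?thesis unfolding blin_def using blinD(1)[OF S] by auto
qed

lemma blin_id: "blin H H (%x. x)" unfolding blin_def by (auto intro!: exI[of _ 1])

lemma blin_const_zero:
 assumes "ip_space H" "ip_space K" shows "blin H K (%x. 0[K])"
proof -
 interpret K: ip_space K by fact
 interpret H: ip_space H by fact
 show ?thesis unfolding blin_def by (auto simp: K.add_zero K.smult_zero intro!: exI[of _ 1])
qed

lemma blin_restrict: "[|semi_ip H (ip H); blin H K T|] ==> restrict T (carrier H) : bounded_ops H K"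
 unfolding bounded_ops_iff blin_def by (auto simp: semi_ip.addC semi_ip.smultC)

text \<open>Extension by continuity. The norm inequality on finite combinations makes the assignment
  of \<open>g s\<close> to \<open>e s\<close> well defined on the span, and completeness of the
  target carries it to the closure.\<close>

lemma bounded_ext:
 fixes e :: "'s => 'h" and g :: "'s => 'k"
 assumes H: "ip_space H" and K: "hilb K" and tot: "total H (e ` S)" and g: "!!s. s : S ==> g s @: K" and B: "B >= 0"
 and bd: "!!F c. [|finite F; F <= S|] ==> hnorm K (lc K c g F) <= B * hnorm H (lc H c e F)"
 shows "EX T:bounded_ops H K. (ALL s:S. T (e s) = g s) & (ALL x:carrier H. hnorm K (T x) <= B * hnorm H x)"
proof -
 interpret H: ip_space H by fact
 interpret K: hilb K by fact
 have eC: "e ` S <= carrier H" by (rule total_sub[OF tot])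
 \<comment> \<open>A formal combination is kept as a pair of coefficients and index set, because one
   vector may arise from several combinations.\<close>
 define P where "P L \<longleftrightarrow> finite (snd L) & snd L <= S" for L :: "('s => complex) \<times> 's set"
 define lH where "lH L = lc H (fst L) e (snd L)" for L
 define lK where "lK L = lc K (fst L) g (snd L)" for L
 have lHC [simp]: "lH L @: H" if "P L" for L unfolding lH_def using that eC by (auto simp: P_def)
 have lKC [simp]: "lK L @: K" if "P L" for L unfolding lK_def using that g by (auto simp: P_def)
 have comb: "EX N. P N & lH N = a *[H] lH L +[H] b *[H] lH M & lK N = a *[K] lK L +[K] b *[K] lK M" if "P L" "P M" for L M a b
 proof (intro exI conjI)
 let ?N = "(%s. a * (if s : snd L then fst L s else 0) + b * (if s : snd M then fst M s else 0), snd L \<union> snd M)"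
 show "P ?N" using that by (auto simp: P_def)
 show "lH ?N = a *[H] lH L +[H] b *[H] lH M" unfolding lH_def fst_conv snd_conv by (rule H.lc_two[symmetric]) (use that eC in \<open>auto simp: P_def\<close>)
 show "lK ?N = a *[K] lK L +[K] b *[K] lK M" unfolding lK_def fst_conv snd_conv by (rule K.lc_two[symmetric]) (use that g in \<open>auto simp: P_def\<close>)
 qed
 have nrm: "hnorm K (lK L) <= B * hnorm H (lH L)" if "P L" for L unfolding lK_def lH_def using that by (intro bd) (auto simp: P_def)
 have dst: "hdist K (lK L) (lK M) <= B * hdist H (lH L) (lH M)" if LM: "P L" "P M" for L M
 proof -
 obtain N where N: "P N" "lH N = 1 *[H] lH L +[H] (- 1) *[H] lH M"
 "lK N = 1 *[K] lK L +[K] (- 1) *[K] lK M" using comb[OF LM] by blast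
 show ?thesis using nrm[OF N(1)] LM unfolding N vdist_def by (simp add: H.one_smult K.one_smult)
 qed
 have appr: "EX L. P L & hdist H x (lH L) < d" if "x @: H" "d > 0" for x d using H.total_approx[OF tot that] unfolding P_def lH_def by (metis fst_conv snd_conv)
 \<comment> \<open>The limit is described by a Lipschitz estimate against every combination, not
   only along the chosen sequence. This makes it independent of the choices and is what the proof of
   linearity uses.\<close>
 have lim: "EX y:carrier K. ALL M. P M --> hdist K y (lK M) <= B * hdist H x (lH M)" if x: "x @: H" for x
 proof -
 have "ALL n. EX L. P L & hdist H x (lH L) < 1 / real (Suc n)" using appr[OF x] by simp
 then obtain L where L: "!!n. P (L n)" "!!n. hdist H x (lH (L n)) < 1 / real (Suc n)" by metis
 have x0: "(%n. hdist H x (lH (L n))) ----> 0"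
 proof (rule Lim_null_comparison[OF always_eventually LIMSEQ_inverse_real_of_nat])
 show "ALL n. norm (hdist H x (lH (L n))) <= inverse (real (Suc n))" using L x by (simp add: divide_inverse less_imp_le)
 qed
 have "EX l:carrier K. (%n. hdist K (lK (L n)) l) ----> 0"
 proof (rule K.complete)
 fix \<epsilon> :: real assume e0: "\<epsilon> > 0"
 then have "\<epsilon> / (2 * (B + 1)) > 0" using B by simp
 from order_tendstoD(2)[OF x0 this] obtain N where N: "!!n. n >= N ==> hdist H x (lH (L n)) < \<epsilon> / (2 * (B + 1))"
 by (auto simp: eventually_sequentially)
 have "hdist K (lK (L m)) (lK (L n)) < \<epsilon>" if "m >= N" "n >= N" for m n
 proof -
 have "hdist K (lK (L m)) (lK (L n)) <= B * hdist H (lH (L m)) (lH (L n))" using dst L by simp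
 also have "... <= B * (hdist H x (lH (L m)) + hdist H x (lH (L n)))"
 using H.vd_triangle[of "lH (L m)" x "lH (L n)"] H.vd_sym[of x "lH (L m)"] L x B by (intro mult_left_mono) auto
 also have "... <= B * (\<epsilon> / (2 * (B + 1)) + \<epsilon> / (2 * (B + 1)))" using N[OF that(1)] N[OF that(2)] B by (intro mult_left_mono) auto
 also have "... = B / (B + 1) * \<epsilon>" using B by (simp add: divide_simps)
 also have "... < \<epsilon>" using B e0 by (simp add: divide_simps)
 finally show ?thesis .
 qed
 then show "EX N. ALL m>=N. ALL n>=N. hdist K (lK (L m)) (lK (L n)) < \<epsilon>" by blast
 qed (use L in auto)
 then obtain y where y: "y @: K" "(%n. hdist K (lK (L n)) y) ----> 0" by blast
 have "hdist K y (lK M) <= B * hdist H x (lH M)" if M: "P M" for M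
 proof (rule LIMSEQ_le_const[where X = "%n. hdist K (lK (L n)) y + B * (hdist H x (lH (L n)) + hdist H x (lH M))"])
 have "(%n. hdist K (lK (L n)) y + B * (hdist H x (lH (L n)) + hdist H x (lH M))) ----> 0 + B * (0 + hdist H x (lH M))" by (intro tendsto_intros y x0)
 then show "(%n. hdist K (lK (L n)) y + B * (hdist H x (lH (L n)) + hdist H x (lH M))) ----> B * hdist H x (lH M)" by simp
 have "hdist K y (lK M) <= hdist K (lK (L n)) y + B * (hdist H x (lH (L n)) + hdist H x (lH M))" for n
 proof -
 have "hdist K y (lK M) <= hdist K (lK (L n)) y + hdist K (lK (L n)) (lK M)" using K.vd_triangle[of y "lK (L n)" "lK M"] K.vd_sym[of y "lK (L n)"] y L M by auto
 moreover have "hdist K (lK (L n)) (lK M) <= B * hdist H (lH (L n)) (lH M)" using dst L M by simp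
 moreover have "B * hdist H (lH (L n)) (lH M) <= B * (hdist H x (lH (L n)) + hdist H x (lH M))"
 using H.vd_triangle[of "lH (L n)" x "lH M"] H.vd_sym[of x "lH (L n)"] L M x B by (intro mult_left_mono) auto
 ultimately show ?thesis by linarith
 qed
 then show "EX N. ALL n>=N. hdist K y (lK M) <= hdist K (lK (L n)) y + B * (hdist H x (lH (L n)) + hdist H x (lH M))" by blast
 qed
 then show ?thesis using y by blast
 qed
 then obtain T0 where T0: "!!x. x @: H ==> T0 x @: K"
 "!!x M. [|x @: H; P M|] ==> hdist K (T0 x) (lK M) <= B * hdist H x (lH M)" by metis
 \<comment> \<open>The defect of linearity will be bounded by a constant times an arbitrary d >
   0.\<close>
 have small: "a <= 0" if "!!d. d > 0 ==> a <= B' * d" for a B' :: real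
 proof (rule ccontr)
 assume "\<not> a <= 0"
 then have a: "a > 0" by simp
 have "a <= B' * (a / (2 * (\<bar>B'\<bar> + 1)))" using that[of "a / (2 * (\<bar>B'\<bar> + 1))"] a by simp
 also have "... <= \<bar>B'\<bar> * (a / (2 * (\<bar>B'\<bar> + 1)))" using a by (intro mult_right_mono) auto
 also have "... < a" using a by (auto simp: field_simps intro!: add_nonneg_pos)
 finally show False by simp
 qed
 have lin: "T0 (a *[H] x +[H] b *[H] y) = a *[K] T0 x +[K] b *[K] T0 y" if x: "x @: H" and y: "y @: H" for x y a b
 proof (rule K.hdist_eq_0)
 let ?z = "a *[H] x +[H] b *[H] y" and ?w = "a *[K] T0 x +[K] b *[K] T0 y"
 show C: "T0 ?z @: K" "?w @: K" using x y T0(1) by auto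
 have "hdist K (T0 ?z) ?w <= (2 * B * (cmod a + cmod b)) * d" if d: "d > 0" for d
 proof -
 obtain L M where L: "P L" "hdist H x (lH L) < d" and M: "P M" "hdist H y (lH M) < d" using appr[OF x d] appr[OF y d] by blast
 obtain N where N: "P N" "lH N = a *[H] lH L +[H] b *[H] lH M"
 "lK N = a *[K] lK L +[K] b *[K] lK M" using comb[OF L(1) M(1)] by blast
 have 1: "hdist K (T0 ?z) (lK N) <= B * (cmod a * hdist H x (lH L) + cmod b * hdist H y (lH M))"
 proof -
 have "hdist K (T0 ?z) (lK N) <= B * hdist H ?z (lH N)" using T0(2)[of ?z N] x y N(1) by simp
 also have "... <= B * (cmod a * hdist H x (lH L) + cmod b * hdist H y (lH M))"
 unfolding N(2) using H.vd_add[of "a *[H] x" "b *[H] y" "a *[H] lH L" "b *[H] lH M"] x y L M B by (intro mult_left_mono) (auto simp: H.vd_smult)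
 finally show ?thesis .
 qed
 have 2: "hdist K ?w (lK N) <= cmod a * hdist K (T0 x) (lK L) + cmod b * hdist K (T0 y) (lK M)"
 unfolding N(3) using K.vd_add[of "a *[K] T0 x" "b *[K] T0 y" "a *[K] lK L" "b *[K] lK M"] T0(1) x y L M by (auto simp: K.vd_smult)
 have 3: "hdist K (T0 ?z) ?w <= hdist K (T0 ?z) (lK N) + hdist K ?w (lK N)" using K.vd_triangle[of "T0 ?z" "lK N" ?w] K.vd_sym[of ?w "lK N"] C N(1) by auto
 have 4: "cmod a * hdist H x (lH L) <= cmod a * d" "cmod b * hdist H y (lH M) <= cmod b * d" using L M by (auto intro!: mult_left_mono)
 have "B * hdist H x (lH L) <= B * d" "B * hdist H y (lH M) <= B * d" using L M B by (auto intro!: mult_left_mono)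
 then have 5: "cmod a * hdist K (T0 x) (lK L) <= cmod a * (B * d)" "cmod b * hdist K (T0 y) (lK M) <= cmod b * (B * d)"
 using T0(2)[OF x L(1)] T0(2)[OF y M(1)] by (auto intro!: mult_left_mono)
 have "B * (cmod a * hdist H x (lH L) + cmod b * hdist H y (lH M)) <= B * (cmod a * d + cmod b * d)" using 4 B by (intro mult_left_mono) auto
 then show ?thesis using 1 2 3 5 by (simp add: algebra_simps)
 qed
 then have "hdist K (T0 ?z) ?w <= 0" by (rule small)
 then show "hdist K (T0 ?z) ?w = 0" using K.vd_nonneg[OF C] by linarith
 qed
 have add: "T0 (x +[H] y) = T0 x +[K] T0 y" if "x @: H" "y @: H" for x y using lin[OF that, of 1 1] that T0(1) by (simp add: H.one_smult K.one_smult)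
 have smul: "T0 (c *[H] x) = c *[K] T0 x" if "x @: H" for x c
 using lin[OF that that, of c 0] that T0(1) by (simp add: H.smult_zero K.smult_zero H.add_zero K.add_zero)
 have bound: "hnorm K (T0 x) <= B * hnorm H x" if "x @: H" for x using T0(2)[OF that, of "(%_. 0, {})"] that T0(1) by (simp add: P_def lH_def lK_def)
 have val: "T0 (e s) = g s" if s: "s : S" for s
 proof -
 have es: "e s @: H" using s eC by auto
 have "hdist K (T0 (e s)) (g s) <= 0" using T0(2)[OF es, of "(%_. 1, {s})"] s es g by (simp add: P_def lH_def lK_def H.lc_sing K.lc_sing)
 then show ?thesis using K.vd_nonneg[of "T0 (e s)" "g s"] T0(1)[OF es] g[OF s] by (intro K.hdist_eq_0) linarith+
 qed
 have "blin H K T0" unfolding blin_def using T0(1) add smul bound by blast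
 then have "restrict T0 (carrier H) : bounded_ops H K" by (rule blin_restrict[OF H.semi_ip_axioms])
 moreover have "ALL s:S. restrict T0 (carrier H) (e s) = g s" using val eC by auto
 ultimately show ?thesis using bound by (intro bexI[of _ "restrict T0 (carrier H)"]) auto
qed

text \<open>Equal Gram matrices give equal norms of finite combinations, so
  \<open>bounded_ext\<close> applies with constant 1. Preservation of inner products then passes
  from the generators to all vectors, one argument at a time.\<close>

lemma isometry_ext:
 assumes H: "ip_space H" and K: "hilb K" and tot: "total H (e ` S)" and g: "!!s. s : S ==> g s @: K"
 and gram: "!!s t. [|s : S; t : S|] ==> ip K (g s) (g t) = ip H (e s) (e t)"
 shows "EX T:bounded_ops H K. (ALL s:S. T (e s) = g s) & (ALL x:carrier H. ALL y:carrier H. ip K (T x) (T y) = ip H x y)"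
proof -
 interpret H: ip_space H by fact
 interpret K: hilb K by fact
 interpret HK: ip_space2 H K by (rule ip_space2.intro) unfold_locales
 have eC: "e ` S <= carrier H" by (rule total_sub[OF tot])
 have "hnorm K (lc K c g F) <= 1 * hnorm H (lc H c e F)" if F: "finite F" "F <= S" for F c
 proof -
 have 1: "g ` F <= carrier K" "e ` F <= carrier H" using F g eC by auto
 have "ip K (lc K c g F) (lc K c g F) = ip H (lc H c e F) (lc H c e F)" unfolding K.ip_lc_lc[OF F(1) 1(1) F(1) 1(1)] H.ip_lc_lc[OF F(1) 1(2) F(1) 1(2)]
 using F by (intro sum.cong refl) (simp add: gram subset_iff)
 then show ?thesis by (simp add: form_norm_def)
 qed
 from bounded_ext[OF H K tot g zero_le_one this]
 obtain T where T: "T : bounded_ops H K" "!!s. s : S ==> T (e s) = g s" "!!x. x @: H ==> hnorm K (T x) <= 1 * hnorm H x" by blast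
 have bT: "blin H K T" using T by (simp add: bounded_ops_iff)
 have cl: "closed_sub H {x : carrier H. ip K y (T x) = ip H z x}" if y: "y @: K" "z @: H" for y z
 proof (rule closed_subI)
 fix s l assume s: "!!n::nat. s n : {x : carrier H. ip K y (T x) = ip H z x}" "l @: H" and lim: "(%n. hdist H (s n) l) ----> 0"
 have "(%n. ip K y (T (s n))) ----> ip K y (T l)" using s y blinD(1)[OF bT] by (intro K.q_tendsto HK.blin_tendsto[OF bT] lim) auto
 moreover have "(%n. ip H z (s n)) ----> ip H z l" using s y by (intro H.q_tendsto lim) auto
 moreover have "(%n. ip K y (T (s n))) = (%n. ip H z (s n))" using s by auto
 ultimately show "l : {x : carrier H. ip K y (T x) = ip H z x}" using s by (auto intro: LIMSEQ_unique)
 qed (use y blinD[OF bT] HK.blin_zero[OF bT] in \<open>auto simp: H.q_simps K.q_simps\<close>)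
 have 1: "ip K (g s) (T x) = ip H (e s) x" if "s : S" "x @: H" for s x
 using totalD[OF tot cl[of "g s" "e s"] _ that(2)] that g eC T(2) gram by (auto simp: image_subset_iff)
 have 2: "ip K (T x) (g s) = ip H x (e s)" if "s : S" "x @: H" for s x
 using 1[OF that] that eC g blinD(1)[OF bT] K.q_sym[of "T x" "g s"] H.q_sym[of x "e s"] by auto
 have "ip K (T x) (T y) = ip H x y" if "x @: H" "y @: H" for x y
 using totalD[OF tot cl[of "T x" x] _ that(2)] that 2 eC T(2) blinD(1)[OF bT] by (auto simp: image_subset_iff)
 then show ?thesis using T by blast
qed

text \<open>Equality of Gram matrices is symmetric, so V arises from the same extension with the
  families exchanged; both composites are the identity on a total set.\<close>

lemma unitary_ext:
 assumes H: "hilb H" and K: "hilb K" and tot: "total H (e ` S)" and tot': "total K (g ` S)"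
 and gram: "!!s t. [|s : S; t : S|] ==> ip K (g s) (g t) = ip H (e s) (e t)"
 shows "EX U V. unitary_op H K U & V : bounded_ops K H & (ALL s:S. U (e s) = g s) & (ALL s:S. V (g s) = e s) &
 (ALL x:carrier H. V (U x) = x) & (ALL y:carrier K. U (V y) = y)"
proof -
 interpret H: hilb H by fact
 interpret K: hilb K by fact
 interpret HH: ip_space2 H H by (rule ip_space2.intro) unfold_locales
 interpret KK: ip_space2 K K by (rule ip_space2.intro) unfold_locales
 have gC: "!!s. s : S ==> g s @: K" using total_sub[OF tot'] by auto
 have eC: "!!s. s : S ==> e s @: H" using total_sub[OF tot] by auto
 obtain U where U: "U : bounded_ops H K" "!!s. s : S ==> U (e s) = g s"
 "!!x y. [|x:carrier H; y:carrier H|] ==> ip K (U x) (U y) = ip H x y" using isometry_ext[OF H.ip_space_axioms K tot gC gram] by blast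
 obtain V where V: "V : bounded_ops K H" "!!s. s : S ==> V (g s) = e s" using isometry_ext[OF K.ip_space_axioms H tot' eC gram[symmetric]] by blast
 have bU: "blin H K U" and bV: "blin K H V" using U V by (auto simp: bounded_ops_iff)
 have VU: "V (U x) = x" if "x @: H" for x by (rule HH.blin_eq_total[OF blin_comp[OF _ _ _ bV bU] blin_id tot _ that]) (use U V in auto, unfold_locales)
 have UV: "U (V x) = x" if "x @: K" for x by (rule KK.blin_eq_total[OF blin_comp[OF _ _ _ bU bV] blin_id tot' _ that]) (use U V in auto, unfold_locales)
 have "U ` carrier H = carrier K"
 proof
 show "carrier K <= U ` carrier H" using UV blinD(1)[OF bV] by (metis imageI subsetI)
 qed (use blinD(1)[OF bU] in auto)
 then have "unitary_op H K U" unfolding unitary_op_def using U by auto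
 then show ?thesis using U V VU UV by blast
qed

text \<open>Separation inside the subspace is tested with the difference of the two vectors, which
  again lies in it.\<close>

lemma ip_space_sub:
 assumes H: "ip_space H" and M: "M <= carrier H" "0[H] : M" "!!x y. x : M ==> y : M ==> x +[H] y : M"
 "!!c x. x : M ==> c *[H] x : M" shows "ip_space (H\<lparr>carrier := M\<rparr>)"
proof -
 interpret H: ip_space H by fact
 have C: "x @: H" if "x : M" for x using that M by blast
 show ?thesis
 proof
 fix x y assume xy: "x @: (H\<lparr>carrier := M\<rparr>)" "y @: (H\<lparr>carrier := M\<rparr>)"
 and *: "!!z. z @: (H\<lparr>carrier := M\<rparr>) ==> ip (H\<lparr>carrier := M\<rparr>) z x = ip (H\<lparr>carrier := M\<rparr>) z y"
 let ?d = "x +[H] (- 1) *[H] y"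
 have "?d : M" using xy M by simp
 then have "ip H ?d x = ip H ?d y" using *[of ?d] by simp
 moreover have "ip H ?d ?d = ip H ?d x - ip H ?d y" using xy C \<open>?d : M\<close> by (simp add: H.q_simps)
 ultimately have "hdist H x y = 0" by (simp add: vdist_def form_norm_def)
 then show "x = y" using xy C by (intro H.hdist_eq_0) auto
 next
 fix x y assume "x @: (H\<lparr>carrier := M\<rparr>)" "y @: (H\<lparr>carrier := M\<rparr>)"
 then show "ip (H\<lparr>carrier := M\<rparr>) x y = cnj (ip (H\<lparr>carrier := M\<rparr>) y x)" using H.q_sym[of x y] C by simp
 qed (use M C in \<open>auto simp: H.q_simps H.q_pos\<close>)
qed

section \<open>Completions\<close>

text \<open>The axiom ties the group difference occurring in \<open>cauchy_seqs\<close> to the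
  scalar multiple occurring in \<open>vdist\<close>.\<close>

locale comp_space = semi_ip +
 assumes minus: "[|x @: V; y @: V|] ==> x \<ominus> y = x \<oplus> (- 1) \<odot> y"
begin

abbreviation "CQ == cauchy_seqs V q"
abbreviation "cl == cauchy_class V q"
abbreviation "HC == completion V q"
abbreviation "emb == completion_embed V q"

lemma fn_minus: "[|x @: V; y @: V|] ==> form_norm q (x \<ominus> y) = vdist V q x y" by (simp add: minus vdist_def)

lemma CQ_iff: "s : CQ \<longleftrightarrow> (ALL n. s n @: V) & (ALL e>0. EX N. ALL m>=N. ALL n>=N. vdist V q (s m) (s n) < e)"
 unfolding cauchy_seqs_def using fn_minus by auto

lemma CQ_C [simp]: "s : CQ ==> s n @: V" by (simp add: CQ_iff)

lemma cl_iff: "s : CQ ==> t : cl s \<longleftrightarrow> t : CQ & (%n. vdist V q (s n) (t n)) ----> 0"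
 unfolding cauchy_class_def using fn_minus by (auto simp: CQ_iff)

lemma const_CQ [simp]: "x @: V ==> (%n. x) : CQ" by (simp add: CQ_iff)

lemma CQ_bounded:
 assumes "s : CQ" shows "EX B>=0. ALL n. form_norm q (s n) <= B"
proof -
 obtain N where N: "!!m n. [|m >= N; n >= N|] ==> vdist V q (s m) (s n) < 1" using assms unfolding CQ_iff by (metis zero_less_one)
 define B where "B = (SUM k<=N. form_norm q (s k)) + 1"
 have nn: "0 <= form_norm q (s k)" for k using assms by simp
 have le: "form_norm q (s k) <= (SUM k<=N. form_norm q (s k))" if "k <= N" for k using that nn by (intro member_le_sum) auto
 have "form_norm q (s n) <= B" for n
 proof (cases "n <= N")
 case True
 then show ?thesis using le[OF True] by (simp add: B_def)
 next
 case False
 then have "vdist V q (s n) (s N) < 1" using N by simp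
 then show ?thesis using fn_le_vd[of "s n" "s N"] le[of N] assms by (simp add: B_def)
 qed
 moreover have "0 <= B" using nn by (simp add: B_def sum_nonneg add_nonneg_nonneg)
 ultimately show ?thesis by blast
qed

lemma eqv_sym: "[|s : CQ; t : CQ; (%n. vdist V q (s n) (t n)) ----> 0|] ==> (%n. vdist V q (t n) (s n)) ----> 0" by (simp add: vd_sym)

lemma eqv_trans:
 assumes C: "s : CQ" "t : CQ" "u : CQ" and st: "(%n. vdist V q (s n) (t n)) ----> 0" and tu: "(%n. vdist V q (t n) (u n)) ----> 0"
 shows "(%n. vdist V q (s n) (u n)) ----> 0"
proof -
 have g: "(%n. vdist V q (s n) (t n) + vdist V q (t n) (u n)) ----> 0" using tendsto_add[OF st tu] by simp
 have "ALL n. norm (vdist V q (s n) (u n)) <= vdist V q (s n) (t n) + vdist V q (t n) (u n)" using C by (simp add: vd_triangle)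
 then show ?thesis by (rule Lim_null_comparison[OF always_eventually g])
qed

lemma cl_eq_iff:
 assumes s: "s : CQ" and t: "t : CQ" shows "cl s = cl t \<longleftrightarrow> (%n. vdist V q (s n) (t n)) ----> 0"
proof
 assume "cl s = cl t"
 moreover have "t : cl t" using t by (simp add: cl_iff)
 ultimately have "t : cl s" by simp
 then show "(%n. vdist V q (s n) (t n)) ----> 0" using s by (simp add: cl_iff)
next
 assume st: "(%n. vdist V q (s n) (t n)) ----> 0"
 note ts = eqv_sym[OF s t st]
 show "cl s = cl t" using eqv_trans[OF s t _ st] eqv_trans[OF t s _ ts] by (auto simp: cl_iff s t)
qed

lemma rep_cl:
 assumes "s : CQ" shows "rep (cl s) : CQ" "(%n. vdist V q (s n) (rep (cl s) n)) ----> 0" "cl (rep (cl s)) = cl s"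
proof -
 have "s : cl s" using assms by (simp add: cl_iff)
 then have "rep (cl s) : cl s" unfolding rep_def by (rule someI[of "%t. t : cl s"])
 then show *: "rep (cl s) : CQ" "(%n. vdist V q (s n) (rep (cl s) n)) ----> 0" using assms by (auto simp: cl_iff)
 then show "cl (rep (cl s)) = cl s" using cl_eq_iff[OF assms *(1)] by simp
qed

lemma CQ_add:
 assumes "s : CQ" "t : CQ" shows "(%n. s n \<oplus> t n) : CQ" unfolding CQ_iff
proof (intro conjI allI impI)
 fix e :: real assume "e > 0"
 then have e: "e/2 > 0" by simp
 obtain N where N: "!!m n. [|m >= N; n >= N|] ==> vdist V q (s m) (s n) < e/2" using assms(1) e unfolding CQ_iff by blast
 obtain M where M: "!!m n. [|m >= M; n >= M|] ==> vdist V q (t m) (t n) < e/2" using assms(2) e unfolding CQ_iff by blast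
 have "vdist V q (s m \<oplus> t m) (s n \<oplus> t n) < e" if "m >= max N M" "n >= max N M" for m n
 using vd_add[of "s m" "t m" "s n" "t n"] N[of m n] M[of m n] that assms by simp
 then show "EX N. ALL m>=N. ALL n>=N. vdist V q (s m \<oplus> t m) (s n \<oplus> t n) < e" by blast
qed (use assms in auto)

lemma CQ_lip:
 assumes s: "s : CQ" and f: "!!x. x @: V ==> f x @: V" and L: "!!x y. [|x @: V; y @: V|] ==> vdist V q (f x) (f y) <= L * vdist V q x y"
 shows "(%n. f (s n)) : CQ" unfolding CQ_iff
proof (intro conjI allI impI)
 fix e :: real assume e: "e > 0"
 then have "e / (\<bar>L\<bar> + 1) > 0" by simp
 then obtain N where N: "!!m n. [|m >= N; n >= N|] ==> vdist V q (s m) (s n) < e / (\<bar>L\<bar> + 1)" using s unfolding CQ_iff by blast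
 have "vdist V q (f (s m)) (f (s n)) < e" if "m >= N" "n >= N" for m n
 proof -
 have "vdist V q (f (s m)) (f (s n)) <= L * vdist V q (s m) (s n)" using L s by simp
 also have "... <= (\<bar>L\<bar> + 1) * vdist V q (s m) (s n)" using s by (intro mult_right_mono) auto
 also have "... < (\<bar>L\<bar> + 1) * (e / (\<bar>L\<bar> + 1))" using N[OF that] by (intro mult_strict_left_mono) auto
 also have "... = e" by simp
 finally show ?thesis .
 qed
 then show "EX N. ALL m>=N. ALL n>=N. vdist V q (f (s m)) (f (s n)) < e" by blast
qed (use s f in auto)

text \<open>\<open>completion\<close> computes with the representative chosen by \<open>rep\<close>;
  under a Lipschitz map the resulting class does not depend on that choice. Applied to scalar
  multiplication and to left multiplication in the GNS space.\<close>

lemma cl_lip: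
 assumes s: "s : CQ" and f: "!!x. x @: V ==> f x @: V" and L: "!!x y. [|x @: V; y @: V|] ==> vdist V q (f x) (f y) <= L * vdist V q x y"
 shows "cl (%n. f (rep (cl s) n)) = cl (%n. f (s n))"
proof (subst cl_eq_iff)
 have g: "(%n. L * vdist V q (s n) (rep (cl s) n)) ----> 0" using tendsto_mult_right_zero[OF rep_cl(2)[OF s]] by simp
 have "ALL n. norm (vdist V q (f (s n)) (f (rep (cl s) n))) <= L * vdist V q (s n) (rep (cl s) n)" using L s f rep_cl(1)[OF s] by simp
 then have "(%n. vdist V q (f (s n)) (f (rep (cl s) n))) ----> 0" by (rule Lim_null_comparison[OF always_eventually g])
 then show "(%n. vdist V q (f (rep (cl s) n)) (f (s n))) ----> 0" using s f rep_cl(1)[OF s] by (simp add: vd_sym)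
qed (use CQ_lip[OF _ f L] s rep_cl(1)[OF s] in auto)

lemma CQ_smult: "s : CQ ==> (%n. c \<odot> s n) : CQ" using CQ_lip[of s "%x. c \<odot> x" "cmod c"] by (simp add: vd_smult)

lemma carrier_HC: "carrier HC = cl ` CQ" by (simp add: completion_def)

lemma zero_HC: "0[HC] = cl (%n. \<zero>)" by (simp add: completion_def)

lemma add_HC:
 assumes s: "s : CQ" and t: "t : CQ" shows "cl s +[HC] cl t = cl (%n. s n \<oplus> t n)"
proof -
 let ?s = "rep (cl s)" and ?t = "rep (cl t)"
 note rs = rep_cl[OF s] and rt = rep_cl[OF t]
 have g: "(%n. vdist V q (s n) (?s n) + vdist V q (t n) (?t n)) ----> 0" using tendsto_add[OF rs(2) rt(2)] by simp
 have "ALL n. norm (vdist V q (s n \<oplus> t n) (?s n \<oplus> ?t n)) <= vdist V q (s n) (?s n) + vdist V q (t n) (?t n)" using vd_add s t rs rt by simp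
 then have "(%n. vdist V q (s n \<oplus> t n) (?s n \<oplus> ?t n)) ----> 0" by (rule Lim_null_comparison[OF always_eventually g])
 then have "cl (%n. s n \<oplus> t n) = cl (%n. ?s n \<oplus> ?t n)" using cl_eq_iff CQ_add s t rs rt by simp
 then show ?thesis by (simp add: completion_def)
qed

lemma smult_HC:
 assumes s: "s : CQ" shows "c *[HC] cl s = cl (%n. c \<odot> s n)" using cl_lip[OF s, of "%x. c \<odot> x" "cmod c"] by (simp add: vd_smult completion_def)

text \<open>Makes the inner product independent of representatives: Cauchy sequences are bounded, so
  the estimate of \<open>q_diff_le\<close> tends to 0.\<close>

lemma q_eqv:
 assumes C: "s : CQ" "t : CQ" "s' : CQ" "t' : CQ" and ss: "(%n. vdist V q (s n) (s' n)) ----> 0" and tt: "(%n. vdist V q (t n) (t' n)) ----> 0"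
 shows "(%n. q (s n) (t n) - q (s' n) (t' n)) ----> 0"
proof -
 obtain B where B: "B >= 0" "!!n. form_norm q (s n) <= B" using CQ_bounded[OF C(1)] by blast
 obtain D where D: "D >= 0" "!!n. form_norm q (t' n) <= D" using CQ_bounded[OF C(4)] by blast
 have g: "(%n. B * vdist V q (t n) (t' n) + vdist V q (s n) (s' n) * D) ----> 0"
 using tendsto_add[OF tendsto_mult_right_zero[OF tt, of B] tendsto_mult_left_zero[OF ss, of D]] by simp
 have "norm (q (s n) (t n) - q (s' n) (t' n)) <= B * vdist V q (t n) (t' n) + vdist V q (s n) (s' n) * D" for n
 proof -
 have "norm (q (s n) (t n) - q (s' n) (t' n)) <= form_norm q (s n) * vdist V q (t n) (t' n) + vdist V q (s n) (s' n) * form_norm q (t' n)"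
 using C by (intro q_diff_le) auto
 also have "... <= B * vdist V q (t n) (t' n) + vdist V q (s n) (s' n) * D" using B D C by (intro add_mono mult_left_mono mult_right_mono) auto
 finally show ?thesis .
 qed
 then show ?thesis by (intro Lim_null_comparison[OF always_eventually g] allI)
qed

lemma q_convergent:
 assumes s: "s : CQ" and t: "t : CQ" shows "convergent (%n. q (s n) (t n))"
proof -
 obtain B where B: "B >= 0" "!!n. form_norm q (s n) <= B" using CQ_bounded[OF s] by blast
 obtain D where D: "D >= 0" "!!n. form_norm q (t n) <= D" using CQ_bounded[OF t] by blast
 have "Cauchy (%n. q (s n) (t n))"
 proof (rule metric_CauchyI)
 fix e :: real assume "e > 0"
 then have e: "e / (B + D + 1) > 0" using B D by simp
 obtain N where N: "!!m n. [|m >= N; n >= N|] ==> vdist V q (s m) (s n) < e / (B + D + 1)" using s e unfolding CQ_iff by blast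
 obtain M where M: "!!m n. [|m >= M; n >= M|] ==> vdist V q (t m) (t n) < e / (B + D + 1)" using t e unfolding CQ_iff by blast
 have "dist (q (s m) (t m)) (q (s n) (t n)) < e" if "m >= max N M" "n >= max N M" for m n
 proof -
 have "dist (q (s m) (t m)) (q (s n) (t n)) <= form_norm q (s m) * vdist V q (t m) (t n) + vdist V q (s m) (s n) * form_norm q (t n)"
 unfolding dist_norm using s t by (intro q_diff_le) auto
 also have "... <= B * (e / (B + D + 1)) + (e / (B + D + 1)) * D"
 using B D N[of m n] M[of m n] that s t e by (intro add_mono mult_mono) (auto intro: less_imp_le)
 also have "... = (B + D) / (B + D + 1) * e" using B D by (simp add: divide_simps) (simp add: algebra_simps)
 also have "... < e" using B D \<open>e > 0\<close> by (simp add: divide_simps)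
 finally show ?thesis .
 qed
 then show "EX M. ALL m>=M. ALL n>=M. dist (q (s m) (t m)) (q (s n) (t n)) < e" by blast
 qed
 then show ?thesis by (simp add: Cauchy_convergent_iff)
qed

lemma ip_HC_lim:
 assumes s: "s : CQ" and t: "t : CQ" shows "(%n. q (s n) (t n)) ----> ip HC (cl s) (cl t)"
proof -
 let ?s = "rep (cl s)" and ?t = "rep (cl t)"
 note rs = rep_cl[OF s] and rt = rep_cl[OF t]
 have "(%n. q (?s n) (?t n)) ----> ip HC (cl s) (cl t)" using q_convergent[OF rs(1) rt(1)] by (simp add: completion_def convergent_LIMSEQ_iff)
 from tendsto_add[OF q_eqv[OF s t rs(1) rt(1) rs(2) rt(2)] this] show ?thesis by simp
qed

lemma ip_HC_eqI:
 assumes "s : CQ" "t : CQ" "(%n. q (s n) (t n)) ----> l" shows "ip HC (cl s) (cl t) = l" using LIMSEQ_unique[OF ip_HC_lim[OF assms(1,2)] assms(3)] .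

lemma hnorm_HC_lim:
 assumes s: "s : CQ" shows "(%n. form_norm q (s n)) ----> hnorm HC (cl s)" unfolding form_norm_def by (intro tendsto_intros ip_HC_lim s)

lemma hdist_HC_lim:
 assumes s: "s : CQ" and t: "t : CQ" shows "(%n. vdist V q (s n) (t n)) ----> hdist HC (cl s) (cl t)"
proof -
 have "cl s +[HC] (- 1) *[HC] cl t = cl (%n. s n \<oplus> (- 1) \<odot> t n)" using s t by (simp add: smult_HC add_HC CQ_smult)
 then show ?thesis unfolding vdist_def using hnorm_HC_lim[OF CQ_add[OF s CQ_smult[OF t, of "- 1"]]] by simp
qed

lemma semi_ip_HC: "semi_ip HC (ip HC)"
proof
 show "0[HC] : carrier HC" by (simp add: carrier_HC zero_HC)
next
 fix x y assume "x @: HC" "y @: HC"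
 then obtain s t where st: "s : CQ" "t : CQ" "x = cl s" "y = cl t" by (auto simp: carrier_HC)
 show "x +[HC] y @: HC" using st by (auto simp: carrier_HC add_HC CQ_add)
next
 fix x c assume "x @: HC"
 then obtain s where st: "s : CQ" "x = cl s" by (auto simp: carrier_HC)
 show "c *[HC] x @: HC" using st by (auto simp: carrier_HC smult_HC CQ_smult)
next
 fix x y z assume "x @: HC" "y @: HC" "z @: HC"
 then obtain s t u where st: "s : CQ" "t : CQ" "u : CQ" "x = cl s" "y = cl t" "z = cl u" by (auto simp: carrier_HC)
 have "(%n. q (u n) (s n) + q (u n) (t n)) ----> ip HC z x + ip HC z y" unfolding st using st by (intro tendsto_add ip_HC_lim)
 then show "ip HC z (x +[HC] y) = ip HC z x + ip HC z y" using st by (simp add: add_HC) (intro ip_HC_eqI CQ_add; simp add: q_add)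
next
 fix x z c assume "x @: HC" "z @: HC"
 then obtain s u where st: "s : CQ" "u : CQ" "x = cl s" "z = cl u" by (auto simp: carrier_HC)
 have "(%n. c * q (u n) (s n)) ----> c * ip HC z x" unfolding st using st by (intro tendsto_mult_left ip_HC_lim)
 then show "ip HC z (c *[HC] x) = c * ip HC z x" using st by (simp add: smult_HC) (intro ip_HC_eqI CQ_smult; simp add: q_smult)
next
 fix x y assume "x @: HC" "y @: HC"
 then obtain s t where st: "s : CQ" "t : CQ" "x = cl s" "y = cl t" by (auto simp: carrier_HC)
 have "(%n. cnj (q (t n) (s n))) ----> cnj (ip HC y x)" unfolding st using st by (intro tendsto_cnj ip_HC_lim)
 moreover have "(%n. cnj (q (t n) (s n))) = (%n. q (s n) (t n))" using st by (intro ext q_sym[symmetric]) auto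
 ultimately show "ip HC x y = cnj (ip HC y x)" using st by (simp add: ip_HC_eqI)
next
 fix x assume "x @: HC"
 then obtain s where st: "s : CQ" "x = cl s" by (auto simp: carrier_HC)
 have "(%n. Re (q (s n) (s n))) ----> Re (ip HC x x)" unfolding st using st by (intro tendsto_Re ip_HC_lim)
 then show "0 <= Re (ip HC x x)" by (rule LIMSEQ_le_const) (use st q_pos in auto)
next
 fix z assume "z @: HC"
 then obtain s where st: "s : CQ" "z = cl s" by (auto simp: carrier_HC)
 show "ip HC z 0[HC] = 0" unfolding zero_HC st using st by (intro ip_HC_eqI) (auto simp: q_zero)
qed

lemma emb_C [simp, intro]: "x @: V ==> emb x @: HC" by (auto simp: carrier_HC completion_embed_def)

lemma ip_emb [simp]: "[|x @: V; y @: V|] ==> ip HC (emb x) (emb y) = q x y" unfolding completion_embed_def by (intro ip_HC_eqI) auto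

lemma emb_add: "[|x @: V; y @: V|] ==> emb (x \<oplus> y) = emb x +[HC] emb y" unfolding completion_embed_def by (simp add: add_HC)

lemma emb_smult: "x @: V ==> emb (c \<odot> x) = c *[HC] emb x" unfolding completion_embed_def by (simp add: smult_HC)

lemma hdist_emb: "[|x @: V; y @: V|] ==> hdist HC (emb x) (emb y) = vdist V q x y"
 unfolding vdist_def by (simp add: emb_add[symmetric] emb_smult[symmetric] form_norm_def)

lemma hnorm_emb: "x @: V ==> hnorm HC (emb x) = form_norm q x" by (simp add: form_norm_def)

lemma emb_tendsto:
 assumes s: "s : CQ" shows "(%m. hdist HC (emb (s m)) (cl s)) ----> 0"
proof (rule LIMSEQ_I)
 interpret HC: semi_ip HC "ip HC" by (rule semi_ip_HC)
 fix r :: real assume r: "0 < r"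
 then have "r/2 > 0" by simp
 then obtain N where N: "!!m n. [|m >= N; n >= N|] ==> vdist V q (s m) (s n) < r/2" using s unfolding CQ_iff by blast
 have "norm (hdist HC (emb (s m)) (cl s) - 0) < r" if m: "m >= N" for m
 proof -
 have "(%n. vdist V q (s m) (s n)) ----> hdist HC (emb (s m)) (cl s)" unfolding completion_embed_def using hdist_HC_lim[of "%n. s m" s] s by simp
 then have "hdist HC (emb (s m)) (cl s) <= r/2" by (rule LIMSEQ_le_const2) (use N[OF m] in \<open>auto intro!: exI[of _ N] less_imp_le\<close>)
 moreover have "0 <= hdist HC (emb (s m)) (cl s)" using s by (intro HC.vd_nonneg emb_C) (auto simp: carrier_HC)
 ultimately show ?thesis using r by simp
 qed
 then show "EX no. ALL n>=no. norm (hdist HC (emb (s n)) (cl s) - 0) < r" by blast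
qed

lemma emb_dense:
 assumes "x @: HC" "d > 0" shows "EX v:carrier V. hdist HC (emb v) x < d"
proof -
 obtain s where s: "s : CQ" "x = cl s" using assms(1) by (auto simp: carrier_HC)
 obtain n where "hdist HC (emb (s n)) x < d" using order_tendstoD(2)[OF emb_tendsto[OF s(1)] assms(2)] s(2) by (auto simp: eventually_sequentially)
 then show ?thesis using s by auto
qed

text \<open>Given a Cauchy sequence of classes X m, vectors v m whose embeddings have distance less
  than 1/(m+1) from X m form a Cauchy sequence in V, and its class is the limit.\<close>

lemma hilb_HC: "hilb HC"
proof -
 interpret HC: semi_ip HC "ip HC" by (rule semi_ip_HC)
 interpret HC: ip_space HC
 proof
 fix x y assume C: "x @: HC" "y @: HC" and eq: "!!z. z @: HC ==> ip HC z x = ip HC z y"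
 obtain s t where st: "s : CQ" "t : CQ" "x = cl s" "y = cl t" using C by (auto simp: carrier_HC)
 let ?d = "x +[HC] (- 1) *[HC] y"
 have "ip HC ?d ?d = ip HC ?d x - ip HC ?d y" using C by (simp add: HC.q_simps)
 then have "hdist HC x y = 0" using eq[of ?d] C by (simp add: vdist_def form_norm_def)
 then show "x = y" using hdist_HC_lim[OF st(1,2)] cl_eq_iff[OF st(1,2)] st by simp
 qed
 show ?thesis
 proof
 fix X :: "nat => _" assume X: "!!n. X n @: HC" and cau: "!!e. e > 0 ==> EX N. ALL m>=N. ALL n>=N. hdist HC (X m) (X n) < e"
 have "ALL m. EX v:carrier V. hdist HC (emb v) (X m) < inverse (real (Suc m))" using emb_dense[OF X] by simp
 then obtain v where v: "!!m. v m @: V" "!!m. hdist HC (emb (v m)) (X m) < inverse (real (Suc m))" by metis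
 have v0: "(%m. hdist HC (emb (v m)) (X m)) ----> 0"
 proof (rule Lim_null_comparison[OF always_eventually LIMSEQ_inverse_real_of_nat])
 show "ALL n. norm (hdist HC (emb (v n)) (X n)) <= inverse (real (Suc n))" using v X by (simp add: less_imp_le)
 qed
 have vC: "v : CQ" unfolding CQ_iff
 proof (intro conjI allI impI v)
 fix e :: real assume e: "e > 0"
 then obtain N where N: "!!m n. [|m >= N; n >= N|] ==> hdist HC (X m) (X n) < e/3" using cau[of "e/3"] by auto
 obtain M where M: "!!m. m >= M ==> hdist HC (emb (v m)) (X m) < e/3" using order_tendstoD(2)[OF v0, of "e/3"] e by (auto simp: eventually_sequentially)
 have "vdist V q (v m) (v n) < e" if "m >= max N M" "n >= max N M" for m n
 proof -
 have "hdist HC (emb (v m)) (emb (v n)) <= hdist HC (emb (v m)) (X m) + hdist HC (X m) (emb (v n))" using v X by (intro HC.vd_triangle) auto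
 moreover have "hdist HC (X m) (emb (v n)) <= hdist HC (X m) (X n) + hdist HC (emb (v n)) (X n)"
 using v X HC.vd_triangle[of "X m" "X n" "emb (v n)"] HC.vd_sym[of "X n" "emb (v n)"] by auto
 ultimately show ?thesis using N[of m n] M[of m] M[of n] that v by (simp add: hdist_emb)
 qed
 then show "EX N. ALL m>=N. ALL n>=N. vdist V q (v m) (v n) < e" by blast
 qed
 have clC: "cl v @: HC" using vC by (simp add: carrier_HC)
 have g: "(%m. hdist HC (emb (v m)) (X m) + hdist HC (emb (v m)) (cl v)) ----> 0" using tendsto_add[OF v0 emb_tendsto[OF vC]] by simp
 have "ALL m. norm (hdist HC (X m) (cl v)) <= hdist HC (emb (v m)) (X m) + hdist HC (emb (v m)) (cl v)"
 using HC.vd_triangle[OF X _ clC] HC.vd_sym[OF X] v X clC by (metis HC.vd_nonneg abs_of_nonneg emb_C real_norm_def)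
 then have "(%m. hdist HC (X m) (cl v)) ----> 0" by (rule Lim_null_comparison[OF always_eventually g])
 then show "EX l:carrier HC. (%n. hdist HC (X n) l) ----> 0" using clC by blast
 qed
qed

lemma total_emb: "total HC (emb ` carrier V)"
proof (rule totalI)
 fix M x assume M: "closed_sub HC M" "emb ` carrier V <= M" and x: "x @: HC"
 obtain s where s: "s : CQ" "x = cl s" using x by (auto simp: carrier_HC)
 have "emb (s n) : M" for n using M(2) s(1) by auto
 from closed_subD(5)[OF M(1) this x] show "x : M" using emb_tendsto[OF s(1)] s(2) by simp
qed auto

end

section \<open>Positive semidefinite kernels\<close>

definition psd :: "'s set => ('s => 's => complex) => bool" where
 "psd S K \<longleftrightarrow> (ALL s:S. ALL t:S. K s t = cnj (K t s)) & (ALL F c. finite F & F <= S --> 0 <= Re (SUM s:F. SUM t:F. cnj (c s) * c t * K s t))"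

lemma psdI:
 assumes "!!s t. [|s : S; t : S|] ==> K s t = cnj (K t s)"
 "!!F c. [|finite F; F <= S|] ==> 0 <= Re (SUM s:F. SUM t:F. cnj (c s) * c t * K s t)" shows "psd S K" using assms unfolding psd_def by blast

lemma psdD:
 assumes "psd S K" shows "[|s : S; t : S|] ==> K s t = cnj (K t s)"
 "[|finite F; F <= S|] ==> 0 <= Re (SUM s:F. SUM t:F. cnj (c s) * c t * K s t)" using assms unfolding psd_def by blast+

lemma psd_subset: "psd S K ==> T <= S ==> psd T K" unfolding psd_def by (meson order_trans subsetD)

lemma psd_cong:
 assumes K: "psd S K" and eq: "!!s t. [|s : S; t : S|] ==> K s t = L s t" shows "psd S L"
proof (rule psdI)
 fix s t assume "s : S" "t : S"
 then show "L s t = cnj (L t s)" using psdD(1)[OF K, of s t] eq[of s t] eq[of t s] by simp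
next
 fix F c assume F: "finite F" "F <= S"
 have "(SUM s:F. SUM t:F. cnj (c s) * c t * L s t) = (SUM s:F. SUM t:F. cnj (c s) * c t * K s t)" using F eq by (intro sum.cong refl) (simp add: subset_iff)
 then show "0 <= Re (SUM s:F. SUM t:F. cnj (c s) * c t * L s t)" using psdD(2)[OF K F] by simp
qed

lemma (in ip_space) psd_gram:
 assumes "g ` S <= carrier H" shows "psd S (%s t. ip H (g s) (g t))"
proof (rule psdI)
 fix F c assume F: "finite F" "F <= S"
 then have g: "g ` F <= carrier H" using assms by blast
 show "0 <= Re (SUM s:F. SUM t:F. cnj (c s) * c t * ip H (g s) (g t))" using q_pos[OF lc_closed[OF F(1) g, of c]] ip_lc_lc[OF F(1) g F(1) g, of c c] by simp
qed (use assms q_sym in blast)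

lemma free_module_abelian_group: "abelian_group (free_module S)"
proof (rule abelian_groupI)
 fix x y assume "x @: (free_module S)" "y @: (free_module S)"
 moreover have "{s. x s + y s ~= 0} <= {s. x s ~= 0} \<union> {s. y s ~= 0}" by auto
 ultimately show "x +[free_module S] y @: (free_module S)"
 using finite_subset[of "{s. x s + y s ~= 0}" "{s. x s ~= 0} \<union> {s. y s ~= 0}"] by (auto simp: free_module_def)
next
 fix x assume "x @: (free_module S)"
 then show "EX y:carrier (free_module S). y +[free_module S] x = 0[free_module S]" by (intro bexI[of _ "%s. - x s"]) (auto simp: free_module_def)
qed (auto simp: free_module_def algebra_simps)

lemma kernel_form_sum:
 assumes "finite F" "{s. f s ~= 0} <= F" "{s. g s ~= 0} <= F" shows "kernel_form K f g = (SUM s:F. SUM t:F. cnj (f s) * g t * K s t)"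
proof -
 have "kernel_form K f g = (\<Sum>s | f s ~= 0. SUM t:F. cnj (f s) * g t * K s t)"
 unfolding kernel_form_def using assms by (intro sum.cong sum.mono_neutral_left refl) auto
 also have "... = (SUM s:F. SUM t:F. cnj (f s) * g t * K s t)" using assms by (intro sum.mono_neutral_left) auto
 finally show ?thesis .
qed

lemma comp_space_kernel:
 assumes "psd S K" shows "comp_space (free_module S) (kernel_form K)"
proof -
 let ?V = "free_module S"
 interpret A: abelian_group ?V by (rule free_module_abelian_group)
 have fin: "finite {s. f s ~= 0}" "{s. f s ~= 0} <= S" if "f @: ?V" for f using that by (auto simp: free_module_def)
 have smC: "c *[?V] f @: ?V" if "f @: ?V" for c f using that by (auto simp: free_module_def intro: finite_subset[of _ "{s. f s ~= 0}"])
 show ?thesis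
 proof
 show "0[?V] : carrier ?V" by simp
 next
 fix x y assume "x @: ?V" "y @: ?V"
 then show "x +[?V] y @: ?V" by simp
 next
 fix x c assume "x @: ?V"
 then show "c *[?V] x @: ?V" by (rule smC)
 next
 fix x y z assume C: "x @: ?V" "y @: ?V" "z @: ?V"
 define F where "F = {s. x s ~= 0} \<union> {s. y s ~= 0} \<union> {s. z s ~= 0}"
 have F: "finite F" using fin C by (simp add: F_def)
 have xy: "x +[?V] y = (%s. x s + y s)" by (simp add: free_module_def)
 have "kernel_form K z (%s. x s + y s) = (SUM s:F. SUM t:F. cnj (z s) * (x t + y t) * K s t)" using F by (intro kernel_form_sum) (auto simp: F_def)
 moreover have "kernel_form K z x = (SUM s:F. SUM t:F. cnj (z s) * x t * K s t)" using F by (intro kernel_form_sum) (auto simp: F_def)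
 moreover have "kernel_form K z y = (SUM s:F. SUM t:F. cnj (z s) * y t * K s t)" using F by (intro kernel_form_sum) (auto simp: F_def)
 ultimately show "kernel_form K z (x +[?V] y) = kernel_form K z x + kernel_form K z y" unfolding xy by (simp add: algebra_simps sum.distrib)
 next
 fix x z c assume C: "x @: ?V" "z @: ?V"
 define F where "F = {s. x s ~= 0} \<union> {s. z s ~= 0}"
 have F: "finite F" using fin C by (simp add: F_def)
 have cx: "c *[?V] x = (%s. c * x s)" by (simp add: free_module_def)
 have "kernel_form K z (%s. c * x s) = (SUM s:F. SUM t:F. cnj (z s) * (c * x t) * K s t)" using F by (intro kernel_form_sum) (auto simp: F_def)
 moreover have "kernel_form K z x = (SUM s:F. SUM t:F. cnj (z s) * x t * K s t)" using F by (intro kernel_form_sum) (auto simp: F_def)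
 ultimately show "kernel_form K z (c *[?V] x) = c * kernel_form K z x" unfolding cx by (simp add: sum_distrib_left algebra_simps)
 next
 fix x y assume C: "x @: ?V" "y @: ?V"
 define F where "F = {s. x s ~= 0} \<union> {s. y s ~= 0}"
 have F: "finite F" "F <= S" using fin C by (auto simp: F_def)
 have "kernel_form K x y = (SUM s:F. SUM t:F. cnj (x s) * y t * K s t)" using F by (intro kernel_form_sum) (auto simp: F_def)
 also have "... = (SUM t:F. SUM s:F. cnj (x s) * y t * K s t)" by (rule sum.swap)
 also have "... = (SUM t:F. SUM s:F. cnj (cnj (y t) * x s * K t s))"
 proof (intro sum.cong refl)
 fix t s assume "t : F" "s : F"
 then show "cnj (x s) * y t * K s t = cnj (cnj (y t) * x s * K t s)" using F psdD(1)[OF assms, of s t] by (simp add: subset_iff mult_ac)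
 qed
 also have "... = cnj (SUM t:F. SUM s:F. cnj (y t) * x s * K t s)" by simp
 also have "(SUM t:F. SUM s:F. cnj (y t) * x s * K t s) = kernel_form K y x" using F by (intro kernel_form_sum[symmetric]) (auto simp: F_def)
 finally show "kernel_form K x y = cnj (kernel_form K y x)" .
 next
 fix x assume "x @: ?V"
 then show "0 <= Re (kernel_form K x x)" unfolding kernel_form_def by (intro psdD(2)[OF assms] fin)
 next
 fix z assume "z @: ?V"
 show "kernel_form K z 0[?V] = 0" by (simp add: kernel_form_def free_module_def)
 next
 fix x y assume C: "x @: ?V" "y @: ?V"
 have "\<ominus>\<^bsub>?V\<^esub> y = (- 1) *[?V] y" by (rule A.minus_equality) (use C smC[OF C(2), of "- 1"] in \<open>auto simp: free_module_def\<close>)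
 then show "x \<ominus>\<^bsub>?V\<^esub> y = x +[?V] (- 1) *[?V] y" by (simp add: a_minus_def)
 qed
qed

lemma delta_C [simp, intro]: "s : S ==> delta s @: (free_module S)" by (auto simp: free_module_def delta_def)

lemma delta_supp: "{t. delta s t ~= 0} = {s}" by (auto simp: delta_def)

lemma kernel_form_delta: "kernel_form K (delta s) (delta t) = K s t" unfolding kernel_form_def delta_supp by (simp add: delta_def)

lemma kernel_form_delta_right: "kernel_form K g (delta t) = (\<Sum>s | g s ~= 0. cnj (g s) * K s t)"
 unfolding kernel_form_def delta_supp by (simp add: delta_def)

abbreviation "kspace S K == completion (free_module S) (kernel_form K)"
abbreviation "kel S K s == completion_embed (free_module S) (kernel_form K) (delta s)"

text \<open>Kolmogorov's construction: a positive semidefinite kernel is the Gram kernel of a total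
  family \<open>kel\<close> in a Hilbert space. Binary and iterated tensor products are both
  instances, so their theory reduces to positivity of kernels.\<close>

lemma kspace_props:
 assumes "psd S K" shows "hilb (kspace S K)" "s : S ==> kel S K s @: (kspace S K)"
 "[|s : S; t : S|] ==> ip (kspace S K) (kel S K s) (kel S K t) = K s t"
 "total (kspace S K) (kel S K ` S)"
proof -
 interpret C: comp_space "free_module S" "kernel_form K" by (rule comp_space_kernel[OF assms])
 interpret H: hilb "kspace S K" by (rule C.hilb_HC)
 show "hilb (kspace S K)" by (rule C.hilb_HC)
 show kC: "kel S K s @: (kspace S K)" if "s : S" for s using that by auto
 show "ip (kspace S K) (kel S K s) (kel S K t) = K s t" if "s : S" "t : S" for s t using that by (simp add: kernel_form_delta)
 show "total (kspace S K) (kel S K ` S)"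
 proof (rule totalI)
 fix M x assume M: "closed_sub (kspace S K) M" "kel S K ` S <= M" and x: "x @: (kspace S K)"
 have "C.emb f : M" if f: "f @: (free_module S)" for f
 proof -
 have fin: "finite {s. f s ~= 0}" "{s. f s ~= 0} <= S" using f by (auto simp: free_module_def)
 have gC: "(%s. kel S K s) ` {s. f s ~= 0} <= carrier (kspace S K)" using fin kC by auto
 \<comment> \<open>The embedded formal combination is the actual combination of the generators; this
   is tested on the dense set of embedded vectors.\<close>
 have "C.emb f = lc (kspace S K) f (%s. kel S K s) {s. f s ~= 0}"
 proof (rule H.sep_total[OF C.total_emb])
 fix e assume "e : C.emb ` carrier (free_module S)"
 then obtain g where g: "g @: (free_module S)" "e = C.emb g" by blast
 have "ip (kspace S K) e (lc (kspace S K) f (%s. kel S K s) {s. f s ~= 0})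
 = (\<Sum>s | f s ~= 0. f s * ip (kspace S K) e (kel S K s))" using g fin gC by (intro H.ip_lc) auto
 also have "... = (\<Sum>t | f t ~= 0. f t * (\<Sum>s | g s ~= 0. cnj (g s) * K s t))"
 using g fin by (intro sum.cong refl) (simp add: subset_iff kernel_form_delta_right)
 also have "... = (\<Sum>t | f t ~= 0. \<Sum>s | g s ~= 0. cnj (g s) * f t * K s t)" by (simp add: sum_distrib_left mult_ac)
 also have "... = kernel_form K g f" unfolding kernel_form_def by (rule sum.swap)
 finally show "ip (kspace S K) e (C.emb f) = ip (kspace S K) e (lc (kspace S K) f (%s. kel S K s) {s. f s ~= 0})" using f g by simp
 qed (use f fin gC in auto)
 then show ?thesis using H.closed_sub_lc[OF M(1) fin(1) order_trans[OF image_mono[OF fin(2)] M(2)], of f] by simp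
 qed
 then show "x : M" using totalD[OF C.total_emb M(1) _ x] by blast
 qed (use kC in auto)
qed

text \<open>Cholesky decomposition, removing one index at a time and passing to the Schur complement
  of its diagonal entry.\<close>

lemma psd_decomp:
 fixes K :: "'a => 'a => complex"
 assumes "finite F" "psd F K" shows "EX n (b :: nat => 'a => complex). ALL s:F. ALL t:F. K s t = (\<Sum>l<n. cnj (b l s) * b l t)" using assms
proof (induction F arbitrary: K)
 case empty
 then show ?case by simp
next
 case (insert a F)
 interpret C: comp_space "free_module (insert a F)" "kernel_form K" by (rule comp_space_kernel[OF insert(4)])
 note herm = psdD(1)[OF insert(4)]
 define k where "k = Re (K a a)"
 have k: "K a a = of_real k" "k >= 0" using C.q_self_real[of "delta a"] C.q_pos[of "delta a"] by (simp_all add: kernel_form_delta k_def)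
 have Kat: "K a t = 0" if "k = 0" "t : F" for t using C.CS_sq[of "delta a" "delta t"] that k by (simp add: kernel_form_delta)
 \<comment> \<open>If k = 0, division by zero makes L equal to K, and Cauchy-Schwarz makes the row
   of a vanish, so nothing is lost.\<close>
 define L where "L s t = K s t - K s a * K a t / of_real k" for s t
 have LK: "L s a = 0" "L a s = 0" if "k ~= 0" for s using that k by (simp_all add: L_def)
 have "psd F L"
 proof (rule psdI)
 fix s t assume st: "s : F" "t : F"
 show "L s t = cnj (L t s)" using herm[of s t] herm[of s a] herm[of a t] st by (simp add: L_def mult_ac)
 next
 fix G c assume G: "finite G" "G <= F"
 have aG: "a \<notin> G" using G insert by blast
 \<comment> \<open>This coefficient at a completes the square: the form of K at c' equals the form
   of the Schur complement at c.\<close>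
 define c' where "c' s = (if s = a then - (SUM t:G. c t * K a t) / of_real k else c s)" for s
 have c': "c' s = c s" if "s : G" for s using that aG by (auto simp: c'_def)
 define R where "R = (SUM s:G. cnj (c s) * K s a)"
 have Rc: "(SUM t:G. c t * K a t) = cnj R"
 proof -
 have "c t * K a t = cnj (cnj (c t) * K t a)" if "t : G" for t using herm[of a t] that G by auto
 then show ?thesis unfolding R_def cnj_sum by (rule sum.cong[OF refl])
 qed
 have "(SUM s:insert a G. SUM t:insert a G. cnj (c' s) * c' t * K s t)
 = cnj (c' a) * c' a * K a a + cnj (c' a) * (SUM t:G. c t * K a t) + c' a * R
 + (SUM s:G. SUM t:G. cnj (c s) * c t * K s t)" using G aG by (simp add: sum.distrib c' sum_distrib_left R_def mult_ac cong: sum.cong)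
 also have "... = (SUM s:G. SUM t:G. cnj (c s) * c t * L s t)"
 proof -
 have "(SUM s:G. SUM t:G. cnj (c s) * c t * L s t)
 = (SUM s:G. SUM t:G. cnj (c s) * c t * K s t) - (SUM s:G. SUM t:G. (cnj (c s) * K s a) * (c t * K a t)) / of_real k"
 unfolding L_def by (simp add: algebra_simps sum_subtractf sum_divide_distrib)
 also have "(SUM s:G. SUM t:G. (cnj (c s) * K s a) * (c t * K a t)) = R * (SUM t:G. c t * K a t)" unfolding R_def by (simp add: sum_product)
 finally show ?thesis unfolding Rc by (cases "k = 0") (simp_all add: c'_def Rc k(1) field_simps)
 qed
 finally show "0 <= Re (SUM s:G. SUM t:G. cnj (c s) * c t * L s t)" using psdD(2)[OF insert(4), of "insert a G" c'] G by auto
 qed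
 from insert.IH[OF this] obtain n and b :: "nat => 'a => complex" where b0: "ALL s:F. ALL t:F. L s t = (\<Sum>l<n. cnj (b l s) * b l t)" by blast
 then have b: "!!s t. [|s : F; t : F|] ==> L s t = (\<Sum>l<n. cnj (b l s) * b l t)" by simp
 define b' where "b' l s = (if l = n then K a s / of_real (sqrt k) else if s = a then 0 else b l s)" for l s
 have "K s t = (\<Sum>l<Suc n. cnj (b' l s) * b' l t)" if st: "s : insert a F" "t : insert a F" for s t
 proof -
 have sq: "complex_of_real (sqrt k) * complex_of_real (sqrt k) = of_real k" using k(2) by (simp flip: of_real_mult)
 have "(\<Sum>l<Suc n. cnj (b' l s) * b' l t) = (\<Sum>l<n. cnj (b' l s) * b' l t) + K s a * K a t / of_real k" using herm[of s a] st by (simp add: b'_def sq)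
 also have "(\<Sum>l<n. cnj (b' l s) * b' l t) = (if s = a \<or> t = a then 0 else L s t)" using st b[of s t] by (auto simp: b'_def intro!: sum.neutral)
 also have "... + K s a * K a t / of_real k = K s t"
 proof (cases "k = 0")
 case True
 have "K a t = 0" using Kat[OF True] st k True by auto
 moreover have "K s a = 0" using Kat[OF True] st k True herm[of s a] by auto
 ultimately show ?thesis using True st by (auto simp: L_def)
 next
 case False
 then show ?thesis using k by (auto simp: L_def)
 qed
 finally show ?thesis by simp
 qed
 then show ?case by blast
qed

text \<open>Schur product theorem. On a finite set L is a sum of rank one kernels, and multiplying K
  by a rank one kernel only rescales the coefficients c.\<close>

lemma psd_mult:
 assumes K: "psd S K" and L: "psd S L" shows "psd S (%s t. K s t * L s t)"
proof (rule psdI)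
 fix s t assume "s : S" "t : S"
 then show "K s t * L s t = cnj (K t s * L t s)" using psdD(1)[OF K, of s t] psdD(1)[OF L, of s t] by simp
next
 fix F c assume F: "finite F" "F <= S"
 obtain n b where b: "!!s t. [|s : F; t : F|] ==> L s t = (\<Sum>l<n::nat. cnj (b l s) * b l t)" using psd_decomp[OF F(1) psd_subset[OF L F(2)]] by blast
 have "(SUM s:F. SUM t:F. cnj (c s) * c t * (K s t * L s t))
 = (SUM s:F. SUM t:F. \<Sum>l<n. cnj (c s * b l s) * (c t * b l t) * K s t)" by (intro sum.cong refl) (simp add: b sum_distrib_left mult_ac)
 also have "... = (SUM s:F. \<Sum>l<n. SUM t:F. cnj (c s * b l s) * (c t * b l t) * K s t)" by (intro sum.cong refl sum.swap)
 also have "... = (\<Sum>l<n. SUM s:F. SUM t:F. cnj (c s * b l s) * (c t * b l t) * K s t)" by (rule sum.swap)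
 finally have eq: "(SUM s:F. SUM t:F. cnj (c s) * c t * (K s t * L s t))
 = (\<Sum>l<n. SUM s:F. SUM t:F. cnj (c s * b l s) * (c t * b l t) * K s t)" .
 show "0 <= Re (SUM s:F. SUM t:F. cnj (c s) * c t * (K s t * L s t))" unfolding eq Re_sum[of _ "{..<n}"] by (intro sum_nonneg psdD(2)[OF K F])
qed

lemma psd_one: "psd S (%s t. 1)"
proof (rule psdI)
 fix F :: "'a set" and c :: "'a => complex"
 have "(SUM s:F. SUM t:F. cnj (c s) * c t * 1) = cnj (SUM s:F. c s) * (SUM t:F. c t)" by (simp add: sum_product)
 also have "... = of_real ((cmod (SUM s:F. c s))^2)" by (simp add: of_real_cmod_sq mult.commute)
 finally show "0 <= Re (SUM s:F. SUM t:F. cnj (c s) * c t * 1)" by simp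
qed simp

lemma psd_prod: "(!!j. j < n ==> psd S (K j)) ==> psd S (%s t. \<Prod>j<(n::nat). K j s t)"
proof (induction n)
 case 0
 then show ?case by (simp add: psd_one)
next
 case (Suc n)
 then show ?case using psd_mult[of S "%s t. \<Prod>j<n. K j s t" "K n"] by simp
qed

text \<open>A norm inequality for all finite combinations, restated as positivity of a difference of
  Gram kernels. In this form it can be multiplied with another Gram kernel, which is how operator
  inequalities survive tensoring with the identity.\<close>

lemma psd_bound:
 assumes H: "ip_space H" and K: "ip_space K" and C: "C >= 0" and h: "h ` S <= carrier H" and k: "k ` S <= carrier K"
 and bd: "!!F c. [|finite F; F <= S|] ==> hnorm K (lc K c k F) <= C * hnorm H (lc H c h F)"
 shows "psd S (%s t. of_real (C^2) * ip H (h s) (h t) - ip K (k s) (k t))"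
proof (rule psdI)
 interpret H: ip_space H by fact
 interpret K: ip_space K by fact
 fix s t assume "s : S" "t : S"
 then have "h s @: H" "h t @: H" "k s @: K" "k t @: K" using h k by auto
 then show "of_real (C^2) * ip H (h s) (h t) - ip K (k s) (k t) = cnj (of_real (C^2) * ip H (h t) (h s) - ip K (k t) (k s))"
 using H.q_sym[of "h s" "h t"] K.q_sym[of "k s" "k t"] by simp
next
 interpret H: ip_space H by fact
 interpret K: ip_space K by fact
 fix F c assume F: "finite F" "F <= S"
 have hF: "h ` F <= carrier H" and kF: "k ` F <= carrier K" using F h k by auto
 have "(SUM s:F. SUM t:F. cnj (c s) * c t * (of_real (C^2) * ip H (h s) (h t) - ip K (k s) (k t)))
 = of_real (C^2) * ip H (lc H c h F) (lc H c h F) - ip K (lc K c k F) (lc K c k F)" unfolding H.ip_lc_lc[OF F(1) hF F(1) hF] K.ip_lc_lc[OF F(1) kF F(1) kF]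
 by (simp add: algebra_simps sum_subtractf sum_distrib_left)
 also have "Re ... = C^2 * (hnorm H (lc H c h F))^2 - (hnorm K (lc K c k F))^2" using F hF kF by (simp add: H.fn_sq K.fn_sq flip: of_real_power)
 also have "... >= 0" using power_mono[OF bd[OF F] K.fn_ge0[OF K.lc_closed[OF F(1) kF]], where n = 2] by (simp add: power_mult_distrib)
 finally show "0 <= Re (SUM s:F. SUM t:F. cnj (c s) * c t * (of_real (C^2) * ip H (h s) (h t) - ip K (k s) (k t)))" .
qed

section \<open>Tensor products\<close>

locale tensor2 = ip_space2
begin

abbreviation "TS == tensor_space H K"
abbreviation "te == tensor_elem H K"

lemma psd_tensor: "psd (carrier H \<times> carrier K) (tensor_kernel H K)" unfolding tensor_kernel_def
 by (rule psd_mult[OF H.psd_gram[of fst] K.psd_gram[of snd]]) auto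

lemma hilb_TS: "hilb TS" unfolding tensor_space_def by (rule kspace_props(1)[OF psd_tensor])

sublocale T: hilb TS by (rule hilb_TS)

lemma te_C [simp, intro]: "[|h @: H; k @: K|] ==> te h k @: TS" unfolding tensor_space_def tensor_elem_def by (rule kspace_props(2)[OF psd_tensor]) auto

lemma ip_te: "[|h @: H; k @: K; h' @: H; k' @: K|] ==>
 ip TS (te h k) (te h' k') = ip H h h' * ip K k k'" unfolding tensor_space_def tensor_elem_def
 by (subst kspace_props(3)[OF psd_tensor]) (auto simp: tensor_kernel_def)

lemma total_te: "total TS ((%(h, k). te h k) ` (carrier H \<times> carrier K))"
proof -
 have "(%(h, k). te h k) = (%s. kel (carrier H \<times> carrier K) (tensor_kernel H K) s)" by (auto simp: tensor_elem_def)
 then show ?thesis unfolding tensor_space_def using kspace_props(4)[OF psd_tensor] by simp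
qed

lemma te_eqI:
 assumes "x @: TS" "y @: TS"
 "!!h k. [|h @: H; k @: K|] ==> ip TS (te h k) x = ip TS (te h k) y" shows "x = y" by (rule T.sep_total[OF total_te assms(1,2)]) (use assms(3) in auto)

lemma te_add_left: "[|h @: H; h' @: H; k @: K|] ==> te (h +[H] h') k = te h k +[TS] te h' k"
 by (rule te_eqI) (auto simp: ip_te H.q_simps K.q_simps T.q_simps algebra_simps)

lemma te_add_right: "[|h @: H; k @: K; k' @: K|] ==> te h (k +[K] k') = te h k +[TS] te h k'"
 by (rule te_eqI) (auto simp: ip_te H.q_simps K.q_simps T.q_simps algebra_simps)

lemma te_smult_left: "[|h @: H; k @: K|] ==> te (c *[H] h) k = c *[TS] te h k" by (rule te_eqI) (auto simp: ip_te H.q_simps K.q_simps T.q_simps)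

lemma te_smult_right: "[|h @: H; k @: K|] ==> te h (c *[K] k) = c *[TS] te h k" by (rule te_eqI) (auto simp: ip_te H.q_simps K.q_simps T.q_simps)

lemma hnorm_te: "[|h @: H; k @: K|] ==> hnorm TS (te h k) = hnorm H h * hnorm K k"
 unfolding form_norm_def by (simp add: ip_te H.q_self[of h] K.q_self[of k] real_sqrt_mult flip: of_real_power)

lemma blin_te_right: "h @: H ==> blin K TS (%k. te h k)" unfolding blin_def by (auto simp: te_add_right te_smult_right hnorm_te intro!: exI[of _ "hnorm H h"])

lemma total_te_right:
 assumes "total K D" shows "total TS ((%(h, k). te h k) ` (carrier H \<times> D))"
proof (rule totalI)
 interpret KT: ip_space2 K TS by unfold_locales
 have D: "D <= carrier K" by (rule total_sub[OF assms])
 show "(%(h, k). te h k) ` (carrier H \<times> D) <= carrier TS" using D by auto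
 fix M x assume M: "closed_sub TS M" "(%(h, k). te h k) ` (carrier H \<times> D) <= M" and x: "x @: TS"
 have "te h k : M" if "h @: H" "k @: K" for h k
 proof -
 have "D <= {k : carrier K. te h k : M}" using M(2) D that by auto
 from totalD[OF assms KT.closed_sub_vimage[OF blin_te_right[OF that(1)] M(1)] this that(2)] show ?thesis by simp
 qed
 then show "x : M" by (intro totalD[OF total_te M(1) _ x]) auto
qed

text \<open>The kernel given by \<open>psd_bound\<close> for S is multiplied with the Gram kernel of
  the second leg. This yields the bound C on finite combinations of elementary tensors, without loss
  in the constant.\<close>

lemma tensor_op_id:
 assumes S: "S : bounded_ops H H" and C: "C >= 0" "!!h. h @: H ==> hnorm H (S h) <= C * hnorm H h"
 defines "R == tensor_op H K S (\<lambda>w\<in>carrier K. w)" shows "R : bounded_ops TS TS" "!!h k. [|h @: H; k @: K|] ==> R (te h k) = te (S h) k"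
 "!!x. x @: TS ==> hnorm TS (R x) <= C * hnorm TS x"
proof -
 interpret HH: ip_space2 H H by unfold_locales
 interpret TT: ip_space2 TS TS by unfold_locales
 let ?P = "carrier H \<times> carrier K"
 have bS: "blin H H S" using S by (simp add: bounded_ops_iff)
 have SC: "S h @: H" if "h @: H" for h using blinD(1)[OF bS that] .
 have D: "psd ?P (%s t. of_real (C^2) * ip H (fst s) (fst t) - ip H (S (fst s)) (S (fst t)))"
 proof (rule psd_bound)
 fix F :: "('a \<times> 'c) set" and c assume F: "finite F" "F <= ?P"
 have "lc H c (%s. S (fst s)) F = S (lc H c fst F)" using F by (intro HH.blin_lc[OF bS, symmetric]) auto
 then show "hnorm H (lc H c (%s. S (fst s)) F) <= C * hnorm H (lc H c fst F)" using F C by (auto intro!: C(2) H.lc_closed)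
 qed (use C SC in auto, unfold_locales)
 have E: "psd ?P (%s t. (of_real (C^2) * ip H (fst s) (fst t) - ip H (S (fst s)) (S (fst t))) * ip K (snd s) (snd t))" by (rule psd_mult[OF D K.psd_gram]) auto
 have "hnorm TS (lc TS c (%(h, k). te (S h) k) F) <= C * hnorm TS (lc TS c (%(h, k). te h k) F)" if F: "finite F" "F <= ?P" for F c
 proof (rule power2_le_imp_le)
 have 1: "(%(h, k). te (S h) k) ` F <= carrier TS" "(%(h, k). te h k) ` F <= carrier TS" using F SC by auto
 have mem: "fst s @: H & snd s @: K" if "s : F" for s using F that by auto
 have 2: "ip TS (lc TS c (%(h, k). te (S h) k) F) (lc TS c (%(h, k). te (S h) k) F)
 = (SUM s:F. SUM t:F. cnj (c s) * c t * (ip H (S (fst s)) (S (fst t)) * ip K (snd s) (snd t)))" unfolding T.ip_lc_lc[OF F(1) 1(1) F(1) 1(1)] using F SC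
 by (intro sum.cong refl) (simp add: case_prod_beta ip_te mem)
 have 3: "ip TS (lc TS c (%(h, k). te h k) F) (lc TS c (%(h, k). te h k) F)
 = (SUM s:F. SUM t:F. cnj (c s) * c t * (ip H (fst s) (fst t) * ip K (snd s) (snd t)))" unfolding T.ip_lc_lc[OF F(1) 1(2) F(1) 1(2)] using F SC
 by (intro sum.cong refl) (simp add: case_prod_beta ip_te mem)
 have "0 <= Re (of_real (C^2) * ip TS (lc TS c (%(h, k). te h k) F) (lc TS c (%(h, k). te h k) F)
 - ip TS (lc TS c (%(h, k). te (S h) k) F) (lc TS c (%(h, k). te (S h) k) F))"
 using psdD(2)[OF E F, of c] unfolding 2 3 by (simp add: sum_distrib_left sum_subtractf algebra_simps)
 then show "(hnorm TS (lc TS c (%(h, k). te (S h) k) F))^2 <= (C * hnorm TS (lc TS c (%(h, k). te h k) F))^2"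
 using 1 F by (simp add: T.fn_sq power_mult_distrib flip: of_real_power)
 show "0 <= C * hnorm TS (lc TS c (%(h, k). te h k) F)" using C 1 F by auto
 qed
 from bounded_ext[OF T.ip_space_axioms hilb_TS total_te _ C(1) this]
 obtain R' where R': "R' : bounded_ops TS TS" "!!h k. [|h @: H; k @: K|] ==> R' (te h k) = te (S h) k"
 "!!x. x @: TS ==> hnorm TS (R' x) <= C * hnorm TS x" using SC by fastforce
 have "R = R'" unfolding R_def tensor_op_def
 proof (rule the_equality)
 fix Q assume Q: "Q : bounded_ops TS TS & (ALL h:carrier H. ALL k:carrier K. Q (te h k) = te (S h) ((\<lambda>w\<in>carrier K. w) k))"
 show "Q = R'" by (rule TT.bounded_ops_eqI[OF _ R'(1) total_te]) (use Q R' in auto)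
 qed (use R' in auto)
 then show "R : bounded_ops TS TS" "!!h k. [|h @: H; k @: K|] ==> R (te h k) = te (S h) k"
 "!!x. x @: TS ==> hnorm TS (R x) <= C * hnorm TS x" using R' by auto
qed

end

lemma listset_iff: "xs : listset As \<longleftrightarrow> length xs = length As & (ALL j<length As. xs ! j : As ! j)"
proof (induction As arbitrary: xs)
 case (Cons A As)
 show ?case
 proof (cases xs)
 case Nil
 then show ?thesis by (auto simp: set_Cons_def)
 next
 case (Cons y ys)
 then show ?thesis using Cons.IH[of ys] by (auto simp: set_Cons_def nth_Cons less_Suc_eq_0_disj split: nat.splits)
 qed
qed auto

lemma psd_tensor_list:
 assumes "!!j. j < length Hs ==> ip_space (Hs ! j)" shows "psd (listset (map carrier Hs)) (tensor_list_kernel Hs)" unfolding tensor_list_kernel_def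
proof (rule psd_prod)
 fix j assume j: "j < length Hs"
 interpret ip_space "Hs ! j" by (rule assms[OF j])
 show "psd (listset (map carrier Hs)) (%s t. ip (Hs ! j) (s ! j) (t ! j))" using j by (intro psd_gram) (auto simp: listset_iff)
qed

section \<open>Hilbert space direct sums\<close>

lemma ip_spaceI:
 assumes "semi_ip H (ip H)" and eq: "!!x y. [|x @: H; y @: H; hdist H x y = 0|] ==> x = y" shows "ip_space H"
proof -
 interpret H: semi_ip H "ip H" by fact
 show ?thesis
 proof
 fix x y assume C: "x @: H" "y @: H" and *: "!!z. z @: H ==> ip H z x = ip H z y"
 let ?d = "x +[H] (- 1) *[H] y"
 have "ip H ?d ?d = ip H ?d x - ip H ?d y" using C by (simp add: H.q_simps)
 then have "hdist H x y = 0" using *[of ?d] C by (simp add: vdist_def form_norm_def)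
 then show "x = y" using C by (intro eq)
 qed
qed

locale hsum =
 fixes J :: "'j set" and Hs :: "'j => ('h, 'm) inner_space_scheme"
 assumes hilb_summand: "j : J ==> hilb (Hs j)"
begin

abbreviation "HS == hilbert_sum J Hs"

lemma ips: "j : J ==> ip_space (Hs j)" using hilb_summand hilb.axioms(1) by blast

lemma semi: "j : J ==> semi_ip (Hs j) (ip (Hs j))" using ips ip_space.axioms(1) by blast

lemma HS_iff: "v @: HS \<longleftrightarrow> v : extensional J & (ALL j:J. v j @: (Hs j)) & (%j. (hnorm (Hs j) (v j))^2) summable_on J"
 by (auto simp: hilbert_sum_def ip_norm_eq PiE_def)

lemma HS_D:
 assumes "v @: HS" shows "v : extensional J" "j : J ==> v j @: (Hs j)" "(%j. (hnorm (Hs j) (v j))^2) summable_on J" using assms unfolding HS_iff by auto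

lemma ip_HS: "ip HS v w = (\<Sum>\<^sub>\<infinity>j\<in>J. ip (Hs j) (v j) (w j))" by (simp add: hilbert_sum_def)

lemma add_HS: "v +[HS] w = (\<lambda>j\<in>J. v j +[Hs j] w j)" by (simp add: hilbert_sum_def)

lemma smult_HS: "c *[HS] v = (\<lambda>j\<in>J. c *[Hs j] v j)" by (simp add: hilbert_sum_def)

lemma zero_HS: "0[HS] = (\<lambda>j\<in>J. 0[Hs j])" by (simp add: hilbert_sum_def)

lemma ip_summable:
 assumes v: "v @: HS" and w: "w @: HS" shows "(%j. ip (Hs j) (v j) (w j)) summable_on J"
proof (rule abs_summable_summable, rule summable_on_comparison_test)
 show "(%j. (hnorm (Hs j) (v j))^2 + (hnorm (Hs j) (w j))^2) summable_on J" using HS_D(3)[OF v] HS_D(3)[OF w] by (rule summable_on_add)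
 fix j assume j: "j : J"
 interpret semi_ip "Hs j" "ip (Hs j)" by (rule semi[OF j])
 have C: "v j @: (Hs j)" "w j @: (Hs j)" using HS_D(2)[OF v j] HS_D(2)[OF w j] by auto
 have "2 * (hnorm (Hs j) (v j) * hnorm (Hs j) (w j)) <= (hnorm (Hs j) (v j))^2 + (hnorm (Hs j) (w j))^2"
 using sum_squares_bound[of "hnorm (Hs j) (v j)" "hnorm (Hs j) (w j)"] by (simp add: mult.assoc)
 then show "cmod (ip (Hs j) (v j) (w j)) <= (hnorm (Hs j) (v j))^2 + (hnorm (Hs j) (w j))^2"
 using CS[OF C] mult_nonneg_nonneg[OF fn_ge0[OF C(1)] fn_ge0[OF C(2)]] by linarith
qed simp

lemma add_sq:
 assumes "semi_ip V q" "x @: V" "y @: V" shows "(form_norm q (x +[V] y))^2 <= 2 * (form_norm q x)^2 + 2 * (form_norm q y)^2"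
proof -
 interpret semi_ip V q by fact
 have "(form_norm q (x +[V] y))^2 <= (form_norm q x + form_norm q y)^2" using assms by (intro power_mono fn_triangle) auto
 also have "... <= 2 * (form_norm q x)^2 + 2 * (form_norm q y)^2" using sum_squares_bound[of "form_norm q x" "form_norm q y"] by (simp add: power2_sum)
 finally show ?thesis .
qed

lemma HS_add:
 assumes v: "v @: HS" and w: "w @: HS" shows "(\<lambda>j\<in>J. v j +[Hs j] w j) @: HS" unfolding HS_iff
proof (intro conjI ballI)
 have "(%j. 2 * (hnorm (Hs j) (v j))^2 + 2 * (hnorm (Hs j) (w j))^2) summable_on J"
 using HS_D(3)[OF v] HS_D(3)[OF w] by (intro summable_on_add summable_on_cmult_right)
 then show "(%j. (hnorm (Hs j) ((\<lambda>j\<in>J. v j +[Hs j] w j) j))^2) summable_on J"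
 by (rule summable_on_comparison_test) (use HS_D(2)[OF v] HS_D(2)[OF w] add_sq[OF semi] in auto)
qed (use HS_D(2)[OF v] HS_D(2)[OF w] semi_ip.addC[OF semi] in auto)

lemma HS_smult:
 assumes v: "v @: HS" shows "(\<lambda>j\<in>J. c *[Hs j] v j) @: HS" unfolding HS_iff
proof (intro conjI ballI)
 have "(%j. (cmod c)^2 * (hnorm (Hs j) (v j))^2) summable_on J" using HS_D(3)[OF v] by (intro summable_on_cmult_right)
 then show "(%j. (hnorm (Hs j) ((\<lambda>j\<in>J. c *[Hs j] v j) j))^2) summable_on J"
 by (rule summable_on_comparison_test) (use HS_D(2)[OF v] semi_ip.fn_smult[OF semi] in \<open>auto simp: power_mult_distrib\<close>)
qed (use HS_D(2)[OF v] semi_ip.smultC[OF semi] in auto)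

lemma semi_ip_HS: "semi_ip HS (ip HS)"
proof
 have "(%j. (hnorm (Hs j) ((\<lambda>j\<in>J. 0[Hs j]) j))^2) summable_on J \<longleftrightarrow> (%j. 0::real) summable_on J"
 by (intro summable_on_cong) (simp add: semi_ip.fn_zero[OF semi])
 then show "0[HS] : carrier HS" unfolding HS_iff zero_HS using semi_ip.zeroC[OF semi] by auto
next
 fix x y assume "x @: HS" "y @: HS"
 then show "x +[HS] y @: HS" unfolding add_HS by (rule HS_add)
next
 fix x c assume "x @: HS"
 then show "c *[HS] x @: HS" unfolding smult_HS by (rule HS_smult)
next
 fix x y z assume C: "x @: HS" "y @: HS" "z @: HS"
 have "ip HS z (x +[HS] y) = (\<Sum>\<^sub>\<infinity>j\<in>J. ip (Hs j) (z j) (x j) + ip (Hs j) (z j) (y j))"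
 unfolding ip_HS add_HS by (intro infsum_cong) (use HS_D(2)[OF C(1)] HS_D(2)[OF C(2)] HS_D(2)[OF C(3)] semi_ip.q_add[OF semi] in auto)
 then show "ip HS z (x +[HS] y) = ip HS z x + ip HS z y" unfolding ip_HS using C by (simp add: infsum_add ip_summable)
next
 fix x z c assume C: "x @: HS" "z @: HS"
 have "ip HS z (c *[HS] x) = (\<Sum>\<^sub>\<infinity>j\<in>J. c * ip (Hs j) (z j) (x j))"
 unfolding ip_HS smult_HS by (intro infsum_cong) (use HS_D(2)[OF C(1)] HS_D(2)[OF C(2)] semi_ip.q_smult[OF semi] in auto)
 then show "ip HS z (c *[HS] x) = c * ip HS z x" unfolding ip_HS using C by (simp add: infsum_cmult_right')
next
 fix x y assume C: "x @: HS" "y @: HS"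
 have "ip HS x y = (\<Sum>\<^sub>\<infinity>j\<in>J. cnj (ip (Hs j) (y j) (x j)))"
 unfolding ip_HS by (intro infsum_cong semi_ip.q_sym[OF semi] HS_D(2)[OF C(1)] HS_D(2)[OF C(2)])
 then show "ip HS x y = cnj (ip HS y x)" unfolding ip_HS by simp
next
 fix x assume C: "x @: HS"
 have "Re (ip HS x x) = (\<Sum>\<^sub>\<infinity>j\<in>J. Re (ip (Hs j) (x j) (x j)))" unfolding ip_HS by (rule infsum_Re[symmetric, OF ip_summable[OF C C]])
 also have "... >= 0" by (intro infsum_nonneg semi_ip.q_pos[OF semi] HS_D(2)[OF C])
 finally show "0 <= Re (ip HS x x)" .
next
 fix z assume C: "z @: HS"
 have "ip HS z 0[HS] = (\<Sum>\<^sub>\<infinity>j\<in>J. 0)" unfolding ip_HS zero_HS by (intro infsum_cong) (use semi_ip.q_zero[OF semi] HS_D(2)[OF C] in auto)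
 then show "ip HS z 0[HS] = 0" by simp
qed

lemma hnorm_HS:
 assumes C: "x @: HS" shows "(hnorm HS x)^2 = (\<Sum>\<^sub>\<infinity>j\<in>J. (hnorm (Hs j) (x j))^2)"
proof -
 have "(hnorm HS x)^2 = Re (ip HS x x)" by (rule semi_ip.fn_sq[OF semi_ip_HS C])
 also have "... = (\<Sum>\<^sub>\<infinity>j\<in>J. Re (ip (Hs j) (x j) (x j)))" unfolding ip_HS by (rule infsum_Re[symmetric, OF ip_summable[OF C C]])
 also have "... = (\<Sum>\<^sub>\<infinity>j\<in>J. (hnorm (Hs j) (x j))^2)" by (intro infsum_cong semi_ip.fn_sq[OF semi, symmetric] HS_D(2)[OF C])
 finally show ?thesis .
qed

lemma diff_HS:
 assumes x: "x @: HS" and y: "y @: HS" shows "x +[HS] (- 1) *[HS] y = (\<lambda>j\<in>J. x j +[Hs j] (- 1) *[Hs j] y j)"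
 unfolding add_HS smult_HS by (auto simp: restrict_def)

lemma hdist_HS:
 assumes x: "x @: HS" and y: "y @: HS" shows "(%j. (hdist (Hs j) (x j) (y j))^2) summable_on J"
 "(hdist HS x y)^2 = (\<Sum>\<^sub>\<infinity>j\<in>J. (hdist (Hs j) (x j) (y j))^2)"
proof -
 interpret S: semi_ip HS "ip HS" by (rule semi_ip_HS)
 have C: "x +[HS] (- 1) *[HS] y @: HS" using x y by auto
 show "(hdist HS x y)^2 = (\<Sum>\<^sub>\<infinity>j\<in>J. (hdist (Hs j) (x j) (y j))^2)"
 unfolding vdist_def[of HS] hnorm_HS[OF C] unfolding diff_HS[OF x y] vdist_def by (intro infsum_cong) simp
 have "(%j. (hnorm (Hs j) ((\<lambda>j\<in>J. x j +[Hs j] (- 1) *[Hs j] y j) j))^2) summable_on J" using HS_D(3)[OF C] unfolding diff_HS[OF x y] .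
 then show "(%j. (hdist (Hs j) (x j) (y j))^2) summable_on J" unfolding vdist_def by (subst summable_on_cong[symmetric]) auto
qed

lemma hdist_coord:
 assumes x: "x @: HS" and y: "y @: HS" and j: "j : J" shows "hdist (Hs j) (x j) (y j) <= hdist HS x y"
proof (rule power2_le_imp_le)
 have "sum (%j. (hdist (Hs j) (x j) (y j))^2) {j} <= (\<Sum>\<^sub>\<infinity>j\<in>J. (hdist (Hs j) (x j) (y j))^2)"
 by (rule finite_sum_le_infsum[OF hdist_HS(1)[OF x y]]) (use j in auto)
 then show "(hdist (Hs j) (x j) (y j))^2 <= (hdist HS x y)^2" using hdist_HS(2)[OF x y] by simp
 show "0 <= hdist HS x y" using x y by (intro semi_ip.vd_nonneg[OF semi_ip_HS])
qed

lemma ip_space_HS: "ip_space HS"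
proof (rule ip_spaceI[OF semi_ip_HS])
 fix x y assume C: "x @: HS" "y @: HS" and d: "hdist HS x y = 0"
 show "x = y"
 proof (rule extensionalityI[OF HS_D(1)[OF C(1)] HS_D(1)[OF C(2)]])
 fix j assume j: "j : J"
 interpret ip_space "Hs j" by (rule ips[OF j])
 have "hdist (Hs j) (x j) (y j) = 0" using hdist_coord[OF C j] d vd_nonneg[OF HS_D(2)[OF C(1) j] HS_D(2)[OF C(2) j]] by simp
 then show "x j = y j" by (rule hdist_eq_0[OF HS_D(2)[OF C(1) j] HS_D(2)[OF C(2) j]])
 qed
qed

text \<open>Coordinates converge since the summands are complete. Finite partial sums of squared
  distances pass to the limit with a bound independent of the finite set, which gives both
  membership of the limit and convergence in norm.\<close>

lemma hilb_HS: "hilb HS"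
proof -
 interpret S: ip_space HS by (rule ip_space_HS)
 show ?thesis
 proof
 fix X :: "nat => _" assume X: "!!n. X n @: HS" and cau: "!!e. e > 0 ==> EX N. ALL m>=N. ALL n>=N. hdist HS (X m) (X n) < e"
 have XC: "X n j @: (Hs j)" if "j : J" for n j using HS_D(2)[OF X that] .
 have "ALL j:J. EX l:carrier (Hs j). (%n. hdist (Hs j) (X n j) l) ----> 0"
 proof
 fix j assume j: "j : J"
 interpret hilb "Hs j" by (rule hilb_summand[OF j])
 show "EX l:carrier (Hs j). (%n. hdist (Hs j) (X n j) l) ----> 0"
 proof (rule complete)
 fix e :: real assume "e > 0"
 then obtain N where "ALL m>=N. ALL n>=N. hdist HS (X m) (X n) < e" using cau by blast
 then show "EX N. ALL m>=N. ALL n>=N. hdist (Hs j) (X m j) (X n j) < e" using hdist_coord[OF X X j] by (intro exI[of _ N] allI impI) (meson le_less_trans)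
 qed (rule XC[OF j])
 qed
 then obtain l0 where l0: "!!j. j : J ==> l0 j @: (Hs j)"
 "!!j. j : J ==> (%n. hdist (Hs j) (X n j) (l0 j)) ----> 0" by metis
 define l where "l = restrict l0 J"
 have lj: "l j = l0 j" if "j : J" for j using that by (simp add: l_def)
 have fin: "(SUM j:F. (hdist (Hs j) (X n j) (l j))^2) <= e^2"
 if F: "finite F" "F <= J" and N: "ALL m>=N. ALL n>=N. hdist HS (X m) (X n) < e" "n >= N" for F n N e
 proof (rule LIMSEQ_le_const2)
 show "(%m. SUM j:F. (hdist (Hs j) (X n j) (X m j))^2) ----> (SUM j:F. (hdist (Hs j) (X n j) (l j))^2)"
 proof (intro tendsto_sum tendsto_power)
 fix j assume "j : F"
 then have j: "j : J" using F by auto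
 interpret hilb "Hs j" by (rule hilb_summand[OF j])
 have "ALL m. norm (hdist (Hs j) (X n j) (X m j) - hdist (Hs j) (X n j) (l j)) <= hdist (Hs j) (X m j) (l0 j)"
 proof
 fix m
 show "norm (hdist (Hs j) (X n j) (X m j) - hdist (Hs j) (X n j) (l j)) <= hdist (Hs j) (X m j) (l0 j)"
 using vd_triangle[OF XC[OF j, of n] XC[OF j, of m] l0(1)[OF j]]
 vd_triangle[OF XC[OF j, of n] l0(1)[OF j] XC[OF j, of m]]
 vd_sym[OF l0(1)[OF j] XC[OF j, of m]] lj[OF j] by simp
 qed
 then have "(%m. hdist (Hs j) (X n j) (X m j) - hdist (Hs j) (X n j) (l j)) ----> 0" by (rule Lim_null_comparison[OF always_eventually l0(2)[OF j]])
 then show "(%m. hdist (Hs j) (X n j) (X m j)) ----> hdist (Hs j) (X n j) (l j)" by (simp add: LIM_zero_iff)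
 qed
 have "(SUM j:F. (hdist (Hs j) (X n j) (X m j))^2) <= e^2" if m: "m >= N" for m
 proof -
 have "(SUM j:F. (hdist (Hs j) (X n j) (X m j))^2) <= (\<Sum>\<^sub>\<infinity>j\<in>J. (hdist (Hs j) (X n j) (X m j))^2)"
 by (rule finite_sum_le_infsum[OF hdist_HS(1)[OF X X] F]) simp
 also have "... = (hdist HS (X n) (X m))^2" using hdist_HS(2)[OF X X] by simp
 also have "... <= e^2" using N m X by (intro power_mono) (auto intro: less_imp_le)
 finally show ?thesis .
 qed
 then show "EX N. ALL m>=N. (SUM j:F. (hdist (Hs j) (X n j) (X m j))^2) <= e^2" by blast
 qed
 have summ: "(%j. (hdist (Hs j) (X n j) (l j))^2) summable_on J" if N: "ALL m>=N. ALL n>=N. hdist HS (X m) (X n) < e" "n >= N" for n N e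
 by (rule nonneg_bdd_above_summable_on, simp, rule bdd_aboveI2[where M = "e^2"]) (simp add: fin[OF _ _ N])
 have lC: "l @: HS"
 proof -
 obtain N where N: "ALL m>=N. ALL n>=N. hdist HS (X m) (X n) < 1" using cau[of 1] by auto
 have "(%j. 2 * (hdist (Hs j) (X N j) (l j))^2 + 2 * (hnorm (Hs j) (X N j))^2) summable_on J"
 by (intro summable_on_add summable_on_cmult_right summ[OF N order_refl] HS_D(3)[OF X])
 then have "(%j. (hnorm (Hs j) (l j))^2) summable_on J"
 proof (rule summable_on_comparison_test)
 fix j assume j: "j : J"
 interpret hilb "Hs j" by (rule hilb_summand[OF j])
 have "hnorm (Hs j) (l j) <= hdist (Hs j) (X N j) (l j) + hnorm (Hs j) (X N j)"
 using fn_le_vd[of "l j" "X N j"] vd_sym[of "l j" "X N j"] l0(1)[OF j] XC[OF j] lj[OF j] by simp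
 then have "(hnorm (Hs j) (l j))^2 <= (hdist (Hs j) (X N j) (l j) + hnorm (Hs j) (X N j))^2" using l0(1)[OF j] lj[OF j] by (intro power_mono) auto
 also have "... <= 2 * (hdist (Hs j) (X N j) (l j))^2 + 2 * (hnorm (Hs j) (X N j))^2"
 using sum_squares_bound[of "hdist (Hs j) (X N j) (l j)" "hnorm (Hs j) (X N j)"] by (simp add: power2_sum)
 finally show "(hnorm (Hs j) (l j))^2 <= 2 * (hdist (Hs j) (X N j) (l j))^2 + 2 * (hnorm (Hs j) (X N j))^2" .
 qed simp
 then show ?thesis unfolding HS_iff using l0(1) lj by (auto simp: l_def)
 qed
 have "(%n. hdist HS (X n) l) ----> 0"
 proof (rule LIMSEQ_I)
 fix r :: real assume r: "0 < r"
 then obtain N where N: "ALL m>=N. ALL n>=N. hdist HS (X m) (X n) < r/2" using cau[of "r/2"] by auto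
 have "norm (hdist HS (X n) l - 0) < r" if n: "n >= N" for n
 proof -
 have 1: "(%j. (hdist (Hs j) (X n j) (l j))^2) summable_on J" by (rule summ[OF N n])
 have 2: "(SUM j:F. (hdist (Hs j) (X n j) (l j))^2) <= (r/2)^2" if "finite F" "F <= J" for F by (rule fin[OF that N n])
 have "(hdist HS (X n) l)^2 <= (r/2)^2" using infsum_le_finite_sums[OF 1 2] hdist_HS(2)[OF X lC, of n] by simp
 then have "hdist HS (X n) l <= r/2" by (rule power2_le_imp_le) (use r in linarith)
 then show ?thesis using r S.vd_nonneg[OF X lC, of n] by simp
 qed
 then show "EX no. ALL n>=no. norm (hdist HS (X n) l - 0) < r" by blast
 qed
 then show "EX l:carrier HS. (%n. hdist HS (X n) l) ----> 0" using lC by blast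
 qed
qed

sublocale HS: hilb HS by (rule hilb_HS)

definition single :: "'j => 'h => 'j => 'h" where
 "single j x = (\<lambda>k\<in>J. if k = j then x else 0[Hs k])"

lemma single_C:
 assumes "j : J" "x @: (Hs j)" shows "single j x @: HS"
proof -
 have "(%k. (hnorm (Hs k) (single j x k))^2) summable_on J \<longleftrightarrow> (%k. (hnorm (Hs j) x)^2) summable_on {j}"
 by (rule summable_on_cong_neutral) (auto simp: single_def semi_ip.fn_zero[OF semi] assms)
 then show ?thesis unfolding HS_iff using assms semi_ip.zeroC[OF semi] by (auto simp: single_def)
qed

lemma ip_single:
 assumes "j : J" "x @: (Hs j)" "v @: HS" shows "ip HS (single j x) v = ip (Hs j) x (v j)"
proof -
 have "ip HS (single j x) v = infsum (%k. ip (Hs j) x (v j)) {j}"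
 unfolding ip_HS by (rule infsum_cong_neutral) (auto simp: single_def semi_ip.q_zero_left[OF semi] assms HS_D(2)[OF assms(3)])
 then show ?thesis by simp
qed

lemma blin_single:
 assumes j: "j : J" shows "blin (Hs j) HS (single j)"
proof -
 interpret ip_space "Hs j" by (rule ips[OF j])
 have nz: "0[Hs k] +[Hs k] 0[Hs k] = 0[Hs k]" "c *[Hs k] 0[Hs k] = 0[Hs k]" if "k : J" for k c
 using ip_space.add_zero(1)[OF ips[OF that] semi_ip.zeroC[OF semi[OF that]]] ip_space.smult_zero(1)[OF ips[OF that]] by auto
 have "hnorm HS (single j x) = hnorm (Hs j) x" if "x @: (Hs j)" for x
 unfolding form_norm_def ip_single[OF j that single_C[OF j that]] by (simp add: single_def j)
 then have bd: "EX C. ALL x:carrier (Hs j). hnorm HS (single j x) <= C * hnorm (Hs j) x" by (intro exI[of _ 1]) simp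
 have "single j (x +[Hs j] y) = single j x +[HS] single j y" for x y unfolding add_HS single_def by (rule restrict_ext) (simp add: nz)
 moreover have "single j (c *[Hs j] x) = c *[HS] single j x" for c x unfolding smult_HS single_def by (rule restrict_ext) (simp add: nz)
 moreover have "single j ` carrier (Hs j) <= carrier HS" using single_C[OF j] by blast
 ultimately show ?thesis unfolding blin_def using bd by simp
qed

text \<open>Truncations of v to finitely many coordinates are finite sums of \<open>single\<close>
  vectors and converge to v by summability of the squared norms.\<close>

lemma total_single:
 assumes E: "!!j. j : J ==> total (Hs j) (E j)" shows "total HS {single j x | j x. j : J & x : E j}"
proof (rule totalI)
 show "{single j x | j x. j : J & x : E j} <= carrier HS" using total_sub[OF E] single_C by blast
next
 fix M v assume M: "closed_sub HS M" "{single j x | j x. j : J & x : E j} <= M" and v: "v @: HS"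
 have s: "single j x : M" if j: "j : J" and x: "x @: (Hs j)" for j x
 proof -
 interpret ip_space2 "Hs j" HS by (rule ip_space2.intro[OF ips[OF j] ip_space_HS])
 have "E j <= {x : carrier (Hs j). single j x : M}" using M(2) j total_sub[OF E[OF j]] by auto
 from totalD[OF E[OF j] closed_sub_vimage[OF blin_single[OF j] M(1)] this x] show ?thesis by simp
 qed
 define cut where "cut F = (\<lambda>j\<in>J. if j : F then v j else 0[Hs j])" for F
 have cut: "cut F : M" if "finite F" "F <= J" for F using that
 proof (induction F)
 case empty
 have "cut {} = 0[HS]" by (simp add: cut_def zero_HS)
 then show ?case using closed_subD(2)[OF M(1)] by simp
 next
 case (insert a F)
 have "cut (insert a F) = single a (v a) +[HS] cut F" unfolding cut_def single_def add_HS using insert HS_D(2)[OF v]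
 ip_space.add_zero[OF ips] semi_ip.zeroC[OF semi] by (intro restrict_ext) auto
 then show ?case using insert s[of a "v a"] HS_D(2)[OF v] closed_subD(3)[OF M(1)] by auto
 qed
 have ex: "EX F. finite F & F <= J & hdist HS (cut F) v <= e" if e: "e > 0" for e
 proof -
 obtain F where F: "finite F" "F <= J"
 "dist (SUM j:F. (hnorm (Hs j) (v j))^2) (\<Sum>\<^sub>\<infinity>j\<in>J. (hnorm (Hs j) (v j))^2) <= e^2"
 using infsum_finite_approximation[OF HS_D(3)[OF v], of "e^2"] e by auto
 have cC: "cut F @: HS" using cut[OF F(1,2)] closed_subD(1)[OF M(1)] by blast
 have "(hdist HS (cut F) v)^2 <= e^2" unfolding hdist_HS(2)[OF cC v]
 proof (rule infsum_le_finite_sums[OF hdist_HS(1)[OF cC v]])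
 fix G assume G: "finite G" "G <= J"
 have eq: "(hdist (Hs j) (cut F j) (v j))^2 = (if j : F then 0 else (hnorm (Hs j) (v j))^2)" if j: "j : J" for j
 proof -
 interpret ip_space "Hs j" by (rule ips[OF j])
 show ?thesis using j vd_sym[of "0[Hs j]" "v j"] HS_D(2)[OF v j] by (simp add: cut_def)
 qed
 have "(SUM j:G. (hdist (Hs j) (cut F j) (v j))^2) = (SUM j:G. (if j : F then 0 else (hnorm (Hs j) (v j))^2))"
 by (rule sum.cong[OF refl], rule eq) (use G in blast)
 also have "... = (SUM j:G - F. (hnorm (Hs j) (v j))^2)" using G by (intro sum.mono_neutral_cong_right) auto
 also have "... = (SUM j:(G - F) \<union> F. (hnorm (Hs j) (v j))^2) - (SUM j:F. (hnorm (Hs j) (v j))^2)" using G F by (subst sum.union_disjoint) auto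
 also have "... <= (\<Sum>\<^sub>\<infinity>j\<in>J. (hnorm (Hs j) (v j))^2) - (SUM j:F. (hnorm (Hs j) (v j))^2)"
 using G F by (intro diff_right_mono finite_sum_le_infsum[OF HS_D(3)[OF v]]) auto
 also have "... <= e^2" using F(3) by (simp add: dist_real_def)
 finally show "(SUM j:G. (hdist (Hs j) (cut F j) (v j))^2) <= e^2" .
 qed
 then have "hdist HS (cut F) v <= e" by (rule power2_le_imp_le) (use e in linarith)
 then show ?thesis using F by blast
 qed
 have "ALL n. EX F. finite F & F <= J & hdist HS (cut F) v <= inverse (real (Suc n))" using ex by simp
 then obtain F where F: "!!n. finite (F n) & F n <= J & hdist HS (cut (F n)) v <= inverse (real (Suc n))" by metis
 have cM: "cut (F n) : M" for n using cut F by blast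
 have "(%n. hdist HS (cut (F n)) v) ----> 0"
 proof (rule Lim_null_comparison[OF always_eventually LIMSEQ_inverse_real_of_nat])
 show "ALL n. norm (hdist HS (cut (F n)) v) <= inverse (real (Suc n))"
 proof
 fix n
 have "cut (F n) @: HS" using cM closed_subD(1)[OF M(1)] by blast
 then show "norm (hdist HS (cut (F n)) v) <= inverse (real (Suc n))" using F HS.vd_nonneg[OF _ v] by simp
 qed
 qed
 from closed_subD(5)[OF M(1) cM v this] show "v : M" .
qed

end

section \<open>The free product of Hilbert spaces\<close>

lemma (in ip_space2) closed_sub_ip_blin:
 assumes T: "blin H K T" and y: "y @: K" and z: "z @: H" shows "closed_sub H {x : carrier H. ip K y (T x) = ip H z x}"
proof (rule closed_subI)
 fix s l assume s: "!!n::nat. s n : {x : carrier H. ip K y (T x) = ip H z x}" "l @: H" and lim: "(%n. hdist H (s n) l) ----> 0"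
 have C: "s n @: H" and eq: "ip K y (T (s n)) = ip H z (s n)" for n using s(1)[of n] by auto
 have yy: "(%n::nat. hdist K y y) ----> 0" and zz: "(%n::nat. hdist H z z) ----> 0" using y z by simp_all
 have 1: "(%n. ip K y (T (s n))) ----> ip K y (T l)" by (rule K.q_tendsto[OF y y yy blinD(1)[OF T C] blinD(1)[OF T s(2)] blin_tendsto[OF T C s(2) lim]])
 have 2: "(%n. ip K y (T (s n))) ----> ip H z l" unfolding eq by (rule H.q_tendsto[OF z z zz C s(2) lim])
 show "l : {x : carrier H. ip K y (T x) = ip H z x}" using s(2) LIMSEQ_unique[OF 1 2] by simp
qed (use y z blinD[OF T] blin_zero[OF T] in \<open>auto simp: H.q_simps K.q_simps\<close>)

text \<open>With one argument fixed, the vectors satisfying the identity form a closed subspace; the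
  two arguments are released one after the other.\<close>

lemma (in ip_space) adjoint_total:
 assumes S: "blin H H S" and T: "blin H H T" and tot: "total H E" and adj: "!!e f. [|e : E; f : E|] ==> ip H (S e) f = ip H e (T f)" and xy: "x @: H" "y @: H"
 shows "ip H (S x) y = ip H x (T y)"
proof -
 interpret HH: ip_space2 H H by unfold_locales
 note EC = subsetD[OF total_sub[OF tot]] and SC = blinD(1)[OF S] and TC = blinD(1)[OF T]
 have 1: "ip H (T f) u = ip H f (S u)" if f: "f : E" and u: "u @: H" for f u
 proof -
 have "ip H f (S e) = ip H (T f) e" if "e : E" for e using adj[OF that f] q_sym[of f "S e"] q_sym[of "T f" e] EC[OF f] EC[OF that] SC TC by simp
 then have "E <= {x : carrier H. ip H f (S x) = ip H (T f) x}" using EC by auto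
 from totalD[OF tot HH.closed_sub_ip_blin[OF S EC[OF f] TC[OF EC[OF f]]] this u] show ?thesis by simp
 qed
 have "ip H x (T f) = ip H (S x) f" if f: "f : E" for f using 1[OF f xy(1)] q_sym[of x "T f"] q_sym[of "S x" f] EC[OF f] SC TC xy by simp
 then have "E <= {y : carrier H. ip H x (T y) = ip H (S x) y}" using EC by auto
 from totalD[OF tot HH.closed_sub_ip_blin[OF T xy(1) SC[OF xy(1)]] this xy(2)] show ?thesis by simp
qed

text \<open>The Gram kernel of elementary tensors, for words whose letters carry their index.
  Recursion on the first letter matches the way operators of a factor act.\<close>

fun kern :: "('i => 'h inner_space) => ('i \<times> 'h) list => ('i \<times> 'h) list => complex" where
 "kern H [] [] = 1"
| "kern H ((i, h) # w) ((j, k) # v) = (if i = j then ip (H i) h k * kern H w v else 0)"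
| "kern H [] (_ # _) = 0"
| "kern H (_ # _) [] = 0"

lemma kern_eq_prod:
 "kern H w v = (if map fst w = map fst v then \<Prod>j<length w. ip (H (fst (w ! j))) (snd (w ! j)) (snd (v ! j)) else 0)"
 by (induction H w v rule: kern.induct) (auto simp: prod.lessThan_Suc_shift simp del: prod.lessThan_Suc)

text \<open>This is the tensor structure behind every splitting of words into a left and a right
  factor. Equal length of the left factors keeps letters of u from being paired with letters of
  x.\<close>

lemma kern_append: "length u = length v ==> kern H (u @ w) (v @ x) = kern H u v * kern H w x" by (induction u v rule: list_induct2) auto

locale fpsp =
 fixes I :: "'i set" and H :: "'i => 'h inner_space" and \<xi> :: "'i => 'h"
 assumes ipH: "i : I ==> ip_space (H i)" and xiC: "i : I ==> \<xi> i @: (H i)" and xi1: "i : I ==> ip (H i) (\<xi> i) (\<xi> i) = 1"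
begin

abbreviation "Fs == fp_space I H \<xi>"
abbreviation "Fi == fp_subspace I H \<xi>"
abbreviation "tls js == tensor_list_space (circ_list H \<xi> js)"

definition okl :: "'i \<times> 'h => bool" where
 "okl l \<longleftrightarrow> fst l : I & snd l @: (H (fst l)) & ip (H (fst l)) (\<xi> (fst l)) (snd l) = 0"

definition okw :: "('i \<times> 'h) list => bool" where
 "okw w \<longleftrightarrow> (ALL l:set w. okl l) & distinct_adj (map fst w)"

definition ns :: "'i => ('i \<times> 'h) list => bool" where
 "ns i w \<longleftrightarrow> w = [] \<or> fst (hd w) ~= i"

definition E :: "('i \<times> 'h) list => ('i, 'h) fp_vector" where
 "E w = fp_elem I H \<xi> (map fst w) (map snd w)"

lemma okw_Nil [simp]: "okw []" by (simp add: okw_def)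

lemma okw_Cons: "okw ((i, h) # w) \<longleftrightarrow> okl (i, h) & ns i w & okw w" by (cases w) (auto simp: okw_def ns_def)

lemma ip_circ: "i : I ==> ip_space (circ (H i) (\<xi> i))"
proof -
 assume i: "i : I"
 interpret ip_space "H i" by (rule ipH[OF i])
 show ?thesis unfolding circ_def by (rule ip_space_sub[OF ipH[OF i]]) (use xiC[OF i] in \<open>auto simp: q_simps\<close>)
qed

lemma carrier_circ: "carrier (circ (H i) (\<xi> i)) = {h : carrier (H i). ip (H i) (\<xi> i) h = 0}" by (simp add: circ_def)

lemma psd_tl: "js : alternating I ==> psd (listset (map carrier (circ_list H \<xi> js))) (tensor_list_kernel (circ_list H \<xi> js))"
 by (rule psd_tensor_list) (auto simp: circ_list_def alternating_def intro!: ip_circ)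

lemma hsum_tl: "hsum (alternating I) tls" unfolding tensor_list_space_def by (rule hsum.intro) (rule kspace_props(1)[OF psd_tl])

sublocale S: hsum "alternating I" tls by (rule hsum_tl)

lemma Fs_eq: "Fs = S.HS" by (simp add: fp_space_def)

sublocale F: hilb Fs unfolding Fs_eq by (rule S.hilb_HS)

text \<open>Passage between two encodings of an elementary tensor: an index word with a list of
  vectors, as in \<open>fp_elem\<close>, and a word of indexed letters.\<close>

lemma listset_okw:
 "js : alternating I & hs : listset (map carrier (circ_list H \<xi> js)) \<longleftrightarrow>
 length js = length hs & okw (zip js hs)"
proof (cases "length js = length hs")
 case True
 have "hs : listset (map carrier (circ_list H \<xi> js)) \<longleftrightarrow>
 (ALL j<length js. hs ! j @: (H (js ! j)) & ip (H (js ! j)) (\<xi> (js ! j)) (hs ! j) = 0)" using True by (simp add: listset_iff circ_list_def carrier_circ)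
 moreover have "(ALL l:set (zip js hs). okl l) \<longleftrightarrow> (ALL j<length js. js ! j : I & hs ! j @: (H (js ! j)) & ip (H (js ! j)) (\<xi> (js ! j)) (hs ! j) = 0)"
 using True by (auto simp: set_zip okl_def)
 moreover have "set js <= I \<longleftrightarrow> (ALL j<length js. js ! j : I)" by (fastforce simp: set_conv_nth)
 ultimately show ?thesis using True by (auto simp: alternating_def okw_def)
next
 case False
 then show ?thesis by (auto simp: listset_iff circ_list_def)
qed

lemma okw_alternating: "okw w ==> map fst w : alternating I" and okw_listset: "okw w ==> map snd w : listset (map carrier (circ_list H \<xi> (map fst w)))"
 using listset_okw[of "map fst w" "map snd w"] by (auto simp: zip_map_fst_snd)

lemma E_single: "E w = S.single (map fst w) (tensor_list_elem (circ_list H \<xi> (map fst w)) (map snd w))" unfolding E_def fp_elem_def S.single_def by simp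

lemma tl_C: "okw w ==> tensor_list_elem (circ_list H \<xi> (map fst w)) (map snd w) @: (tls (map fst w))" unfolding tensor_list_elem_def tensor_list_space_def
 by (rule kspace_props(2)[OF psd_tl[OF okw_alternating] okw_listset])

lemma E_C [simp, intro]: "okw w ==> E w @: Fs" unfolding E_single Fs_eq by (rule S.single_C[OF okw_alternating tl_C])

lemma ip_E:
 assumes w: "okw w" and v: "okw v" shows "ip Fs (E w) (E v) = kern H w v"
proof -
 have "ip Fs (E w) (E v) = ip (tls (map fst w)) (tensor_list_elem (circ_list H \<xi> (map fst w)) (map snd w)) (E v (map fst w))" unfolding Fs_eq E_single[of w]
 by (rule S.ip_single[OF okw_alternating[OF w] tl_C[OF w]]) (use v in \<open>simp add: Fs_eq[symmetric]\<close>)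
 also have "... = kern H w v"
 proof (cases "map fst w = map fst v")
 case True
 have "E v (map fst w) = tensor_list_elem (circ_list H \<xi> (map fst w)) (map snd v)" unfolding E_single S.single_def using okw_alternating[OF w] True by simp
 moreover have "ip (tls (map fst w)) (tensor_list_elem (circ_list H \<xi> (map fst w)) (map snd w)) (tensor_list_elem (circ_list H \<xi> (map fst w)) (map snd v))
 = tensor_list_kernel (circ_list H \<xi> (map fst w)) (map snd w) (map snd v)" unfolding tensor_list_space_def tensor_list_elem_def
 by (rule kspace_props(3)[OF psd_tl[OF okw_alternating[OF w]] okw_listset[OF w]]) (use okw_listset[OF v] True in simp)
 moreover have "length w = length v" using True map_eq_imp_length_eq by blast
 moreover have "fst (v ! j) = fst (w ! j)" if "j < length v" for j using arg_cong[OF True, of "%l. l ! j"] that \<open>length w = length v\<close> by simp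
 ultimately show ?thesis using True by (simp add: kern_eq_prod tensor_list_kernel_def circ_list_def circ_def)
 next
 case False
 have z: "E v (map fst w) = 0[tls (map fst w)]" unfolding E_single S.single_def using okw_alternating[OF w] False by simp
 show ?thesis unfolding z using semi_ip.q_zero[OF S.semi[OF okw_alternating[OF w]] tl_C[OF w]] False by (simp add: kern_eq_prod)
 qed
 finally show ?thesis .
qed

lemma total_E: "total Fs (E ` {w. okw w})"
proof -
 have "total S.HS {S.single js x | js x. js : alternating I & x : tensor_list_elem (circ_list H \<xi> js) ` listset (map carrier (circ_list H \<xi> js))}"
 proof (rule S.total_single)
 fix js assume js: "js : alternating I"
 show "total (tls js) (tensor_list_elem (circ_list H \<xi> js) ` listset (map carrier (circ_list H \<xi> js)))"
 using kspace_props(4)[OF psd_tl[OF js]] unfolding tensor_list_space_def tensor_list_elem_def by simp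
 qed
 moreover have "{S.single js x | js x. js : alternating I & x : tensor_list_elem (circ_list H \<xi> js) ` listset (map carrier (circ_list H \<xi> js))}
 = E ` {w. okw w}" (is "?A = ?B")
 proof
 show "?A <= ?B"
 proof
 fix y assume "y : ?A"
 then obtain js hs where y: "js : alternating I" "hs : listset (map carrier (circ_list H \<xi> js))"
 "y = S.single js (tensor_list_elem (circ_list H \<xi> js) hs)" by blast
 then have z: "length js = length hs" "okw (zip js hs)" using listset_okw by blast+
 then have "y = E (zip js hs)" unfolding y(3) E_single by simp
 then show "y : ?B" using z by blast
 qed
 show "?B <= ?A" using okw_alternating okw_listset unfolding E_single by blast
 qed
 ultimately show ?thesis unfolding Fs_eq by simp
qed

lemma E_eqI:
 assumes "x @: Fs" "y @: Fs" "!!w. okw w ==> ip Fs (E w) x = ip Fs (E w) y" shows "x = y" by (rule F.sep_total[OF total_E assms(1,2)]) (use assms(3) in auto)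

lemma E_add:
 assumes "okw (u @ (i, h) # w)" "okw (u @ (i, k) # w)"
 shows "okw (u @ (i, h +[H i] k) # w)" "E (u @ (i, h +[H i] k) # w) = E (u @ (i, h) # w) +[Fs] E (u @ (i, k) # w)"
proof -
 have hk: "okl (i, h)" "okl (i, k)" using assms by (auto simp: okw_def)
 have i: "i : I" using hk by (simp add: okl_def)
 interpret Hi: ip_space "H i" by (rule ipH[OF i])
 show ok: "okw (u @ (i, h +[H i] k) # w)" using assms hk xiC[OF i] by (auto simp: okw_def okl_def Hi.q_simps)
 have "kern H v (u @ (i, h +[H i] k) # w) = kern H v (u @ (i, h) # w) + kern H v (u @ (i, k) # w)" if "okw v" for v using that
 proof (induction u arbitrary: v)
 case Nil
 then show ?case using hk by (cases v) (auto simp: okw_Cons okl_def Hi.q_simps algebra_simps)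
 next
 case (Cons a u)
 obtain ai ah where a: "a = (ai, ah)" by (cases a)
 show ?case
 proof (cases v)
 case (Cons b v')
 then show ?thesis using Cons.IH[of v'] Cons.prems a by (cases b) (auto simp: okw_Cons algebra_simps)
 qed (simp add: a)
 qed
 then show "E (u @ (i, h +[H i] k) # w) = E (u @ (i, h) # w) +[Fs] E (u @ (i, k) # w)" using ok assms by (intro E_eqI) (auto simp: ip_E F.q_simps)
qed

lemma E_smult:
 assumes "okw (u @ (i, h) # w)" shows "okw (u @ (i, c *[H i] h) # w)" "E (u @ (i, c *[H i] h) # w) = c *[Fs] E (u @ (i, h) # w)"
proof -
 have h: "okl (i, h)" using assms by (auto simp: okw_def)
 have i: "i : I" using h by (simp add: okl_def)
 interpret Hi: ip_space "H i" by (rule ipH[OF i])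
 show ok: "okw (u @ (i, c *[H i] h) # w)" using assms h xiC[OF i] by (auto simp: okw_def okl_def Hi.q_simps)
 have "kern H v (u @ (i, c *[H i] h) # w) = c * kern H v (u @ (i, h) # w)" if "okw v" for v using that
 proof (induction u arbitrary: v)
 case Nil
 then show ?case using h by (cases v) (auto simp: okw_Cons okl_def Hi.q_simps)
 next
 case (Cons a u)
 obtain ai ah where a: "a = (ai, ah)" by (cases a)
 show ?case
 proof (cases v)
 case (Cons b v')
 then show ?thesis using Cons.IH[of v'] Cons.prems a by (cases b) (auto simp: okw_Cons)
 qed (simp add: a)
 qed
 then show "E (u @ (i, c *[H i] h) # w) = c *[Fs] E (u @ (i, h) # w)" using ok assms by (intro E_eqI) (auto simp: ip_E F.q_simps)
qed

subsection \<open>The subspaces of words not starting with a given index\<close>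

lemma ns_not_starting: "okw w ==> ns i w \<longleftrightarrow> map fst w : not_starting I i"
 using okw_alternating[of w] by (cases w) (auto simp: ns_def not_starting_def)

lemma not_starting_alt: "not_starting I i <= alternating I" by (auto simp: not_starting_def)

lemma carrier_Fi: "v @: (Fi i) \<longleftrightarrow> v @: Fs & (ALL js:alternating I - not_starting I i. v js = 0[tls js])" by (simp add: fp_subspace_def)

lemma ip_Fi: "ip (Fi i) = ip Fs" and zero_Fi: "0[Fi i] = 0[Fs]" and add_Fi: "v +[Fi i] w = v +[Fs] w" and smult_Fi: "c *[Fi i] v = c *[Fs] v"
 by (simp_all add: fp_subspace_def)

lemma tl_zero:
 assumes "js : alternating I" shows "0[tls js] +[tls js] 0[tls js] = 0[tls js]" "c *[tls js] 0[tls js] = 0[tls js]"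
 using ip_space.add_zero(1)[OF S.ips[OF assms] semi_ip.zeroC[OF S.semi[OF assms]]] ip_space.smult_zero(1)[OF S.ips[OF assms]] by auto

lemma ip_space_Fi: "ip_space (Fi i)" unfolding fp_subspace_def
proof (rule ip_space_sub[OF F.ip_space_axioms])
 let ?M = "{v : carrier Fs. ALL js:alternating I - not_starting I i. v js = 0[tls js]}"
 show "0[Fs] : ?M" using F.zeroC by (auto simp: Fs_eq S.zero_HS)
 show "x +[Fs] y : ?M" if "x : ?M" "y : ?M" for x y using that F.addC[of x y] by (auto simp: Fs_eq S.add_HS tl_zero)
 show "c *[Fs] x : ?M" if "x : ?M" for c x using that F.smultC[of x c] by (auto simp: Fs_eq S.smult_HS tl_zero)
qed auto

lemma E_Fi: "okw w ==> ns i w ==> E w @: (Fi i)" unfolding carrier_Fi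
proof (intro conjI ballI)
 fix js assume "okw w" "ns i w" "js : alternating I - not_starting I i"
 then show "E w js = 0[tls js]" using ns_not_starting[of w i] by (auto simp: E_single S.single_def)
qed auto

text \<open>The orthogonal projection onto \<open>H(i)\<close>. It transports totality of the words
  from the whole space to the subspace.\<close>

definition cutFi :: "'i => ('i, 'h) fp_vector => ('i, 'h) fp_vector" where
 "cutFi i v = (\<lambda>js\<in>alternating I. if js : not_starting I i then v js else 0[tls js])"

lemma cutFi_C:
 assumes v: "v @: Fs" shows "cutFi i v @: (Fi i)" "hnorm Fs (cutFi i v) <= hnorm Fs v"
proof -
 have v': "v @: S.HS" using v by (simp add: Fs_eq)
 have le: "(hnorm (tls js) (cutFi i v js))^2 <= (hnorm (tls js) (v js))^2" if "js : alternating I" for js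
 using that by (simp add: cutFi_def semi_ip.fn_zero[OF S.semi])
 have C: "cutFi i v @: S.HS" unfolding S.HS_iff
 proof (intro conjI ballI)
 show "(%js. (hnorm (tls js) (cutFi i v js))^2) summable_on alternating I" by (rule summable_on_comparison_test[OF S.HS_D(3)[OF v'] le]) auto
 qed (use S.HS_D(2)[OF v'] semi_ip.zeroC[OF S.semi] in \<open>auto simp: cutFi_def\<close>)
 then show "cutFi i v @: (Fi i)" unfolding carrier_Fi by (auto simp: Fs_eq cutFi_def)
 have "(hnorm Fs (cutFi i v))^2 <= (hnorm Fs v)^2"
 unfolding Fs_eq S.hnorm_HS[OF C] S.hnorm_HS[OF v'] by (rule infsum_mono[OF S.HS_D(3)[OF C] S.HS_D(3)[OF v'] le])
 then show "hnorm Fs (cutFi i v) <= hnorm Fs v" by (rule power2_le_imp_le) (rule F.fn_ge0[OF v])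
qed

lemma blin_cutFi: "blin Fs (Fi i) (cutFi i)"
proof -
 have "cutFi i (x +[Fs] y) = cutFi i x +[Fi i] cutFi i y" for x y unfolding add_Fi unfolding Fs_eq S.add_HS cutFi_def by (rule restrict_ext) (simp add: tl_zero)
 moreover have "cutFi i (c *[Fs] x) = c *[Fi i] cutFi i x" for c x
 unfolding smult_Fi unfolding Fs_eq S.smult_HS cutFi_def by (rule restrict_ext) (simp add: tl_zero)
 moreover have "EX C. ALL x:carrier Fs. hnorm (Fi i) (cutFi i x) <= C * hnorm Fs x" using cutFi_C(2) by (intro exI[of _ 1]) (simp add: ip_Fi)
 ultimately show ?thesis unfolding blin_def using cutFi_C(1) by auto
qed

lemma total_Fi: "total (Fi i) (E ` {w. okw w & ns i w})"
proof (rule totalI)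
 interpret FFi: ip_space2 Fs "Fi i" by (rule ip_space2.intro[OF F.ip_space_axioms ip_space_Fi])
 fix M v assume M: "closed_sub (Fi i) M" "E ` {w. okw w & ns i w} <= M" and v: "v @: (Fi i)"
 have "cutFi i (E w) : M" if w: "okw w" for w
 proof (cases "ns i w")
 case True
 have "cutFi i (E w) = E w" unfolding cutFi_def E_single S.single_def using True ns_not_starting[OF w] by (intro restrict_ext) auto
 then show ?thesis using M(2) True w by auto
 next
 case False
 have "cutFi i (E w) = 0[Fi i]" unfolding zero_Fi unfolding Fs_eq S.zero_HS cutFi_def E_single S.single_def
 using False ns_not_starting[OF w] by (intro restrict_ext) auto
 then show ?thesis using closed_subD(2)[OF M(1)] by simp
 qed
 then have "E ` {w. okw w} <= {x : carrier Fs. cutFi i x : M}" by auto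
 moreover have "v @: Fs" using v by (simp add: carrier_Fi)
 ultimately have "cutFi i v : M" using totalD[OF total_E FFi.closed_sub_vimage[OF blin_cutFi M(1)]] by blast
 moreover have "cutFi i v = v"
 proof (rule extensionalityI[of _ "alternating I"])
 show "v : extensional (alternating I)" using \<open>v @: Fs\<close> S.HS_D(1) by (simp add: Fs_eq)
 qed (use v in \<open>auto simp: cutFi_def carrier_Fi\<close>)
 ultimately show "v : M" by simp
qed (use E_Fi in auto)

end

section \<open>The canonical unitaries and ampliations\<close>

context fpsp
begin

definition crc :: "'i => 'h => 'h" where
 "crc i h = h +[H i] (- ip (H i) (\<xi> i) h) *[H i] \<xi> i"

text \<open>The image of the elementary tensor of h and w under the canonical unitary, for arbitrary
  h in \<open>H i\<close>: the component of h along the distinguished vector leaves w alone, the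
  rest becomes a new first letter.\<close>

definition Ev :: "'i => 'h => ('i \<times> 'h) list => ('i, 'h) fp_vector" where
 "Ev i h w = ip (H i) (\<xi> i) h *[Fs] E w +[Fs] E ((i, crc i h) # w)"

lemma crc_C: "[|i : I; h @: (H i)|] ==> crc i h @: (H i)" and okl_crc: "[|i : I; h @: (H i)|] ==> okl (i, crc i h)"
proof -
 assume i: "i : I" and h: "h @: (H i)"
 interpret Hi: ip_space "H i" by (rule ipH[OF i])
 show "crc i h @: (H i)" unfolding crc_def using h xiC[OF i] by auto
 then show "okl (i, crc i h)" unfolding okl_def using i h xiC[OF i] xi1[OF i] by (simp add: crc_def Hi.q_simps)
qed

lemma crc_decomp:
 assumes i: "i : I" and h: "h @: (H i)" shows "h = ip (H i) (\<xi> i) h *[H i] \<xi> i +[H i] crc i h"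
proof -
 interpret Hi: ip_space "H i" by (rule ipH[OF i])
 show ?thesis unfolding crc_def using h xiC[OF i] by (intro Hi.sep) (auto simp: Hi.q_simps)
qed

lemma crc_id:
 assumes "okl (i, h)" shows "crc i h = h"
proof -
 have i: "i : I" and h: "h @: (H i)" "ip (H i) (\<xi> i) h = 0" using assms by (auto simp: okl_def)
 interpret Hi: ip_space "H i" by (rule ipH[OF i])
 show ?thesis unfolding crc_def using h xiC[OF i] by (intro Hi.sep) (auto simp: Hi.q_simps)
qed

lemma Ev_C: "[|i : I; h @: (H i); okw w; ns i w|] ==> Ev i h w @: Fs" unfolding Ev_def using okl_crc by (auto simp: okw_Cons)

lemma Ev_okl:
 assumes "okw ((i, h) # w)" shows "Ev i h w = E ((i, h) # w)"
proof -
 have "okl (i, h)" "okw w" using assms by (auto simp: okw_Cons)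
 then show ?thesis using assms crc_id[of i h] unfolding Ev_def by (simp add: okl_def F.smult_zero F.add_zero)
qed

lemma Ev_xi:
 assumes i: "i : I" and w: "okw w" "ns i w" shows "Ev i (\<xi> i) w = E w"
proof -
 interpret Hi: ip_space "H i" by (rule ipH[OF i])
 have ok: "okw ((i, crc i (\<xi> i)) # w)" using okl_crc[OF i xiC[OF i]] w by (simp add: okw_Cons)
 have z: "crc i (\<xi> i) = 0 *[H i] crc i (\<xi> i)" using xiC[OF i] xi1[OF i] crc_C[OF i xiC[OF i]] by (intro Hi.sep) (auto simp: crc_def Hi.q_simps)
 have "E ((i, crc i (\<xi> i)) # w) = 0 *[Fs] E ((i, crc i (\<xi> i)) # w)" using E_smult(2)[of "[]" i "crc i (\<xi> i)" w 0] ok z by simp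
 then show ?thesis unfolding Ev_def using ok w xi1[OF i] by (simp add: F.smult_zero F.one_smult F.add_zero)
qed

lemma t2: "i : I ==> tensor2 (H i) (Fi i)" using ipH ip_space_Fi by (simp add: tensor2_def ip_space2_def)

abbreviation "TSi i == tensor_space (H i) (Fi i)"
abbreviation "tei i == tensor_elem (H i) (Fi i)"

text \<open>The prescribed values have the same Gram matrix as the elementary tensors, so
  \<open>unitary_ext\<close> yields a unitary with its inverse. Uniqueness on a total set identifies
  it with the definite description, and the inverse with the adjoint.\<close>

lemma fp_unitary_ex:
 assumes i: "i : I" shows "EX V. unitary_op (TSi i) Fs (fp_unitary I H \<xi> i) & adjoint (TSi i) Fs (fp_unitary I H \<xi> i) = V &
 V : bounded_ops Fs (TSi i) & (ALL w h. okw w --> ns i w --> h @: (H i) --> fp_unitary I H \<xi> i (tei i h (E w)) = Ev i h w) &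
 (ALL x:carrier (TSi i). V (fp_unitary I H \<xi> i x) = x) & (ALL y:carrier Fs. fp_unitary I H \<xi> i (V y) = y)"
proof -
 interpret T: tensor2 "H i" "Fi i" by (rule t2[OF i])
 interpret TF: ip_space2 "TSi i" Fs by (rule ip_space2.intro) unfold_locales
 define W where "W = {w. okw w & ns i w}"
 \<comment> \<open>\<open>None\<close> stands for the distinguished vector and \<open>Some h\<close>
   for a letter h, so that both cases of the prescription form one indexed family.\<close>
 define X where "X = {(ho, w). w : W & (case ho of None => True | Some h => okl (i, h))}"
 define e where "e = (%(ho, w). tei i (case ho of None => \<xi> i | Some h => h) (E w))"
 define g where "g = (%(ho, w). case ho of None => E w | Some h => E ((i, h) # w))"
 have W: "okw w" "ns i w" "E w @: (Fi i)" if "w : W" for w using that E_Fi by (auto simp: W_def)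
 have okc: "okw ((i, h) # w)" if "w : W" "okl (i, h)" for h w using that by (simp add: W_def okw_Cons)
 have okh: "h @: (H i)" "ip (H i) (\<xi> i) h = 0" "ip (H i) h (\<xi> i) = 0" if "okl (i, h)" for h
 using that T.H.q_sym[of h "\<xi> i"] xiC[OF i] by (auto simp: okl_def)
 have te_C: "tei i h (E w) @: (TSi i)" if "h @: (H i)" "w : W" for h w using that W by auto
 have dec: "tei i h (E w) = ip (H i) (\<xi> i) h *[TSi i] tei i (\<xi> i) (E w) +[TSi i] tei i (crc i h) (E w)" if "h @: (H i)" "w : W" for h w
 by (subst crc_decomp[OF i that(1)]) (use that W xiC[OF i] crc_C[OF i that(1)] in \<open>simp add: T.te_add_left T.te_smult_left\<close>)
 have t1: "total (TSi i) (e ` X)"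
 proof (rule totalI)
 show "e ` X <= carrier (TSi i)" using te_C xiC[OF i] okh by (auto simp: X_def e_def split: option.splits)
 fix M x assume M: "closed_sub (TSi i) M" "e ` X <= M" and x: "x @: (TSi i)"
 have a: "tei i (\<xi> i) (E w) : M" if "w : W" for w
 proof -
 have "(None, w) : X" using that by (simp add: X_def)
 then have "e (None, w) : M" using M(2) by blast
 then show ?thesis by (simp add: e_def)
 qed
 have b: "tei i h (E w) : M" if "w : W" "okl (i, h)" for h w
 proof -
 have "(Some h, w) : X" using that by (simp add: X_def)
 then have "e (Some h, w) : M" using M(2) by blast
 then show ?thesis by (simp add: e_def)
 qed
 have "tei i h (E w) : M" if "h @: (H i)" "w : W" for h w unfolding dec[OF that] by (intro closed_subD(3,4)[OF M(1)] a b that okl_crc i)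
 then have "(%(h, k). tei i h k) ` (carrier (H i) \<times> E ` {w. okw w & ns i w}) <= M" by (auto simp: W_def)
 then show "x : M" by (rule totalD[OF T.total_te_right[OF total_Fi] M(1) _ x])
 qed
 have t2: "total Fs (g ` X)"
 proof -
 have "g ` X = E ` {w. okw w}"
 proof
 show "g ` X <= E ` {w. okw w}" using W okc by (auto simp: X_def g_def split: option.splits)
 show "E ` {w. okw w} <= g ` X"
 proof
 fix y assume "y : E ` {w. okw w}"
 then obtain w where w: "okw w" "y = E w" by blast
 show "y : g ` X"
 proof (cases "ns i w")
 case True
 then have "(None, w) : X" "y = g (None, w)" using w by (auto simp: X_def W_def g_def)
 then show ?thesis by blast
 next
 case False
 then obtain h v where v: "w = (i, h) # v" by (cases w) (auto simp: ns_def)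
 then have "(Some h, v) : X" "y = g (Some h, v)" using w by (auto simp: X_def W_def g_def okw_Cons)
 then show ?thesis by blast
 qed
 qed
 qed
 then show ?thesis using total_E by simp
 qed
 \<comment> \<open>Words beginning with index i are orthogonal to words that do not; this settles
   the mixed entries of the Gram matrix.\<close>
 have kz: "kern H w ((i, h) # v) = 0" "kern H ((i, h) # v) w = 0" if "w : W" for h v w using that by (cases w; auto simp: W_def ns_def)+
 have gram: "ip Fs (g s) (g t) = ip (TSi i) (e s) (e t)" if st: "s : X" "t : X" for s t
 proof -
 obtain ho w where s: "s = (ho, w)" "w : W" "!!h. ho = Some h ==> okl (i, h)" using st(1) by (auto simp: X_def split: option.splits)
 obtain ko v where t: "t = (ko, v)" "v : W" "!!h. ko = Some h ==> okl (i, h)" using st(2) by (auto simp: X_def split: option.splits)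
 define h where "h = (case ho of None => \<xi> i | Some h => h)"
 define k where "k = (case ko of None => \<xi> i | Some h => h)"
 have hC: "h @: (H i)" using s(3) xiC[OF i] okh by (cases ho) (auto simp: h_def)
 have kC: "k @: (H i)" using t(3) xiC[OF i] okh by (cases ko) (auto simp: k_def)
 have "ip (TSi i) (e s) (e t) = ip (H i) h k * kern H w v" unfolding s t e_def prod.case h_def[symmetric] k_def[symmetric]
 by (subst T.ip_te[OF hC W(3)[OF s(2)] kC W(3)[OF t(2)]]) (simp add: ip_Fi ip_E W s t)
 moreover have "ip Fs (g s) (g t) = ip (H i) h k * kern H w v" unfolding s t g_def prod.case h_def k_def
 using s(2,3) t(2,3) by (cases ho; cases ko) (simp_all add: ip_E W okc kz okh xi1[OF i])
 ultimately show ?thesis by simp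
 qed
 obtain U V where U: "unitary_op (TSi i) Fs U" and V: "V : bounded_ops Fs (TSi i)"
 and Ue: "!!s. s : X ==> U (e s) = g s" and VU: "!!x. x @: (TSi i) ==> V (U x) = x" and UV: "!!y. y @: Fs ==> U (V y) = y"
 proof -
 have "EX U V. unitary_op (TSi i) Fs U & V : bounded_ops Fs (TSi i) & (ALL s:X. U (e s) = g s) & (ALL s:X. V (g s) = e s) &
 (ALL x:carrier (TSi i). V (U x) = x) & (ALL y:carrier Fs. U (V y) = y)" by (rule unitary_ext[OF T.hilb_TS F.hilb_axioms t1 t2]) (rule gram)
 then obtain U V where
 "unitary_op (TSi i) Fs U & V : bounded_ops Fs (TSi i) & (ALL s:X. U (e s) = g s) & (ALL s:X. V (g s) = e s) &
 (ALL x:carrier (TSi i). V (U x) = x) & (ALL y:carrier Fs. U (V y) = y)" by (elim exE)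
 then show thesis by (intro that[of U V]) simp_all
 qed
 have bU: "U : bounded_ops (TSi i) Fs" using U by (simp add: unitary_op_def)
 \<comment> \<open>The clauses of the definite description, rewritten over the index set X.\<close>
 have conv: "(ALL js:not_starting I i. ALL hs:listset (map carrier (circ_list H \<xi> js)).
 U' (tei i (\<xi> i) (fp_elem I H \<xi> js hs)) = fp_elem I H \<xi> js hs &
 (ALL h:carrier (circ (H i) (\<xi> i)). U' (tei i h (fp_elem I H \<xi> js hs)) = fp_elem I H \<xi> (i # js) (h # hs)))
 \<longleftrightarrow> (ALL s:X. U' (e s) = g s)" (is "?L \<longleftrightarrow> ?R") for U'
 proof
 assume L: ?L
 show ?R
 proof
 fix s assume "s : X"
 then obtain ho w where s: "s = (ho, w)" "w : W" "!!h. ho = Some h ==> okl (i, h)" by (auto simp: X_def split: option.splits)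
 have w: "map fst w : not_starting I i" "map snd w : listset (map carrier (circ_list H \<xi> (map fst w)))" using W[OF s(2)] ns_not_starting okw_listset by auto
 show "U' (e s) = g s" using bspec[OF bspec[OF L w(1)] w(2)] s okh by (cases ho) (auto simp: e_def g_def E_def carrier_circ)
 qed
 next
 assume R: ?R
 show ?L
 proof (intro ballI)
 fix js hs assume js: "js : not_starting I i" and hs: "hs : listset (map carrier (circ_list H \<xi> js))"
 have z: "length js = length hs" "okw (zip js hs)" using listset_okw[of js hs] js hs not_starting_alt by blast+
 then have zW: "zip js hs : W" and Ez: "E (zip js hs) = fp_elem I H \<xi> js hs" and Eh: "!!h. E ((i, h) # zip js hs) = fp_elem I H \<xi> (i # js) (h # hs)"
 using js ns_not_starting[of "zip js hs" i] by (auto simp: W_def E_def)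
 have "U' (tei i (\<xi> i) (fp_elem I H \<xi> js hs)) = fp_elem I H \<xi> js hs"
 using bspec[OF R, of "(None, zip js hs)"] zW by (simp add: X_def e_def g_def Ez)
 moreover have "U' (tei i h (fp_elem I H \<xi> js hs)) = fp_elem I H \<xi> (i # js) (h # hs)" if "h @: (circ (H i) (\<xi> i))" for h
 using bspec[OF R, of "(Some h, zip js hs)"] zW that i by (simp add: X_def e_def g_def Ez Eh okl_def carrier_circ)
 ultimately show "U' (tei i (\<xi> i) (fp_elem I H \<xi> js hs)) = fp_elem I H \<xi> js hs &
 (ALL h:carrier (circ (H i) (\<xi> i)). U' (tei i h (fp_elem I H \<xi> js hs)) = fp_elem I H \<xi> (i # js) (h # hs))" by blast
 qed
 qed
 have Ueq: "fp_unitary I H \<xi> i = U" unfolding fp_unitary_def conv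
 proof (rule the_equality)
 show "unitary_op (TSi i) Fs U & (ALL s:X. U (e s) = g s)" using U Ue by blast
 fix U' assume U': "unitary_op (TSi i) Fs U' & (ALL s:X. U' (e s) = g s)"
 then have "U' : bounded_ops (TSi i) Fs" by (simp add: unitary_op_def)
 then show "U' = U" by (rule TF.bounded_ops_eqI[OF _ bU t1]) (use U' Ue in auto)
 qed
 note VC = blinD(1)[OF bounded_ops_blin[OF V]] and UC = blinD(1)[OF bounded_ops_blin[OF bU]]
 have isoU: "ALL x:carrier (TSi i). ALL y:carrier (TSi i). ip Fs (U x) (U y) = ip (TSi i) x y" using U by (simp add: unitary_op_def)
 have adj: "ip (TSi i) (V y) x = ip Fs y (U x)" if "x @: (TSi i)" "y @: Fs" for x y using bspec[OF bspec[OF isoU VC[OF that(2)]] that(1)] UV[OF that(2)] by simp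
 have "adjoint (TSi i) Fs U = V" unfolding adjoint_def
 proof (rule the_equality)
 show "V : bounded_ops Fs (TSi i) & (ALL x:carrier (TSi i). ALL y:carrier Fs. ip (TSi i) (V y) x = ip Fs y (U x))" using V adj by blast
 fix S assume S: "S : bounded_ops Fs (TSi i) & (ALL x:carrier (TSi i). ALL y:carrier Fs. ip (TSi i) (S y) x = ip Fs y (U x))"
 then have bS: "S : bounded_ops Fs (TSi i)" and
 S2: "!!x y. [|x @: (TSi i); y @: Fs|] ==> ip (TSi i) (S y) x = ip Fs y (U x)" by auto
 note SC = blinD(1)[OF bounded_ops_blin[OF bS]]
 show "S = V"
 proof (rule extensionalityI[of _ "carrier Fs"])
 fix y assume y: "y @: Fs"
 show "S y = V y"
 proof (rule T.T.sep[OF SC[OF y] VC[OF y]])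
 fix z assume z: "z @: (TSi i)"
 have "ip (TSi i) (S y) z = ip (TSi i) (V y) z" using S2[OF z y] adj[OF z y] by simp
 then show "ip (TSi i) z (S y) = ip (TSi i) z (V y)" using T.T.q_sym[OF z SC[OF y]] T.T.q_sym[OF z VC[OF y]] by simp
 qed
 qed (use bS V in \<open>simp_all add: bounded_ops_iff\<close>)
 qed
 moreover have "U (tei i h (E w)) = Ev i h w" if "okw w" "ns i w" "h @: (H i)" for h w
 proof -
 have w: "w : W" using that by (simp add: W_def)
 have 1: "U (tei i (\<xi> i) (E w)) = E w" using Ue[of "(None, w)"] w by (simp add: X_def e_def g_def)
 have 2: "U (tei i (crc i h) (E w)) = E ((i, crc i h) # w)" using Ue[of "(Some (crc i h), w)"] w okl_crc[OF i that(3)] by (simp add: X_def e_def g_def)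
 show ?thesis unfolding dec[OF that(3) w] Ev_def using te_C[OF xiC[OF i] w] te_C[OF crc_C[OF i that(3)] w] by (simp add: blinD[OF bounded_ops_blin[OF bU]] 1 2)
 qed
 ultimately show ?thesis unfolding Ueq using U V VU UV by simp
qed

lemma ip_Ev:
 assumes i: "i : I" and h: "h @: (H i)" and w: "okw w" "ns i w" and k: "k @: (H i)" and v: "okw v" "ns i v"
 shows "ip Fs (Ev i h w) (Ev i k v) = ip (H i) h k * kern H w v"
proof -
 interpret T: tensor2 "H i" "Fi i" by (rule t2[OF i])
 obtain V where U: "unitary_op (TSi i) Fs (fp_unitary I H \<xi> i)"
 and Ue: "!!w h. [|okw w; ns i w; h @: (H i)|] ==> fp_unitary I H \<xi> i (tei i h (E w)) = Ev i h w" using fp_unitary_ex[OF i] by blast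
 have "ip Fs (Ev i h w) (Ev i k v) = ip (TSi i) (tei i h (E w)) (tei i k (E v))"
 proof -
 have "ip Fs (fp_unitary I H \<xi> i (tei i h (E w))) (fp_unitary I H \<xi> i (tei i k (E v))) = ip (TSi i) (tei i h (E w)) (tei i k (E v))"
 using U T.te_C[OF h E_Fi[OF w]] T.te_C[OF k E_Fi[OF v]] unfolding unitary_op_def by blast
 then show ?thesis by (simp only: Ue[OF w h] Ue[OF v k])
 qed
 then show ?thesis using h k w v by (simp add: T.ip_te[OF h E_Fi[OF w] k E_Fi[OF v]] ip_Fi ip_E)
qed

lemma total_Ev:
 assumes i: "i : I" shows "total Fs {Ev i h w | h w. h @: (H i) & okw w & ns i w}"
proof (rule totalI)
 fix M x assume M: "closed_sub Fs M" "{Ev i h w | h w. h @: (H i) & okw w & ns i w} <= M" and x: "x @: Fs"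
 have "E w : M" if w: "okw w" for w
 proof (cases "ns i w")
 case True
 have "Ev i (\<xi> i) w : M" using M(2) True w xiC[OF i] by blast
 then show ?thesis using Ev_xi[OF i w True] by simp
 next
 case False
 then obtain h v where v: "w = (i, h) # v" by (cases w) (auto simp: ns_def)
 then have "h @: (H i)" "okw v" "ns i v" using w by (auto simp: okw_Cons okl_def)
 then have "Ev i h v : M" using M(2) by blast
 then show ?thesis using Ev_okl w v by simp
 qed
 then show "x : M" by (intro totalD[OF total_E M(1) _ x]) auto
qed (use Ev_C[OF i] in auto)

abbreviation "ampl == fp_ampliation I H \<xi>"

text \<open>Later statements on amplifications rest on these three facts. Values on the total family
  \<open>Ev\<close> determine the operator, and every bound of T is inherited because the canonical
  unitary and its inverse are isometric.\<close>

lemma ampl_props: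
 assumes i: "i : I" and T: "T : bounded_ops (H i) (H i)" shows "ampl i T : bounded_ops Fs Fs"
 "[|h @: (H i); okw w; ns i w|] ==> ampl i T (Ev i h w) = Ev i (T h) w"
 "[|C >= 0; !!h. h @: (H i) ==> hnorm (H i) (T h) <= C * hnorm (H i) h; v @: Fs|] ==>
 hnorm Fs (ampl i T v) <= C * hnorm Fs v"
proof -
 interpret Tn: tensor2 "H i" "Fi i" by (rule t2[OF i])
 interpret HH: ip_space2 "H i" "H i" by (rule ip_space2.intro[OF ipH[OF i] ipH[OF i]])
 define U where "U = fp_unitary I H \<xi> i"
 from fp_unitary_ex[OF i, folded U_def] obtain V where
 *: "unitary_op (TSi i) Fs U & adjoint (TSi i) Fs U = V & V : bounded_ops Fs (TSi i) &
 (ALL w h. okw w --> ns i w --> h @: (H i) --> U (tei i h (E w)) = Ev i h w) & (ALL x:carrier (TSi i). V (U x) = x) & (ALL y:carrier Fs. U (V y) = y)" ..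
 have U: "unitary_op (TSi i) Fs U" and Va: "adjoint (TSi i) Fs U = V" and V: "V : bounded_ops Fs (TSi i)"
 and Ue: "!!w h. [|okw w; ns i w; h @: (H i)|] ==> U (tei i h (E w)) = Ev i h w"
 and VU: "!!x. x @: (TSi i) ==> V (U x) = x" and UV: "!!y. y @: Fs ==> U (V y) = y" using * by simp_all
 have bU: "blin (TSi i) Fs U" using U by (simp add: unitary_op_def bounded_ops_iff)
 have bV: "blin Fs (TSi i) V" using V by (simp add: bounded_ops_iff)
 have bT: "blin (H i) (H i) T" using T by (simp add: bounded_ops_iff)
 have nU: "hnorm Fs (U x) = hnorm (TSi i) x" if "x @: (TSi i)" for x using U that by (simp add: unitary_op_def form_norm_def)
 have nV: "hnorm (TSi i) (V y) = hnorm Fs y" if "y @: Fs" for y using nU[OF blinD(1)[OF bV that]] UV[OF that] by simp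
 define R where "R = tensor_op (H i) (Fi i) T (\<lambda>w\<in>carrier (Fi i). w)"
 have A: "ampl i T = (\<lambda>v\<in>carrier Fs. U (R (V v)))" unfolding fp_ampliation_def Let_def U_def[symmetric] Va R_def by simp
 obtain C0 where C0: "C0 >= 0" "!!h. h @: (H i) ==> hnorm (H i) (T h) <= C0 * hnorm (H i) h" using HH.blin_bound[OF bT] by blast
 note R = Tn.tensor_op_id[OF T C0, folded R_def]
 have bR: "blin (TSi i) (TSi i) R" using R(1) by (simp add: bounded_ops_iff)
 have "blin Fs Fs (%v. U (R (V v)))" by (rule blin_comp[OF F.ip_space_axioms Tn.T.ip_space_axioms F.ip_space_axioms bU
 blin_comp[OF F.ip_space_axioms Tn.T.ip_space_axioms Tn.T.ip_space_axioms bR bV]])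
 then show "ampl i T : bounded_ops Fs Fs" unfolding A by (rule blin_restrict[OF F.semi_ip_axioms])
 show "ampl i T (Ev i h w) = Ev i (T h) w" if "h @: (H i)" "okw w" "ns i w"
 proof -
 have te: "tei i h (E w) @: (TSi i)" using that E_Fi by auto
 have "ampl i T (Ev i h w) = U (R (V (U (tei i h (E w)))))" unfolding A using that Ev_C[OF i] by (simp add: Ue)
 also have "... = U (tei i (T h) (E w))" using te R(2) that E_Fi by (simp add: VU)
 also have "... = Ev i (T h) w" using that blinD(1)[OF bT] by (simp add: Ue)
 finally show ?thesis .
 qed
 show "hnorm Fs (ampl i T v) <= C * hnorm Fs v" if C: "C >= 0" "!!h. h @: (H i) ==> hnorm (H i) (T h) <= C * hnorm (H i) h" and v: "v @: Fs"
 proof -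
 note VC = blinD(1)[OF bV v]
 have "hnorm Fs (ampl i T v) = hnorm (TSi i) (R (V v))" using nU[OF blinD(1)[OF bR VC]] v by (simp add: A)
 also have "... <= C * hnorm (TSi i) (V v)" unfolding R_def by (rule Tn.tensor_op_id(3)[OF T C VC])
 finally show ?thesis by (simp add: nV[OF v])
 qed
qed

lemma Ev_add:
 assumes i: "i : I" and h: "h @: (H i)" "k @: (H i)" and w: "okw w" "ns i w" shows "Ev i (h +[H i] k) w = Ev i h w +[Fs] Ev i k w"
 "Ev i (c *[H i] h) w = c *[Fs] Ev i h w"
proof -
 interpret Hi: ip_space "H i" by (rule ipH[OF i])
 note C = Ev_C[OF i _ w]
 have *: "ip Fs e x = ip Fs e y ==> ip Fs e x = ip Fs e y" for e x y by simp
 show "Ev i (h +[H i] k) w = Ev i h w +[Fs] Ev i k w"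
 by (rule F.sep_total[OF total_Ev[OF i]]) (use h w C Ev_C[OF i] in \<open>auto simp: F.q_simps ip_Ev[OF i] Hi.q_simps algebra_simps\<close>)
 show "Ev i (c *[H i] h) w = c *[Fs] Ev i h w"
 by (rule F.sep_total[OF total_Ev[OF i]]) (use h w C Ev_C[OF i] in \<open>auto simp: F.q_simps ip_Ev[OF i] Hi.q_simps algebra_simps\<close>)
qed

text \<open>Algebraic identities of amplifications are checked on the family \<open>Ev\<close>,
  where an amplification changes h only.\<close>

lemma ampl_add:
 assumes i: "i : I" and S: "S : bounded_ops (H i) (H i)" and T: "T : bounded_ops (H i) (H i)"
 and R: "R : bounded_ops (H i) (H i)" and eq: "!!h. h @: (H i) ==> R h = S h +[H i] T h" and v: "v @: Fs" shows "ampl i R v = ampl i S v +[Fs] ampl i T v"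
proof -
 interpret FF: ip_space2 Fs Fs by (rule ip_space2.intro) unfold_locales
 note b = bounded_ops_blin[OF ampl_props(1)[OF i S]] bounded_ops_blin[OF ampl_props(1)[OF i T]] bounded_ops_blin[OF ampl_props(1)[OF i R]]
 note C = blinD(1)[OF bounded_ops_blin[OF S]] blinD(1)[OF bounded_ops_blin[OF T]]
 show ?thesis by (rule FF.blin_eq_total[OF b(3) blin_add[OF F.ip_space_axioms F.ip_space_axioms b(1,2)] total_Ev[OF i] _ v])
 (use C in \<open>auto simp: ampl_props(2)[OF i S] ampl_props(2)[OF i T] ampl_props(2)[OF i R] eq Ev_add[OF i]\<close>)
qed

lemma ampl_smult:
 assumes i: "i : I" and S: "S : bounded_ops (H i) (H i)" and R: "R : bounded_ops (H i) (H i)" and eq: "!!h. h @: (H i) ==> R h = c *[H i] S h" and v: "v @: Fs"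
 shows "ampl i R v = c *[Fs] ampl i S v"
proof -
 interpret FF: ip_space2 Fs Fs by (rule ip_space2.intro) unfold_locales
 note b = bounded_ops_blin[OF ampl_props(1)[OF i S]] bounded_ops_blin[OF ampl_props(1)[OF i R]]
 note C = blinD(1)[OF bounded_ops_blin[OF S]]
 show ?thesis by (rule FF.blin_eq_total[OF b(2) blin_smult[OF F.ip_space_axioms F.ip_space_axioms b(1)] total_Ev[OF i] _ v])
 (use C in \<open>auto simp: ampl_props(2)[OF i S] ampl_props(2)[OF i R] eq Ev_add(2)[OF i]\<close>)
qed

lemma ampl_comp:
 assumes i: "i : I" and S: "S : bounded_ops (H i) (H i)" and T: "T : bounded_ops (H i) (H i)"
 and R: "R : bounded_ops (H i) (H i)" and eq: "!!h. h @: (H i) ==> R h = S (T h)" and v: "v @: Fs" shows "ampl i R v = ampl i S (ampl i T v)"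
proof -
 interpret FF: ip_space2 Fs Fs by (rule ip_space2.intro) unfold_locales
 note b = bounded_ops_blin[OF ampl_props(1)[OF i S]] bounded_ops_blin[OF ampl_props(1)[OF i T]] bounded_ops_blin[OF ampl_props(1)[OF i R]]
 note C = blinD(1)[OF bounded_ops_blin[OF S]] blinD(1)[OF bounded_ops_blin[OF T]]
 show ?thesis by (rule FF.blin_eq_total[OF b(3) blin_comp[OF F.ip_space_axioms F.ip_space_axioms F.ip_space_axioms b(1,2)] total_Ev[OF i] _ v])
 (use C in \<open>auto simp: ampl_props(2)[OF i S] ampl_props(2)[OF i T] ampl_props(2)[OF i R] eq\<close>)
qed

lemma ampl_id:
 assumes i: "i : I" and R: "R : bounded_ops (H i) (H i)" and eq: "!!h. h @: (H i) ==> R h = h" and v: "v @: Fs" shows "ampl i R v = v"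
proof -
 interpret FF: ip_space2 Fs Fs by (rule ip_space2.intro) unfold_locales
 show ?thesis by (rule FF.blin_eq_total[OF bounded_ops_blin[OF ampl_props(1)[OF i R]] blin_id total_Ev[OF i] _ v]) (auto simp: ampl_props(2)[OF i R] eq)
qed

lemma ampl_adj:
 assumes i: "i : I" and S: "S : bounded_ops (H i) (H i)" and T: "T : bounded_ops (H i) (H i)"
 and adj: "!!h k. [|h @: (H i); k @: (H i)|] ==> ip (H i) (S h) k = ip (H i) h (T k)" and x: "x @: Fs" and y: "y @: Fs"
 shows "ip Fs (ampl i S x) y = ip Fs x (ampl i T y)"
proof -
 note C = blinD(1)[OF bounded_ops_blin[OF S]] blinD(1)[OF bounded_ops_blin[OF T]]
 define D where "D = {Ev i h w |h w. h @: (H i) & okw w & ns i w}"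
 have tot: "total Fs D" unfolding D_def by (rule total_Ev[OF i])
 have adjD: "ip Fs (ampl i S e) f = ip Fs e (ampl i T f)" if ef: "e : D" "f : D" for e f
 proof -
 obtain h w where e: "e = Ev i h w" "h @: (H i)" "okw w" "ns i w" using ef(1) by (auto simp: D_def)
 obtain k v where f: "f = Ev i k v" "k @: (H i)" "okw v" "ns i v" using ef(2) by (auto simp: D_def)
 show ?thesis unfolding e(1) f(1) ampl_props(2)[OF i S e(2-4)] ampl_props(2)[OF i T f(2-4)]
 ip_Ev[OF i C(1)[OF e(2)] e(3,4) f(2-4)] ip_Ev[OF i e(2-4) C(2)[OF f(2)] f(3,4)] by (simp add: adj[OF e(2) f(2)])
 qed
 show ?thesis by (rule F.adjoint_total[OF bounded_ops_blin[OF ampl_props(1)[OF i S]] bounded_ops_blin[OF ampl_props(1)[OF i T]] tot adjD x y])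
qed

end

section \<open>Operator norms and the GNS construction\<close>

context ip_space
begin

lemma op_norm_bound:
 assumes T: "T : bounded_ops H H" and x: "x @: H" shows "hnorm H (T x) <= op_norm H T * hnorm H x"
proof -
 interpret HH: ip_space2 H H by unfold_locales
 have bT: "blin H H T" using T by (simp add: bounded_ops_iff)
 obtain C where C: "C >= 0" "!!x. x @: H ==> hnorm H (T x) <= C * hnorm H x" using HH.blin_bound[OF bT] by blast
 let ?S = "{x : carrier H. hnorm H x <= 1}"
 have bdd: "bdd_above ((%x. hnorm H (T x)) ` ?S)"
 proof (rule bdd_aboveI2)
 fix x assume x: "x : ?S"
 then show "hnorm H (T x) <= C" using C(2)[of x] mult_left_mono[of "hnorm H x" 1 C] C(1) by auto
 qed
 have up: "hnorm H (T y) <= op_norm H T" if "y : ?S" for y unfolding op_norm_def ip_norm_eq by (rule cSUP_upper[OF that bdd])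
 show ?thesis
 proof (cases "hnorm H x = 0")
 case True
 then show ?thesis using C(2)[OF x] by simp
 next
 case False
 then have pos: "hnorm H x > 0" using fn_ge0[OF x] by linarith
 let ?y = "complex_of_real (1 / hnorm H x) \<odot> x"
 have n1: "cmod (complex_of_real (1 / hnorm H x)) = 1 / hnorm H x" using pos by (simp only: norm_of_real) simp
 have yS: "?y : ?S" using x pos fn_smult[OF x, of "complex_of_real (1 / hnorm H x)"] n1 by simp
 have "hnorm H (T ?y) = hnorm H (T x) / hnorm H x" unfolding blinD(3)[OF bT x] fn_smult[OF blinD(1)[OF bT x]] n1 by simp
 then have "hnorm H (T x) / hnorm H x <= op_norm H T" using up[OF yS] by simp
 then show ?thesis using pos by (simp add: pos_divide_le_eq)
 qed
qed

lemma op_norm_nonneg: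
 assumes T: "T : bounded_ops H H" shows "0 <= op_norm H T"
proof -
 interpret HH: ip_space2 H H by unfold_locales
 have bT: "blin H H T" using T by (simp add: bounded_ops_iff)
 obtain C where C: "C >= 0" "!!x. x @: H ==> hnorm H (T x) <= C * hnorm H x" using HH.blin_bound[OF bT] by blast
 let ?S = "{x : carrier H. hnorm H x <= 1}"
 have bdd: "bdd_above ((%x. hnorm H (T x)) ` ?S)"
 proof (rule bdd_aboveI2)
 fix x assume x: "x : ?S"
 then show "hnorm H (T x) <= C" using C(2)[of x] mult_left_mono[of "hnorm H x" 1 C] C(1) by auto
 qed
 have "hnorm H (T \<zero>) <= op_norm H T" unfolding op_norm_def ip_norm_eq by (rule cSUP_upper[OF _ bdd]) simp
 then show ?thesis using fn_ge0[OF blinD(1)[OF bT zeroC]] by linarith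
qed

lemma op_norm_le:
 assumes "C >= 0" "!!x. x @: H ==> hnorm H (T x) <= C * hnorm H x" shows "op_norm H T <= C" unfolding op_norm_def ip_norm_eq
proof (rule cSUP_least)
 show "{x : carrier H. hnorm H x <= 1} ~= {}" by (auto intro!: exI[of _ \<zero>])
 fix x assume "x : {x : carrier H. hnorm H x <= 1}"
 then show "hnorm H (T x) <= C" using assms(2)[of x] mult_left_mono[of "hnorm H x" 1 C] assms(1) by auto
qed

end

lemma complex_ring_simps [simp]:
 "carrier complex_ring = UNIV" "a +[complex_ring] b = a + b" "a .[complex_ring] b = a * b"
 "1[complex_ring] = 1" "0[complex_ring] = 0" by (simp_all add: complex_ring_def)

lemma cring_complex_ring: "cring complex_ring"
proof (rule cringI)
 show "abelian_group complex_ring" by (rule abelian_groupI) (auto simp: algebra_simps intro: exI[of _ "- x" for x])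
 show "comm_monoid complex_ring" by (rule comm_monoidI) (auto simp: algebra_simps)
qed (auto simp: algebra_simps)

context unital_star_algebra
begin

lemma ringA: "ring A" by (rule unital_star_algebra.axioms(1)[OF unital_star_algebra_axioms])

lemmas A_assoc = ring.ring_simprules(11)[OF ringA]
lemmas A_ldist = ring.ring_simprules(13)[OF ringA]
lemmas A_rdist = ring.ring_simprules(23)[OF ringA]
lemmas A_minus_equality = abelian_group.minus_equality[OF ring.is_abelian_group[OF ringA]]

lemma smultC [simp, intro]: "x @: A ==> c \<odot> x @: A" using smult_closed[of c x] by simp

lemma smult_add: "x @: A ==> (c + d) \<odot> x = c \<odot> x \<oplus> d \<odot> x" using smult_l_distr[of c d x] by simp

lemma smult_add_right: "[|x @: A; y @: A|] ==> c \<odot> (x \<oplus> y) = c \<odot> x \<oplus> c \<odot> y" using smult_r_distr[of c x y] by simp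

lemma smult_smult: "x @: A ==> (c * d) \<odot> x = c \<odot> (d \<odot> x)" using smult_assoc1[of c d x] by simp

lemma smult_1: "x @: A ==> 1 \<odot> x = x" using smult_one[of x] by simp

lemma smult_0: "x @: A ==> 0 \<odot> x = \<zero>" using smult_l_null[of x] by simp

lemma minus_smult: "x @: A ==> \<ominus> x = (- 1) \<odot> x"
proof -
 assume x: "x @: A"
 have "(- 1) \<odot> x \<oplus> x = \<zero>" using smult_add[OF x, of "- 1" 1] x by (simp add: smult_0 smult_1)
 then show ?thesis using x by (intro A_minus_equality) auto
qed

lemma star_one: "star A \<one> = \<one>"
proof -
 have "star A (star A \<one> \<otimes> \<one>) = star A \<one> \<otimes> star A (star A \<one>)" by (rule star_mult) (simp_all add: star_closed)
 then show ?thesis by (simp add: star_star star_closed)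
qed

end

locale star_state = unital_star_algebra A for A :: "('a, 'm) star_algebra_scheme" (structure) +
 fixes \<phi> :: "'a => complex"
 assumes state: "state A \<phi>"
begin

abbreviation "q == gns_form A \<phi>"
abbreviation "G == gns_space A \<phi>"
abbreviation "fn == form_norm q"

lemma phi_add: "[|x @: A; y @: A|] ==> \<phi> (x \<oplus> y) = \<phi> x + \<phi> y" and phi_smult: "x @: A ==> \<phi> (c \<odot> x) = c * \<phi> x"
 and phi_one: "\<phi> \<one> = 1" and phi_pos: "x @: A ==> \<phi> (star A x \<otimes> x) : \<real>\<^sub>\<ge>\<^sub>0"
 and phi_bound: "a @: A ==> EX C. ALL x:carrier A. Re (q (a \<otimes> x) (a \<otimes> x)) <= C * Re (q x x)"
 using state unfolding state_def gns_form_def by blast+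

lemma phi_zero: "\<phi> \<zero> = 0" using phi_smult[of \<zero> 0] by (simp add: smult_0)

lemma q_mult_left: "[|a @: A; x @: A; y @: A|] ==> q x (a \<otimes> y) = q (star A a \<otimes> x) y"
 by (simp add: gns_form_def star_mult star_star star_closed A_assoc)

lemma q_one: "x @: A ==> q \<one> x = \<phi> x" by (simp add: gns_form_def star_one)

text \<open>Hermitian symmetry comes from positivity: q is real on the diagonal, and evaluation at x
  + c y for c = 1 and c = \<i> compares imaginary and real parts.\<close>

lemma q_hermitian:
 assumes x: "x @: A" and y: "y @: A" shows "q x y = cnj (q y x)"
proof -
 have Im0: "Im (c * q x y + cnj c * q y x) = 0" for c
 proof -
 let ?z = "x \<oplus> c \<odot> y"
 have "q ?z ?z = q x x + c * q x y + cnj c * q y x + cnj c * c * q y y" using x y unfolding gns_form_def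
 by (simp add: star_add star_smult star_closed A_ldist A_rdist smult_mult_left smult_mult_right phi_add phi_smult algebra_simps)
 moreover have "Im (q ?z ?z) = 0" "Im (q x x) = 0" "Im (q y y) = 0"
 using phi_pos[of ?z] phi_pos[OF x] phi_pos[OF y] x y unfolding gns_form_def by (auto simp: nonneg_Reals_def)
 ultimately show ?thesis by (simp add: algebra_simps)
 qed
 have "Im (q x y) = - Im (q y x)" using Im0[of 1] by simp
 moreover have "Re (q x y) = Re (q y x)" using Im0[of \<i>] by simp
 ultimately show ?thesis by (simp add: complex_eq_iff)
qed

sublocale C: comp_space A q
proof
 fix x y z c assume C: "x @: A" "y @: A" "z @: A"
 show "q z (x \<oplus> y) = q z x + q z y" using C by (simp add: gns_form_def A_rdist phi_add star_closed)
next
 fix x z c assume C: "x @: A" "z @: A"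
 show "q z (c \<odot> x) = c * q z x" using C by (simp add: gns_form_def smult_mult_right phi_smult star_closed)
next
 fix x assume "x @: A"
 then show "0 <= Re (q x x)" using phi_pos[of x] by (auto simp: gns_form_def nonneg_Reals_def)
next
 fix z assume "z @: A"
 then show "q z \<zero> = 0" by (simp add: gns_form_def phi_zero star_closed)
next
 fix x y assume "x @: A" "y @: A"
 then show "q x y = cnj (q y x)" "x \<ominus> y = x \<oplus> (- 1) \<odot> y" by (auto simp: a_minus_def minus_smult intro: q_hermitian)
qed auto

lemma G_eq: "G = C.HC" by (simp add: gns_space_def)

sublocale G: hilb G unfolding G_eq by (rule C.hilb_HC)

abbreviation "emb == completion_embed A q"

lemma emb_C [simp, intro]: "x @: A ==> emb x @: G" and ip_emb [simp]: "[|x @: A; y @: A|] ==> ip G (emb x) (emb y) = q x y"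
 and emb_add: "[|x @: A; y @: A|] ==> emb (x \<oplus> y) = emb x +[G] emb y" and emb_smult: "x @: A ==> emb (c \<odot> x) = c *[G] emb x"
 and hnorm_emb: "x @: A ==> hnorm G (emb x) = fn x" and total_emb: "total G (emb ` carrier A)"
 unfolding G_eq using C.emb_add C.emb_smult C.hnorm_emb C.total_emb by auto

lemma mult_bound: "a @: A ==> EX L>=0. ALL x:carrier A. fn (a \<otimes> x) <= L * fn x"
proof -
 assume a: "a @: A"
 then obtain K where K: "!!x. x @: A ==> Re (q (a \<otimes> x) (a \<otimes> x)) <= K * Re (q x x)" using phi_bound by blast
 have "fn (a \<otimes> x) <= sqrt \<bar>K\<bar> * fn x" if x: "x @: A" for x
 proof -
 have "Re (q (a \<otimes> x) (a \<otimes> x)) <= \<bar>K\<bar> * Re (q x x)"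
 using K[OF x] mult_right_mono[of K "\<bar>K\<bar>" "Re (q x x)"] C.q_pos[OF x] by linarith
 then show ?thesis unfolding form_norm_def by (simp flip: real_sqrt_mult)
 qed
 then show ?thesis by (intro exI[of _ "sqrt \<bar>K\<bar>"]) auto
qed

lemma mult_lip:
 assumes a: "a @: A" shows "EX L. ALL x:carrier A. ALL y:carrier A. vdist A q (a \<otimes> x) (a \<otimes> y) <= L * vdist A q x y"
proof -
 obtain L where L: "!!x. x @: A ==> fn (a \<otimes> x) <= L * fn x" using mult_bound[OF a] by blast
 have "vdist A q (a \<otimes> x) (a \<otimes> y) <= L * vdist A q x y" if "x @: A" "y @: A" for x y
 using L[of "x \<oplus> (- 1) \<odot> y"] that a by (simp add: vdist_def A_rdist smult_mult_right)
 then show ?thesis by blast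
qed

lemma gns_rep_cl:
 assumes a: "a @: A" and s: "s : C.CQ" shows "(%n. a \<otimes> s n) : C.CQ" "gns_rep A \<phi> a (C.cl s) = C.cl (%n. a \<otimes> s n)"
proof -
 obtain L where L: "!!x y. [|x @: A; y @: A|] ==> vdist A q (a \<otimes> x) (a \<otimes> y) <= L * vdist A q x y" using mult_lip[OF a] by blast
 show "(%n. a \<otimes> s n) : C.CQ" by (rule C.CQ_lip[OF s _ L]) (use a in auto)
 have "C.cl (%n. a \<otimes> rep (C.cl s) n) = C.cl (%n. a \<otimes> s n)" by (rule C.cl_lip[OF s _ L]) (use a in auto)
 then show "gns_rep A \<phi> a (C.cl s) = C.cl (%n. a \<otimes> s n)" using s by (simp add: gns_rep_def G_eq C.carrier_HC)
qed

lemma gns_rep_emb: "[|a @: A; x @: A|] ==> gns_rep A \<phi> a (emb x) = emb (a \<otimes> x)" unfolding completion_embed_def by (simp add: gns_rep_cl)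

lemma gns_rep_norm:
 assumes a: "a @: A" and L: "!!x. x @: A ==> fn (a \<otimes> x) <= L * fn x" and X: "X @: G" shows "hnorm G (gns_rep A \<phi> a X) <= L * hnorm G X"
proof -
 obtain s where s: "s : C.CQ" "X = C.cl s" using X by (auto simp: G_eq C.carrier_HC)
 have "(%n. fn (a \<otimes> s n)) ----> hnorm G (gns_rep A \<phi> a X)"
 unfolding s gns_rep_cl(2)[OF a s(1)] G_eq by (rule C.hnorm_HC_lim[OF gns_rep_cl(1)[OF a s(1)]])
 moreover have "(%n. L * fn (s n)) ----> L * hnorm G X" unfolding s G_eq by (intro tendsto_mult_left C.hnorm_HC_lim s)
 ultimately show ?thesis by (rule LIMSEQ_le) (use L s in auto)
qed

lemma gns_rep_bounded:
 assumes a: "a @: A" shows "gns_rep A \<phi> a : bounded_ops G G"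
proof -
 obtain L where L: "!!x. x @: A ==> fn (a \<otimes> x) <= L * fn x" using mult_bound[OF a] by blast
 have "gns_rep A \<phi> a (X +[G] Y) = gns_rep A \<phi> a X +[G] gns_rep A \<phi> a Y" if XY: "X @: G" "Y @: G" for X Y
 proof -
 obtain s t where s: "s : C.CQ" "X = C.cl s" and t: "t : C.CQ" "Y = C.cl t" using XY by (auto simp: G_eq C.carrier_HC)
 show ?thesis unfolding s t G_eq C.add_HC[OF s(1) t(1)] gns_rep_cl(2)[OF a C.CQ_add[OF s(1) t(1)]]
 gns_rep_cl(2)[OF a s(1)] gns_rep_cl(2)[OF a t(1)] C.add_HC[OF gns_rep_cl(1)[OF a s(1)] gns_rep_cl(1)[OF a t(1)]] using a s t by (simp add: A_rdist)
 qed
 moreover have "gns_rep A \<phi> a (c *[G] X) = c *[G] gns_rep A \<phi> a X" if X: "X @: G" for c X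
 proof -
 obtain s where s: "s : C.CQ" "X = C.cl s" using X by (auto simp: G_eq C.carrier_HC)
 show ?thesis unfolding s G_eq C.smult_HC[OF s(1)] gns_rep_cl(2)[OF a C.CQ_smult[OF s(1)]]
 gns_rep_cl(2)[OF a s(1)] C.smult_HC[OF gns_rep_cl(1)[OF a s(1)]] using a s by (simp add: smult_mult_right)
 qed
 moreover have "gns_rep A \<phi> a X @: G" if X: "X @: G" for X
 proof -
 obtain s where s: "s : C.CQ" "X = C.cl s" using X by (auto simp: G_eq C.carrier_HC)
 show ?thesis unfolding s gns_rep_cl(2)[OF a s(1)] using gns_rep_cl(1)[OF a s(1)] by (simp add: G_eq C.carrier_HC)
 qed
 ultimately have "blin G G (gns_rep A \<phi> a)" unfolding blin_def using gns_rep_norm[OF a L] by blast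
 moreover have "gns_rep A \<phi> a : extensional (carrier G)" by (simp add: gns_rep_def)
 ultimately show ?thesis by (simp add: bounded_ops_iff)
qed

lemma gns_rep_C [simp, intro]: "[|a @: A; X @: G|] ==> gns_rep A \<phi> a X @: G" using blinD(1)[OF bounded_ops_blin[OF gns_rep_bounded]] .

lemma gns_rep_add:
 assumes "a @: A" "b @: A" "X @: G" shows "gns_rep A \<phi> (a \<oplus> b) X = gns_rep A \<phi> a X +[G] gns_rep A \<phi> b X"
proof -
 interpret GG: ip_space2 G G by unfold_locales
 show ?thesis by (rule GG.blin_eq_total[OF bounded_ops_blin[OF gns_rep_bounded] blin_add[OF G.ip_space_axioms G.ip_space_axioms
 bounded_ops_blin[OF gns_rep_bounded] bounded_ops_blin[OF gns_rep_bounded]] total_emb _ assms(3)])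
 (use assms in \<open>auto simp: gns_rep_emb A_ldist emb_add\<close>)
qed

lemma gns_rep_smult:
 assumes "a @: A" "X @: G" shows "gns_rep A \<phi> (c \<odot> a) X = c *[G] gns_rep A \<phi> a X"
proof -
 interpret GG: ip_space2 G G by unfold_locales
 show ?thesis by (rule GG.blin_eq_total[OF bounded_ops_blin[OF gns_rep_bounded] blin_smult[OF G.ip_space_axioms G.ip_space_axioms
 bounded_ops_blin[OF gns_rep_bounded]] total_emb _ assms(2)]) (use assms in \<open>auto simp: gns_rep_emb smult_mult_left emb_smult\<close>)
qed

lemma gns_rep_mult:
 assumes "a @: A" "b @: A" "X @: G" shows "gns_rep A \<phi> (a \<otimes> b) X = gns_rep A \<phi> a (gns_rep A \<phi> b X)"
proof -
 interpret GG: ip_space2 G G by unfold_locales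
 show ?thesis by (rule GG.blin_eq_total[OF bounded_ops_blin[OF gns_rep_bounded] blin_comp[OF G.ip_space_axioms G.ip_space_axioms G.ip_space_axioms
 bounded_ops_blin[OF gns_rep_bounded] bounded_ops_blin[OF gns_rep_bounded]] total_emb _ assms(3)]) (use assms in \<open>auto simp: gns_rep_emb A_assoc\<close>)
qed

lemma gns_rep_one: "X @: G ==> gns_rep A \<phi> \<one> X = X"
proof -
 interpret GG: ip_space2 G G by unfold_locales
 assume "X @: G"
 then show ?thesis by (rule GG.blin_eq_total[OF bounded_ops_blin[OF gns_rep_bounded] blin_id total_emb, rotated -1]) (auto simp: gns_rep_emb)
qed

lemma gns_rep_star:
 assumes a: "a @: A" and "X @: G" "Y @: G" shows "ip G (gns_rep A \<phi> (star A a) X) Y = ip G X (gns_rep A \<phi> a Y)"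
 by (rule G.adjoint_total[OF bounded_ops_blin[OF gns_rep_bounded] bounded_ops_blin[OF gns_rep_bounded] total_emb _ assms(2,3)])
 (use a in \<open>auto simp: gns_rep_emb star_closed q_mult_left\<close>)

definition gn :: "'a => real" where
 "gn a = op_norm G (gns_rep A \<phi> a)"

lemma gn_ge0 [simp, intro]: "a @: A ==> 0 <= gn a" unfolding gn_def by (rule G.op_norm_nonneg[OF gns_rep_bounded])

lemma gn_bound: "[|a @: A; x @: A|] ==> fn (a \<otimes> x) <= gn a * fn x"
 using G.op_norm_bound[OF gns_rep_bounded, of a "emb x"] by (simp add: gns_rep_emb hnorm_emb gn_def)

lemma gn_rep_bound: "[|a @: A; X @: G|] ==> hnorm G (gns_rep A \<phi> a X) <= gn a * hnorm G X"
 using G.op_norm_bound[OF gns_rep_bounded, of a X] by (simp add: gn_def)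

text \<open>Lets norms of the GNS representation be estimated by the seminorm on the algebra itself,
  without entering the completion.\<close>

lemma gn_le: "[|a @: A; L >= 0; !!x. x @: A ==> fn (a \<otimes> x) <= L * fn x|] ==> gn a <= L" unfolding gn_def by (intro G.op_norm_le gns_rep_norm) auto

lemma fn_one: "fn \<one> = 1" by (simp add: form_norm_def q_one phi_one)

lemma gn_add: "[|a @: A; b @: A|] ==> gn (a \<oplus> b) <= gn a + gn b"
proof (rule gn_le)
 fix x assume C: "a @: A" "b @: A" "x @: A"
 then show "fn ((a \<oplus> b) \<otimes> x) <= (gn a + gn b) * fn x"
 using C.fn_triangle[of "a \<otimes> x" "b \<otimes> x"] gn_bound[of a x] gn_bound[of b x] by (simp add: A_ldist distrib_right)
qed auto

lemma gn_smult_le: "a @: A ==> gn (c \<odot> a) <= cmod c * gn a"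
proof (rule gn_le)
 fix x assume C: "a @: A" "x @: A"
 then show "fn ((c \<odot> a) \<otimes> x) <= cmod c * gn a * fn x" using gn_bound[of a x] by (simp add: smult_mult_left C.fn_smult mult.assoc mult_left_mono)
qed auto

lemma gn_mult: "[|a @: A; b @: A|] ==> gn (a \<otimes> b) <= gn a * gn b"
proof (rule gn_le)
 fix x assume C: "a @: A" "b @: A" "x @: A"
 then show "fn (a \<otimes> b \<otimes> x) <= gn a * gn b * fn x"
 using gn_bound[of a "b \<otimes> x"] mult_left_mono[OF gn_bound[of b x] gn_ge0[of a]] by (simp add: A_assoc mult.assoc)
qed auto

lemma gn_star_le:
 assumes a: "a @: A" shows "gn (star A a) <= gn a"
proof (rule gn_le)
 fix x assume x: "x @: A"
 let ?y = "star A a \<otimes> x"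
 have y: "?y @: A" using a x by (simp add: star_closed)
 have "(fn ?y)^2 = cmod (q ?y ?y)" using C.q_self[OF y] by (simp flip: of_real_power)
 also have "q ?y ?y = q x (a \<otimes> ?y)" using q_mult_left[of a x ?y] a x y by simp
 also have "cmod ... <= fn x * fn (a \<otimes> ?y)" using a x y by (intro C.CS) auto
 also have "... <= fn x * (gn a * fn ?y)" using a x y by (intro mult_left_mono gn_bound) auto
 finally have le: "fn ?y * fn ?y <= (gn a * fn x) * fn ?y" by (simp add: power2_eq_square mult_ac)
 show "fn ?y <= gn a * fn x"
 proof (cases "fn ?y = 0")
 case True
 then show ?thesis using a x by simp
 next
 case False
 then have "fn ?y > 0" using C.fn_ge0[OF y] by linarith
 then show ?thesis using le mult_right_le_imp_le by blast
 qed
qed (use a star_closed in auto)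

end

section \<open>The free star-algebra on words\<close>

lemma ideal_from_closed:
 fixes R (structure)
 assumes R: "ring R" and sub: "N <= carrier R" and z: "\<zero> : N"
 and add: "!!x y. x : N ==> y : N ==> x \<oplus> y : N" and inv: "!!x. x : N ==> \<ominus> x : N"
 and l: "!!a x. [|a : N; x @: R|] ==> x \<otimes> a : N" and r: "!!a x. [|a : N; x @: R|] ==> a \<otimes> x : N" shows "ideal N R"
proof (rule idealI[OF R _ l r])
 show "subgroup N (add_monoid R)" by (rule subgroup.intro) (use sub z add inv in \<open>auto simp: a_inv_def[symmetric]\<close>)
qed

definition fsupp :: "('w => complex) => 'w set" where
 "fsupp f = {w. f w ~= 0}"

text \<open>The linear extension of a function on words; it turns identities between convolutions into
 identities between finite sums.\<close>

definition pair :: "('w => complex) => ('w => complex) => complex" where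
 "pair f ka = (SUM w:fsupp f. f w * ka w)"

definition conv :: "('l list => complex) => ('l list => complex) => 'l list => complex" where
 "conv f g = (%w. SUM n<=length w. f (take n w) * g (drop n w))"

lemma pair_sum: "[|finite S; fsupp f <= S|] ==> pair f ka = (SUM w:S. f w * ka w)" unfolding pair_def by (rule sum.mono_neutral_left) (auto simp: fsupp_def)

lemma pair_cong: "(!!w. w : fsupp f ==> ka w = ka' w) ==> pair f ka = pair f ka'" unfolding pair_def by simp

lemma fsupp_delta: "fsupp (delta w) = {w}" by (auto simp: fsupp_def delta_def)

lemma pair_delta: "pair (delta w) ka = ka w" unfolding pair_def fsupp_delta by (simp add: delta_def)

lemma pair_indicator:
 assumes "finite (fsupp f)" shows "pair f (%v. if v = w then 1 else 0) = f w"
 unfolding pair_def using assms by (simp add: sum.delta' if_distrib cong: if_cong) (simp add: fsupp_def)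

lemma pair_eqI: "[|finite (fsupp f); finite (fsupp g); !!ka. pair f ka = pair g ka|] ==> f = g"
 using pair_indicator[of f] pair_indicator[of g] by (intro ext) simp

lemma fsupp_add: "fsupp (%w. f w + g w) <= fsupp f \<union> fsupp g" by (auto simp: fsupp_def)

lemma pair_add:
 assumes "finite (fsupp f)" "finite (fsupp g)" shows "pair (%w. f w + g w) ka = pair f ka + pair g ka"
proof -
 let ?S = "fsupp f \<union> fsupp g"
 have "finite ?S" using assms by simp
 then show ?thesis using pair_sum[of ?S "%w. f w + g w" ka] pair_sum[of ?S f ka] pair_sum[of ?S g ka] fsupp_add[of f g] by (simp add: distrib_right sum.distrib)
qed

lemma fsupp_smult: "fsupp (%w. c * f w) <= fsupp f" by (auto simp: fsupp_def)

lemma pair_smult: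
 assumes "finite (fsupp f)" shows "pair (%w. c * f w) ka = c * pair f ka"
 using pair_sum[OF assms fsupp_smult, of c ka] unfolding pair_def by (simp add: sum_distrib_left mult.assoc)

lemma pair_fun_add: "pair f (%w. ka w + \<psi> w) = pair f ka + pair f \<psi>" unfolding pair_def by (simp add: distrib_left sum.distrib)

lemma pair_fun_smult: "pair f (%w. c * ka w) = c * pair f ka" unfolding pair_def by (simp add: sum_distrib_left mult_ac)

lemma pair_swap: "pair f (%u. pair g (%v. X u v)) = pair g (%v. pair f (%u. X u v))" unfolding pair_def sum_distrib_left by (subst sum.swap) (simp add: mult_ac)

lemma fsupp_conv: "fsupp (conv f g) <= (%(u, v). u @ v) ` (fsupp f \<times> fsupp g)"
proof
 fix w assume "w : fsupp (conv f g)"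
 then have "(SUM n<=length w. f (take n w) * g (drop n w)) ~= 0" by (simp add: fsupp_def conv_def)
 then obtain n where "f (take n w) * g (drop n w) ~= 0" by (meson sum.neutral)
 then show "w : (%(u, v). u @ v) ` (fsupp f \<times> fsupp g)" by (intro image_eqI[of _ _ "(take n w, drop n w)"]) (auto simp: fsupp_def)
qed

lemma finite_conv: "[|finite (fsupp f); finite (fsupp g)|] ==> finite (fsupp (conv f g))" using finite_subset[OF fsupp_conv] by blast

lemma pair_conv:
 assumes f: "finite (fsupp f)" and g: "finite (fsupp g)" shows "pair (conv f g) ka = pair f (%u. pair g (%v. ka (u @ v)))"
proof -
 define P where "P = fsupp f \<times> fsupp g"
 define S where "S = (%(u, v). u @ v) ` P"
 have fin: "finite P" "finite S" using f g by (auto simp: P_def S_def)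
 define t where "t = (%(w, n). f (take n w) * g (drop n w) * ka w)"
 \<comment> \<open>A factorisation of a word is the same as the word together with a cut
   position.\<close>
 define \<iota> where "\<iota> = (%(u, v). (u @ v, length u) :: 'a list \<times> nat)"
 have inj: "inj_on \<iota> P" by (rule inj_onI) (auto simp: \<iota>_def)
 have "pair (conv f g) ka = (SUM w:S. conv f g w * ka w)" using fin fsupp_conv[of f g] by (intro pair_sum) (auto simp: S_def P_def)
 also have "... = (SUM w:S. SUM n<=length w. t (w, n))" by (simp add: conv_def t_def sum_distrib_right)
 also have "... = (SUM x:Sigma S (%w. {..length w}). t x)" using fin by (subst sum.Sigma) auto
 also have "... = (SUM x:\<iota> ` P. t x)"
 proof (rule sum.mono_neutral_right)
 show "\<iota> ` P <= Sigma S (%w. {..length w})" by (auto simp: \<iota>_def S_def)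
 show "ALL x:Sigma S (%w. {..length w}) - \<iota> ` P. t x = 0"
 proof
 fix x assume x: "x : Sigma S (%w. {..length w}) - \<iota> ` P"
 obtain w n where wn: "x = (w, n)" "n <= length w" using x by auto
 then have "x = \<iota> (take n w, drop n w)" by (simp add: \<iota>_def)
 then have "(take n w, drop n w) \<notin> P" using x by auto
 then show "t x = 0" by (auto simp: wn t_def P_def fsupp_def)
 qed
 qed (use fin in auto)
 also have "... = (SUM x:P. t (\<iota> x))" by (simp add: sum.reindex[OF inj])
 also have "... = (SUM (u, v):P. f u * (g v * ka (u @ v)))" by (intro sum.cong) (auto simp: t_def \<iota>_def)
 also have "... = pair f (%u. pair g (%v. ka (u @ v)))" unfolding P_def pair_def by (simp add: sum.cartesian_product sum_distrib_left)
 finally show ?thesis .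
qed

locale fpalg =
 fixes I :: "'i set" and A :: "'i => 'a star_algebra"
 assumes alg: "i : I ==> unital_star_algebra (A i)"
begin

abbreviation "FA == free_star_algebra I A"
abbreviation "W == fp_words I A"
abbreviation "ws == word_star A"
abbreviation "PA == fp_algebra I A"
abbreviation "cls == fp_class I A"

lemma FA_C: "f @: FA \<longleftrightarrow> finite (fsupp f) & fsupp f <= W" by (simp add: free_star_algebra_def fsupp_def)

lemma FA_fin: "f @: FA ==> finite (fsupp f)" and FA_sub: "f @: FA ==> fsupp f <= W" by (simp_all add: FA_C)

lemma FA_ops: "f .[FA] g = conv f g" "1[FA] = delta []" "0[FA] = (%w. 0)" "f +[FA] g = (%w. f w + g w)"
 "c *[FA] f = (%w. c * f w)" "star FA f = (%w. if w : W then cnj (f (ws w)) else 0)" by (simp_all add: free_star_algebra_def conv_def)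

lemma W_Cons: "(i, a) # w : W \<longleftrightarrow> i : I & a @: (A i) & w : W" by (auto simp: fp_words_def)

lemma W_Nil [simp]: "[] : W" by (simp add: fp_words_def)

lemma W_append [simp]: "u @ v : W \<longleftrightarrow> u : W & v : W" by (simp add: fp_words_def)

lemma ws_simps [simp]: "ws [] = []" "ws ((i, a) # w) = ws w @ [(i, star (A i) a)]" "ws (u @ v) = ws v @ ws u" by (simp_all add: word_star_def)

lemma ws_W: "w : W ==> ws w : W & ws (ws w) = w"
proof (induction w)
 case (Cons l w)
 obtain i a where l: "l = (i, a)" by (cases l)
 interpret unital_star_algebra "A i" using Cons(2) l by (simp add: W_Cons alg)
 show ?case using Cons l by (simp add: W_Cons star_closed star_star)
qed simp

lemma delta_FA [simp, intro]: "w : W ==> delta w @: FA" by (simp add: FA_C fsupp_delta)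

lemma FA_closed:
 "[|f @: FA; g @: FA|] ==> f +[FA] g @: FA"
 "[|f @: FA; g @: FA|] ==> f .[FA] g @: FA"
 "f @: FA ==> c *[FA] f @: FA"
 "f @: FA ==> star FA f @: FA"
proof -
 show "f +[FA] g @: FA" if "f @: FA" "g @: FA" using that fsupp_add[of f g] finite_subset[OF fsupp_add[of f g]] unfolding FA_C FA_ops by auto
 show "f .[FA] g @: FA" if "f @: FA" "g @: FA"
 proof -
 have "(%(u, v). u @ v) ` (fsupp f \<times> fsupp g) <= W" using that by (auto simp: FA_C)
 then show ?thesis using that fsupp_conv[of f g] finite_conv[of f g] unfolding FA_C FA_ops by blast
 qed
 show "c *[FA] f @: FA" if "f @: FA" using that fsupp_smult[of c f] finite_subset[OF fsupp_smult[of c f]] unfolding FA_C FA_ops by auto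
 show "star FA f @: FA" if f: "f @: FA"
 proof -
 have "fsupp (star FA f) <= ws ` fsupp f \<inter> W"
 proof
 fix w assume "w : fsupp (star FA f)"
 then have "w : W" "ws w : fsupp f" by (auto simp: FA_ops fsupp_def split: if_splits)
 then show "w : ws ` fsupp f \<inter> W" using ws_W by (metis IntI imageI)
 qed
 then show ?thesis using f finite_subset[of "fsupp (star FA f)" "ws ` fsupp f"] unfolding FA_C by blast
 qed
qed

lemma pair_star:
 assumes f: "f @: FA" shows "pair (star FA f) ka = cnj (pair f (%w. cnj (ka (ws w))))"
proof -
 have S: "fsupp f <= W" "finite (fsupp f)" using f by (auto simp: FA_C)
 have inj: "inj_on ws (fsupp f)" using ws_W S by (intro inj_on_inverseI[of _ ws]) auto
 have "fsupp (star FA f) <= ws ` fsupp f"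
 proof
 fix w assume "w : fsupp (star FA f)"
 then have "w : W" "ws w : fsupp f" by (auto simp: FA_ops fsupp_def split: if_splits)
 then show "w : ws ` fsupp f" using ws_W by (metis imageI)
 qed
 then have "pair (star FA f) ka = (SUM w:ws ` fsupp f. star FA f w * ka w)" using S by (intro pair_sum) auto
 also have "... = (SUM w:fsupp f. star FA f (ws w) * ka (ws w))" by (simp add: sum.reindex[OF inj])
 also have "... = (SUM w:fsupp f. cnj (f w) * ka (ws w))" using ws_W S by (intro sum.cong refl) (auto simp: FA_ops subset_iff)
 also have "... = cnj (pair f (%w. cnj (ka (ws w))))" by (simp add: pair_def)
 finally show ?thesis .
qed

lemma FA_eqI: "[|f @: FA; g @: FA; !!ka. pair f ka = pair g ka|] ==> f = g" by (rule pair_eqI) (auto simp: FA_C)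

lemma pair_FA:
 "[|f @: FA; g @: FA|] ==> pair (f +[FA] g) ka = pair f ka + pair g ka"
 "f @: FA ==> pair (c *[FA] f) ka = c * pair f ka"
 "[|f @: FA; g @: FA|] ==> pair (f .[FA] g) ka = pair f (%u. pair g (%v. ka (u @ v)))"
 "pair 1[FA] ka = ka []" "pair 0[FA] ka = 0" by (simp_all add: FA_ops FA_fin pair_add pair_smult pair_conv pair_delta) (simp add: pair_def fsupp_def)

lemma FA_consts: "1[FA] : carrier FA" "0[FA] : carrier FA" unfolding FA_ops by (simp_all, simp add: FA_C fsupp_def)

lemma ring_FA: "ring FA"
proof (rule ringI)
 show "abelian_group FA"
 proof (rule abelian_groupI)
 fix f assume f: "f @: FA"
 have "(- 1) *[FA] f +[FA] f = 0[FA]" by (simp add: FA_ops)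
 then show "EX y:carrier FA. y +[FA] f = 0[FA]" using FA_closed(3)[OF f] by blast
 qed (simp add: FA_closed, rule FA_consts, simp_all add: FA_ops algebra_simps)
 show "monoid FA" by (rule monoidI) (auto intro!: FA_eqI simp: FA_closed FA_consts pair_FA)
qed (auto intro!: FA_eqI simp: FA_closed pair_FA pair_fun_add)

lemma usa_FA: "unital_star_algebra FA"
proof (rule unital_star_algebra.intro[OF ring_FA])
 show "module complex_ring FA" by (rule moduleI[OF cring_complex_ring ring.is_abelian_group[OF ring_FA]])
 (auto simp: FA_closed, auto simp: FA_ops algebra_simps)
 show "unital_star_algebra_axioms FA"
 proof
 fix f g assume C: "f @: FA" "g @: FA"
 have "cnj (pair f (%u. pair g (%v. cnj (ka (ws v @ ws u))))) = cnj (pair g (%v. pair f (%u. cnj (ka (ws v @ ws u)))))" for ka by (subst pair_swap) (rule refl)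
 then show "star FA (f .[FA] g) = star FA g .[FA] star FA f" using C by (intro FA_eqI) (simp_all add: FA_closed pair_FA pair_star)
 have "pair f (%w. ka (ws (ws w))) = pair f ka" for ka using C ws_W by (intro pair_cong) (auto simp: FA_C)
 then show "star FA (star FA f) = f" using C by (intro FA_eqI) (simp_all add: FA_closed pair_star)
 qed (auto intro!: FA_eqI simp: FA_closed pair_FA pair_star pair_fun_smult)
qed

sublocale FA: unital_star_algebra FA by (rule usa_FA)

section \<open>The algebraic free product\<close>

definition gen :: "'i => 'a => ('i \<times> 'a) list => complex" where
 "gen i a = delta [(i, a)]"

lemma gen_C [simp, intro]: "[|i : I; a @: (A i)|] ==> gen i a @: FA" unfolding gen_def by (rule delta_FA) (simp add: W_Cons)

lemma delta_mult: "[|u : W; v : W|] ==> delta u .[FA] delta v = delta (u @ v)" by (intro FA_eqI) (auto simp: FA_closed pair_FA pair_delta)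

lemma delta_star: "w : W ==> star FA (delta w) = delta (ws w)" using ws_W by (intro FA_eqI) (auto simp: FA_closed pair_star pair_delta)

lemma gen_star: "[|i : I; a @: (A i)|] ==> star FA (gen i a) = gen i (star (A i) a)" unfolding gen_def by (subst delta_star) (auto simp: W_Cons)

abbreviation "rels == fp_relations I A"
abbreviation "J == fp_ideal I A"

lemma rels_cases:
 assumes "r : rels"
 obtains (add) i a b where "i : I" "a @: (A i)" "b @: (A i)" "r = gen i (a +[A i] b) \<ominus>\<^bsub>FA\<^esub> (gen i a +[FA] gen i b)"
 | (smult) i a c where "i : I" "a @: (A i)" "r = gen i (c *[A i] a) \<ominus>\<^bsub>FA\<^esub> c *[FA] gen i a"
 | (mult) i a b where "i : I" "a @: (A i)" "b @: (A i)" "r = gen i (a .[A i] b) \<ominus>\<^bsub>FA\<^esub> (gen i a .[FA] gen i b)"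
 | (one) i where "i : I" "r = gen i 1[A i] \<ominus>\<^bsub>FA\<^esub> 1[FA]" using assms unfolding fp_relations_def Let_def gen_def by blast

lemma relsI:
 assumes i: "i : I" and a: "a @: (A i)" and b: "b @: (A i)" shows "gen i (a +[A i] b) \<ominus>\<^bsub>FA\<^esub> (gen i a +[FA] gen i b) : rels"
 "gen i (c *[A i] a) \<ominus>\<^bsub>FA\<^esub> c *[FA] gen i a : rels"
 "gen i (a .[A i] b) \<ominus>\<^bsub>FA\<^esub> (gen i a .[FA] gen i b) : rels"
 "gen i 1[A i] \<ominus>\<^bsub>FA\<^esub> 1[FA] : rels" unfolding fp_relations_def Let_def gen_def using assms by blast+

lemma alg_closed:
 assumes "i : I" "a @: (A i)" "b @: (A i)" shows "a +[A i] b @: (A i)" "a .[A i] b @: (A i)" "c *[A i] a @: (A i)"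
 "1[A i] : carrier (A i)" "star (A i) a @: (A i)"
proof -
 interpret unital_star_algebra "A i" by (rule alg[OF assms(1)])
 show "a +[A i] b @: (A i)" "a .[A i] b @: (A i)" "c *[A i] a @: (A i)"
 "1[A i] : carrier (A i)" "star (A i) a @: (A i)" using assms star_closed by auto
qed

lemma one_A: "i : I ==> 1[A i] : carrier (A i)" using unital_star_algebra.ringA[OF alg] by (simp add: ring.ring_simprules)

lemma rels_C: "rels <= carrier FA"
proof
 fix r assume "r : rels"
 then show "r @: FA" by (cases rule: rels_cases) (auto simp: alg_closed one_A FA_closed FA_consts)
qed

lemma ideal_J: "ideal J FA" unfolding fp_ideal_def by (rule ring.genideal_ideal[OF ring_FA rels_C])

lemma J_minimal: "[|ideal N FA; rels <= N|] ==> J <= N" unfolding fp_ideal_def by (rule ring.genideal_minimal[OF ring_FA])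

lemma rels_J: "rels <= J" unfolding fp_ideal_def by (rule ring.genideal_self[OF ring_FA rels_C])

sublocale J: ideal J FA by (rule ideal_J)

lemma J_C: "f : J ==> f @: FA" using J.Icarr by simp

lemma minus_FA: "[|f @: FA; g @: FA|] ==> f \<ominus>\<^bsub>FA\<^esub> g = f +[FA] (- 1) *[FA] g" by (simp add: a_minus_def FA.minus_smult)

lemma J_smult: "f : J ==> c *[FA] f : J"
proof -
 assume f: "f : J"
 have "c *[FA] f = (c *[FA] 1[FA]) .[FA] f" using J_C[OF f] by (intro FA_eqI) (simp_all add: FA_closed FA_consts pair_FA)
 then show ?thesis using J.I_l_closed[OF f, of "c *[FA] 1[FA]"] by (simp add: FA_closed FA_consts)
qed

lemma star_minus: "[|f @: FA; g @: FA|] ==> star FA (f \<ominus>\<^bsub>FA\<^esub> g) = star FA f \<ominus>\<^bsub>FA\<^esub> star FA g"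
 by (simp add: minus_FA FA_closed FA.star_add FA.star_smult)

text \<open>The ideal is generated without reference to star. Its preimage under star is an ideal as
  well, and it contains the relations because the star of a relation is again a relation.\<close>

lemma J_star: "f : J ==> star FA f : J"
proof -
 define N where "N = {f : carrier FA. star FA f : J}"
 have "ideal N FA"
 proof (rule ideal_from_closed[OF ring_FA])
 show "0[FA] : N" unfolding N_def using FA_consts J.zero_closed by (simp add: FA_ops cong: if_cong)
 show "x +[FA] y : N" if "x : N" "y : N" for x y using that by (auto simp: N_def FA_closed FA.star_add)
 show "\<ominus>\<^bsub>FA\<^esub> x : N" if "x : N" for x using that by (auto simp: N_def FA.minus_smult FA_closed FA.star_smult J_smult)
 show "x .[FA] a : N" "a .[FA] x : N" if "a : N" "x @: FA" for a x using that by (auto simp: N_def FA_closed FA.star_mult intro: J.I_l_closed J.I_r_closed)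
 qed (auto simp: N_def)
 moreover have "rels <= N"
 proof
 fix r assume r: "r : rels"
 then have rC: "r @: FA" using rels_C by blast
 from r have "star FA r : rels"
 proof (cases rule: rels_cases)
 case (add i a b)
 interpret unital_star_algebra "A i" by (rule alg[OF add(1)])
 show ?thesis using relsI(1)[OF add(1), of "star (A i) a" "star (A i) b"] add by (simp add: star_minus alg_closed FA_closed FA.star_add gen_star star_add)
 next
 case (smult i a c)
 interpret unital_star_algebra "A i" by (rule alg[OF smult(1)])
 show ?thesis using relsI(2)[OF smult(1), of "star (A i) a" "star (A i) a" "cnj c"] smult
 by (simp add: star_minus alg_closed FA_closed FA.star_smult gen_star star_smult)
 next
 case (mult i a b)
 interpret unital_star_algebra "A i" by (rule alg[OF mult(1)])
 show ?thesis using relsI(3)[OF mult(1), of "star (A i) b" "star (A i) a"] mult by (simp add: star_minus alg_closed FA_closed FA.star_mult gen_star star_mult)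
 next
 case (one i)
 interpret unital_star_algebra "A i" by (rule alg[OF one(1)])
 show ?thesis using r one by (simp add: star_minus one_A FA_consts FA.star_one gen_star star_one)
 qed
 then show "r : N" using rC rels_J by (auto simp: N_def)
 qed
 ultimately have "J <= N" by (rule J_minimal)
 then show "f : J ==> star FA f : J" by (auto simp: N_def)
qed

lemma cls_eq_iff: "[|f @: FA; g @: FA|] ==> cls f = cls g \<longleftrightarrow> f \<ominus>\<^bsub>FA\<^esub> g : J"
 unfolding fp_class_def by (rule ring.quotient_eq_iff_same_a_r_cos[OF ring_FA ideal_J, symmetric])

lemma PA_carrier: "carrier PA = cls ` carrier FA" by (auto simp: fp_algebra_def Let_def FactRing_def A_RCOSETS_def' fp_class_def)

lemma cls_C [simp, intro]: "f @: FA ==> cls f @: PA" by (simp add: PA_carrier)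

lemma cls_self: "f @: FA ==> f : cls f" unfolding fp_class_def by (rule J.a_rcos_self)

lemma in_cls:
 assumes "f @: FA" "g : cls f" shows "g @: FA" "cls g = cls f"
proof -
 show g: "g @: FA" using assms J.a_rcosets_carrier[of "cls f"] by (auto simp: fp_class_def A_RCOSETS_def')
 have "g \<ominus>\<^bsub>FA\<^esub> f : J" using J.a_rcos_module_minus[OF ring_FA assms(1) g] assms(2) by (simp add: fp_class_def)
 then show "cls g = cls f" using cls_eq_iff[OF g assms(1)] by simp
qed

lemma cls_ring:
 assumes f: "f @: FA" and g: "g @: FA" shows "cls f +[PA] cls g = cls (f +[FA] g)" "cls f .[PA] cls g = cls (f .[FA] g)"
 "1[PA] = cls 1[FA]" "0[PA] = cls 0[FA]"
proof -
 have h: "(+>\<^bsub>FA\<^esub>) J : ring_hom FA (FA Quot J)" by (rule J.rcos_ring_hom)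
 show "cls f +[PA] cls g = cls (f +[FA] g)" "cls f .[PA] cls g = cls (f .[FA] g)"
 "1[PA] = cls 1[FA]" using ring_hom_add[OF h f g] ring_hom_mult[OF h f g] ring_hom_one[OF h] by (simp_all add: fp_algebra_def Let_def fp_class_def)
 have "J +>\<^bsub>FA\<^esub> 0[FA] = 0[FA Quot J]" using ring_hom_zero[OF h ring_FA J.quotient_is_ring] .
 then show "0[PA] = cls 0[FA]" by (simp add: fp_algebra_def Let_def fp_class_def)
qed

text \<open>Well-definedness of the operations that \<open>fp_algebra\<close> describes by unions:
  all classes in such a union coincide.\<close>

lemma cls_diff_smult:
 assumes "f @: FA" "g @: FA" "cls f = cls g" shows "cls (c *[FA] f) = cls (c *[FA] g)" "cls (star FA f) = cls (star FA g)"
proof -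
 have d: "f \<ominus>\<^bsub>FA\<^esub> g : J" using assms cls_eq_iff by blast
 have "c *[FA] (f \<ominus>\<^bsub>FA\<^esub> g) = c *[FA] f \<ominus>\<^bsub>FA\<^esub> c *[FA] g"
 using assms by (intro FA_eqI) (simp_all add: minus_FA FA_closed pair_FA algebra_simps)
 then show "cls (c *[FA] f) = cls (c *[FA] g)" using J_smult[OF d, of c] assms by (simp add: cls_eq_iff FA_closed)
 show "cls (star FA f) = cls (star FA g)" using J_star[OF d] assms by (simp add: cls_eq_iff FA_closed star_minus)
qed

lemma cls_smult: "f @: FA ==> c *[PA] cls f = cls (c *[FA] f)"
proof -
 assume f: "f @: FA"
 have "(\<Union>g\<in>cls f. cls (c *[FA] g)) = (\<Union>g\<in>cls f. cls (c *[FA] f))" using in_cls[OF f] cls_diff_smult(1) f by (intro SUP_cong refl) blast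
 also have "... = cls (c *[FA] f)" using cls_self[OF f] by blast
 finally show ?thesis by (simp add: fp_algebra_def Let_def)
qed

lemma cls_star: "f @: FA ==> star PA (cls f) = cls (star FA f)"
proof -
 assume f: "f @: FA"
 have "(\<Union>g\<in>cls f. cls (star FA g)) = (\<Union>g\<in>cls f. cls (star FA f))" using in_cls[OF f] cls_diff_smult(2) f by (intro SUP_cong refl) blast
 also have "... = cls (star FA f)" using cls_self[OF f] by blast
 finally show ?thesis by (simp add: fp_algebra_def Let_def)
qed

lemmas cls_simps = cls_ring cls_smult cls_star FA_closed FA_consts

lemma usa_PA: "unital_star_algebra PA"
proof -
 note R = ring.ring_simprules[OF ring_FA]
 have ab: "abelian_group PA"
 proof (rule abelian_groupI)
 fix x assume "x @: PA"
 then obtain f where fg: "f @: FA" "x = cls f" by (auto simp: PA_carrier)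
 show "EX y:carrier PA. y +[PA] x = 0[PA]" using fg R(9)[of f] by (intro bexI[of _ "cls (\<ominus>\<^bsub>FA\<^esub> f)"]) (simp_all add: cls_simps)
 qed (auto simp: PA_carrier cls_simps cls_ring[OF FA_consts(1,1)] R(7,8,10,22))
 have mo: "monoid PA" by (rule monoidI) (auto simp: PA_carrier cls_simps cls_ring[OF FA_consts(1,1)] R(11))
 have ri: "ring PA" by (rule ringI[OF ab mo]) (auto simp: PA_carrier cls_simps R(13,23))
 have md: "module complex_ring PA" by (rule moduleI[OF cring_complex_ring ab])
 (auto simp: PA_carrier cls_simps FA.smult_add FA.smult_smult FA.smult_1 FA.smult_add_right)
 show ?thesis by (intro unital_star_algebra.intro[OF ri md], unfold_locales)
 (auto simp: PA_carrier cls_simps FA.smult_mult_left FA.smult_mult_right FA.star_add FA.star_mult FA.star_star FA.star_smult)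
qed

sublocale PA: unital_star_algebra PA by (rule usa_PA)

end

section \<open>The free product representation and the free product state\<close>

lemma blin_cong:
 assumes "semi_ip H (ip H)" "blin H K S" "!!x. x @: H ==> T x = S x" shows "blin H K T"
 using assms(2,3) semi_ip.addC[OF assms(1)] semi_ip.smultC[OF assms(1)] unfolding blin_def by (auto simp: image_subset_iff)

lemma blin_lc_fun:
 assumes H: "ip_space H" and K: "ip_space K" and S: "finite S" and T: "!!s. s : S ==> blin H K (T s)" shows "blin H K (%v. lc K c (%s. T s v) S)"
proof -
 interpret H: ip_space H by fact
 interpret K: ip_space K by fact
 show ?thesis using S T
 proof (induction S)
 case empty
 then show ?case using blin_const_zero[OF H K] by simp
 next
 case (insert a S)
 have "blin H K (%v. c a *[K] T a v +[K] lc K c (%s. T s v) S)" using insert by (intro blin_add blin_smult H K) auto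
 then show ?case
 proof (rule blin_cong[OF H.semi_ip_axioms])
 fix v assume "v @: H"
 then have "(%s. T s v) ` insert a S <= carrier K" using blinD(1)[OF insert.prems] by auto
 then show "lc K c (%s. T s v) (insert a S) = c a *[K] T a v +[K] lc K c (%s. T s v) S" using insert by (intro K.lc_insert) auto
 qed
 qed
qed

lemma adjoint_eqI:
 assumes H: "ip_space H" and S: "S : bounded_ops H H" and T: "T : bounded_ops H H" and adj: "!!x y. [|x @: H; y @: H|] ==> ip H (S y) x = ip H y (T x)"
 shows "adjoint H H T = S" unfolding adjoint_def
proof (rule the_equality)
 interpret ip_space H by fact
 show "S : bounded_ops H H & (ALL x:carrier H. ALL y:carrier H. ip H (S y) x = ip H y (T x))" using S adj by blast
 fix R assume R: "R : bounded_ops H H & (ALL x:carrier H. ALL y:carrier H. ip H (R y) x = ip H y (T x))"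
 then have bR: "R : bounded_ops H H" and R2: "!!x y. [|x @: H; y @: H|] ==> ip H (R y) x = ip H y (T x)" by auto
 note RC = blinD(1)[OF bounded_ops_blin[OF bR]] and SC = blinD(1)[OF bounded_ops_blin[OF S]]
 show "R = S"
 proof (rule extensionalityI[of _ "carrier H"])
 fix y assume y: "y @: H"
 show "R y = S y"
 proof (rule sep[OF RC[OF y] SC[OF y]])
 fix z assume z: "z @: H"
 show "ip H z (R y) = ip H z (S y)" using q_sym[OF z RC[OF y]] q_sym[OF z SC[OF y]] R2[OF z y] adj[OF z y] by simp
 qed
 qed (use bR S in \<open>simp_all add: bounded_ops_iff\<close>)
qed

locale fpst = fpalg I A for I :: "'i set" and A :: "'i => 'a star_algebra" +
 fixes \<phi> :: "'i => 'a => complex"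
 assumes st: "i : I ==> state (A i) (\<phi> i)"
begin

abbreviation "GH == (%i. gns_space (A i) (\<phi> i))"
abbreviation "GX == (%i. gns_vec (A i) (\<phi> i))"
abbreviation "rp i a == gns_rep (A i) (\<phi> i) a"

lemma ss: "i : I ==> star_state (A i) (\<phi> i)" by (intro star_state.intro star_state_axioms.intro alg st)

lemma fpsp_GH: "fpsp I GH GX"
proof (rule fpsp.intro)
 fix i assume i: "i : I"
 interpret S: star_state "A i" "\<phi> i" by (rule ss[OF i])
 show "ip_space (GH i)" by (rule S.G.ip_space_axioms)
 show "GX i @: (GH i)" "ip (GH i) (GX i) (GX i) = 1" unfolding gns_vec_def using one_A[OF i] by (auto simp: S.q_one S.phi_one)
qed

sublocale P: fpsp I GH GX by (rule fpsp_GH)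

lemma rp_bounded: "[|i : I; a @: (A i)|] ==> rp i a : bounded_ops (GH i) (GH i)" by (rule star_state.gns_rep_bounded[OF ss])

primrec opw :: "('i \<times> 'a) list => ('i, (nat => 'a) set) fp_vector => ('i, (nat => 'a) set) fp_vector" where
 "opw [] v = v"
| "opw (l # w) v = P.ampl (fst l) (rp (fst l) (snd l)) (opw w v)"

lemma opw_append: "opw (u @ w) v = opw u (opw w v)" by (induction u) auto

lemma blin_opw: "w : W ==> blin P.Fs P.Fs (opw w)"
proof (induction w)
 case Nil
 then show ?case using blin_id[of P.Fs] by simp
next
 case (Cons l w)
 obtain i a where l: "l = (i, a)" by (cases l)
 have ia: "i : I" "a @: (A i)" "w : W" using Cons(2) unfolding l W_Cons by auto
 have "blin P.Fs P.Fs (%v. P.ampl i (rp i a) (opw w v))" by (rule blin_comp[OF P.F.ip_space_axioms P.F.ip_space_axioms P.F.ip_space_axioms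
 bounded_ops_blin[OF P.ampl_props(1)[OF ia(1) rp_bounded[OF ia(1,2)]]] Cons.IH[OF ia(3)]])
 then show ?case using l by simp
qed

lemma opw_C [simp, intro]: "[|w : W; v @: P.Fs|] ==> opw w v @: P.Fs" using blinD(1)[OF blin_opw] .

lemma opw_star:
 assumes "w : W" "x @: P.Fs" "y @: P.Fs" shows "ip P.Fs (opw (ws w) x) y = ip P.Fs x (opw w y)" using assms
proof (induction w arbitrary: x y)
 case (Cons l w)
 obtain i a where l: "l = (i, a)" "i : I" "a @: (A i)" "w : W"
 proof (cases l)
 case (Pair i a)
 then show thesis using that[of i a] Cons.prems(1) by (simp add: W_Cons)
 qed
 interpret S: star_state "A i" "\<phi> i" by (rule ss[OF l(2)])
 have sa: "star (A i) a @: (A i)" using l by (simp add: S.star_closed)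
 have "ip P.Fs (opw (ws (l # w)) x) y = ip P.Fs (opw (ws w) (P.ampl i (rp i (star (A i) a)) x)) y" using l by (simp add: opw_append)
 also have "... = ip P.Fs (P.ampl i (rp i (star (A i) a)) x) (opw w y)"
 by (rule Cons.IH[OF l(4) blinD(1)[OF bounded_ops_blin[OF P.ampl_props(1)[OF l(2) rp_bounded[OF l(2) sa]]] Cons.prems(2)] Cons.prems(3)])
 also have "... = ip P.Fs x (P.ampl i (rp i a) (opw w y))"
 by (rule P.ampl_adj[OF l(2) rp_bounded[OF l(2) sa] rp_bounded[OF l(2,3)] S.gns_rep_star[OF l(3)] Cons.prems(2) opw_C[OF l(4) Cons.prems(3)]])
 finally show ?case using l by simp
qed simp

text \<open>The representation before passing to the quotient. As a combination of words its matrix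
  coefficients are values of \<open>pair\<close>, so identities reduce to finite sums.\<close>

definition rho :: "(('i \<times> 'a) list => complex) => ('i, (nat => 'a) set) fp_vector => ('i, (nat => 'a) set) fp_vector" where
 "rho f v = lc P.Fs f (%w. opw w v) (fsupp f)"

lemma rho_sub: "[|f @: FA; v @: P.Fs|] ==> (%w. opw w v) ` fsupp f <= carrier P.Fs" using FA_sub by blast

lemma rho_C [simp, intro]: "[|f @: FA; v @: P.Fs|] ==> rho f v @: P.Fs" unfolding rho_def by (intro P.F.lc_closed rho_sub FA_fin)

lemma ip_rho: "[|f @: FA; v @: P.Fs; z @: P.Fs|] ==>
 ip P.Fs z (rho f v) = pair f (%w. ip P.Fs z (opw w v))" unfolding rho_def pair_def by (intro P.F.ip_lc rho_sub FA_fin)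

lemma blin_rho: "f @: FA ==> blin P.Fs P.Fs (rho f)" unfolding rho_def[abs_def]
 by (rule blin_lc_fun[OF P.F.ip_space_axioms P.F.ip_space_axioms FA_fin]) (use FA_sub blin_opw in auto)

lemma rho_delta: "[|w : W; v @: P.Fs|] ==> rho (delta w) v = opw w v" by (rule P.F.sep) (auto simp: ip_rho pair_delta)

lemma rho_gen: "[|i : I; a @: (A i); v @: P.Fs|] ==> rho (gen i a) v = P.ampl i (rp i a) v" unfolding gen_def by (subst rho_delta) (auto simp: W_Cons)

lemma rho_add: "[|f @: FA; g @: FA; v @: P.Fs|] ==> rho (f +[FA] g) v = rho f v +[P.Fs] rho g v"
 by (rule P.F.sep) (auto simp: ip_rho pair_FA FA_closed P.F.q_simps)

lemma rho_smult: "[|f @: FA; v @: P.Fs|] ==> rho (c *[FA] f) v = c *[P.Fs] rho f v" by (rule P.F.sep) (auto simp: ip_rho pair_FA FA_closed P.F.q_simps)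

lemma rho_one: "v @: P.Fs ==> rho 1[FA] v = v" by (rule P.F.sep) (auto simp: ip_rho pair_FA FA_consts)

lemma rho_zero: "v @: P.Fs ==> rho 0[FA] v = 0[P.Fs]" by (rule P.F.sep) (auto simp: ip_rho pair_FA FA_consts P.F.q_simps)

lemma rho_mult:
 assumes f: "f @: FA" and g: "g @: FA" and v: "v @: P.Fs" shows "rho (f .[FA] g) v = rho f (rho g v)"
proof (rule P.F.sep)
 fix z assume z: "z @: P.Fs"
 interpret FF: ip_space2 P.Fs P.Fs by (rule ip_space2.intro) unfold_locales
 have "ip P.Fs z (opw u (rho g v)) = pair g (%w. ip P.Fs z (opw u (opw w v)))" if u: "u : W" for u
 proof -
 have sub: "(%s. opw u (opw s v)) ` fsupp g <= carrier P.Fs" using u v FA_sub[OF g] by auto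
 have "opw u (rho g v) = lc P.Fs g (%s. opw u (opw s v)) (fsupp g)" unfolding rho_def by (rule FF.blin_lc[OF blin_opw[OF u] FA_fin[OF g] rho_sub[OF g v]])
 then show ?thesis unfolding pair_def using P.F.ip_lc[OF FA_fin[OF g] sub z] by simp
 qed
 then have "pair f (%u. ip P.Fs z (opw u (rho g v))) = pair f (%u. pair g (%w. ip P.Fs z (opw u (opw w v))))" using FA_sub[OF f] by (intro pair_cong) auto
 then show "ip P.Fs z (rho (f .[FA] g) v) = ip P.Fs z (rho f (rho g v))" using assms z by (simp add: ip_rho FA_closed pair_FA opw_append)
qed (use assms FA_closed in auto)

lemma rho_star:
 assumes f: "f @: FA" and x: "x @: P.Fs" and y: "y @: P.Fs" shows "ip P.Fs (rho (star FA f) x) y = ip P.Fs x (rho f y)"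
proof -
 have "ip P.Fs (rho (star FA f) x) y = cnj (ip P.Fs y (rho (star FA f) x))" using assms FA_closed by (intro P.F.q_sym) auto
 also have "... = cnj (cnj (pair f (%w. cnj (ip P.Fs y (opw (ws w) x)))))" using assms by (simp add: ip_rho FA_closed pair_star)
 also have "... = pair f (%w. ip P.Fs x (opw w y))"
 proof -
 have "cnj (ip P.Fs y (opw (ws w) x)) = ip P.Fs x (opw w y)" if w: "w : W" for w using P.F.q_sym[of "opw (ws w) x" y] opw_star[OF w x y] ws_W[OF w] x y by simp
 then show ?thesis using FA_sub[OF f] by simp (intro pair_cong, auto)
 qed
 finally show ?thesis using assms by (simp add: ip_rho)
qed

lemma rho_minus:
 assumes "f @: FA" "g @: FA" "v @: P.Fs" shows "rho (f \<ominus>\<^bsub>FA\<^esub> g) v = rho f v +[P.Fs] (- 1) *[P.Fs] rho g v"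
 using assms by (simp add: minus_FA rho_add rho_smult FA_closed)

text \<open>The elements acting as zero form an ideal. It contains the four kinds of relations since
  amplification is additive, homogeneous, multiplicative and unital.\<close>

lemma rho_J:
 assumes "f : J" "v @: P.Fs" shows "rho f v = 0[P.Fs]"
proof -
 define N where "N = {f : carrier FA. ALL v:carrier P.Fs. rho f v = 0[P.Fs]}"
 have zz: "0[P.Fs] +[P.Fs] 0[P.Fs] = 0[P.Fs]" by (simp add: P.F.add_zero)
 have "ideal N FA"
 proof (rule ideal_from_closed[OF ring_FA])
 show "0[FA] : N" by (simp add: N_def FA_consts rho_zero)
 show "x +[FA] y : N" if "x : N" "y : N" for x y using that by (simp add: N_def FA_closed rho_add zz)
 show "\<ominus>\<^bsub>FA\<^esub> x : N" if "x : N" for x using that by (simp add: N_def FA.minus_smult FA_closed rho_smult P.F.smult_zero)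
 show "x .[FA] a : N" "a .[FA] x : N" if "a : N" "x @: FA" for a x
 proof -
 interpret FF: ip_space2 P.Fs P.Fs by (rule ip_space2.intro) unfold_locales
 show "x .[FA] a : N" "a .[FA] x : N" using that FF.blin_zero[OF blin_rho[OF that(2)]] by (simp_all add: N_def FA_closed rho_mult)
 qed
 qed (auto simp: N_def)
 moreover have "rels <= N"
 proof
 fix r assume r: "r : rels"
 have eq: "f \<ominus>\<^bsub>FA\<^esub> g : N" if f: "f @: FA" and g: "g @: FA" and fg: "!!v. v @: P.Fs ==> rho f v = rho g v" for f g
 proof -
 have "rho (f \<ominus>\<^bsub>FA\<^esub> g) v = 0[P.Fs]" if v: "v @: P.Fs" for v unfolding rho_minus[OF f g v] fg[OF v]
 using rho_C[OF g v] by (intro P.F.sep) (auto simp: P.F.q_simps)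
 then show ?thesis using f g ring.ring_simprules(4)[OF ring_FA] by (simp add: N_def)
 qed
 from r show "r : N"
 proof (cases rule: rels_cases)
 case (add i a b)
 interpret S: star_state "A i" "\<phi> i" by (rule ss[OF add(1)])
 have "P.ampl i (rp i (a +[A i] b)) v = P.ampl i (rp i a) v +[P.Fs] P.ampl i (rp i b) v" if "v @: P.Fs" for v
 by (rule P.ampl_add[OF add(1) rp_bounded[OF add(1,2)] rp_bounded[OF add(1,3)]
 rp_bounded[OF add(1) alg_closed(1)[OF add(1-3)]] S.gns_rep_add[OF add(2,3)] that])
 then show ?thesis unfolding add(4) by (intro eq) (use add in \<open>simp_all add: alg_closed FA_closed rho_add rho_gen\<close>)
 next
 case (smult i a c)
 interpret S: star_state "A i" "\<phi> i" by (rule ss[OF smult(1)])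
 have "P.ampl i (rp i (c *[A i] a)) v = c *[P.Fs] P.ampl i (rp i a) v" if "v @: P.Fs" for v by (rule P.ampl_smult[OF smult(1) rp_bounded[OF smult(1,2)]
 rp_bounded[OF smult(1) alg_closed(3)[OF smult(1,2,2)]] S.gns_rep_smult[OF smult(2)] that])
 then show ?thesis unfolding smult(3) by (intro eq) (use smult in \<open>simp_all add: alg_closed FA_closed rho_smult rho_gen\<close>)
 next
 case (mult i a b)
 interpret S: star_state "A i" "\<phi> i" by (rule ss[OF mult(1)])
 have C: "P.ampl i (rp i b) v @: P.Fs" if "v @: P.Fs" for v using blinD(1)[OF bounded_ops_blin[OF P.ampl_props(1)[OF mult(1) rp_bounded[OF mult(1,3)]]] that] .
 have "P.ampl i (rp i (a .[A i] b)) v = P.ampl i (rp i a) (P.ampl i (rp i b) v)" if "v @: P.Fs" for v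
 by (rule P.ampl_comp[OF mult(1) rp_bounded[OF mult(1,2)] rp_bounded[OF mult(1,3)]
 rp_bounded[OF mult(1) alg_closed(2)[OF mult(1-3)]] S.gns_rep_mult[OF mult(2,3)] that])
 then show ?thesis unfolding mult(4) by (intro eq) (use mult C in \<open>simp_all add: alg_closed FA_closed rho_mult rho_gen\<close>)
 next
 case (one i)
 interpret S: star_state "A i" "\<phi> i" by (rule ss[OF one(1)])
 have "P.ampl i (rp i 1[A i]) v = v" if "v @: P.Fs" for v by (rule P.ampl_id[OF one(1) rp_bounded[OF one(1) one_A[OF one(1)]] S.gns_rep_one that])
 then show ?thesis unfolding one(2) by (intro eq) (use one in \<open>simp_all add: one_A FA_consts rho_one rho_gen\<close>)
 qed
 qed
 ultimately have "J <= N" by (rule J_minimal)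
 then show ?thesis using assms by (auto simp: N_def)
qed

lemma rho_cls:
 assumes "f @: FA" "g @: FA" "cls f = cls g" "v @: P.Fs" shows "rho f v = rho g v"
proof -
 have "f \<ominus>\<^bsub>FA\<^esub> g : J" using assms cls_eq_iff by blast
 then have z: "rho f v +[P.Fs] (- 1) *[P.Fs] rho g v = 0[P.Fs]" using rho_minus[OF assms(1,2,4)] rho_J[OF _ assms(4)] by simp
 show ?thesis by (rule P.F.hdist_eq_0) (use assms z in \<open>auto simp: vdist_def\<close>)
qed

text \<open>The representative is arbitrary; \<open>rho_cls\<close> shows that the choice has no
  effect.\<close>

definition frep :: "(('i \<times> 'a) list => complex) set => ('i, (nat => 'a) set) fp_vector => ('i, (nat => 'a) set) fp_vector" where
 "frep = (\<lambda>X\<in>carrier PA. \<lambda>v\<in>carrier P.Fs. rho (SOME f. f @: FA & cls f = X) v)"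

lemma frep_cls:
 assumes f: "f @: FA" shows "frep (cls f) = restrict (rho f) (carrier P.Fs)"
proof -
 have "EX g. g @: FA & cls g = cls f" using f by blast
 then have "(SOME g. g @: FA & cls g = cls f) @: FA & cls (SOME g. g @: FA & cls g = cls f) = cls f" by (rule someI_ex)
 then show ?thesis unfolding frep_def using f rho_cls by (auto intro!: restrict_ext)
qed

lemma frep_bounded: "X @: PA ==> frep X : bounded_ops P.Fs P.Fs" using blin_restrict[OF P.F.semi_ip_axioms blin_rho] by (auto simp: PA_carrier frep_cls)

abbreviation "OA == op_algebra P.Fs"

lemma fp_incl_eq: "fp_incl I A i a = cls (gen i a)" by (simp add: fp_incl_def gen_def)

lemma frep_hom: "unital_star_hom PA OA frep" unfolding unital_star_hom_def
proof (intro conjI allI ballI)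
 note frep_simps = PA_carrier cls_simps frep_cls op_algebra_def compose_def
 show "frep : ring_hom PA OA"
 proof (rule ring_hom_memI)
 show "frep X @: OA" if "X @: PA" for X using frep_bounded[OF that] by (simp add: op_algebra_def)
 qed (auto simp: frep_simps rho_mult rho_add rho_one FA_consts cls_ring[OF FA_consts(1,1)] intro!: restrict_ext)
 fix X assume X: "X @: PA"
 then obtain f where f: "f @: FA" "X = cls f" by (auto simp: PA_carrier)
 show "frep (c *[PA] X) = c *[OA] frep X" for c using f by (auto simp: frep_simps rho_smult intro!: restrict_ext)
 have "adjoint P.Fs P.Fs (frep X) = frep (star PA X)" by (rule adjoint_eqI[OF P.F.ip_space_axioms frep_bounded frep_bounded[OF X]])
 (use X f in \<open>auto simp: PA.star_closed cls_simps frep_cls rho_star\<close>)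
 then show "frep (star PA X) = star OA (frep X)" by (simp add: op_algebra_def)
qed

lemma FA_induct [consumes 1, case_names zero delta add]:
 assumes f: "f @: FA" and z: "Q 0[FA]" and d: "!!w c. w : W ==> Q (c *[FA] delta w)" and add: "!!f g. [|f @: FA; g @: FA; Q f; Q g|] ==> Q (f +[FA] g)"
 shows "Q f"
proof -
 have "ALL f. f @: FA --> fsupp f = S --> Q f" if "finite S" for S using that
 proof (induction S)
 case empty
 then show ?case using z by (auto simp: FA_ops fsupp_def)
 next
 case (insert w S)
 show ?case
 proof (intro allI impI)
 fix f assume f: "f @: FA" and S: "fsupp f = insert w S"
 define g where "g = f(w := 0)"
 have gS: "fsupp g = S" using S insert(2) by (auto simp: g_def fsupp_def)
 have w: "w : W" "S <= W" using FA_sub[OF f] S by auto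
 have g: "g @: FA" using gS insert(1) w by (simp add: FA_C)
 have "f = f w *[FA] delta w +[FA] g" by (auto simp: FA_ops g_def delta_def)
 then show "Q f" using add[OF FA_closed(3)[OF delta_FA[OF w(1)], of "f w"] g d[OF w(1)]] insert(3) g gS by simp
 qed
 qed
 then show ?thesis using f FA_fin by blast
qed

text \<open>Agreement on the generators spreads to words by multiplicativity and to all classes by
  linearity, as the definite description in \<open>fp_rep\<close> requires.\<close>

lemma frep_unique:
 assumes ext: "\<pi> : extensional (carrier PA)" and hom: "unital_star_hom PA OA \<pi>"
 and gen: "!!i a. [|i : I; a @: (A i)|] ==> \<pi> (fp_incl I A i a) = P.ampl i (rp i a)" shows "\<pi> = frep"
proof (rule extensionalityI[OF ext])
 have rh: "\<pi> : ring_hom PA OA" and sm: "!!c X. X @: PA ==> \<pi> (c *[PA] X) = c *[OA] \<pi> X" using hom unfolding unital_star_hom_def by auto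
 have piB: "\<pi> X : bounded_ops P.Fs P.Fs" if "X @: PA" for X using ring_hom_closed[OF rh that] by (simp add: op_algebra_def)
 have d: "\<pi> (cls (delta w)) = frep (cls (delta w))" if "w : W" for w using that
 proof (induction w)
 case Nil
 have "delta [] = 1[FA]" by (simp add: FA_ops)
 then show ?case using ring_hom_one[OF rh] ring_hom_one[of frep PA OA] frep_hom cls_ring(3)[OF FA_consts(1,1)] by (simp add: unital_star_hom_def)
 next
 case (Cons l w)
 obtain i a where l: "l = (i, a)" "i : I" "a @: (A i)" "w : W" using Cons(2) by (cases l) (auto simp: W_Cons)
 have eq: "cls (delta (l # w)) = cls (gen i a) .[PA] cls (delta w)" using l delta_mult[of "[(i, a)]" w] by (simp add: cls_simps gen_def W_Cons)
 have g: "frep (cls (gen i a)) = \<pi> (cls (gen i a))" unfolding gen[OF l(2,3), unfolded fp_incl_eq] frep_cls[OF gen_C[OF l(2,3)]]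
 using P.ampl_props(1)[OF l(2) rp_bounded[OF l(2,3)]] rho_gen[OF l(2,3)] by (intro extensionalityI[of _ "carrier P.Fs"]) (auto simp: bounded_ops_iff)
 have fh: "frep : ring_hom PA OA" using frep_hom by (simp add: unital_star_hom_def)
 show ?case unfolding eq using l Cons g ring_hom_mult[OF rh, of "cls (gen i a)" "cls (delta w)"]
 ring_hom_mult[OF fh, of "cls (gen i a)" "cls (delta w)"] by simp
 qed
 have fh: "frep : ring_hom PA OA" and fsm: "!!c X. X @: PA ==> frep (c *[PA] X) = c *[OA] frep X" using frep_hom unfolding unital_star_hom_def by auto
 have sc: "\<pi> (cls (c *[FA] delta w)) = frep (cls (c *[FA] delta w))" if "w : W" for c w
 using sm[of "cls (delta w)" c] fsm[of "cls (delta w)" c] d[OF that] that by (simp add: cls_smult)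
 have "\<pi> (cls f) = frep (cls f)" if "f @: FA" for f using that
 proof (induction f rule: FA_induct)
 case zero
 have "0[FA] = 0 *[FA] delta []" by (simp add: FA_ops)
 then show ?case using sc[of "[]" 0] by simp
 next
 case (delta w c)
 then show ?case by (rule sc)
 next
 case (add f g)
 then show ?case using ring_hom_add[OF rh, of "cls f" "cls g"] ring_hom_add[OF fh, of "cls f" "cls g"] by (simp add: cls_ring)
 qed
 then show "\<pi> X = frep X" if "X @: PA" for X using that by (auto simp: PA_carrier)
 show "frep : extensional (carrier PA)" by (simp add: frep_def)
qed

lemma fp_rep_eq: "fp_rep I A \<phi> = frep" unfolding fp_rep_def Let_def
proof (rule the_equality)
 show "frep : extensional (carrier PA) & unital_star_hom PA OA frep & (ALL i:I. ALL a:carrier (A i). frep (fp_incl I A i a) = P.ampl i (rp i a))"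
 proof (intro conjI ballI frep_hom)
 show "frep : extensional (carrier PA)" by (simp add: frep_def)
 fix i a assume i: "i : I" "a @: (A i)"
 show "frep (fp_incl I A i a) = P.ampl i (rp i a)" unfolding fp_incl_eq frep_cls[OF gen_C[OF i]] using P.ampl_props(1)[OF i(1) rp_bounded[OF i]] rho_gen[OF i]
 by (intro extensionalityI[of _ "carrier P.Fs"]) (auto simp: bounded_ops_iff)
 qed
 fix \<pi> assume "\<pi> : extensional (carrier PA) & unital_star_hom PA OA \<pi> & (ALL i:I. ALL a:carrier (A i). \<pi> (fp_incl I A i a) = P.ampl i (rp i a))"
 then show "\<pi> = frep" by (intro frep_unique) auto
qed

abbreviation "vac == P.E []"
abbreviation "\<psi> == fp_state I A \<phi>"

lemma vac_C: "vac @: P.Fs" by auto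

lemma psi_cls: "f @: FA ==> \<psi> (cls f) = ip P.Fs vac (rho f vac)"
 unfolding fp_state_def Let_def fp_rep_eq using frep_cls[of f] vac_C by (simp add: fp_vac_def P.E_def)

lemma psi_form:
 assumes "f @: FA" "g @: FA" shows "\<psi> (star PA (cls f) .[PA] cls g) = ip P.Fs (rho f vac) (rho g vac)"
proof -
 have "\<psi> (star PA (cls f) .[PA] cls g) = ip P.Fs vac (rho (star FA f) (rho g vac))" using assms by (simp add: cls_simps psi_cls rho_mult)
 also have "... = ip P.Fs (rho f vac) (rho g vac)" using rho_star[of "star FA f" vac "rho g vac"] assms by (simp add: FA_closed FA.star_star)
 finally show ?thesis .
qed

text \<open>Boundedness of the GNS representation, a part of being a state here, is inherited from
  boundedness of \<open>rho f\<close>.\<close>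

lemma star_state_psi: "star_state PA \<psi>"
proof (intro star_state.intro usa_PA star_state_axioms.intro)
 have pos: "\<psi> (star PA (cls f) .[PA] cls f) : \<real>\<^sub>\<ge>\<^sub>0" if "f @: FA" for f
 unfolding psi_form[OF that that] P.F.q_self[OF rho_C[OF that vac_C]] nonneg_Reals_of_real_iff by simp
 have "EX C. ALL g:carrier FA. Re (\<psi> (star PA (cls f .[PA] cls g) .[PA] (cls f .[PA] cls g))) <= C * Re (\<psi> (star PA (cls g) .[PA] cls g))"
 if f: "f @: FA" for f
 proof -
 interpret FF: ip_space2 P.Fs P.Fs by (rule ip_space2.intro) unfold_locales
 obtain C where C: "C >= 0" "!!x. x @: P.Fs ==> hnorm P.Fs (rho f x) <= C * hnorm P.Fs x" using FF.blin_bound[OF blin_rho[OF f]] by blast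
 have "(hnorm P.Fs (rho f (rho g vac)))^2 <= (C * hnorm P.Fs (rho g vac))^2" if "g @: FA" for g using f that by (intro power_mono C(2)) auto
 then show ?thesis using f by (intro exI[of _ "C^2"] ballI) (simp add: cls_ring(2) psi_form FA_closed rho_mult P.F.fn_sq power_mult_distrib)
 qed
 then show "state PA \<psi>"
 using pos by (auto simp: state_def PA_carrier cls_ring(1) cls_smult psi_cls rho_add rho_smult rho_one FA_consts cls_ring(3)[OF FA_consts(1,1)]
 P.F.q_simps P.ip_E FA_closed)
qed

sublocale Psi: star_state PA \<psi> by (rule star_state_psi)

text \<open>Models the GNS space of the free product state by the vectors \<open>rho f vac\<close>:
  the norms to be compared are those of \<open>rho f\<close> on these vectors.\<close>

lemma psi_ip: "[|f @: FA; g @: FA|] ==> gns_form PA \<psi> (cls f) (cls g) = ip P.Fs (rho f vac) (rho g vac)" unfolding gns_form_def by (rule psi_form)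

lemma psi_norm: "f @: FA ==> form_norm (gns_form PA \<psi>) (cls f) = hnorm P.Fs (rho f vac)" by (simp add: form_norm_def psi_ip)

end

section \<open>Reduction of the norm to finitely generated right modules\<close>

context ip_space
begin

text \<open>Pythagoras: blocks with different labels are orthogonal.\<close>

lemma block_le:
 assumes F: "finite F" "g ` F <= carrier H" and orth: "!!s t. [|s : F; t : F; lab s ~= lab t|] ==> ip H (g s) (g t) = 0"
 shows "hnorm H (lc H c g {s : F. lab s = l}) <= hnorm H (lc H c g F)"
proof (rule power2_le_imp_le)
 let ?A = "{s : F. lab s = l}" and ?B = "{s : F. lab s ~= l}"
 have A: "finite ?A" "g ` ?A <= carrier H" and B: "finite ?B" "g ` ?B <= carrier H" using F by auto
 have AB: "F = ?A \<union> ?B" "?A \<inter> ?B = {}" by auto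
 have sp: "(SUM s:F. f s) = (SUM s:?A. f s) + (SUM s:?B. f s)" for f :: "_ => complex" using sum.union_disjoint[OF A(1) B(1) AB(2), of f] AB(1) by simp
 have z: "(SUM s:?A. SUM t:?B. cnj (c s) * c t * ip H (g s) (g t)) = 0"
 "(SUM s:?B. SUM t:?A. cnj (c s) * c t * ip H (g s) (g t)) = 0" using orth by (auto intro!: sum.neutral)
 have "ip H (lc H c g F) (lc H c g F) = ip H (lc H c g ?A) (lc H c g ?A) + ip H (lc H c g ?B) (lc H c g ?B)"
 unfolding ip_lc_lc[OF F F] ip_lc_lc[OF A A] ip_lc_lc[OF B B] by (simp only: sp sum.distrib z add_0_right add_0_left)
 then have "(hnorm H (lc H c g F))^2 = (hnorm H (lc H c g ?A))^2 + (hnorm H (lc H c g ?B))^2" using F A B by (simp add: fn_sq)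
 then show "(hnorm H (lc H c g ?A))^2 <= (hnorm H (lc H c g F))^2" by simp
qed (use F in auto)

text \<open>Together with \<open>block_le\<close> this costs one factor per label; the numbers of
  labels that occur are at most polynomial in the word length.\<close>

lemma block_triangle:
 assumes F: "finite F" "g ` F <= carrier H" and L: "finite L" "lab ` F <= L" shows "hnorm H (lc H c g F) <= (SUM l:L. hnorm H (lc H c g {s : F. lab s = l}))"
 using L(1) L(2) F
proof (induction L arbitrary: F)
 case empty
 then show ?case by simp
next
 case (insert l L)
 let ?A = "{s : F. lab s = l}" and ?B = "{s : F. lab s ~= l}"
 have A: "finite ?A" "g ` ?A <= carrier H" and B: "finite ?B" "g ` ?B <= carrier H" using insert.prems by auto
 have "lc H c g F = lc H c g ?A \<oplus> lc H c g ?B"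
 proof (rule lc_eqI[OF insert.prems(2,3)])
 show "lc H c g ?A \<oplus> lc H c g ?B @: H" using A B by auto
 fix z assume z: "z @: H"
 have "(SUM s:F. c s * ip H z (g s)) = (SUM s:?A \<union> ?B. c s * ip H z (g s))" by (rule sum.cong) auto
 also have "... = (SUM s:?A. c s * ip H z (g s)) + (SUM s:?B. c s * ip H z (g s))" using A B by (intro sum.union_disjoint) auto
 finally show "ip H z (lc H c g ?A \<oplus> lc H c g ?B) = (SUM s:F. c s * ip H z (g s))" using A B z by (simp add: q_add ip_lc)
 qed
 then have "hnorm H (lc H c g F) <= hnorm H (lc H c g ?A) + hnorm H (lc H c g ?B)" using A B by (simp add: fn_triangle)
 also have "hnorm H (lc H c g ?B) <= (SUM k:L. hnorm H (lc H c g {s : ?B. lab s = k}))" by (rule insert.IH[OF _ B]) (use insert.prems in auto)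
 also have "(SUM k:L. hnorm H (lc H c g {s : ?B. lab s = k})) = (SUM k:L. hnorm H (lc H c g {s : F. lab s = k}))"
 proof (rule sum.cong[OF refl])
 fix k assume "k : L"
 then have "{s : ?B. lab s = k} = {s : F. lab s = k}" using insert(2) by auto
 then show "hnorm H (lc H c g {s : ?B. lab s = k}) = hnorm H (lc H c g {s : F. lab s = k})" by simp
 qed
 finally show ?case using insert(1,2) by simp
qed

lemma lc_in_subspace:
 assumes "finite F" "g ` F <= carrier H" "\<zero> : D" "!!x y. x : D ==> y : D ==> x \<oplus> y : D"
 "!!a x. x : D ==> a \<odot> x : D" "g ` F <= D" shows "lc H c g F : D" using assms(1,2,6)
proof (induction F)
 case empty
 then show ?case using assms(3) by simp
next
 case (insert a F)
 then show ?case using assms(4,5) by (simp add: lc_insert)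
qed

end

context fpsp
begin

text \<open>Arbitrary operators stand in place of the GNS operators, because the estimate will be
  applied to perturbed generators.\<close>

primrec opT :: "('i => 'l => 'h => 'h) => ('i \<times> 'l) list => ('i, 'h) fp_vector => ('i, 'h) fp_vector" where
 "opT \<tau> [] v = v"
| "opT \<tau> (l # w) v = ampl (fst l) (\<tau> (fst l) (snd l)) (opT \<tau> w v)"

lemma blin_opT:
 assumes "!!i a. (i, a) : set w ==> i : I & \<tau> i a : bounded_ops (H i) (H i)" shows "blin Fs Fs (opT \<tau> w)" using assms
proof (induction w)
 case Nil
 then show ?case using blin_id[of Fs] by simp
next
 case (Cons l w)
 obtain i a where l: "l = (i, a)" by (cases l)
 have ia: "i : I" "\<tau> i a : bounded_ops (H i) (H i)" using Cons.prems[of i a] l by auto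
 have "blin Fs Fs (opT \<tau> w)" by (rule Cons.IH) (use Cons.prems in auto)
 then have "blin Fs Fs (%v. ampl i (\<tau> i a) (opT \<tau> w v))"
 by (rule blin_comp[OF F.ip_space_axioms F.ip_space_axioms F.ip_space_axioms bounded_ops_blin[OF ampl_props(1)[OF ia]]])
 then show ?case using l by simp
qed

lemma psd_kern: "r ` S <= {w. okw w} ==> psd S (%s t. kern H (r s) (r t))"
proof -
 assume r: "r ` S <= {w. okw w}"
 have "psd S (%s t. ip Fs (E (r s)) (E (r t)))" by (rule F.psd_gram) (use r in auto)
 then show ?thesis by (rule psd_cong) (use r in \<open>auto simp: ip_E image_subset_iff\<close>)
qed

end

text \<open>In the application \<open>B i\<close> consists of the finitely many tracked directions
  of factor i, and \<open>Wm i m\<close> of the vectors orthogonal to its m-th level. By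
  \<open>tau_W\<close> an operator lowers the level by one, so a letter from \<open>Wm i N\<close>
  remains orthogonal to the distinguished vector for N steps. \<open>G i\<close> collects the
  letters coming from the algebra, which split into a tracked part and a remainder of the same
  kind.\<close>

locale slots = fpsp +
 fixes I0 :: "'a set" and N :: nat and B :: "'a => 'b set" and Wm :: "'a => nat => 'b set"
 and G :: "'a => 'b set" and \<tau> :: "'a => 'l => 'b => 'b" and Lt :: "'a => 'l set"
 assumes I0: "finite I0" "I0 <= I" and B_fin: "i : I0 ==> finite (B i)" and B_okl: "[|i : I0; b : B i|] ==> okl (i, b)"
 and W_okl: "[|i : I0; w : Wm i m|] ==> okl (i, w)" and W_dec: "[|i : I0; w : Wm i (Suc m)|] ==> w : Wm i m"
 and BW: "[|i : I0; b : B i; w : Wm i N|] ==> ip (H i) b w = 0" and G_okl: "[|i : I; h : G i|] ==> okl (i, h)"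
 and G_dec: "[|i : I0; h : G i|] ==> EX c w. w : Wm i N & w : G i & h = lc (H i) c (%b. b) (B i) +[H i] w"
 and tau_b: "[|i : I0; a : Lt i|] ==> \<tau> i a : bounded_ops (H i) (H i)" and tau_W: "[|i : I0; a : Lt i; m < N; w : Wm i (Suc m)|] ==> \<tau> i a w : Wm i m"
begin

lemma BW': "[|i : I0; b : B i; w : Wm i N|] ==> ip (H i) w b = 0"
proof -
 assume *: "i : I0" "b : B i" "w : Wm i N"
 have i: "i : I" using * I0 by auto
 interpret Hi: ip_space "H i" by (rule ipH[OF i])
 show ?thesis using BW[OF *] B_okl[OF *(1,2)] W_okl[OF *(1,3)] Hi.q_sym[of w b] by (simp add: okl_def)
qed

definition Bw :: "('a \<times> 'b) list => bool" where
 "Bw u \<longleftrightarrow> (ALL l:set u. fst l : I0 & snd l : B (fst l))"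

text \<open>The right factors that stay untouched. For \<open>None\<close> no operator with index in
  \<open>I0\<close> can act on the first letter of r; for \<open>Some i\<close> a letter of index i
  in front of r shields it.\<close>

definition rest :: "'a option => ('a \<times> 'b) list => bool" where
 "rest ka r \<longleftrightarrow> okw r & (case ka of None => r = [] \<or> fst (hd r) \<notin> I0 | Some i => ns i r)"

text \<open>Invariant of the left factor after t steps. The last letter (i, h) shields the right
  factor as long as enough letters precede it for the remaining N - t steps, or h still lies in
  \<open>Wm i (N - t)\<close>. Initial left factors have at most N + 1 letters, and a step adds at
  most one.\<close>

definition sinv :: "'a option => nat => ('a \<times> 'b) list => bool" where
 "sinv ka t v \<longleftrightarrow> okw v & length v <= N + 1 + t & (case ka of None => fst ` set v <= I0
 | Some i => i : I0 & (EX g h. v = g @ [(i, h)] & (N - t <= length g \<or> h : Wm i (N - t))))"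

lemma okw_append: "okw (u @ v) \<longleftrightarrow> okw u & okw v & (u = [] \<or> v = [] \<or> fst (last u) ~= fst (hd v))"
 unfolding okw_def by (auto simp: distinct_adj_append_iff last_map hd_map)

lemma sinv_okw: "sinv ka t v ==> rest ka r ==> okw (v @ r)"
 unfolding sinv_def rest_def okw_append ns_def by (auto split: option.splits) (metis image_eqI last_in_set subsetD)

lemma sinv_ns: "[|sinv ka t v; rest ka r; j : I0; v = [] \<or> fst (hd v) ~= j|] ==> ns j (v @ r)"
 unfolding sinv_def rest_def ns_def by (cases v) (auto split: option.splits)

lemma sinv_mono: "sinv ka t v ==> sinv ka (Suc t) v"
proof -
 assume v: "sinv ka t v"
 show ?thesis
 proof (cases ka)
 case None
 then show ?thesis using v by (auto simp: sinv_def)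
 next
 case (Some i)
 then obtain g h where gh: "i : I0" "v = g @ [(i, h)]" "N - t <= length g \<or> h : Wm i (N - t)" using v by (auto simp: sinv_def)
 have "N - Suc t <= length g \<or> h : Wm i (N - Suc t)"
 proof (cases "t < N")
 case True
 then have "N - t = Suc (N - Suc t)" by simp
 then show ?thesis using gh W_dec[of i h "N - Suc t"] by auto
 next
 case False
 then show ?thesis by simp
 qed
 then show ?thesis using v gh Some by (auto simp: sinv_def)
 qed
qed

lemma sinv_mono_le: "sinv ka t v ==> t <= t' ==> sinv ka t' v" by (induction t') (auto simp: le_Suc_eq sinv_mono)

text \<open>A family of vectors indexed by the right factor \<open>r\<close> whose left factors do not depend on \<open>r\<close>.\<close>

definition repr :: "'a option => nat => (('a \<times> 'b) list => ('a, 'b) fp_vector) => bool" where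
 "repr ka t X \<longleftrightarrow> (EX F c. finite F & (ALL v:F. sinv ka t v) & (ALL r. rest ka r --> X r = lc Fs c (%v. E (v @ r)) F))"

lemma repr_sub: "[|ALL v:F. sinv ka t v; rest ka r|] ==> (%v. E (v @ r)) ` F <= carrier Fs" using sinv_okw by auto

lemma repr_C: "[|repr ka t X; rest ka r|] ==> X r @: Fs"
proof -
 assume "repr ka t X" and r: "rest ka r"
 then obtain S c where S: "finite S" "ALL v:S. sinv ka t v" "X r = lc Fs c (%v. E (v @ r)) S" unfolding repr_def by blast
 show "X r @: Fs" unfolding S(3) by (rule F.lc_closed[OF S(1) repr_sub[OF S(2) r]])
qed

lemma repr_E: "sinv ka t v ==> repr ka t (%r. E (v @ r))" unfolding repr_def using sinv_okw by (intro exI[of _ "{v}"] exI[of _ "%_. 1"]) (auto simp: F.lc_sing)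

lemma repr_zero: "repr ka t (%r. 0[Fs])" unfolding repr_def by (intro exI[of _ "{}"]) auto

lemma repr_cong: "[|repr ka t X; !!r. rest ka r ==> Y r = X r|] ==> repr ka t Y" unfolding repr_def by auto

lemma repr_lin:
 assumes "repr ka t X" "repr ka t Y" shows "repr ka t (%r. a *[Fs] X r +[Fs] b *[Fs] Y r)"
proof -
 obtain S c where S: "finite S" "ALL v:S. sinv ka t v" "!!r. rest ka r ==> X r = lc Fs c (%v. E (v @ r)) S" using assms(1) unfolding repr_def by blast
 obtain T d where T: "finite T" "ALL v:T. sinv ka t v" "!!r. rest ka r ==> Y r = lc Fs d (%v. E (v @ r)) T" using assms(2) unfolding repr_def by blast
 let ?e = "%s. a * (if s : S then c s else 0) + b * (if s : T then d s else 0)"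
 have "a *[Fs] X r +[Fs] b *[Fs] Y r = lc Fs ?e (%v. E (v @ r)) (S \<union> T)" if "rest ka r" for r unfolding S(3)[OF that] T(3)[OF that]
 by (rule F.lc_two[OF S(1) repr_sub[OF S(2) that] T(1) repr_sub[OF T(2) that]])
 then show ?thesis unfolding repr_def using S T by (intro exI[of _ "S \<union> T"] exI[of _ ?e]) auto
qed

lemma repr_add:
 assumes "repr ka t X" "repr ka t Y" shows "repr ka t (%r. X r +[Fs] Y r)"
 by (rule repr_cong[OF repr_lin[OF assms, of 1 1]]) (use repr_C assms in \<open>auto simp: F.one_smult\<close>)

lemma repr_smult:
 assumes "repr ka t X" shows "repr ka t (%r. a *[Fs] X r)"
 by (rule repr_cong[OF repr_lin[OF assms assms, of a 0]]) (use repr_C assms in \<open>auto simp: F.smult_zero F.add_zero\<close>)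

lemma repr_lc:
 assumes "finite S" "!!s. s : S ==> repr ka t (X s)" shows "repr ka t (%r. lc Fs c (%s. X s r) S)" using assms
proof (induction S)
 case empty
 show ?case using repr_zero by simp
next
 case (insert a S)
 have "repr ka t (%r. c a *[Fs] X a r +[Fs] lc Fs c (%s. X s r) S)" by (intro repr_add repr_smult insert) auto
 then show ?case
 proof (rule repr_cong)
 fix r assume r: "rest ka r"
 have "(%s. X s r) ` insert a S <= carrier Fs" using repr_C[OF insert.prems r] by auto
 then show "lc Fs c (%s. X s r) (insert a S) = c a *[Fs] X a r +[Fs] lc Fs c (%s. X s r) S" using insert by (intro F.lc_insert) auto
 qed
qed

lemma sinv_Cons:
 assumes v: "sinv ka t v" and j: "j : I0" "okl (j, h)" and n: "v = [] \<or> fst (hd v) ~= j" shows "sinv ka (Suc t) ((j, h) # v)"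
proof -
 have ok: "okw ((j, h) # v)" using v j n by (auto simp: sinv_def okw_Cons ns_def)
 show ?thesis
 proof (cases ka)
 case None
 then show ?thesis using v ok j by (auto simp: sinv_def)
 next
 case (Some i)
 then obtain g k where gk: "i : I0" "v = g @ [(i, k)]" "N - Suc t <= length g \<or> k : Wm i (N - Suc t)" using sinv_mono[OF v] by (auto simp: sinv_def)
 then have "(j, h) # v = ((j, h) # g) @ [(i, k)]" by simp
 moreover have "N - Suc t <= length ((j, h) # g) \<or> k : Wm i (N - Suc t)" using gk(3) by auto
 ultimately have "EX g h'. (j, h) # v = g @ [(i, h')] & (N - Suc t <= length g \<or> h' : Wm i (N - Suc t))" by blast
 then show ?thesis using v ok gk(1) Some by (auto simp: sinv_def)
 qed
qed

text \<open>An operator adds a first letter, or changes or removes it. The critical case is that the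
  shielding letter itself comes first: by \<open>tau_W\<close> its image is again orthogonal to the
  distinguished vector, so no term without a shielding letter arises.\<close>

lemma repr_ampl_E:
 assumes v: "sinv ka t v" and t: "t < N" and j: "j : I0" "a : Lt j" shows "repr ka (Suc t) (%r. ampl j (\<tau> j a) (E (v @ r)))"
proof -
 have jI: "j : I" using j I0 by auto
 note tb = tau_b[OF j]
 have tC: "\<tau> j a h @: (H j)" if "h @: (H j)" for h using blinD(1)[OF bounded_ops_blin[OF tb] that] .
 show ?thesis
 proof (cases "v = [] \<or> fst (hd v) ~= j")
 case True
 let ?h = "\<tau> j a (\<xi> j)"
 have hC: "?h @: (H j)" using tC xiC[OF jI] .
 have "repr ka (Suc t) (%r. ip (H j) (\<xi> j) ?h *[Fs] E (v @ r) +[Fs] E (((j, crc j ?h) # v) @ r))"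
 by (intro repr_add repr_smult repr_E sinv_mono[OF v] sinv_Cons[OF v j(1) okl_crc[OF jI hC] True])
 then show ?thesis
 proof (rule repr_cong)
 fix r assume r: "rest ka r"
 note ok = sinv_okw[OF v r] sinv_ns[OF v r j(1) True]
 have "ampl j (\<tau> j a) (E (v @ r)) = Ev j ?h (v @ r)" using ampl_props(2)[OF jI tb xiC[OF jI] ok] Ev_xi[OF jI ok] by simp
 then show "ampl j (\<tau> j a) (E (v @ r)) = ip (H j) (\<xi> j) ?h *[Fs] E (v @ r) +[Fs] E (((j, crc j ?h) # v) @ r)" by (simp add: Ev_def)
 qed
 next
 case False
 then obtain h v' where vh: "v = (j, h) # v'" by (cases v) auto
 have h: "okl (j, h)" "ns j v'" "okw v'" using v by (auto simp: sinv_def vh okw_Cons)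
 have hC: "h @: (H j)" using h by (simp add: okl_def)
 let ?h = "\<tau> j a h"
 have thC: "?h @: (H j)" by (rule tC[OF hC])
 have amp: "ampl j (\<tau> j a) (E (v @ r)) = Ev j ?h (v' @ r)" if r: "rest ka r" for r
 proof -
 have ok: "okw ((j, h) # (v' @ r))" using sinv_okw[OF v r] by (simp add: vh)
 then have "okw (v' @ r)" "ns j (v' @ r)" by (auto simp: okw_Cons)
 then have "ampl j (\<tau> j a) (Ev j h (v' @ r)) = Ev j ?h (v' @ r)" by (rule ampl_props(2)[OF jI tb hC])
 then show ?thesis by (simp add: Ev_okl[OF ok] vh)
 qed
 show ?thesis
 proof (cases "v' = [] & ka ~= None")
 case True
 then obtain i where i: "ka = Some i" by auto
 then have ij: "i = j" "h : Wm j (N - t)" using v True t by (auto simp: sinv_def vh)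
 have "N - t = Suc (N - Suc t)" using t by simp
 then have w: "?h : Wm j (N - Suc t)" using tau_W[OF j, of "N - Suc t" h] ij t by simp
 have okh: "okl (j, ?h)" by (rule W_okl[OF j(1) w])
 have "sinv ka (Suc t) [(j, ?h)]" using okh w j(1) i ij by (auto simp: sinv_def okw_Cons ns_def)
 then have "repr ka (Suc t) (%r. E ([(j, ?h)] @ r))" by (rule repr_E)
 then show ?thesis
 proof (rule repr_cong)
 fix r assume r: "rest ka r"
 have "okw ((j, ?h) # r)" using r okh i ij by (auto simp: rest_def okw_Cons)
 then show "ampl j (\<tau> j a) (E (v @ r)) = E ([(j, ?h)] @ r)" using amp[OF r] Ev_okl True by simp
 qed
 next
 case False
 \<comment> \<open>Removing the first letter shortens the part before the shielding letter by one,
   which the decrease from N - t to N - t - 1 allows.\<close>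
 have v': "sinv ka (Suc t) v'"
 proof (cases ka)
 case None
 then show ?thesis using v h by (auto simp: sinv_def vh)
 next
 case (Some i)
 then obtain g k where gk: "i : I0" "v = g @ [(i, k)]" "N - t <= length g \<or> k : Wm i (N - t)" using v by (auto simp: sinv_def)
 then obtain g' where g': "g = (j, h) # g'" "v' = g' @ [(i, k)]" using False Some vh by (cases g) auto
 have "N - Suc t <= length g' \<or> k : Wm i (N - Suc t)" using gk(3) g'(1) t W_dec[OF gk(1), of k "N - Suc t"] by (auto simp: Suc_diff_Suc)
 then show ?thesis using v h Some gk(1) g'(2) by (auto simp: sinv_def vh)
 qed
 have n: "v' = [] \<or> fst (hd v') ~= j" using h(2) by (simp add: ns_def)
 have c: "sinv ka (Suc t) ((j, crc j ?h) # v')"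
 proof -
 have ok: "okw ((j, crc j ?h) # v')" using h okl_crc[OF jI thC] by (simp add: okw_Cons)
 have len: "length ((j, crc j ?h) # v') <= N + 1 + Suc t" using v by (simp add: sinv_def vh)
 show ?thesis
 proof (cases ka)
 case None
 then show ?thesis using v' ok len j by (auto simp: sinv_def)
 next
 case (Some i)
 then obtain g k where gk: "i : I0" "v' = g @ [(i, k)]" "N - Suc t <= length g \<or> k : Wm i (N - Suc t)" using v' by (auto simp: sinv_def)
 then have "(j, crc j ?h) # v' = ((j, crc j ?h) # g) @ [(i, k)]" by simp
 moreover have "N - Suc t <= length ((j, crc j ?h) # g) \<or> k : Wm i (N - Suc t)" using gk(3) by auto
 ultimately have "EX g h'. (j, crc j ?h) # v' = g @ [(i, h')] & (N - Suc t <= length g \<or> h' : Wm i (N - Suc t))" by blast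
 then show ?thesis using ok len gk(1) Some by (auto simp: sinv_def)
 qed
 qed
 have "repr ka (Suc t) (%r. ip (H j) (\<xi> j) ?h *[Fs] E (v' @ r) +[Fs] E (((j, crc j ?h) # v') @ r))" by (intro repr_add repr_smult repr_E v' c)
 then show ?thesis by (rule repr_cong) (simp add: amp Ev_def)
 qed
 qed
qed

lemma repr_ampl:
 assumes X: "repr ka t X" and t: "t < N" and j: "j : I0" "a : Lt j" shows "repr ka (Suc t) (%r. ampl j (\<tau> j a) (X r))"
proof -
 interpret FF: ip_space2 Fs Fs by (rule ip_space2.intro) unfold_locales
 have jI: "j : I" using j I0 by auto
 obtain S c where S: "finite S" "ALL v:S. sinv ka t v" "!!r. rest ka r ==> X r = lc Fs c (%v. E (v @ r)) S" using X unfolding repr_def by blast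
 have "repr ka (Suc t) (%r. lc Fs c (%v. ampl j (\<tau> j a) (E (v @ r))) S)" by (rule repr_lc[OF S(1)]) (use S repr_ampl_E[OF _ t j] in auto)
 then show ?thesis by (rule repr_cong) (simp add: S(3) FF.blin_lc[OF bounded_ops_blin[OF ampl_props(1)[OF jI tau_b[OF j]]] S(1) repr_sub[OF S(2)]])
qed

definition Lw :: "('a \<times> 'l) list => bool" where
 "Lw w \<longleftrightarrow> (ALL l:set w. fst l : I0 & snd l : Lt (fst l))"

lemma repr_opT:
 assumes u: "sinv ka 0 u" and w: "Lw w" "length w <= N" shows "repr ka (length w) (%r. opT \<tau> w (E (u @ r)))" using w
proof (induction w)
 case Nil
 then show ?case using repr_E[OF u] by simp
next
 case (Cons l w)
 then have "repr ka (length w) (%r. opT \<tau> w (E (u @ r)))" by (simp add: Lw_def)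
 then show ?case using repr_ampl[of ka "length w" _ "fst l" "snd l"] Cons.prems by (simp add: Lw_def)
qed

lemma repr_mono: "repr ka t X ==> t <= t' ==> repr ka t' X" unfolding repr_def using sinv_mono_le by meson

text \<open>The type (n, ka) records where reading from the left stops after n tracked letters: at
  the end of the word or before an index outside \<open>I0\<close> for \<open>None\<close>, at a
  letter from \<open>Wm i N\<close> for \<open>Some i\<close>. After N tracked letters any letter of
  \<open>G i\<close> may close the piece, since words of length at most N cannot reach it.\<close>

definition piece :: "nat \<times> 'a option => (('a \<times> 'b) list \<times> ('a \<times> 'b) list) set" where
 "piece l = {(u, r). okw (u @ r) & fst l <= N & (case snd l of
 None => Bw u & length u = fst l & (r = [] \<or> fst (hd r) \<notin> I0)
 | Some i => i : I0 & (EX f h. u = f @ [(i, h)] & Bw f & length f = fst l & h : G i & (h : Wm i N \<or> fst l = N)))}"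

lemma piece_inv:
 assumes "(u, r) : piece l" shows "sinv (snd l) 0 u" "rest (snd l) r" "rest (snd l) []" using assms
 by (auto simp: piece_def sinv_def rest_def okw_append ns_def Bw_def split: option.splits)

lemma piece_length: "(u, r) : piece l ==> length u = fst l + (case snd l of None => 0 | Some i => 1)" by (auto simp: piece_def split: option.splits)

lemma kern_zero:
 assumes "n < length w" "fst (w ! n) = fst (v ! n) ==> n < length v ==> ip (H (fst (w ! n))) (snd (w ! n)) (snd (v ! n)) = 0" shows "kern H w v = 0"
proof (cases "map fst w = map fst v")
 case True
 then have len: "length w = length v" by (rule map_eq_imp_length_eq)
 have "fst (w ! n) = fst (v ! n)" using arg_cong[OF True, of "%l. l ! n"] assms(1) len by simp
 then have "ip (H (fst (w ! n))) (snd (w ! n)) (snd (v ! n)) = 0" using assms len by simp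
 then show ?thesis using assms(1) by (auto simp: kern_eq_prod intro!: bexI[of _ n])
qed (simp add: kern_eq_prod)

text \<open>At position n the word of type n' has a tracked letter, while the other word ends there,
  has an index outside \<open>I0\<close>, or has a letter orthogonal to all tracked ones. The
  exception at n = N is ruled out by n < n' and n' at most N.\<close>

lemma piece_orth_less:
 assumes u: "(u, r) : piece (n, ka)" and u': "(u', r') : piece (n', ka')" and nn: "n < n'" shows "kern H (u @ r) (u' @ r') = 0"
proof (rule ccontr)
 assume nz: "kern H (u @ r) (u' @ r') ~= 0"
 have eq: "map fst (u @ r) = map fst (u' @ r')" using nz by (auto simp: kern_eq_prod split: if_splits)
 then have len: "length (u @ r) = length (u' @ r')" by (rule map_eq_imp_length_eq)
 have nN: "n < N" "n < length u'" and Bn: "fst (u' ! n) : I0" "snd (u' ! n) : B (fst (u' ! n))"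
 using u' nn by (auto simp: piece_def Bw_def nth_append split: option.splits)
 have fe: "fst ((u @ r) ! n) = fst (u' ! n)" using arg_cong[OF eq, of "%l. l ! n"] len nN by (simp add: nth_append del: map_append)
 show False
 proof (cases ka)
 case None
 then have "length u = n" "r = [] \<or> fst (hd r) \<notin> I0" using u by (auto simp: piece_def)
 then show False using fe Bn len nN by (cases r) (auto simp: nth_append)
 next
 case (Some i)
 then obtain f h where f: "u = f @ [(i, h)]" "length f = n" "h : Wm i N" "i : I0" using u nN by (auto simp: piece_def)
 then have un: "(u @ r) ! n = (i, h)" by (simp add: nth_append)
 have "kern H (u @ r) (u' @ r') = 0" by (rule kern_zero[of n]) (use un f fe Bn nN BW' in \<open>auto simp: nth_append\<close>)
 then show False using nz by simp
 qed
qed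

lemma kern_sym:
 assumes "okw w" "okw v" shows "kern H w v = cnj (kern H v w)" using F.q_sym[of "E w" "E v"] assms by (simp add: ip_E)

lemma piece_okw: "(u, r) : piece l ==> okw (u @ r) & okw u & okw r" by (auto simp: piece_def okw_append)

text \<open>For equal n the types are told apart by the index of the letter at position n.\<close>

lemma piece_orth:
 assumes u: "(u, r) : piece l" and u': "(u', r') : piece l'" and ll: "l ~= l'" shows "kern H (u @ r) (u' @ r') = 0"
proof -
 obtain n ka where l: "l = (n, ka)" by (cases l)
 obtain n' ka' where l': "l' = (n', ka')" by (cases l')
 have s: "kern H (u @ r) (u' @ r') = cnj (kern H (u' @ r') (u @ r))" using kern_sym piece_okw[OF u] piece_okw[OF u'] by blast
 consider "n < n'" | "n' < n" | "n = n'" by linarith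
 then show ?thesis
 proof cases
 case 1
 then show ?thesis using piece_orth_less u u' l l' by blast
 next
 case 2
 then show ?thesis using piece_orth_less[of u' r' n' ka' u r n ka] u u' l l' s by simp
 next
 case 3
 have some_none: "map fst (v @ x) ~= map fst (v' @ x')" if vv: "(v, x) : piece (n, Some i)" "(v', x') : piece (n, None)" for v x v' x' i
 proof
 assume eq: "map fst (v @ x) = map fst (v' @ x')"
 then have len: "length (v @ x) = length (v' @ x')" by (rule map_eq_imp_length_eq)
 obtain f h where f: "v = f @ [(i, h)]" "length f = n" "i : I0" using vv by (auto simp: piece_def)
 have v': "length v' = n" "x' = [] \<or> fst (hd x') \<notin> I0" using vv by (auto simp: piece_def)
 have "fst ((v @ x) ! n) = fst ((v' @ x') ! n)" using arg_cong[OF eq, of "%l. l ! n"] len f by (simp del: map_append)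
 then show False using f v' len by (cases x') (auto simp: nth_append)
 qed
 show ?thesis
 proof (cases ka; cases ka')
 fix i i' assume k: "ka = Some i" "ka' = Some i'"
 obtain f h where f: "u = f @ [(i, h)]" "length f = n" using u l k by (auto simp: piece_def)
 obtain f' h' where f': "u' = f' @ [(i', h')]" "length f' = n" using u' l' k 3 by (auto simp: piece_def)
 have "i ~= i'" using ll l l' k 3 by auto
 then show ?thesis by (intro kern_zero[of n]) (use f f' in \<open>auto simp: nth_append\<close>)
 next
 fix i assume "ka = Some i" "ka' = None"
 then show ?thesis using some_none[of u r i u' r'] u u' l l' 3 by (simp add: kern_eq_prod)
 next
 fix i assume "ka' = Some i" "ka = None"
 then show ?thesis using some_none[of u' r' i u r] u u' l l' 3 s by (simp add: kern_eq_prod)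
 next
 assume "ka = None" "ka' = None"
 then show ?thesis using ll l l' 3 by simp
 qed
 qed
qed

definition trip :: "((nat \<times> 'a option) \<times> ('a \<times> 'b) list \<times> ('a \<times> 'b) list) set" where
 "trip = {(l, u, r). (u, r) : piece l}"

abbreviation "Et == (%(l, u, r). E (u @ r))"

lemma Et_C: "Et ` trip <= carrier Fs" using piece_okw by (auto simp: trip_def)

definition spanned :: "('a, 'b) fp_vector => bool" where
 "spanned y \<longleftrightarrow> (EX F c. finite F & F <= trip & y = lc Fs c Et F)"

lemma spanned_lin:
 assumes "spanned x" "spanned y" shows "spanned (a *[Fs] x +[Fs] b *[Fs] y)"
proof -
 obtain S c where S: "finite S" "S <= trip" "x = lc Fs c Et S" using assms(1) spanned_def by blast
 obtain T d where T: "finite T" "T <= trip" "y = lc Fs d Et T" using assms(2) spanned_def by blast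
 have "Et ` S <= carrier Fs" "Et ` T <= carrier Fs" using Et_C S T by blast+
 from F.lc_two[OF S(1) this(1) T(1) this(2), of a c b d]
 have "a *[Fs] x +[Fs] b *[Fs] y
 = lc Fs (%s. a * (if s : S then c s else 0) + b * (if s : T then d s else 0)) Et (S \<union> T)" unfolding S(3) T(3) .
 moreover have "finite (S \<union> T)" "S \<union> T <= trip" using S T by auto
 ultimately show ?thesis unfolding spanned_def by blast
qed

lemma spanned_C: "spanned x ==> x @: Fs"
proof -
 assume "spanned x"
 then obtain S c where S: "finite S" "S <= trip" "x = lc Fs c Et S" using spanned_def by blast
 have "Et ` S <= carrier Fs" using Et_C S(2) by blast
 then show "x @: Fs" unfolding S(3) by (rule F.lc_closed[OF S(1)])
qed

lemma spanned_add: "spanned x ==> spanned y ==> spanned (x +[Fs] y)" using spanned_lin[of x y 1 1] spanned_C by (simp add: F.one_smult)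

lemma spanned_smult: "spanned x ==> spanned (a *[Fs] x)" using spanned_lin[of x x a 0] spanned_C by (simp add: F.smult_zero F.add_zero)

lemma spanned_zero: "spanned 0[Fs]" unfolding spanned_def by (intro exI[of _ "{}"]) auto

lemma spanned_lc: "[|finite S; !!s. s : S ==> spanned (g s)|] ==> spanned (lc Fs c g S)" by (rule F.lc_in_subspace[of S g "Collect spanned", simplified])
 (auto simp: spanned_zero spanned_add spanned_smult spanned_C)

lemma spanned_piece: "(u, r) : piece l ==> spanned (E (u @ r))" unfolding spanned_def
 by (intro exI[of _ "{(l, u, r)}"] exI[of _ "%_. 1"]) (use piece_okw in \<open>auto simp: trip_def F.lc_sing\<close>)

lemma E_lc:
 assumes i: "i : I" and S: "finite S" "!!s. s : S ==> okw (u @ (i, s) # r)" and w: "okw (u @ (i, w) # r)"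
 shows "okw (u @ (i, lc (H i) c (%b. b) S +[H i] w) # r) &
 E (u @ (i, lc (H i) c (%b. b) S +[H i] w) # r) = lc Fs c (%b. E (u @ (i, b) # r)) S +[Fs] E (u @ (i, w) # r)" using S
proof (induction S)
 case empty
 interpret Hi: ip_space "H i" by (rule ipH[OF i])
 have "w @: (H i)" using w by (auto simp: okw_append okw_Cons okl_def)
 then show ?case using w by (simp add: Hi.add_zero F.add_zero)
next
 case (insert a S)
 interpret Hi: ip_space "H i" by (rule ipH[OF i])
 have C: "s @: (H i)" if "s : insert a S" for s using insert.prems[OF that] by (auto simp: okw_append okw_Cons okl_def)
 have wC: "w @: (H i)" using w by (auto simp: okw_append okw_Cons okl_def)
 have S: "(%b. b) ` S <= carrier (H i)" and lS: "lc (H i) c (%b. b) S @: (H i)" using C insert(1) by auto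
 have ES: "(%b. E (u @ (i, b) # r)) ` insert a S <= carrier Fs" using insert.prems by auto
 have lES: "lc Fs c (%b. E (u @ (i, b) # r)) S @: Fs" using ES insert(1) by auto
 have eq: "lc (H i) c (%b. b) (insert a S) +[H i] w = c a *[H i] a +[H i] (lc (H i) c (%b. b) S +[H i] w)"
 proof -
 have "(%b. b) ` insert a S <= carrier (H i)" using C by auto
 from Hi.lc_insert[OF insert(1,2) this, of c] show ?thesis using C wC lS by (intro Hi.sep) (auto simp: Hi.q_simps)
 qed
 have IH: "okw (u @ (i, lc (H i) c (%b. b) S +[H i] w) # r)"
 "E (u @ (i, lc (H i) c (%b. b) S +[H i] w) # r) = lc Fs c (%b. E (u @ (i, b) # r)) S +[Fs] E (u @ (i, w) # r)" using insert.IH insert.prems by auto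
 have a: "okw (u @ (i, a) # r)" using insert.prems by simp
 note sm = E_smult[OF a, of "c a"]
 have "lc Fs c (%b. E (u @ (i, b) # r)) (insert a S) +[Fs] E (u @ (i, w) # r)
 = c a *[Fs] E (u @ (i, a) # r) +[Fs] (lc Fs c (%b. E (u @ (i, b) # r)) S +[Fs] E (u @ (i, w) # r))"
 using insert(1,2) ES lES w a by (intro F.sep) (auto simp: F.lc_insert F.q_simps)
 then show ?case unfolding eq using E_add[OF sm(1) IH(1)] sm(2) IH(2) by simp
qed

text \<open>Read from the left, each letter with index in \<open>I0\<close> is split into a tracked
  part and a remainder. The tracked part continues the induction, the remainder closes a
  piece.\<close>

lemma spanned_word:
 assumes "Bw u" "length u <= N" "okw (u @ w)" "!!l. l : set w ==> snd l : G (fst l)" shows "spanned (E (u @ w))" using assms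
proof (induction w arbitrary: u)
 case Nil
 then have "(u, []) : piece (length u, None)" by (auto simp: piece_def)
 then show ?case by (rule spanned_piece)
next
 case (Cons l r)
 obtain i h where l: "l = (i, h)" by (cases l)
 have hG: "h : G i" using Cons.prems(4)[of l] l by simp
 have iI: "i : I" using Cons.prems(3) l by (auto simp: okw_append okw_Cons okl_def)
 show ?case
 proof (cases "i : I0")
 case False
 then have "(u, l # r) : piece (length u, None)" using Cons.prems l by (auto simp: piece_def)
 then show ?thesis by (rule spanned_piece)
 next
 case i: True
 show ?thesis
 proof (cases "length u = N")
 case True
 then have "(u @ [(i, h)], r) : piece (N, Some i)" using Cons.prems l i hG by (auto simp: piece_def)
 from spanned_piece[OF this] show ?thesis by (simp add: l)
 next
 case False
 obtain c w where w: "w : Wm i N" "w : G i" "h = lc (H i) c (%b. b) (B i) +[H i] w" using G_dec[OF i hG] by blast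
 have okc: "okw (u @ (i, k) # r)" if "okl (i, k)" for k using Cons.prems(3) that unfolding l by (auto simp: okw_append okw_Cons)
 have okw': "okw (u @ (i, w) # r)" using okc W_okl[OF i w(1)] .
 have okB: "okw (u @ (i, b) # r)" if "b : B i" for b using okc B_okl[OF i that] .
 have "spanned (E ((u @ [(i, b)]) @ r))" if b: "b : B i" for b using Cons.prems False i b okB[OF b] by (intro Cons.IH) (auto simp: Bw_def)
 then have 1: "spanned (lc Fs c (%b. E (u @ (i, b) # r)) (B i))" by (intro spanned_lc B_fin i) simp
 have "(u @ [(i, w)], r) : piece (length u, Some i)" using Cons.prems i w okw' by (auto simp: piece_def)
 from spanned_piece[OF this] have 2: "spanned (E (u @ (i, w) # r))" by simp
 show ?thesis unfolding l w(3) using E_lc[OF iI B_fin[OF i] okB okw', of c] spanned_add[OF 1 2] by simp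
 qed
 qed
qed

text \<open>On one piece the operator acts on left factors only, with coefficients independent of r,
  and the bound M on left factors extends to the piece by a Schur product with the Gram kernel of
  the right factors. The factors of the constant count the values of n, the values of
  \<open>ka\<close>, and the lengths 0 to 2N + 1 of left factors in the image.\<close>

theorem slot_bound:
 assumes Sx: "finite Sx" "!!s. s : Sx ==> Lw s & length s <= N" and M: "M >= 0" and D: "!!l. fst l <= N ==> snd l : insert None (Some ` I0) ==>
 0[Fs] : D l & (ALL x:D l. ALL y:D l. x +[Fs] y : D l) & (ALL a. ALL x:D l. a *[Fs] x : D l) & (ALL u r. (u, r) : piece l --> E u : D l) &
 (ALL x:D l. hnorm Fs (lc Fs c (%s. opT \<tau> s x) Sx) <= M * hnorm Fs x)" and y: "finite Y" "!!w. w : Y ==> okw w & (ALL l:set w. snd l : G (fst l))"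
 shows "hnorm Fs (lc Fs c (%s. opT \<tau> s (lc Fs d E Y)) Sx)
 <= (real (N + 1) * real (card I0 + 1) * real (2 * N + 2)) * M * hnorm Fs (lc Fs d E Y)"
proof -
 interpret FF: ip_space2 Fs Fs by (rule ip_space2.intro) unfold_locales
 define X where "X = (%v. lc Fs c (%s. opT \<tau> s v) Sx)"
 have bX: "blin Fs Fs X" unfolding X_def
 proof (rule blin_lc_fun[OF F.ip_space_axioms F.ip_space_axioms Sx(1)])
 fix s assume "s : Sx"
 then have "Lw s" using Sx by simp
 then show "blin Fs Fs (opT \<tau> s)" using I0 tau_b by (intro blin_opT) (auto simp: Lw_def)
 qed
 have XC: "X v @: Fs" if "v @: Fs" for v using blinD(1)[OF bX that] .
 have reprX: "repr ka N (%r. X (E (u @ r)))" if "sinv ka 0 u" for ka u unfolding X_def using Sx repr_mono[OF repr_opT[OF that]] by (intro repr_lc) auto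
 define \<Lambda> where "\<Lambda> = {..N} \<times> insert None (Some ` I0)"
 have cardL: "card \<Lambda> = (N + 1) * (card I0 + 1)" "finite \<Lambda>"
 using I0 by (auto simp: \<Lambda>_def card_cartesian_product card_insert_if card_image)
 have piece_L: "l : \<Lambda>" if "(u, r) : piece l" for u r l using that by (cases l) (auto simp: piece_def \<Lambda>_def split: option.splits)
 have single_piece: "hnorm Fs (X (lc Fs a Et P)) <= real (2 * N + 2) * M * hnorm Fs (lc Fs a Et P)"
 if P: "finite P" "!!s. s : P ==> fst s = l & snd s : piece l" for P l and a
 proof (cases "P = {}")
 case True
 then show ?thesis using FF.blin_zero[OF bX] by simp
 next
 case False
 define u where "u s = fst (snd s)" for s :: "(nat \<times> 'a option) \<times> ('a \<times> 'b) list \<times> ('a \<times> 'b) list"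
 define r where "r s = snd (snd s)" for s :: "(nat \<times> 'a option) \<times> ('a \<times> 'b) list \<times> ('a \<times> 'b) list"
 have pc: "(u s, r s) : piece l" if "s : P" for s using P(2)[OF that] by (simp add: u_def r_def)
 have Et: "Et s = E (u s @ r s)" for s by (simp add: u_def r_def case_prod_beta)
 have lL: "l : \<Lambda>" using False pc piece_L by blast
 note iv = piece_inv[OF pc] and po = piece_okw[OF pc]
 have "ALL s. s : P --> (EX F f. finite F & (ALL v:F. sinv (snd l) N v) & (ALL r. rest (snd l) r --> X (E (u s @ r)) = lc Fs f (%v. E (v @ r)) F))"
 using reprX[OF iv(1)] unfolding repr_def by blast
 then obtain Fv f0 where Fv: "!!s. s : P ==> finite (Fv s) & (ALL v:Fv s. sinv (snd l) N v) &
 (ALL r. rest (snd l) r --> X (E (u s @ r)) = lc Fs (f0 s) (%v. E (v @ r)) (Fv s))" by metis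
 \<comment> \<open>One finite set of left factors serves all s in P, with coefficients extended by
   zero.\<close>
 define V where "V = \<Union> (Fv ` P)"
 define f where "f s v = (if v \<in> Fv s then f0 s v else 0)" for s v
 have V: "finite V" "!!v. v : V ==> sinv (snd l) N v" using P(1) Fv by (auto simp: V_def)
 have sub: "(%v. E (v @ x)) ` V <= carrier Fs" if x: "rest (snd l) x" for x using E_C[OF sinv_okw[OF V(2) x]] by blast
 have XE: "X (E (u s @ x)) = lc Fs (f s) (%v. E (v @ x)) V" if "s : P" "rest (snd l) x" for s x
 proof -
 have "Fv s <= V" using that by (auto simp: V_def)
 then show ?thesis using Fv[OF that(1)] that(2) F.lc_extend[OF V(1) sub[OF that(2)], of "Fv s" "f0 s"] by (simp add: f_def[abs_def])
 qed
 \<comment> \<open>Inner products of words v @ r factor only for left factors v of equal length;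
   hence the image is cut by length.\<close>
 define Vm where "Vm m = {v : V. length v = m}" for m
 have Vm: "finite (Vm m)" "Vm m <= V" for m using V(1) by (auto simp: Vm_def)
 define z where "z m s = lc Fs (f s) E (Vm m)" for m s
 define zr where "zr m s = lc Fs (f s) (%v. E (v @ r s)) (Vm m)" for m s
 have r0: "rest (snd l) []" using False iv(3) by blast
 have EV: "E ` V <= carrier Fs" using sub[OF r0] by simp
 have EVm: "E ` Vm m <= carrier Fs" for m using EV Vm(2)[of m] by blast
 have zC: "z m s @: Fs" for m s unfolding z_def using Vm(1) EVm by (intro F.lc_closed)
 have subm: "(%v. E (v @ r s)) ` Vm m <= carrier Fs" if "s : P" for s m using sub[OF iv(2)[OF that]] Vm(2)[of m] by blast
 have zrC: "zr m s @: Fs" if "s : P" for m s unfolding zr_def using Vm(1) subm[OF that] by (intro F.lc_closed)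
 have okv: "okw v" if "v : V" for v using V(2)[OF that] by (simp add: sinv_def)
 have okvr: "okw (v @ r s)" if "v : V" "s : P" for v s using sinv_okw[OF V(2)[OF that(1)] iv(2)[OF that(2)]] .
 have ipz: "ip Fs (zr m s) (zr m t) = ip Fs (z m s) (z m t) * kern H (r s) (r t)" if st: "s : P" "t : P" for m s t
 proof -
 have "ip Fs (zr m s) (zr m t) = (SUM v:Vm m. SUM v':Vm m. cnj (f s v) * f t v' * ip Fs (E (v @ r s)) (E (v' @ r t)))"
 unfolding zr_def by (rule F.ip_lc_lc[OF Vm(1) subm[OF st(1)] Vm(1) subm[OF st(2)]])
 also have "... = (SUM v:Vm m. SUM v':Vm m. cnj (f s v) * f t v' * ip Fs (E v) (E v') * kern H (r s) (r t))"
 proof (intro sum.cong refl)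
 fix v v' assume v: "v : Vm m" "v' : Vm m"
 then have "v : V" "v' : V" "length v = length v'" by (auto simp: Vm_def)
 then show "cnj (f s v) * f t v' * ip Fs (E (v @ r s)) (E (v' @ r t)) = cnj (f s v) * f t v' * ip Fs (E v) (E v') * kern H (r s) (r t)"
 using st okv okvr by (simp add: ip_E kern_append)
 qed
 also have "... = ip Fs (z m s) (z m t) * kern H (r s) (r t)" unfolding z_def F.ip_lc_lc[OF Vm(1) EVm Vm(1) EVm] by (simp add: sum_distrib_right)
 finally show ?thesis .
 qed
 have uC: "(%s. E (u s)) ` P <= carrier Fs" using po by auto
 \<comment> \<open>With empty right factor, the part of length m is an orthogonal block of X applied
   to a combination of left factors, where the bound on \<open>D l\<close> is available.\<close>
 have Xsum: "hnorm Fs (lc Fs b (z m) Q) <= M * hnorm Fs (lc Fs b (%s. E (u s)) Q)" if Q: "finite Q" "Q <= P" for b Q m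
 proof -
 have QC: "(%s. E (u s)) ` Q <= carrier Fs" using Q uC by blast
 define h where "h v = (SUM s:Q. b s * f s v)" for v
 have ipsum: "(SUM s:Q. b s * (SUM v:A. f s v * k v)) = (SUM v:A. h v * k v)" for A and k :: "_ => complex"
 unfolding h_def sum_distrib_left sum_distrib_right by (subst sum.swap) (simp add: mult.assoc)
 have e1: "lc Fs b (z m) Q = lc Fs h E (Vm m)" using Q zC Vm EVm by (intro F.lc_eqI) (auto simp: z_def F.ip_lc ipsum)
 have XuC: "(%s. X (E (u s))) ` Q <= carrier Fs" using QC XC by auto
 have "X (lc Fs b (%s. E (u s)) Q) = lc Fs b (%s. X (E (u s))) Q" by (rule FF.blin_lc[OF bX Q(1) QC])
 also have "... = lc Fs h E V"
 proof (rule F.lc_eqI[OF Q(1) XuC])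
 show "lc Fs h E V @: Fs" using V EV by auto
 fix x assume x: "x @: Fs"
 have "ip Fs x (X (E (u s))) = (SUM v:V. f s v * ip Fs x (E v))" if "s : Q" for s using XE[OF _ r0, of s] that Q F.ip_lc[OF V(1) EV x, of "f s"] by auto
 then show "ip Fs x (lc Fs h E V) = (SUM s:Q. b s * ip Fs x (X (E (u s))))" using F.ip_lc[OF V(1) EV x, of h] by (simp add: ipsum)
 qed
 finally have e2: "X (lc Fs b (%s. E (u s)) Q) = lc Fs h E V" .
 have "hnorm Fs (lc Fs h E (Vm m)) <= hnorm Fs (lc Fs h E V)" unfolding Vm_def
 proof (rule F.block_le[OF V(1) EV])
 fix v v' assume v: "v : V" "v' : V" "length v ~= length v'"
 then have "map fst v ~= map fst v'" by (metis map_eq_imp_length_eq)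
 then show "ip Fs (E v) (E v') = 0" using v okv by (simp add: ip_E kern_eq_prod)
 qed
 moreover have "lc Fs b (%s. E (u s)) Q : D l"
 proof (rule F.lc_in_subspace[OF Q(1) QC])
 have l: "fst l <= N" "snd l : insert None (Some ` I0)" using lL by (auto simp: \<Lambda>_def)
 note Dl = D[OF l]
 show "0[Fs] : D l" using Dl by (rule conjunct1)
 show "x +[Fs] y : D l" if "x : D l" "y : D l" for x y using Dl that by blast
 show "e *[Fs] x : D l" if "x : D l" for e x using Dl that by blast
 have "E (u s) : D l" if "s : Q" for s
 proof -
 have "(u s, r s) : piece l" using Q that pc by blast
 then show ?thesis using Dl by blast
 qed
 then show "(%s. E (u s)) ` Q <= D l" by blast
 qed
 moreover have "ALL x:D l. hnorm Fs (X x) <= M * hnorm Fs x" using D[of l] lL by (auto simp: \<Lambda>_def X_def)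
 ultimately show ?thesis unfolding e1 e2[symmetric] by fastforce
 qed
 have EtC: "Et ` P <= carrier Fs" using po Et by auto
 have kp: "psd P (%s t. kern H (r s) (r t))" by (rule psd_kern) (use po in auto)
 have Zm: "hnorm Fs (lc Fs a (zr m) P) <= M * hnorm Fs (lc Fs a Et P)" for m
 proof (rule power2_le_imp_le)
 \<comment> \<open>The inequality for left factors as a positive kernel; its product with the kernel
   of the right factors is the inequality for the words u @ r.\<close>
 have "psd P (%s t. of_real (M^2) * ip Fs (E (u s)) (E (u t)) - ip Fs (z m s) (z m t))"
 by (rule psd_bound[OF F.ip_space_axioms F.ip_space_axioms M uC _ Xsum]) (use zC in auto)
 from psdD(2)[OF psd_mult[OF this kp] P(1) order_refl, of a]
 have "0 <= Re (SUM s:P. SUM t:P. cnj (a s) * a t * ((of_real (M^2) * ip Fs (E (u s)) (E (u t)) - ip Fs (z m s) (z m t)) * kern H (r s) (r t)))" .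
 also have "(SUM s:P. SUM t:P. cnj (a s) * a t * ((of_real (M^2) * ip Fs (E (u s)) (E (u t)) - ip Fs (z m s) (z m t)) * kern H (r s) (r t)))
 = of_real (M^2) * ip Fs (lc Fs a Et P) (lc Fs a Et P) - ip Fs (lc Fs a (zr m) P) (lc Fs a (zr m) P)"
 proof -
 have A: "(zr m) ` P <= carrier Fs" using zrC by auto
 have len: "length (u s) = length (u t)" if "s : P" "t : P" for s t using piece_length[OF pc] that by metis
 have "of_real (M^2) * ip Fs (lc Fs a Et P) (lc Fs a Et P) - ip Fs (lc Fs a (zr m) P) (lc Fs a (zr m) P)
 = (SUM s:P. SUM t:P. of_real (M^2) * (cnj (a s) * a t * ip Fs (Et s) (Et t)) - cnj (a s) * a t * ip Fs (zr m s) (zr m t))"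
 unfolding F.ip_lc_lc[OF P(1) EtC P(1) EtC] F.ip_lc_lc[OF P(1) A P(1) A] by (simp add: sum_subtractf sum_distrib_left)
 also have "... = (SUM s:P. SUM t:P. cnj (a s) * a t * ((of_real (M^2) * ip Fs (E (u s)) (E (u t)) - ip Fs (z m s) (z m t)) * kern H (r s) (r t)))"
 proof (intro sum.cong refl)
 fix s t assume st: "s : P" "t : P"
 have "ip Fs (Et s) (Et t) = ip Fs (E (u s)) (E (u t)) * kern H (r s) (r t)"
 unfolding Et using po[OF st(1)] po[OF st(2)] kern_append[OF len[OF st]] by (simp add: ip_E)
 then show "of_real (M^2) * (cnj (a s) * a t * ip Fs (Et s) (Et t)) - cnj (a s) * a t * ip Fs (zr m s) (zr m t)
 = cnj (a s) * a t * ((of_real (M^2) * ip Fs (E (u s)) (E (u t)) - ip Fs (z m s) (z m t)) * kern H (r s) (r t))"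
 unfolding ipz[OF st] by (simp add: algebra_simps)
 qed
 finally show ?thesis by simp
 qed
 also have "Re ... = (M * hnorm Fs (lc Fs a Et P))^2 - (hnorm Fs (lc Fs a (zr m) P))^2"
 proof -
 have C1: "lc Fs a Et P @: Fs" using P(1) EtC by (rule F.lc_closed)
 have C2: "lc Fs a (zr m) P @: Fs" using P(1) zrC by (intro F.lc_closed) auto
 show ?thesis unfolding power_mult_distrib F.fn_sq[OF C1] F.fn_sq[OF C2] by (simp flip: of_real_power)
 qed
 finally show "(hnorm Fs (lc Fs a (zr m) P))^2 <= (M * hnorm Fs (lc Fs a Et P))^2" by simp
 show "0 <= M * hnorm Fs (lc Fs a Et P)" using M P(1) EtC by auto
 qed
 \<comment> \<open>The expansion of X on the piece is indexed by pairs of an input word and a left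
   factor of its image, to be sorted by the length of the latter.\<close>
 define Q where "Q = (SIGMA s:P. V)"
 define g where "g x = E (snd x @ r (fst x))" for x
 define b where "b x = a (fst x) * f (fst x) (snd x)" for x
 have Q: "finite Q" using P(1) V(1) by (simp add: Q_def)
 have gC: "g ` Q <= carrier Fs" using okvr by (auto simp: g_def Q_def)
 have ipQ: "(SUM x:(SIGMA s:P. A). b x * k (fst x) (snd x)) = (SUM s:P. a s * (SUM v:A. f s v * k s v))" if "finite A" for A and k :: "_ => _ => complex"
 unfolding sum.cartesian_product' by (simp add: b_def sum_distrib_left mult.assoc)
 have XQ: "X (lc Fs a Et P) = lc Fs b g Q"
 proof -
 have XEtC: "(%s. X (Et s)) ` P <= carrier Fs" using EtC XC by auto
 have "X (lc Fs a Et P) = lc Fs a (%s. X (Et s)) P" by (rule FF.blin_lc[OF bX P(1) EtC])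
 also have "... = lc Fs b g Q"
 proof (rule F.lc_eqI[OF P(1) XEtC])
 show "lc Fs b g Q @: Fs" using Q gC by (rule F.lc_closed)
 fix x assume x: "x @: Fs"
 have "ip Fs x (X (Et s)) = (SUM v:V. f s v * ip Fs x (E (v @ r s)))" if s: "s : P" for s
 unfolding Et XE[OF s iv(2)[OF s]] by (rule F.ip_lc[OF V(1) sub[OF iv(2)[OF s]] x])
 then show "ip Fs x (lc Fs b g Q) = (SUM s:P. a s * ip Fs x (X (Et s)))"
 unfolding F.ip_lc[OF Q gC x] using ipQ[OF V(1), of "%s v. ip Fs x (E (v @ r s))"] by (simp add: Q_def g_def)
 qed
 finally show ?thesis .
 qed
 have "hnorm Fs (X (lc Fs a Et P)) = hnorm Fs (lc Fs b g Q)" by (simp add: XQ)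
 also have "... <= (SUM m:{..2*N+1}. hnorm Fs (lc Fs b g {x : Q. length (snd x) = m}))"
 proof (rule F.block_triangle[OF Q gC])
 have "length v <= 2 * N + 1" if "v : V" for v using V(2)[OF that] by (simp add: sinv_def)
 then show "(%x. length (snd x)) ` Q <= {..2 * N + 1}" by (auto simp: Q_def)
 qed simp
 also have "... = (SUM m:{..2*N+1}. hnorm Fs (lc Fs a (zr m) P))"
 proof (rule sum.cong[OF refl])
 fix m
 have eq: "{x : Q. length (snd x) = m} = (SIGMA s:P. Vm m)" by (auto simp: Q_def Vm_def)
 have fin: "finite (SIGMA s:P. Vm m)" using P(1) Vm by simp
 have "(SIGMA s:P. Vm m) <= Q" using Vm(2)[of m] by (auto simp: Q_def)
 then have gs: "g ` (SIGMA s:P. Vm m) <= carrier Fs" using gC by blast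
 have "lc Fs b g (SIGMA s:P. Vm m) = lc Fs a (zr m) P"
 proof (rule F.lc_eqI[OF fin gs])
 show "lc Fs a (zr m) P @: Fs" using P(1) zrC by (intro F.lc_closed) auto
 fix x assume x: "x @: Fs"
 have "ip Fs x (zr m s) = (SUM v:Vm m. f s v * ip Fs x (E (v @ r s)))" if s: "s : P" for s unfolding zr_def by (rule F.ip_lc[OF Vm(1) subm[OF s] x])
 moreover have "ip Fs x (lc Fs a (zr m) P) = (SUM s:P. a s * ip Fs x (zr m s))" using P(1) zrC x by (intro F.ip_lc) auto
 ultimately show "ip Fs x (lc Fs a (zr m) P) = (SUM s:(SIGMA s:P. Vm m). b s * ip Fs x (g s))"
 using ipQ[OF Vm(1)[of m], of "%s v. ip Fs x (E (v @ r s))"] by (simp add: g_def)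
 qed
 then show "hnorm Fs (lc Fs b g {x : Q. length (snd x) = m}) = hnorm Fs (lc Fs a (zr m) P)" unfolding eq by simp
 qed
 also have "... <= (SUM m:{..2*N+1}. M * hnorm Fs (lc Fs a Et P))" by (intro sum_mono Zm)
 also have "... = real (2 * N + 2) * M * hnorm Fs (lc Fs a Et P)" by (simp add: mult.assoc)
 finally show ?thesis .
 qed
 have "spanned (lc Fs d E Y)"
 proof (rule spanned_lc[OF y(1)])
 fix w assume "w : Y"
 then show "spanned (E w)" using spanned_word[of "[]" w] y(2) by (simp add: Bw_def)
 qed
 then obtain T a where T: "finite T" "T <= trip" "lc Fs d E Y = lc Fs a Et T" unfolding spanned_def by blast
 have EtC: "Et ` T <= carrier Fs" using Et_C T by blast
 have XEtC: "(%s. X (Et s)) ` T <= carrier Fs" using EtC XC by auto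
 have "hnorm Fs (X (lc Fs a Et T)) = hnorm Fs (lc Fs a (%s. X (Et s)) T)" by (simp add: FF.blin_lc[OF bX T(1) EtC])
 also have "... <= (SUM l:\<Lambda>. hnorm Fs (lc Fs a (%s. X (Et s)) {s : T. fst s = l}))"
 by (rule F.block_triangle[OF T(1) XEtC cardL(2)]) (use T(2) piece_L in \<open>auto simp: trip_def\<close>)
 also have "... <= (SUM l:\<Lambda>. real (2 * N + 2) * M * hnorm Fs (lc Fs a Et T))"
 proof (rule sum_mono)
 fix l assume "l : \<Lambda>"
 let ?P = "{s : T. fst s = l}"
 have P: "finite ?P" "Et ` ?P <= carrier Fs" using T(1) EtC by auto
 have "hnorm Fs (lc Fs a (%s. X (Et s)) ?P) = hnorm Fs (X (lc Fs a Et ?P))" by (simp add: FF.blin_lc[OF bX P])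
 also have "... <= real (2 * N + 2) * M * hnorm Fs (lc Fs a Et ?P)" by (rule single_piece[OF P(1), of l a]) (use T(2) in \<open>auto simp: trip_def\<close>)
 also have "... <= real (2 * N + 2) * M * hnorm Fs (lc Fs a Et T)"
 proof (intro mult_left_mono F.block_le[OF T(1) EtC])
 fix s t assume st: "s : T" "t : T" "fst s ~= fst t"
 obtain l u r where s: "s = (l, u, r)" by (cases s)
 obtain l' u' r' where t: "t = (l', u', r')" by (cases t)
 have pp: "(u, r) : piece l" "(u', r') : piece l'" using st T(2) s t by (auto simp: trip_def)
 show "ip Fs (Et s) (Et t) = 0" using piece_orth[OF pp] piece_okw[OF pp(1)] piece_okw[OF pp(2)] st(3) by (simp add: s t ip_E)
 qed (use M in auto)
 finally show "hnorm Fs (lc Fs a (%s. X (Et s)) ?P) <= real (2 * N + 2) * M * hnorm Fs (lc Fs a Et T)" .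
 qed
 also have "... = (real (N + 1) * real (card I0 + 1) * real (2 * N + 2)) * M * hnorm Fs (lc Fs a Et T)" using cardL(1) by (simp add: algebra_simps)
 finally show ?thesis unfolding T(3) X_def .
qed

end

section \<open>Matrices over a star-algebra with a state\<close>

context unital_star_algebra
begin

lemma abmA: "abelian_monoid A" using ringA by (simp add: ring.is_abelian_group abelian_group.axioms(1))

lemmas finsum_emptyA = abelian_monoid.finsum_empty[OF abmA]
lemmas finsum_insertA = abelian_monoid.finsum_insert[OF abmA]

lemma finsum_C [simp, intro]: "f : S \<rightarrow> carrier A ==> finsum A f S @: A" by (rule abelian_monoid.finsum_closed[OF abmA])

lemma finsum_lin:
 fixes L :: "'a => complex"
 assumes add: "!!x y. [|x @: A; y @: A|] ==> L (x \<oplus> y) = L x + L y" and S: "finite S" "f : S \<rightarrow> carrier A"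
 shows "L (finsum A f S) = (SUM s:S. L (f s))" using S
proof (induction S)
 case empty
 have "L \<zero> = L \<zero> + L \<zero>" using add[of \<zero> \<zero>] by (simp add: abelian_monoid.l_zero[OF abmA])
 then show ?case by (simp add: finsum_emptyA)
next
 case (insert s S)
 then show ?case by (simp add: finsum_insertA add Pi_iff)
qed

end

context star_state
begin

lemma fn_cong: "[|a @: A; b @: A; !!z. z @: A ==> q z a = q z b|] ==> fn a = fn b" using C.q_sym[of b a] by (simp add: form_norm_def)

lemma q_finsum: "[|z @: A; finite S; f : S \<rightarrow> carrier A|] ==> q z (finsum A f S) = (SUM s:S. q z (f s))" by (rule finsum_lin) (auto simp: C.q_add)

lemma gn_zero: "gn \<zero> = 0" using gn_smult_le[of \<zero> 0] gn_ge0[of \<zero>] by (intro antisym) (simp_all add: smult_0)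

lemma gn_sq_le:
 assumes a: "a @: A" shows "(gn a)^2 <= gn (star A a \<otimes> a)"
proof -
 have s: "star A a \<otimes> a @: A" using a by (simp add: star_closed)
 have "gn a <= sqrt (gn (star A a \<otimes> a))"
 proof (rule gn_le[OF a])
 fix x assume x: "x @: A"
 have "(fn (a \<otimes> x))^2 = cmod (q (a \<otimes> x) (a \<otimes> x))" using C.q_self[of "a \<otimes> x"] a x by (simp flip: of_real_power)
 also have "q (a \<otimes> x) (a \<otimes> x) = q x (star A a \<otimes> a \<otimes> x)" using a x by (simp add: gns_form_def star_mult star_closed A_assoc)
 also have "cmod ... <= fn x * fn (star A a \<otimes> a \<otimes> x)" using s x by (intro C.CS) auto
 also have "... <= fn x * (gn (star A a \<otimes> a) * fn x)" using s x by (intro mult_left_mono gn_bound) auto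
 also have "... = (sqrt (gn (star A a \<otimes> a)) * fn x)^2" using s by (simp add: power_mult_distrib power2_eq_square mult_ac)
 finally show "fn (a \<otimes> x) <= sqrt (gn (star A a \<otimes> a)) * fn x" using s x by (auto intro: power2_le_imp_le)
 qed (use s in auto)
 then have "(gn a)^2 <= (sqrt (gn (star A a \<otimes> a)))^2" using a by (intro power_mono) auto
 then show ?thesis using s by simp
qed

end

text \<open>A selfadjoint matrix acting on columns over A. Selfadjointness is stated through the
  form q, which is how it will be known for Gram matrices.\<close>

locale star_matrix = star_state +
 fixes T :: "'t set" and R :: "'t => 't => 'a"
 assumes T: "finite T" and RC [simp]: "[|s : T; t : T|] ==> R s t @: A"
 and herm: "[|s : T; t : T; a @: A; b @: A|] ==> q a (R s t \<otimes> b) = cnj (q b (R t s \<otimes> a))"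
begin

abbreviation "FT == T \<rightarrow> carrier A"

definition mv :: "('t => 'a) => 't => 'a" where
 "mv h s = finsum A (%t. R s t \<otimes> h t) T"

text \<open>Powers are formed entrywise in the algebra, because strong convergence controls the
  norms of single elements.\<close>

primrec rpow :: "nat => 't => 't => 'a" where
 "rpow 0 s t = (if s = t then \<one> else \<zero>)"
| "rpow (Suc n) s t = finsum A (%u. R s u \<otimes> rpow n u t) T"

definition tip :: "('t => 'a) => ('t => 'a) => complex" where
 "tip g h = (SUM t:T. q (g t) (h t))"

definition tn :: "('t => 'a) => real" where
 "tn h = L2_set (%t. fn (h t)) T"

lemma mv_C [simp, intro]: "h : FT ==> mv h : FT" unfolding mv_def by (intro Pi_I finsum_C) (auto simp: Pi_iff)

lemma mvn_C [simp, intro]: "h : FT ==> (mv ^^ n) h : FT" by (induction n) (auto simp del: Pi_iff)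

lemma rpow_C [simp, intro]: "s : T ==> t : T ==> rpow n s t @: A" by (induction n arbitrary: s) (auto intro!: finsum_C)

lemma q_mv: "[|h : FT; s : T; z @: A|] ==> q z (mv h s) = (SUM t:T. q z (R s t \<otimes> h t))" unfolding mv_def by (rule q_finsum) (auto simp: T Pi_iff)

text \<open>Iterating the action agrees with the matrix of entries. Pairing with z turns sums in the
  algebra into sums of numbers.\<close>

lemma q_mvn:
 assumes "h : FT" "s : T" "z @: A" shows "q z ((mv ^^ n) h s) = (SUM t:T. q z (rpow n s t \<otimes> h t))" using assms(2,3)
proof (induction n arbitrary: s z)
 case 0
 have "q z (rpow 0 s t \<otimes> h t) = (if t = s then q z (h t) else 0)" if "t : T" for t
 using that 0 assms(1) C.q_zero[of z] smult_mult_left[of \<zero> "h t" 0] by (auto simp: Pi_iff smult_0)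
 then show ?case using 0 T by simp
next
 case (Suc n)
 have "q z (rpow (Suc n) s t \<otimes> h t) = (SUM u:T. q z ((R s u \<otimes> rpow n u t) \<otimes> h t))" if t: "t : T" for t unfolding rpow.simps
 by (rule finsum_lin[where L = "%x. q z (x \<otimes> h t)"]) (use Suc.prems assms(1) t T in \<open>auto simp: A_ldist C.q_add Pi_iff\<close>)
 then have "(SUM t:T. q z (rpow (Suc n) s t \<otimes> h t)) = (SUM u:T. SUM t:T. q z ((R s u \<otimes> rpow n u t) \<otimes> h t))" by (subst sum.swap) simp
 also have "... = (SUM u:T. q z (R s u \<otimes> (mv ^^ n) h u))"
 proof (intro sum.cong refl)
 fix u assume u: "u : T"
 have sz: "star A (R s u) \<otimes> z @: A" using u Suc.prems by (simp add: star_closed)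
 have "q z (R s u \<otimes> (mv ^^ n) h u) = q (star A (R s u) \<otimes> z) ((mv ^^ n) h u)"
 using u Suc.prems mvn_C[OF assms(1), of n] by (intro q_mult_left) auto
 also have "... = (SUM t:T. q (star A (R s u) \<otimes> z) (rpow n u t \<otimes> h t))" by (rule Suc.IH[OF u sz])
 also have "... = (SUM t:T. q z ((R s u \<otimes> rpow n u t) \<otimes> h t))"
 proof (intro sum.cong refl)
 fix t assume "t : T"
 then show "q (star A (R s u) \<otimes> z) (rpow n u t \<otimes> h t) = q z ((R s u \<otimes> rpow n u t) \<otimes> h t)"
 using u Suc.prems assms(1) q_mult_left[of "R s u" z "rpow n u t \<otimes> h t"] by (simp add: Pi_iff A_assoc)
 qed
 finally show "(SUM t:T. q z ((R s u \<otimes> rpow n u t) \<otimes> h t)) = q z (R s u \<otimes> (mv ^^ n) h u)" by simp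
 qed
 also have "... = q z ((mv ^^ Suc n) h s)" using q_mv[OF mvn_C[OF assms(1)] Suc.prems, of n] by simp
 finally show ?case by simp
qed

lemma tn_ge0 [simp]: "0 <= tn h" by (simp add: tn_def L2_set_nonneg)

lemma tip_self: "h : FT ==> tip h h = of_real ((tn h)^2)" unfolding tip_def tn_def L2_set_def by (simp add: sum_nonneg Pi_iff C.q_self)

lemma tip_le: "[|g : FT; h : FT|] ==> cmod (tip g h) <= tn g * tn h"
proof -
 assume g: "g : FT" and h: "h : FT"
 have "cmod (tip g h) <= (SUM t:T. cmod (q (g t) (h t)))" unfolding tip_def by (rule norm_sum)
 also have "... <= (SUM t:T. \<bar>fn (g t)\<bar> * \<bar>fn (h t)\<bar>)" using g h by (intro sum_mono) (auto simp: Pi_iff intro!: C.CS)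
 also have "... <= tn g * tn h" unfolding tn_def by (rule L2_set_mult_ineq)
 finally show ?thesis .
qed

lemma tip_mv:
 assumes g: "g : FT" and h: "h : FT" shows "tip g (mv h) = (SUM s:T. SUM t:T. q (g s) (R s t \<otimes> h t))"
 unfolding tip_def by (intro sum.cong refl q_mv) (use g h in auto)

lemma tip_mv_left:
 assumes g: "g : FT" and h: "h : FT" shows "tip (mv g) h = tip g (mv h)"
proof -
 have "tip (mv g) h = cnj (tip h (mv g))" unfolding tip_def cnj_sum by (intro sum.cong refl C.q_sym funcset_mem[OF mv_C[OF g]] funcset_mem[OF h])
 also have "... = (SUM s:T. SUM t:T. cnj (q (h s) (R s t \<otimes> g t)))" by (simp add: tip_mv g h)
 also have "... = (SUM s:T. SUM t:T. q (g t) (R t s \<otimes> h s))"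
 proof (intro sum.cong refl)
 fix s t assume st: "s : T" "t : T"
 show "cnj (q (h s) (R s t \<otimes> g t)) = q (g t) (R t s \<otimes> h s)" using herm[OF st(2,1) funcset_mem[OF g st(2)] funcset_mem[OF h st(1)]] by simp
 qed
 also have "... = tip g (mv h)" unfolding tip_mv[OF g h] by (rule sum.swap)
 finally show ?thesis .
qed

lemma tip_mvn:
 assumes "h : FT" shows "g : FT ==> tip ((mv ^^ n) g) h = tip g ((mv ^^ n) h)"
proof (induction n arbitrary: g)
 case (Suc n)
 show ?case using Suc.IH[OF mv_C[OF Suc.prems]] tip_mv_left[OF Suc.prems mvn_C[OF assms, of n]] by (simp add: funpow_swap1)
qed simp

lemma tn_sq_le: "h : FT ==> (tn ((mv ^^ n) h))^2 <= tn h * tn ((mv ^^ (n + n)) h)"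
proof -
 assume h: "h : FT"
 have "(tn ((mv ^^ n) h))^2 = cmod (tip ((mv ^^ n) h) ((mv ^^ n) h))" unfolding tip_self[OF mvn_C[OF h]] by (simp only: norm_of_real) simp
 also have "... = cmod (tip h ((mv ^^ (n + n)) h))" using tip_mvn[OF mvn_C[OF h] h, of n] by (simp add: funpow_add)
 also have "... <= tn h * tn ((mv ^^ (n + n)) h)" by (rule tip_le[OF h mvn_C[OF h]])
 finally show ?thesis .
qed

text \<open>By selfadjointness the squared norm of R^n h is at most the norm of h times that of
  R^(2n) h; this is iterated along powers of two.\<close>

lemma tn_pow_le:
 assumes h: "h : FT" and pos: "tn h > 0" shows "(tn (mv h) / tn h) ^ (2 ^ m) <= tn ((mv ^^ (2 ^ m)) h) / tn h"
proof (induction m)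
 case (Suc m)
 have "(tn (mv h) / tn h) ^ (2 ^ Suc m) = ((tn (mv h) / tn h) ^ (2 ^ m))^2" by (simp add: power_mult power_commutes flip: power_mult)
 also have "... <= (tn ((mv ^^ (2 ^ m)) h) / tn h)^2" by (rule power_mono[OF Suc]) simp
 also have "... <= tn ((mv ^^ (2 ^ Suc m)) h) / tn h"
 using tn_sq_le[OF h, of "2 ^ m"] pos by (simp add: power_divide divide_simps power2_eq_square mult_2 mult.commute)
 finally show ?case .
qed simp

text \<open>A crude count of entries. The factor is harmless because it does not depend on n and a
  root of order n will be taken.\<close>

lemma tn_mvn_entries:
 assumes h: "h : FT" and E: "!!s t. [|s : T; t : T|] ==> gn (rpow n s t) <= e" shows "tn ((mv ^^ n) h) <= real (card T * card T) * e * tn h"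
proof -
 have "fn ((mv ^^ n) h s) <= real (card T) * (e * tn h)" if s: "s : T" for s
 proof -
 let ?a = "(mv ^^ n) h s"
 have a: "?a @: A" using mvn_C[OF h, of n] s by auto
 have "fn (rpow n s t \<otimes> h t) <= e * tn h" if t: "t : T" for t
 proof -
 have hC: "h t @: A" using h t by auto
 have "fn (rpow n s t \<otimes> h t) <= gn (rpow n s t) * fn (h t)" using s t hC by (intro gn_bound) auto
 also have "... <= e * fn (h t)" using E[OF s t] hC by (intro mult_right_mono) auto
 also have "... <= e * tn h" unfolding tn_def using order_trans[OF gn_ge0 E[OF s t]] s t T by (intro mult_left_mono member_le_L2_set) auto
 finally show ?thesis .
 qed
 note le = this
 have "(fn ?a)^2 = cmod (SUM t:T. q ?a (rpow n s t \<otimes> h t))"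
 using C.q_self[OF a] q_mvn[OF h s a, of n] by (metis norm_of_real abs_of_nonneg zero_le_power2)
 also have "... <= (SUM t:T. fn ?a * (e * tn h))"
 proof (rule sum_norm_le)
 fix t assume t: "t : T"
 have "cmod (q ?a (rpow n s t \<otimes> h t)) <= fn ?a * fn (rpow n s t \<otimes> h t)" using a s t h by (intro C.CS) auto
 also have "... <= fn ?a * (e * tn h)" using le[OF t] a by (intro mult_left_mono) auto
 finally show "cmod (q ?a (rpow n s t \<otimes> h t)) <= fn ?a * (e * tn h)" .
 qed
 finally have *: "fn ?a * fn ?a <= real (card T) * (e * tn h) * fn ?a" by (simp add: power2_eq_square mult_ac)
 show ?thesis
 proof (cases "fn ?a = 0")
 case True
 have "0 <= e" using order_trans[OF gn_ge0 E[OF s s]] s by auto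
 then show ?thesis using True by simp
 next
 case False
 then have "fn ?a > 0" using C.fn_ge0[OF a] by linarith
 then show ?thesis using * mult_right_le_imp_le by blast
 qed
 qed
 then have "(SUM s:T. \<bar>fn ((mv ^^ n) h s)\<bar>) <= (SUM s:T. real (card T) * (e * tn h))" using mvn_C[OF h, of n] by (intro sum_mono) (auto simp: Pi_iff)
 moreover have "tn ((mv ^^ n) h) <= (SUM s:T. \<bar>fn ((mv ^^ n) h s)\<bar>)" unfolding tn_def by (rule L2_set_le_sum_abs)
 ultimately show ?thesis by (simp add: mult.assoc)
qed

text \<open>The way back from a bound on the form to the entries: an entry of R^n is seen by
  applying R^n to a column supported at t.\<close>

lemma entry_bound:
 assumes c: "c >= 0" and bd: "!!g h. [|g : FT; h : FT|] ==> cmod (tip g (mv h)) <= c * tn g * tn h" and st: "s : T" "t : T" shows "gn (rpow n s t) <= c ^ n"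
proof (rule gn_le)
 have step: "tn (mv h) <= c * tn h" if h: "h : FT" for h
 proof (cases "tn (mv h) = 0")
 case False
 have "(tn (mv h))^2 = cmod (tip (mv h) (mv h))" unfolding tip_self[OF mv_C[OF h]] by (simp only: norm_of_real) simp
 also have "... <= c * tn (mv h) * tn h" by (rule bd[OF mv_C[OF h] h])
 finally have "tn (mv h) * tn (mv h) <= c * tn h * tn (mv h)" by (simp add: power2_eq_square mult_ac)
 moreover have "tn (mv h) > 0" using False tn_ge0[of "mv h"] by linarith
 ultimately show ?thesis using mult_right_le_imp_le by blast
 qed (use c in simp)
 have pw: "tn ((mv ^^ n) h) <= c ^ n * tn h" if h: "h : FT" for h
 proof (induction n)
 case (Suc n)
 then show ?case using step[OF mvn_C[OF h, of n]] mult_left_mono[OF Suc c] by (simp add: mult.assoc)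
 qed simp
 fix a assume a: "a @: A"
 define h where "h u = (if u = t then a else \<zero>)" for u
 have h: "h : FT" using a by (auto simp: h_def)
 have hC: "(mv ^^ n) h s @: A" using mvn_C[OF h, of n] st by auto
 have z: "q z (rpow n s u \<otimes> h u) = (if u = t then q z (rpow n s t \<otimes> a) else 0)" if "u : T" "z @: A" for u z
 using st that smult_mult_right[of "rpow n s u" \<zero> 0] by (auto simp: h_def smult_0 C.q_zero)
 have "fn (rpow n s t \<otimes> a) = fn ((mv ^^ n) h s)" using st a hC T by (intro fn_cong) (auto simp: q_mvn[OF h st(1)] z)
 also have "... <= tn ((mv ^^ n) h)" unfolding tn_def using st T by (intro member_le_L2_set) auto
 also have "... <= c ^ n * tn h" by (rule pw[OF h])
 also have "tn h = fn a"
 proof -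
 have "(SUM u:T. (fn (h u))^2) = (SUM u:T. if u = t then (fn a)^2 else 0)" by (intro sum.cong) (auto simp: h_def)
 then show ?thesis using st T a by (simp add: tn_def L2_set_def)
 qed
 finally show "fn (rpow n s t \<otimes> a) <= c ^ n * fn a" .
qed (use st c in auto)

end

section \<open>Strongly convergent states\<close>

text \<open>The index \<open>None\<close> stands for the limit and \<open>Some k\<close> for the \<open>k\<close>-th term of a sequence.\<close>

definition cv :: "(nat option => 'b::topological_space) => bool" where
 "cv f \<longleftrightarrow> (%k. f (Some k)) ----> f None"

definition ev :: "(nat option => bool) => bool" where
 "ev P \<longleftrightarrow> P None & (\<forall>\<^sub>F k in sequentially. P (Some k))"

lemma ev_mono: "ev P ==> (!!ka. P ka ==> Q ka) ==> ev Q" unfolding ev_def by (auto elim: eventually_mono)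

lemma ev_conj: "ev P ==> ev Q ==> ev (%ka. P ka & Q ka)" unfolding ev_def by (auto intro: eventually_conj)

lemma ev_ball: "finite S ==> (!!s. s : S ==> ev (P s)) ==> ev (%ka. ALL s:S. P s ka)" unfolding ev_def by (simp add: eventually_ball_finite_distrib)

lemma exp_beats_poly:
 fixes c d :: real
 assumes "0 < c" "c < d" shows "EX m0. ALL m>=m0. (a * (1 + real m)^2) * c ^ m <= d ^ m"
proof -
 have "(%m. a * (1 + real m)^2 * (c / d) ^ m) ----> 0" using assms by real_asymp
 then have "\<forall>\<^sub>F m in sequentially. a * (1 + real m)^2 * (c / d) ^ m < 1" by (rule order_tendstoD) simp
 then obtain m0 where "!!m. m >= m0 ==> a * (1 + real m)^2 * (c / d) ^ m < 1" by (auto simp: eventually_sequentially)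
 then have "a * (1 + real m)^2 * c ^ m <= d ^ m" if "m >= m0" for m using assms that by (fastforce simp: power_divide divide_simps)
 then show ?thesis by blast
qed

locale sconv = unital_star_algebra A for A :: "'a star_algebra" (structure) +
 fixes \<Phi> :: "nat option => 'a => complex"
 assumes st: "state A (\<Phi> ka)" and mom: "c @: A ==> cv (%ka. \<Phi> ka c)" and nrm: "c @: A ==> cv (%ka. star_state.gn A (\<Phi> ka) c)"
begin

abbreviation "q ka == gns_form A (\<Phi> ka)"
abbreviation "fn ka == form_norm (q ka)"
abbreviation "gn ka == star_state.gn A (\<Phi> ka)"

lemma S: "star_state A (\<Phi> ka)" by (intro star_state.intro star_state_axioms.intro st unital_star_algebra_axioms)
text \<open>Combinations of fixed elements with convergent scalar coefficients. Gram-Schmidt in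
  varying states and conditional expectations produce such families rather than fixed elements;
  moments and norms converge along them.\<close>

inductive CE :: "(nat option => 'a) => bool" where
 CE_const: "a @: A ==> CE (%ka. a)"
| CE_smult: "CE u ==> cv c ==> CE (%ka. c ka \<odot> u ka)"
| CE_add: "CE u ==> CE v ==> CE (%ka. u ka \<oplus> v ka)"

lemma addA [simp, intro]: "[|x @: A; y @: A|] ==> x \<oplus> y @: A" using S[of None] by (simp add: star_state_def)

lemma CE_C [simp, intro]: "CE u ==> u ka @: A" by (induction rule: CE.induct) auto

lemma CE_mult_const: "CE v ==> a @: A ==> CE (%ka. a \<otimes> v ka)" by (induction rule: CE.induct) (auto simp: smult_mult_right A_rdist intro: CE.intros)

lemma CE_mult: "CE u ==> CE v ==> CE (%ka. u ka \<otimes> v ka)"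
 by (induction rule: CE.induct) (auto simp: smult_mult_left A_ldist CE_mult_const intro: CE.intros)

lemma CE_star: "CE u ==> CE (%ka. star A (u ka))"
 by (induction rule: CE.induct) (auto simp: star_smult star_add star_closed cv_def intro!: CE.intros tendsto_cnj)

lemma CE_zero: "CE (%ka. \<zero>)" and CE_one: "CE (%ka. \<one>)" using star_state.fn_one[OF S] by (auto intro: CE_const)

lemma CE_finsum: "finite S ==> (!!s. s : S ==> CE (f s)) ==> CE (%ka. finsum A (%s. f s ka) S)"
proof (induction S rule: finite_induct)
 case empty
 then show ?case by (simp add: finsum_emptyA CE_zero)
next
 case (insert s S)
 then have "finsum A (%s. f s ka) (insert s S) = f s ka \<oplus> finsum A (%s. f s ka) S" for ka by (intro finsum_insertA) auto
 then show ?case using insert by (simp add: CE_add)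
qed

lemma CE_phi: "CE u ==> cv (%ka. \<Phi> ka (u ka))"
proof (induction rule: CE.induct)
 case (CE_smult u c)
 then show ?case by (auto simp: cv_def star_state.phi_smult[OF S] intro!: tendsto_mult)
next
 case (CE_add u v)
 then show ?case by (auto simp: cv_def star_state.phi_add[OF S] intro!: tendsto_add)
qed (rule mom)

lemma CE_q: "CE u ==> CE v ==> cv (%ka. q ka (u ka) (v ka))" unfolding gns_form_def by (intro CE_phi CE_mult CE_star)

lemma CE_fn: "CE u ==> cv (%ka. fn ka (u ka))" using CE_q[of u u] unfolding form_norm_def cv_def by (intro tendsto_real_sqrt tendsto_Re)

lemma gn_diff:
 assumes "x @: A" "y @: A" shows "\<bar>gn ka x - gn ka y\<bar> <= gn ka (x \<oplus> (- 1) \<odot> y)"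
proof -
 interpret S: star_state A "\<Phi> ka" by (rule S)
 let ?d = "x \<oplus> (- 1) \<odot> y"
 have z: "(- 1) \<odot> y \<oplus> y = \<zero>" using smult_add[of y "- 1" 1] assms by (simp add: smult_0 smult_1)
 have x: "x = ?d \<oplus> y" using assms z abelian_monoid.a_assoc[OF abmA, of x "(- 1) \<odot> y" y] by (simp add: abelian_monoid.r_zero[OF abmA])
 have y: "y = (- 1) \<odot> ?d \<oplus> x"
 using assms z smult_add[of x "- 1" 1] abelian_monoid.a_comm[OF abmA] abelian_monoid.a_assoc[OF abmA, of y "(- 1) \<odot> x" x]
 by (simp add: smult_add_right smult_0 smult_1 abelian_monoid.r_zero[OF abmA] flip: smult_smult)
 show ?thesis using S.gn_add[of ?d y] S.gn_add[of "(- 1) \<odot> ?d" x] S.gn_smult_le[of ?d "- 1"] x y assms by (simp add: abs_le_iff)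
qed

lemma add4: "[|a @: A; b @: A; c @: A; d @: A|] ==> a \<oplus> b \<oplus> (c \<oplus> d) = a \<oplus> c \<oplus> (b \<oplus> d)"
 using abelian_monoid.a_assoc[OF abmA, of a b "c \<oplus> d"] abelian_monoid.a_assoc[OF abmA, of a c "b \<oplus> d"] abelian_monoid.a_lcomm[OF abmA, of b c d]
 by simp

text \<open>The family is compared with its value at the limit: by induction, the norm of their
  difference in the k-th state tends to 0, and for the fixed element u None convergence is the
  hypothesis \<open>nrm\<close>.\<close>

lemma CE_nn: "CE u ==> cv (%ka. gn ka (u ka))"
proof -
 assume u: "CE u"
 have "(%k. gn (Some k) (u (Some k) \<oplus> (- 1) \<odot> u None)) ----> 0" using u
 proof (induction rule: CE.induct)
 case (CE_const a)
 then have "a \<oplus> (- 1) \<odot> a = \<zero>" using smult_add[of a 1 "- 1"] by (simp add: smult_0 smult_1)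
 then show ?case by (simp add: star_state.gn_zero[OF S])
 next
 case (CE_smult u c)
 let ?d = "%k. u (Some k) \<oplus> (- 1) \<odot> u None"
 have "(%k. cmod (c (Some k)) * gn (Some k) (?d k) + cmod (c (Some k) - c None) * gn (Some k) (u None)) ----> cmod (c None) * 0 + cmod (c None - c None) * gn None (u None)"
 using CE_smult nrm[of "u None"] unfolding cv_def by (intro tendsto_intros) auto
 then have "(%k. cmod (c (Some k)) * gn (Some k) (?d k) + cmod (c (Some k) - c None) * gn (Some k) (u None)) ----> 0" by simp
 then show ?case
 proof (rule tendsto_sandwich[OF always_eventually always_eventually tendsto_const, rotated 2])
 have C: "u ka @: A" for ka using CE_smult by auto
 then have dC: "?d k @: A" for k by auto
 show "ALL k. 0 <= gn (Some k) (c (Some k) \<odot> u (Some k) \<oplus> (- 1) \<odot> (c None \<odot> u None))" using C by (auto intro!: star_state.gn_ge0[OF S])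
 show "ALL k. gn (Some k) (c (Some k) \<odot> u (Some k) \<oplus> (- 1) \<odot> (c None \<odot> u None))
 <= cmod (c (Some k)) * gn (Some k) (?d k) + cmod (c (Some k) - c None) * gn (Some k) (u None)"
 proof
 fix k
 interpret S: star_state A "\<Phi> (Some k)" by (rule S)
 have "c (Some k) \<odot> ?d k \<oplus> (c (Some k) - c None) \<odot> u None = c (Some k) \<odot> u (Some k) \<oplus> ((- c (Some k)) \<odot> u None \<oplus> (c (Some k) - c None) \<odot> u None)"
 using C by (simp add: smult_add_right abelian_monoid.a_assoc[OF abmA] flip: smult_smult)
 also have "(- c (Some k)) \<odot> u None \<oplus> (c (Some k) - c None) \<odot> u None = (- 1) \<odot> (c None \<odot> u None)"
 using smult_add[OF C, of "- c (Some k)" "c (Some k) - c None"] smult_smult[OF C, of "- 1" "c None" None] by simp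
 finally have eq: "c (Some k) \<odot> u (Some k) \<oplus> (- 1) \<odot> (c None \<odot> u None) = c (Some k) \<odot> ?d k \<oplus> (c (Some k) - c None) \<odot> u None" by simp
 show "gn (Some k) (c (Some k) \<odot> u (Some k) \<oplus> (- 1) \<odot> (c None \<odot> u None))
 <= cmod (c (Some k)) * gn (Some k) (?d k) + cmod (c (Some k) - c None) * gn (Some k) (u None)" unfolding eq
 by (rule order_trans[OF S.gn_add add_mono[OF S.gn_smult_le S.gn_smult_le]]) (use C dC in auto)
 qed
 qed
 next
 case (CE_add u v)
 let ?d = "%u k. u (Some k) \<oplus> (- 1) \<odot> u None"
 have "(%k. gn (Some k) (?d u k) + gn (Some k) (?d v k)) ----> 0" using tendsto_add[OF CE_add.IH] by simp
 then show ?case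
 proof (rule tendsto_sandwich[OF always_eventually always_eventually tendsto_const, rotated 2])
 have C: "u ka @: A" "v ka @: A" for ka using CE_add by auto
 show "ALL k. 0 <= gn (Some k) (u (Some k) \<oplus> v (Some k) \<oplus> (- 1) \<odot> (u None \<oplus> v None))"
 using C by (auto intro!: star_state.gn_ge0[OF S])
 have "u (Some k) \<oplus> v (Some k) \<oplus> (- 1) \<odot> (u None \<oplus> v None) = ?d u k \<oplus> ?d v k" for k
 using add4[OF C(1) C(2) smultC[OF C(1)] smultC[OF C(2)]] smult_add_right[OF C(1) C(2)] by simp
 then show "ALL k. gn (Some k) (u (Some k) \<oplus> v (Some k) \<oplus> (- 1) \<odot> (u None \<oplus> v None)) <= gn (Some k) (?d u k) + gn (Some k) (?d v k)"
 using C by (auto intro!: star_state.gn_add[OF S])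
 qed
 qed
 then have "(%k. gn (Some k) (u (Some k)) - gn (Some k) (u None)) ----> 0"
 proof (rule Lim_null_comparison[OF always_eventually, rotated], intro allI)
 fix k
 show "norm (gn (Some k) (u (Some k)) - gn (Some k) (u None)) <= gn (Some k) (u (Some k) \<oplus> (- 1) \<odot> u None)"
 using gn_diff[OF CE_C[OF u] CE_C[OF u]] by simp
 qed
 from tendsto_add[OF this nrm[of "u None", unfolded cv_def]] show ?thesis using u by (simp add: cv_def)
qed

subsection \<open>Norms of matrices\<close>

text \<open>In the limit state the entries of R^n have norm at most c^n, hence less than d^n for a
  slightly larger d, and this strict inequality persists eventually. With n so large that (c + e)^n
  absorbs the number of entries, \<open>tn_pow_le\<close> leads back from R^n to R.\<close>

lemma matrix_bound:
 fixes R :: "'t => 't => nat option => 'a"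
 assumes T: "finite T" and R: "!!s t. [|s : T; t : T|] ==> CE (R s t)"
 and herm: "!!ka s t a b. [|s : T; t : T; a @: A; b @: A|] ==> q ka a (R s t ka \<otimes> b) = cnj (q ka b (R t s ka \<otimes> a))" and c: "c >= 0"
 and bd: "!!g h. [|g : T \<rightarrow> carrier A; h : T \<rightarrow> carrier A|] ==>
 cmod (SUM s:T. SUM t:T. q None (g s) (R s t None \<otimes> h t)) <= c * L2_set (%t. fn None (g t)) T * L2_set (%t. fn None (h t)) T" and e: "e > 0"
 shows "\<forall>\<^sub>F k in sequentially. ALL h:T \<rightarrow> carrier A.
 cmod (SUM s:T. SUM t:T. q (Some k) (h s) (R s t (Some k) \<otimes> h t)) <= (c + e) * (L2_set (%t. fn (Some k) (h t)) T)^2"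
proof -
 have SM: "star_matrix A (\<Phi> ka) T (%s t. R s t ka)" for ka by (intro star_matrix.intro S star_matrix_axioms.intro T CE_C[OF R] herm)
 let ?rp = "%ka. star_matrix.rpow A T (%s t. R s t ka)"
 have rCE: "CE (%ka. ?rp ka n s t)" if "s : T" "t : T" for n s t using that
 proof (induction n arbitrary: s)
 case 0
 then show ?case by (simp add: star_matrix.rpow.simps[OF SM] CE_zero CE_one)
 next
 case (Suc n)
 then show ?case unfolding star_matrix.rpow.simps[OF SM] by (intro CE_finsum T CE_mult R) auto
 qed
 define d where "d = c + e / 2"
 have d: "0 < d" "c < d" "d < c + e" using c e by (auto simp: d_def)
 obtain m0 where m0: "!!m. m >= m0 ==> (real (card T * card T) * (1 + real m)^2) * d ^ m <= (c + e) ^ m" using exp_beats_poly[OF d(1,3)] by blast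
 \<comment> \<open>A power of two, as \<open>tn_pow_le\<close> requires, and at least m0.\<close>
 define n where "n = (2::nat) ^ m0"
 have "m0 <= n" unfolding n_def using less_exp[of m0] by linarith
 have n: "0 < n" by (simp add: n_def)
 have "real (card T * card T) * d ^ n * 1 <= real (card T * card T) * d ^ n * (1 + real n)^2" using d by (intro mult_left_mono one_le_power) auto
 also have "... <= (c + e) ^ n" using m0[OF \<open>m0 <= n\<close>] by (simp add: mult_ac)
 finally have n: "real (card T * card T) * d ^ n <= (c + e) ^ n" "0 < n" using n by simp_all
 have "gn None (?rp None n s t) < d ^ n" if "s : T" "t : T" for s t
 proof -
 interpret M: star_matrix A "\<Phi> None" T "%s t. R s t None" by (rule SM)
 have "gn None (?rp None n s t) <= c ^ n" by (rule M.entry_bound[OF c _ that]) (use bd M.tip_mv in \<open>simp add: M.tn_def\<close>)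
 also have "... < d ^ n" by (rule power_strict_mono) (use d c n in auto)
 finally show ?thesis .
 qed
 then have "\<forall>\<^sub>F k in sequentially. gn (Some k) (?rp (Some k) n s t) < d ^ n" if "s : T" "t : T" for s t
 using CE_nn[OF rCE[OF that]] that unfolding cv_def by (intro order_tendstoD) auto
 then have "\<forall>\<^sub>F k in sequentially. ALL s:T. ALL t:T. gn (Some k) (?rp (Some k) n s t) < d ^ n"
 using T by (simp add: eventually_ball_finite_distrib)
 then show ?thesis
 proof (eventually_elim, intro ballI)
 fix k h assume en: "ALL s:T. ALL t:T. gn (Some k) (?rp (Some k) n s t) < d ^ n" and h: "h : T \<rightarrow> carrier A"
 interpret M: star_matrix A "\<Phi> (Some k)" T "%s t. R s t (Some k)" by (rule SM)
 have "cmod (M.tip h (M.mv h)) <= (c + e) * (M.tn h)^2"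
 proof (cases "M.tn h = 0")
 case True
 then show ?thesis using M.tip_le[OF h M.mv_C[OF h]] by simp
 next
 case False
 then have pos: "M.tn h > 0" using M.tn_ge0[of h] by linarith
 have "(M.tn (M.mv h) / M.tn h) ^ n <= M.tn ((M.mv ^^ n) h) / M.tn h" unfolding n_def by (rule M.tn_pow_le[OF h pos])
 also have "... <= real (card T * card T) * d ^ n * M.tn h / M.tn h" using pos en by (intro divide_right_mono M.tn_mvn_entries[OF h]) (auto intro: less_imp_le)
 also have "... <= (c + e) ^ n" using n pos by simp
 finally have "M.tn (M.mv h) / M.tn h <= c + e" using c e n(2) by (metis add_nonneg_nonneg less_imp_le power_le_imp_le_base power_mono_iff M.tn_ge0 divide_nonneg_nonneg)
 then have "M.tn (M.mv h) <= (c + e) * M.tn h" using pos by (simp add: divide_simps)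
 then have "M.tn h * M.tn (M.mv h) <= M.tn h * ((c + e) * M.tn h)" using pos by simp
 then show ?thesis using M.tip_le[OF h M.mv_C[OF h]] by (simp add: power2_eq_square mult_ac)
 qed
 then show "cmod (SUM s:T. SUM t:T. q (Some k) (h s) (R s t (Some k) \<otimes> h t)) <= (c + e) * (L2_set (%t. fn (Some k) (h t)) T)^2"
 unfolding M.tip_mv[OF h h] by (simp add: M.tn_def)
 qed
qed

subsection \<open>Orthonormal families\<close>

definition onk :: "nat option => (nat option => 'a) set => bool" where
 "onk ka X \<longleftrightarrow> (ALL u:X. ALL v:X. q ka (u ka) (v ka) = (if u = v then 1 else 0))"

definition onf :: "(nat option => 'a) set => bool" where
 "onf X \<longleftrightarrow> finite X & (ALL u:X. CE u) & ev (%ka. onk ka X)"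

text \<open>In the limit, \<open>y\<close> is in the closed span of \<open>X\<close>.\<close>

definition cap :: "(nat option => 'a) set => (nat option => 'a) => bool" where
 "cap X y \<longleftrightarrow> (ALL z:carrier A. (ALL u:X. q None (u None) z = 0) --> q None (y None) z = 0)"

text \<open>The component of y orthogonal to X, for X orthonormal in the state \<open>ka\<close>.
  Its coefficients are convergent moments, so it is again a \<open>CE\<close> family.\<close>

definition res :: "(nat option => 'a) set => (nat option => 'a) => nat option => 'a" where
 "res X y ka = y ka \<oplus> (- 1) \<odot> finsum A (%u. q ka (u ka) (y ka) \<odot> u ka) X"

lemma onkD: "onk ka X ==> u : X ==> v : X ==> q ka (u ka) (v ka) = (if u = v then 1 else 0)" by (simp add: onk_def)

lemma cap_mono: "cap X y ==> X <= P ==> cap P y" unfolding cap_def by blast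

lemma onfD: "onf X ==> finite X" "onf X ==> u : X ==> CE u" "onf X ==> ev (%ka. onk ka X)" by (auto simp: onf_def)

lemma CE_neg: "CE u ==> CE (%ka. (- 1) \<odot> u ka)" by (rule CE_smult) (simp_all add: cv_def)

lemma CE_res: "[|finite X; !!u. u : X ==> CE u; CE y|] ==> CE (res X y)" unfolding res_def[abs_def] by (intro CE_add CE_neg CE_finsum CE_smult CE_q) auto

lemma ip_res:
 assumes X: "finite X" "!!u. u : X ==> CE u" and y: "CE y" and h: "h @: (gns_space A (\<Phi> ka))"
 shows "ip (gns_space A (\<Phi> ka)) h (completion_embed A (q ka) (res X y ka))
 = ip (gns_space A (\<Phi> ka)) h (completion_embed A (q ka) (y ka))
 - (SUM u:X. q ka (u ka) (y ka) * ip (gns_space A (\<Phi> ka)) h (completion_embed A (q ka) (u ka)))"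
proof -
 interpret S: star_state A "\<Phi> ka" by (rule S)
 have C: "(%u. q ka (u ka) (y ka) \<odot> u ka) : X \<rightarrow> carrier A" using X by auto
 have "ip S.G h (S.emb (finsum A (%u. q ka (u ka) (y ka) \<odot> u ka) X)) = (SUM u:X. ip S.G h (S.emb (q ka (u ka) (y ka) \<odot> u ka)))"
 by (rule finsum_lin[OF _ X(1) C]) (use h in \<open>simp add: S.emb_add S.G.q_add\<close>)
 then show ?thesis using X(2) y h finsum_C[OF C] unfolding res_def by (simp add: S.emb_add S.emb_smult S.G.q_simps)
qed

lemma q_res:
 assumes X: "finite X" "!!u. u : X ==> CE u" and y: "CE y" and z: "z @: A"
 shows "q ka z (res X y ka) = q ka z (y ka) - (SUM u:X. q ka (u ka) (y ka) * q ka z (u ka))"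
proof -
 interpret S: star_state A "\<Phi> ka" by (rule S)
 show ?thesis using ip_res[OF X y, of "S.emb z" ka] z X(2) y CE_C[OF CE_res[OF X y], of ka] by simp
qed

lemma q_res_orth:
 assumes X: "finite X" "!!u. u : X ==> CE u" "onk ka X" and y: "CE y" and u: "u : X" shows "q ka (u ka) (res X y ka) = 0"
proof -
 have "(SUM v:X. q ka (v ka) (y ka) * q ka (u ka) (v ka)) = (SUM v:X. if v = u then q ka (u ka) (y ka) else 0)"
 by (intro sum.cong refl) (simp add: onkD[OF X(3) u])
 then show ?thesis using X(1) u q_res[OF X(1,2) y CE_C[OF X(2)[OF u]], of ka ka] by simp
qed

text \<open>In the limit the residual is null, since y lies in the closed span of X. Along the
  sequence it may be nonzero, but its norm converges with the moments.\<close>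

lemma res_small:
 assumes X: "onf X" and c: "cap X y" and y: "CE y" shows "(%k. fn (Some k) (res X y (Some k))) ----> 0"
proof -
 interpret S: star_state A "\<Phi> None" by (rule S)
 have on: "onk None X" using onfD(3)[OF X] by (simp add: ev_def)
 note fin = onfD(1)[OF X] and CEX = onfD(2)[OF X]
 note r = CE_res[OF fin CEX y]
 let ?z = "res X y None"
 have z: "?z @: A" using r by blast
 have o: "q None (u None) ?z = 0" if "u : X" for u by (rule q_res_orth[OF fin CEX on y that])
 have o': "q None ?z (u None) = 0" if "u : X" for u using S.C.q_sym[OF z CE_C[OF onfD(2)[OF X that]], of None] o[OF that] by simp
 have "q None (y None) ?z = 0" using c z o by (simp add: cap_def)
 then have "q None ?z (y None) = 0" using S.C.q_sym[OF z CE_C[OF y], of None] by simp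
 then have "q None ?z ?z = 0" using q_res[OF fin CEX y z, of None] o' by simp
 then show ?thesis using CE_fn[OF r] by (simp add: cv_def form_norm_def)
qed

text \<open>If the residual of y is null in the limit, X already captures y. Otherwise its norm is
  eventually positive along the sequence too, and the normalised residual is added to X.\<close>

lemma gram_schmidt_step:
 assumes X: "onf X" and y: "CE y" shows "EX P. X <= P & onf P & cap P y"
proof -
 interpret S: star_state A "\<Phi> None" by (rule S)
 note fin = onfD(1)[OF X] and CEO = onfD(2)[OF X]
 note r = CE_res[OF fin CEO y]
 let ?r = "res X y"
 have on: "onk None X" using onfD(3)[OF X] by (simp add: ev_def)
 show ?thesis
 proof (cases "fn None (?r None) = 0")
 case True
 have "cap X y" unfolding cap_def
 proof (intro ballI impI)
 fix z assume z: "z @: A" "ALL u:X. q None (u None) z = 0"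
 have zu: "q None z (u None) = 0" if "u : X" for u using S.C.q_sym[OF z(1) CE_C[OF CEO[OF that]], of None] z(2) that by simp
 have "cmod (q None z (?r None)) <= fn None z * fn None (?r None)" using z r by (intro S.C.CS) auto
 then have "q None z (y None) = 0" using True q_res[OF fin CEO y z(1), of None] zu by simp
 then show "q None (y None) z = 0" using S.C.q_sym[OF z(1) CE_C[OF y], of None] by simp
 qed
 then show ?thesis using X by blast
 next
 case False
 then have pos: "fn None (?r None) > 0" using S.C.fn_ge0[OF CE_C[OF r]] by (simp add: less_le)
 define c where "c ka = complex_of_real (inverse (fn ka (?r ka)))" for ka
 define u where "u ka = c ka \<odot> ?r ka" for ka
 have "cv c" using CE_fn[OF r] pos unfolding cv_def c_def by (intro tendsto_of_real tendsto_inverse) auto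
 from CE_smult[OF r this] have CEu: "CE u" unfolding u_def[abs_def] .
 have evp: "ev (%ka. fn ka (?r ka) > 0)" unfolding ev_def using CE_fn[OF r] pos by (auto simp: cv_def intro: order_tendstoD)
 have key: "q ka (u ka) (u ka) = 1 & (ALL v:X. q ka (v ka) (u ka) = 0 & q ka (u ka) (v ka) = 0)" if on: "onk ka X" "fn ka (?r ka) > 0" for ka
 proof -
 interpret K: star_state A "\<Phi> ka" by (rule S)
 have rC: "?r ka @: A" using r by blast
 have 1: "q ka (v ka) (?r ka) = 0" if "v : X" for v by (rule q_res_orth[OF fin CEO on(1) y that])
 have 2: "q ka (?r ka) (v ka) = 0" if "v : X" for v using K.C.q_sym[OF rC CE_C[OF CEO[OF that]], of ka] 1[OF that] by simp
 show ?thesis using rC CEO 1 2 on(2) K.C.q_self[OF rC] unfolding u_def c_def by (auto simp: K.C.q_simps power2_eq_square field_simps)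
 qed
 have onN: "onk None (insert u X)" and onev: "ev (%ka. onk ka (insert u X))"
 proof -
 have "u \<notin> X" using key[OF on pos] by auto
 then have "onk ka (insert u X)" if "onk ka X & fn ka (?r ka) > 0" for ka using key[of ka] that unfolding onk_def by auto
 then show "ev (%ka. onk ka (insert u X))" by (rule ev_mono[OF ev_conj[OF onfD(3)[OF X] evp]])
 then show "onk None (insert u X)" by (simp add: ev_def)
 qed
 have "cap (insert u X) y" unfolding cap_def
 proof (intro ballI impI)
 fix z assume z: "z @: A" "ALL v:insert u X. q None (v None) z = 0"
 have zu: "q None z (v None) = 0" if "v : X" for v using S.C.q_sym[OF z(1) CE_C[OF CEO[OF that]], of None] z(2) that by simp
 have "q None z (u None) = 0" using S.C.q_sym[OF z(1) CE_C[OF CEu], of None] z(2) by simp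
 then have "q None z (?r None) = 0" using pos CE_C[OF r, of None] z(1) by (simp add: u_def c_def S.C.q_smult)
 then have "q None z (y None) = 0" using q_res[OF fin CEO y z(1), of None] zu by simp
 then show "q None (y None) z = 0" using S.C.q_sym[OF z(1) CE_C[OF y], of None] by simp
 qed
 moreover have "onf (insert u X)" using fin CEO CEu onev by (auto simp: onf_def)
 ultimately show ?thesis by blast
 qed
qed

lemma gram_schmidt:
 assumes "finite Y" "!!y. y : Y ==> CE y" "onf X" shows "EX P. X <= P & onf P & (ALL y:Y. cap P y)" using assms
proof (induction Y)
 case (insert y Y)
 then obtain P where P: "X <= P" "onf P" "ALL y:Y. cap P y" by auto
 obtain P' where P': "P <= P'" "onf P'" "cap P' y" using gram_schmidt_step[OF P(2), of y] insert.prems by auto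
 then have "X <= P' & onf P' & (ALL y:insert y Y. cap P' y)" using P cap_mono by auto
 then show ?case by blast
qed auto

text \<open>Each level captures the products of the previous one with the stars of the generators in
  L. Starting from the unit makes orthogonality to any level imply orthogonality to the
  distinguished vector.\<close>

lemma levels_ex:
 assumes L: "finite L" "L <= carrier A"
 shows "EX Os. Os 0 = {%ka. \<one>} & (ALL m. onf (Os m) & Os m <= Os (Suc m) & (ALL u:Os m. ALL a:L. cap (Os (Suc m)) (%ka. star A a \<otimes> u ka)))"
proof -
 let ?P = "%n::nat. %X. onf X & (n = 0 --> X = {%ka. \<one>})"
 have "onf {%ka. \<one>}" unfolding onf_def onk_def using CE_one by (auto simp: ev_def star_state.q_one[OF S] star_state.phi_one[OF S])
 then have 0: "EX X. ?P 0 X" by blast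
 have "EX Os. ALL n. ?P n (Os n) & (Os n <= Os (Suc n) & (ALL u:Os n. ALL a:L. cap (Os (Suc n)) (%ka. star A a \<otimes> u ka)))"
 proof (rule dependent_nat_choice[where P = ?P, OF 0])
 fix X n assume P: "?P n X"
 let ?Y = "(%(u, a). (%ka. star A a \<otimes> u ka)) ` (X \<times> L)"
 have "finite ?Y" using P L by (auto simp: onf_def)
 moreover have "CE y" if "y : ?Y" for y using that P L by (auto simp: onf_def star_closed intro!: CE_mult CE_const)
 ultimately obtain P' where "X <= P'" "onf P'" "ALL y:?Y. cap P' y" using gram_schmidt[of ?Y X] P by blast
 then show "EX P'. ?P (Suc n) P' & (X <= P' & (ALL u:X. ALL a:L. cap P' (%ka. star A a \<otimes> u ka)))" by (intro exI[of _ P']) auto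
 qed
 then obtain Os where Os: "ALL n. ?P n (Os n) & (Os n <= Os (Suc n) & (ALL u:Os n. ALL a:L. cap (Os (Suc n)) (%ka. star A a \<otimes> u ka)))" ..
 show ?thesis by (intro exI[of _ Os] conjI allI) (insert spec[OF Os, of 0] spec[OF Os], simp_all)
qed

end

locale levels = sconv +
 fixes L :: "'a set" and N :: nat and Os :: "nat => (nat option => 'a) set"
 assumes LC: "L <= carrier A" and Os0: "Os 0 = {%ka. \<one>}" and Os_onf: "onf (Os m)" and Os_Suc: "Os m <= Os (Suc m)"
 and Os_cap: "u : Os m ==> a : L ==> cap (Os (Suc m)) (%ka. star A a \<otimes> u ka)"
begin

abbreviation "GG ka == gns_space A (\<Phi> ka)"
abbreviation "em ka == completion_embed A (q ka)"

lemma Os_mono: "m <= n ==> Os m <= Os n" by (rule lift_Suc_mono_le[of Os, OF Os_Suc])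

lemma Os_CE: "u : Os m ==> CE u" by (rule onfD(2)[OF Os_onf])

text \<open>The least level containing u makes the residual \<open>nu a u\<close> depend on a and u
  alone, so one correction serves all levels simultaneously.\<close>

definition lev :: "(nat option => 'a) => nat" where
 "lev u = (LEAST m. u : Os m)"

lemma lev: "u : Os m ==> lev u <= m & u : Os (lev u)" unfolding lev_def by (auto intro: Least_le LeastI)

definition nu :: "'a => (nat option => 'a) => nat option => 'a" where
 "nu a u = res (Os (Suc (lev u))) (%ka. star A a \<otimes> u ka)"

lemma star_CE: "a : L ==> u : Os m ==> CE (%ka. star A a \<otimes> u ka)" using LC Os_CE by (intro CE_mult CE_const) (auto simp: star_closed)

lemma nu_CE: "a : L ==> u : Os m ==> CE (nu a u)" unfolding nu_def by (intro CE_res star_CE onfD(1)[OF Os_onf] Os_CE)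

text \<open>A correction of finite rank. Where \<open>Os N\<close> is orthonormal, the adjoint of
  the corrected generator sends u to star a u minus the residual \<open>nu a u\<close>, hence level
  m exactly into the span of level m + 1 for m < N.\<close>

definition del :: "nat option => 'a => (nat => 'a) set => (nat => 'a) set" where
 "del ka a = (\<lambda>h\<in>carrier (GG ka). lc (GG ka) (%u. - ip (GG ka) (em ka (nu a u ka)) h) (%u. em ka (u ka)) (Os (N - 1)))"

definition tau :: "nat option => 'a => (nat => 'a) set => (nat => 'a) set" where
 "tau ka a = (\<lambda>h\<in>carrier (GG ka). gns_rep A (\<Phi> ka) a h +[GG ka] del ka a h)"

lemma em_C: "u : Os m ==> em ka (u ka) @: (GG ka)" using Os_CE star_state.emb_C[OF S] by auto

lemma ip_del:
 assumes "h @: (GG ka)" "z @: (GG ka)" shows "ip (GG ka) z (del ka a h) = (SUM u:Os (N - 1). - ip (GG ka) (em ka (nu a u ka)) h * ip (GG ka) z (em ka (u ka)))"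
proof -
 interpret S: star_state A "\<Phi> ka" by (rule S)
 show ?thesis unfolding del_def using assms em_C onfD(1)[OF Os_onf] by (simp add: S.G.ip_lc image_subset_iff)
qed

lemma del_C: "h @: (GG ka) ==> del ka a h @: (GG ka)"
proof -
 assume h: "h @: (GG ka)"
 interpret S: star_state A "\<Phi> ka" by (rule S)
 show ?thesis unfolding del_def using h em_C onfD(1)[OF Os_onf] by (simp add: S.G.lc_closed image_subset_iff)
qed

lemma del_norm:
 assumes on: "onk ka (Os (N - 1))" and a: "a : L" and h: "h @: (GG ka)"
 shows "hnorm (GG ka) (del ka a h) <= (SUM u:Os (N - 1). fn ka (nu a u ka)) * hnorm (GG ka) h"
proof -
 interpret S: star_state A "\<Phi> ka" by (rule S)
 let ?d = "del ka a h"
 have d: "?d @: S.G" by (rule del_C[OF h])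
 have nuC: "nu a u ka @: A" if "u : Os (N - 1)" for u using nu_CE[OF a that] by auto
 have "(hnorm S.G ?d)^2 = cmod (SUM u:Os (N - 1). - ip S.G (em ka (nu a u ka)) h * ip S.G ?d (em ka (u ka)))"
 using S.G.q_self[OF d] ip_del[OF h d, of a] by (metis norm_of_real abs_of_nonneg zero_le_power2)
 also have "... <= (SUM u:Os (N - 1). (fn ka (nu a u ka) * hnorm S.G h) * hnorm S.G ?d)"
 proof (rule sum_norm_le)
 fix u assume u: "u : Os (N - 1)"
 have "cmod (ip S.G (em ka (nu a u ka)) h) <= fn ka (nu a u ka) * hnorm S.G h" using S.G.CS[OF S.emb_C[OF nuC[OF u]] h] by (simp add: S.hnorm_emb nuC[OF u])
 moreover have "cmod (ip S.G ?d (em ka (u ka))) <= hnorm S.G ?d"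
 using S.G.CS[OF d em_C[OF u]] onkD[OF on u u] CE_C[OF Os_CE[OF u]] by (simp add: S.hnorm_emb form_norm_def)
 ultimately show "cmod (- ip S.G (em ka (nu a u ka)) h * ip S.G ?d (em ka (u ka))) <= (fn ka (nu a u ka) * hnorm S.G h) * hnorm S.G ?d"
 unfolding norm_mult norm_minus_cancel using h nuC[OF u] by (intro mult_mono) auto
 qed
 finally have *: "hnorm S.G ?d * hnorm S.G ?d <= ((SUM u:Os (N - 1). fn ka (nu a u ka)) * hnorm S.G h) * hnorm S.G ?d"
 by (simp add: power2_eq_square sum_distrib_right)
 have "0 <= (SUM u:Os (N - 1). fn ka (nu a u ka))" using nuC by (intro sum_nonneg) auto
 then show ?thesis using * d h by (cases "hnorm S.G ?d = 0") (auto simp: less_le dest: mult_right_le_imp_le)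
qed

text \<open>Each residual comes from a product captured by the next level, so
  \<open>res_small\<close> applies to every summand of the bound in \<open>del_norm\<close>; the
  orthonormality needed there holds eventually.\<close>

lemma del_small:
 assumes "a : L" "e > 0"
 shows "\<forall>\<^sub>F k in sequentially. ALL h:carrier (GG (Some k)). hnorm (GG (Some k)) (del (Some k) a h) <= e * hnorm (GG (Some k)) h"
proof -
 have "(%k. SUM u:Os (N - 1). fn (Some k) (nu a u (Some k))) ----> (SUM u:Os (N - 1). 0)"
 unfolding nu_def using lev assms(1) star_CE by (intro tendsto_sum res_small Os_onf Os_cap) blast+
 then have "\<forall>\<^sub>F k in sequentially. (SUM u:Os (N - 1). fn (Some k) (nu a u (Some k))) < e" using assms(2) by (intro order_tendstoD) auto
 moreover have "\<forall>\<^sub>F k in sequentially. onk (Some k) (Os (N - 1))" using onfD(3)[OF Os_onf] by (simp add: ev_def)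
 ultimately show ?thesis
 proof eventually_elim
 case (elim k)
 interpret S: star_state A "\<Phi> (Some k)" by (rule S)
 show ?case
 proof
 fix h assume h: "h @: S.G"
 show "hnorm S.G (del (Some k) a h) <= e * hnorm S.G h"
 using del_norm[OF elim(2) assms(1) h] mult_right_mono[OF less_imp_le[OF elim(1)] S.G.fn_ge0[OF h]] by linarith
 qed
 qed
qed

text \<open>For u in level m, star a u minus \<open>nu a u\<close> lies in the span of level
  \<open>Suc (lev u)\<close>, to which w is orthogonal because \<open>lev u\<close> is at most m.
  The condition m < N puts u among the summands of \<open>del\<close>.\<close>

lemma tau_orth:
 assumes on: "onk ka (Os N)" and a: "a : L" and m: "m < N" and w: "w @: (GG ka)"
 and ow: "!!u. u : Os (Suc m) ==> ip (GG ka) (em ka (u ka)) w = 0" and u: "u : Os m" shows "ip (GG ka) (em ka (u ka)) (tau ka a w) = 0"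
proof -
 interpret S: star_state A "\<Phi> ka" by (rule S)
 have aC: "a @: A" using a LC by blast
 have uC: "u ka @: A" using Os_CE[OF u] by blast
 have uN: "u : Os (N - 1)" proof -
 have "m <= N - 1" using m by linarith
 then show ?thesis using Os_mono u by blast
 qed
 have lu: "lev u <= m" using lev[OF u] by simp
 have saC: "star A a @: A" using aC by (rule star_closed)
 have eqs: "S.emb (star A a \<otimes> u ka) = gns_rep A (\<Phi> ka) (star A a) (S.emb (u ka))" using saC uC by (simp add: S.gns_rep_emb)
 have 1: "ip S.G (S.emb (u ka)) (gns_rep A (\<Phi> ka) a w) = ip S.G (S.emb (star A a \<otimes> u ka)) w"
 unfolding eqs using S.gns_rep_star[OF aC S.emb_C[OF uC] w] by simp
 have nuC: "nu a u ka @: A" using nu_CE[OF a u] by blast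
 have wu: "ip S.G w (S.emb (v ka)) = 0" if "v : Os (Suc (lev u))" for v
 proof -
 have "v : Os (Suc m)" using that Os_mono[of "Suc (lev u)" "Suc m"] lu by auto
 then show ?thesis using S.G.q_sym[OF w em_C, of v "Suc m"] ow by simp
 qed
 have "ip S.G w (S.emb (nu a u ka)) = ip S.G w (S.emb (star A a \<otimes> u ka))" unfolding nu_def using wu
 by (subst ip_res[OF onfD(1)[OF Os_onf] Os_CE star_CE[OF a u] w]) (auto intro: sum.neutral)
 then have 2: "ip S.G (S.emb (nu a u ka)) w = ip S.G (S.emb (star A a \<otimes> u ka)) w"
 using S.G.q_sym[OF S.emb_C[OF nuC] w] S.G.q_sym[OF S.emb_C[of "star A a \<otimes> u ka"] w] saC uC by simp
 have "ip S.G (S.emb (u ka)) (del ka a w) = (SUM v:Os (N - 1). if v = u then - ip S.G (S.emb (nu a u ka)) w else 0)" unfolding ip_del[OF w S.emb_C[OF uC]]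
 proof (intro sum.cong refl)
 fix v assume v: "v : Os (N - 1)"
 then have "v : Os N" "u : Os N" using Os_mono[of "N - 1" N] uN by auto
 then show "- ip S.G (S.emb (nu a v ka)) w * ip S.G (S.emb (u ka)) (S.emb (v ka)) = (if v = u then - ip S.G (S.emb (nu a u ka)) w else 0)"
 using onkD[OF on, of u v] uC CE_C[OF Os_CE[OF v]] by simp
 qed
 also have "... = - ip S.G (S.emb (star A a \<otimes> u ka)) w" using uN onfD(1)[OF Os_onf] 2 by simp
 finally show ?thesis unfolding tau_def using w uC aC 1 del_C[OF w, of a] by (simp add: S.G.q_add)
qed

lemma del_bounded:
 assumes "a : L" shows "del ka a : bounded_ops (GG ka) (GG ka)"
proof -
 interpret S: star_state A "\<Phi> ka" by (rule S)
 have nuC: "nu a u ka @: A" if "u : Os (N - 1)" for u using nu_CE[OF assms that] by auto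
 \<comment> \<open>With unit coefficients, the correction becomes a finite sum of rank one
   operators.\<close>
 have "blin S.G S.G (%h. lc S.G (%_. 1) (%u. (- ip S.G (em ka (nu a u ka)) h) *[S.G] em ka (u ka)) (Os (N - 1)))"
 proof (rule blin_lc_fun[OF S.G.ip_space_axioms S.G.ip_space_axioms onfD(1)[OF Os_onf]])
 fix u assume u: "u : Os (N - 1)"
 let ?n = "em ka (nu a u ka)"
 have n: "?n @: S.G" using nuC[OF u] by simp
 show "blin S.G S.G (%h. (- ip S.G ?n h) *[S.G] em ka (u ka))" unfolding blin_def
 proof (intro conjI ballI allI exI[of _ "hnorm S.G ?n * hnorm S.G (em ka (u ka))"])
 show "(%h. (- ip S.G ?n h) *[S.G] em ka (u ka)) ` carrier S.G <= carrier S.G" using em_C[OF u] by auto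
 fix x y c assume x: "x @: S.G"
 show "y @: S.G ==> (- ip S.G ?n (x +[S.G] y)) *[S.G] em ka (u ka) = (- ip S.G ?n x) *[S.G] em ka (u ka) +[S.G] (- ip S.G ?n y) *[S.G] em ka (u ka)"
 using x n em_C[OF u] by (intro S.G.sep) (auto simp: S.G.q_simps algebra_simps)
 show "(- ip S.G ?n (c *[S.G] x)) *[S.G] em ka (u ka) = c *[S.G] ((- ip S.G ?n x) *[S.G] em ka (u ka))"
 using x n em_C[OF u] by (intro S.G.sep) (auto simp: S.G.q_simps)
 show "hnorm S.G ((- ip S.G ?n x) *[S.G] em ka (u ka)) <= hnorm S.G ?n * hnorm S.G (em ka (u ka)) * hnorm S.G x"
 using mult_right_mono[OF S.G.CS[OF n x] S.G.fn_ge0[OF em_C[OF u]]] em_C[OF u] by (simp add: S.G.fn_smult mult_ac)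
 qed
 qed
 then have "restrict (%h. lc S.G (%_. 1) (%u. (- ip S.G (em ka (nu a u ka)) h) *[S.G] em ka (u ka)) (Os (N - 1))) (carrier S.G) : bounded_ops S.G S.G"
 by (rule blin_restrict[OF S.G.semi_ip_axioms])
 moreover have "lc S.G (%_. 1) (%u. (- ip S.G (em ka (nu a u ka)) h) *[S.G] em ka (u ka)) (Os (N - 1)) = lc S.G (%u. - ip S.G (em ka (nu a u ka)) h) (%u. em ka (u ka)) (Os (N - 1))" if "h @: S.G" for h
 using em_C onfD(1)[OF Os_onf] by (intro S.G.lc_eqI) (auto simp: S.G.ip_lc image_subset_iff S.G.q_smult)
 ultimately show ?thesis by (simp add: del_def cong: restrict_cong)
qed

end

section \<open>Conditional expectations of words\<close>

context fpst
begin

abbreviation "em i == completion_embed (A i) (gns_form (A i) (\<phi> i))"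

definition emw :: "('i \<times> 'a) list => ('i \<times> (nat => 'a) set) list" where
 "emw w = map (%(i, a). (i, em i a)) w"

definition cen :: "'i \<times> 'a => bool" where
 "cen l \<longleftrightarrow> fst l : I & snd l @: (A (fst l)) & \<phi> (fst l) (snd l) = 0"

lemma emw_simps [simp]: "emw [] = []" "emw ((i, a) # w) = (i, em i a) # emw w" "emw (u @ w) = emw u @ emw w"
 "map fst (emw w) = map fst w" by (auto simp: emw_def)

lemma em_C: "[|i : I; a @: (A i)|] ==> em i a @: (GH i)" by (rule star_state.emb_C[OF ss])

lemma xi_em: "[|i : I; a @: (A i)|] ==> ip (GH i) (GX i) (em i a) = \<phi> i a"
 unfolding gns_vec_def by (simp add: star_state.ip_emb[OF ss] one_A star_state.q_one[OF ss])

lemma okl_em: "cen l ==> P.okl (fst l, em (fst l) (snd l))" by (simp add: cen_def P.okl_def em_C xi_em)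

lemma okw_emw: "[|ALL l:set w. cen l; distinct_adj (map fst w)|] ==> P.okw (emw w)"
 unfolding P.okw_def using okl_em by (auto simp: emw_def comp_def case_prod_beta)

lemma rp_xi: "[|i : I; a @: (A i)|] ==> rp i a (GX i) = em i a"
proof -
 assume i: "i : I" and a: "a @: (A i)"
 interpret S: star_state "A i" "\<phi> i" by (rule ss[OF i])
 show ?thesis unfolding gns_vec_def using a one_A[OF i] ring.ring_simprules(12)[OF S.ringA a] by (simp add: S.gns_rep_emb)
qed

lemma opw_Cons_E: "[|i : I; a @: (A i); P.okw w; P.ns i w|] ==> P.ampl i (rp i a) (P.E w) = P.Ev i (em i a) w"
 using P.ampl_props(2)[of i "rp i a" "GX i" w] P.Ev_xi[of i w] by (simp add: rp_xi rp_bounded P.xiC)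

lemma opw_E:
 assumes "ALL l:set u. cen l" "P.okw (emw u @ w)" shows "opw u (P.E w) = P.E (emw u @ w)" using assms
proof (induction u)
 case (Cons l u)
 obtain i a where l: "l = (i, a)" by (cases l)
 then have "P.okw ((i, em i a) # (emw u @ w))" using Cons.prems by simp
 moreover from this have "P.okw (emw u @ w)" "P.ns i (emw u @ w)" by (auto simp: P.okw_Cons)
 ultimately show ?case using Cons l by (simp add: cen_def opw_Cons_E P.Ev_okl)
qed simp

definition mom :: "('i \<times> 'a) list => complex" where
 "mom w = ip P.Fs vac (opw w vac)"

lemma mom_single: "[|i : I; a @: (A i)|] ==> mom [(i, a)] = \<phi> i a" unfolding mom_def using P.okl_crc[OF _ em_C, of i a]
 by (simp add: opw_Cons_E P.ns_def P.Ev_def P.F.q_simps P.okw_Cons P.ip_E xi_em)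

lemma opw_add:
 assumes i: "i : I" "a @: (A i)" "b @: (A i)" and u: "u : W" and v: "v @: P.Fs"
 shows "opw (u @ [(i, a +[A i] b)]) v = opw (u @ [(i, a)]) v +[P.Fs] opw (u @ [(i, b)]) v"
proof -
 interpret S: star_state "A i" "\<phi> i" by (rule ss[OF i(1)])
 have "P.ampl i (rp i (a +[A i] b)) v = P.ampl i (rp i a) v +[P.Fs] P.ampl i (rp i b) v"
 by (rule P.ampl_add[OF i(1) rp_bounded[OF i(1,2)] rp_bounded[OF i(1,3)] rp_bounded[OF i(1) alg_closed(1)[OF i]] S.gns_rep_add[OF i(2,3)] v])
 then show ?thesis using blinD(2)[OF blin_opw[OF u], of "opw [(i, a)] v" "opw [(i, b)] v"] i v opw_C[of "[(i, a)]" v] opw_C[of "[(i, b)]" v]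
 by (simp add: opw_append W_Cons)
qed

lemma opw_smult:
 assumes i: "i : I" "a @: (A i)" and u: "u : W" and v: "v @: P.Fs" shows "opw (u @ [(i, c *[A i] a)]) v = c *[P.Fs] opw (u @ [(i, a)]) v"
proof -
 interpret S: star_state "A i" "\<phi> i" by (rule ss[OF i(1)])
 have "P.ampl i (rp i (c *[A i] a)) v = c *[P.Fs] P.ampl i (rp i a) v"
 by (rule P.ampl_smult[OF i(1) rp_bounded[OF i] rp_bounded[OF i(1) alg_closed(3)[OF i i(2)]] S.gns_rep_smult[OF i(2)] v])
 then show ?thesis using blinD(3)[OF blin_opw[OF u], of "opw [(i, a)] v"] i v opw_C[of "[(i, a)]" v] by (simp add: opw_append W_Cons)
qed

lemma opw_mult:
 assumes i: "i : I" "a @: (A i)" "b @: (A i)" and v: "v @: P.Fs" shows "opw (u @ [(i, a .[A i] b)]) v = opw (u @ [(i, a), (i, b)]) v"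
proof -
 interpret S: star_state "A i" "\<phi> i" by (rule ss[OF i(1)])
 have "P.ampl i (rp i (a .[A i] b)) v = P.ampl i (rp i a) (P.ampl i (rp i b) v)"
 by (rule P.ampl_comp[OF i(1) rp_bounded[OF i(1,2)] rp_bounded[OF i(1,3)] rp_bounded[OF i(1) alg_closed(2)[OF i]] S.gns_rep_mult[OF i(2,3)] v])
 then show ?thesis by (simp add: opw_append)
qed

lemma opw_one: "[|i : I; v @: P.Fs|] ==> opw (u @ [(i, 1[A i])]) v = opw u v"
 using P.ampl_id[of i "rp i 1[A i]" v] by (simp add: opw_append one_A rp_bounded star_state.gns_rep_one[OF ss])

lemma mom_letter:
 assumes i: "i : I" and a: "a @: (A i)" and w: "u : W" "w : W"
 shows "b @: (A i) ==> mom (u @ (i, a +[A i] b) # w) = mom (u @ (i, a) # w) + mom (u @ (i, b) # w)"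
 "mom (u @ (i, c *[A i] a) # w) = c * mom (u @ (i, a) # w)"
 "b @: (A i) ==> mom (u @ (i, a .[A i] b) # w) = mom (u @ (i, a) # (i, b) # w)"
 "mom (u @ (i, 1[A i]) # w) = mom (u @ w)"
proof -
 have ass: "opw (u @ x # w) vac = opw (u @ [x]) (opw w vac)" "opw (u @ x # y # w) vac = opw (u @ [x, y]) (opw w vac)" for x y
 using opw_append[of "u @ [x]" w] opw_append[of "u @ [x, y]" w] by simp_all
 have C: "opw w vac @: P.Fs" "opw (u @ [(i, d)]) (opw w vac) @: P.Fs" if "d @: (A i)" for d using w i that by (auto simp: W_Cons)
 show "mom (u @ (i, a +[A i] b) # w) = mom (u @ (i, a) # w) + mom (u @ (i, b) # w)"
 "mom (u @ (i, a .[A i] b) # w) = mom (u @ (i, a) # (i, b) # w)" if "b @: (A i)"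
 using that a i w C unfolding mom_def ass by (simp_all add: opw_add opw_mult P.F.q_add)
 show "mom (u @ (i, c *[A i] a) # w) = c * mom (u @ (i, a) # w)" using a i w C unfolding mom_def ass by (simp add: opw_smult P.F.q_smult)
 show "mom (u @ (i, 1[A i]) # w) = mom (u @ w)" using opw_one[OF i C(1)[OF a], of u] unfolding mom_def ass by (simp add: opw_append)
qed

text \<open>The last letter b may have nonzero mean: the mean gives the word w alone, the centred
  part gives w with one more letter.\<close>

lemma opw_snoc:
 assumes w: "ALL l:set w. cen l" "distinct_adj (map fst w)" "w = [] \<or> fst (last w) ~= i" and i: "i : I" "b @: (A i)"
 shows "P.okw (emw w)" "P.okw (emw w @ [(i, P.crc i (em i b))])"
 "opw (w @ [(i, b)]) vac = \<phi> i b *[P.Fs] P.E (emw w) +[P.Fs] P.E (emw w @ [(i, P.crc i (em i b))])"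
proof -
 let ?k = "P.crc i (em i b)"
 have W: "w : W" using w(1) by (auto simp: fp_words_def cen_def)
 have ok0: "P.okl (i, ?k)" using P.okl_crc[OF i(1) em_C[OF i]] .
 show okw1: "P.okw (emw w)" by (rule okw_emw[OF w(1,2)])
 have "P.okl l" if "l : set (emw w @ [(i, ?k)])" for l using that okw1 ok0 by (auto simp: P.okw_def)
 moreover have "distinct_adj (map fst (emw w @ [(i, ?k)]))" using w by (auto simp: distinct_adj_append_iff last_map)
 ultimately show okw2: "P.okw (emw w @ [(i, ?k)])" unfolding P.okw_def by blast
 have k1: "P.okw [(i, ?k)]" using ok0 by (simp add: P.okw_Cons P.ns_def)
 have "opw (w @ [(i, b)]) vac = opw w (\<phi> i b *[P.Fs] P.E [] +[P.Fs] P.E [(i, ?k)])" using i by (simp add: opw_append opw_Cons_E P.ns_def P.Ev_def xi_em)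
 also have "... = \<phi> i b *[P.Fs] P.E (emw w) +[P.Fs] P.E (emw w @ [(i, ?k)])"
 using opw_E[OF w(1), of "[]"] opw_E[OF w(1) okw2] okw1 k1 blinD[OF blin_opw[OF W]] by simp
 finally show "opw (w @ [(i, b)]) vac = \<phi> i b *[P.Fs] P.E (emw w) +[P.Fs] P.E (emw w @ [(i, ?k)])" .
qed

text \<open>Freeness. With the letter a moved to the other side as its star, both vectors expand
  into words; the index words never match, since w is nonempty and begins with an index other than
  i.\<close>

lemma mom_centered:
 assumes w: "ALL l:set w. cen l" "distinct_adj (map fst w)" "w ~= []" "fst (hd w) ~= i" "fst (last w) ~= i" and i: "i : I" "a @: (A i)" "b @: (A i)"
 shows "mom ((i, a) # w @ [(i, b)]) = 0"
proof -
 interpret S: star_state "A i" "\<phi> i" by (rule ss[OF i(1)])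
 have sa: "star (A i) a @: (A i)" using i by (simp add: S.star_closed)
 have W: "w : W" using w(1) by (auto simp: fp_words_def cen_def)
 obtain j d w' where wj: "w = (j, d) # w'" "j ~= i" using w by (cases w) auto
 note 1 = opw_snoc[OF w(1,2) disjI2[OF w(5)] i(1,3)] and 2 = opw_snoc[of "[]", OF _ _ _ i(1) sa, simplified]
 have "mom ((i, a) # w @ [(i, b)]) = ip P.Fs (opw (ws [(i, a)]) vac) (opw (w @ [(i, b)]) vac)"
 unfolding mom_def using opw_star[of "[(i, a)]" vac "opw (w @ [(i, b)]) vac"] i W by (simp add: W_Cons)
 also have "... = 0" using 1 2 wj by (simp add: P.F.q_simps P.ip_E)
 finally show ?thesis .
qed

end

locale fpconv = fpalg I A for I :: "'i set" and A :: "'i => 'a star_algebra" +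
 fixes \<Phi> :: "nat option => 'i => 'a => complex"
 assumes sc: "i : I ==> sconv (A i) (%ka. \<Phi> ka i)"
begin

lemma K: "fpst I A (\<Phi> ka)" by (intro fpst.intro fpalg_axioms fpst_axioms.intro sconv.st[OF sc])

abbreviation "mo ka == fpst.mom I A (\<Phi> ka)"

definition evl :: "nat option => ('i \<times> (nat option => 'a)) list => ('i \<times> 'a) list" where
 "evl ka w = map (%(i, u). (i, u ka)) w"

definition CEw :: "('i \<times> (nat option => 'a)) list => bool" where
 "CEw w \<longleftrightarrow> (ALL l:set w. fst l : I & sconv.CE (A (fst l)) (snd l))"

text \<open>r is the conditional expectation of the word w onto the i-th factor, in all the states
  at once and as a convergent family.\<close>

definition cex :: "'i => ('i \<times> (nat option => 'a)) list => (nat option => 'a) => bool" where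
 "cex i w r \<longleftrightarrow> sconv.CE (A i) r & (ALL ka. ALL a:carrier (A i). ALL b:carrier (A i).
 mo ka ((i, a) # evl ka w @ [(i, b)]) = \<Phi> ka i (a .[A i] r ka .[A i] b))"

lemma evl_simps [simp]: "evl ka [] = []" "evl ka ((i, u) # w) = (i, u ka) # evl ka w" "evl ka (v @ w) = evl ka v @ evl ka w"
 "map fst (evl ka w) = map fst w" by (auto simp: evl_def)

lemma CEw_simps [simp]: "CEw []" "CEw ((i, u) # w) \<longleftrightarrow> i : I & sconv.CE (A i) u & CEw w" "CEw (v @ w) \<longleftrightarrow> CEw v & CEw w"
 by (auto simp: CEw_def)

lemma CEw_W: "CEw w ==> evl ka w : W" using sconv.CE_C[OF sc] by (fastforce simp: CEw_def evl_def fp_words_def)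

text \<open>Induction on length. Letters of index i at an end are absorbed by the bimodule property,
  and neighbours of equal index are multiplied. In an alternating word the letters are centred one
  by one: the mean of a letter leaves a shorter word, and the fully centred word has conditional
  expectation 0. All scalars that appear are convergent moments.\<close>

lemma cex_ex: "[|CEw w; i : I|] ==> EX r. cex i w r"
proof (induction w arbitrary: i rule: length_induct)
 case (1 w)
 have IH: "EX r. cex i w' r" if "length w' < length w" "CEw w'" for w' using 1 that by blast
 note w = 1(2) and i = 1(3)
 interpret S: sconv "A i" "%ka. \<Phi> ka i" by (rule sc[OF i])
 note letter = fpst.mom_letter[OF K]
 have as: "a .[A i] (b .[A i] c) = a .[A i] b .[A i] c" "a .[A i] b @: (A i)" if "a @: (A i)" "b @: (A i)" "c @: (A i)" for a b c
 using that S.A_assoc[of a b c] alg_closed(2)[OF i] by simp_all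
 consider "w = []" | (hd) u v where "w = (i, u) # v" | (last) u v where "w = v @ [(i, u)]"
 | (rep) p j x y s where "w = p @ (j, x) # (j, y) # s"
 | (alt) "w ~= []" "fst (hd w) ~= i" "fst (last w) ~= i" "distinct_adj (map fst w)"
 proof -
 have "EX p j x y s. w = p @ (j, x) # (j, y) # s" if "\<not> distinct_adj (map fst w)" using that
 proof (induction w)
 case (Cons l w)
 show ?case
 proof (cases "distinct_adj (map fst w)")
 case True
 then obtain m w' where "w = m # w'" "fst m = fst l" using Cons.prems by (cases w) auto
 then show ?thesis by (intro exI[of _ "[]"]) (cases l, cases m, auto)
 next
 case False
 then obtain p j x y s where "w = p @ (j, x) # (j, y) # s" using Cons.IH by blast
 then show ?thesis by (intro exI[of _ "l # p"]) auto
 qed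
 qed simp
 moreover have "EX u v. w = (i, u) # v" if "w ~= []" "fst (hd w) = i" using that by (cases w) auto
 moreover have "EX u v. w = v @ [(i, u)]" if "w ~= []" "fst (List.last w) = i" using that by (cases w rule: rev_cases) auto
 ultimately show thesis using that by blast
 qed
 then show ?case
 proof cases
 case 1
 have "mo ka [(i, a), (i, b)] = \<Phi> ka i (a .[A i] b)" if "a @: (A i)" "b @: (A i)" for a b ka
 using letter(3)[OF i that(1) W_Nil W_Nil that(2)] fpst.mom_single[OF K i, of "a .[A i] b"] as(2)[OF that that(1)] by simp
 then show ?thesis using 1 S.CE_one one_A[OF i] ring.ring_simprules(12)[OF S.ringA] by (intro exI[of _ "%ka. 1[A i]"]) (simp add: cex_def)
 next
 case (hd u v)
 then obtain r where r: "cex i v r" using IH[of v] w by auto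
 have u: "S.CE u" using w hd by simp
 have vW: "evl ka v @ [(i, b)] : W" if "b @: (A i)" for ka b using w hd that i CEw_W[of v] by (simp add: W_Cons)
 have "mo ka ((i, a) # (i, u ka) # evl ka v @ [(i, b)]) = \<Phi> ka i (a .[A i] (u ka .[A i] r ka) .[A i] b)" if ab: "a @: (A i)" "b @: (A i)" for a b ka
 proof -
 have uk: "u ka @: (A i)" "r ka @: (A i)" using u r by (auto simp: cex_def)
 show ?thesis using letter(3)[OF i ab(1) W_Nil vW[OF ab(2)] uk(1), of ka ka] r ab uk by (simp add: cex_def as)
 qed
 then show ?thesis using r hd S.CE_mult[OF u] by (intro exI[of _ "%ka. u ka .[A i] r ka"]) (simp add: cex_def)
 next
 case (last u v)
 then obtain r where r: "cex i v r" using IH[of v] w by auto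
 have u: "S.CE u" using w last by simp
 have "mo ka ((i, a) # evl ka v @ [(i, u ka), (i, b)]) = \<Phi> ka i (a .[A i] (r ka .[A i] u ka) .[A i] b)" if ab: "a @: (A i)" "b @: (A i)" for a b ka
 proof -
 have uk: "u ka @: (A i)" "r ka @: (A i)" using u r by (auto simp: cex_def)
 have vW: "(i, a) # evl ka v : W" using w last ab CEw_W[of v] i by (simp add: W_Cons)
 show ?thesis using letter(3)[OF i uk(1) vW W_Nil ab(2), of ka] r ab uk by (simp add: cex_def as)
 qed
 then show ?thesis using r last S.CE_mult[OF _ u] by (intro exI[of _ "%ka. r ka .[A i] u ka"]) (simp add: cex_def)
 next
 case (rep p j x y s)
 have xy: "j : I" "sconv.CE (A j) x" "sconv.CE (A j) y" "CEw p" "CEw s" using w rep by auto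
 interpret Sj: sconv "A j" "%ka. \<Phi> ka j" by (rule sc[OF xy(1)])
 obtain r where r: "cex i (p @ (j, %ka. x ka .[A j] y ka) # s) r" using IH[of "p @ (j, %ka. x ka .[A j] y ka) # s"] xy rep Sj.CE_mult by auto
 have "mo ka ((i, a) # evl ka p @ (j, x ka) # (j, y ka) # evl ka s @ [(i, b)])
 = mo ka ((i, a) # evl ka p @ (j, x ka .[A j] y ka) # evl ka s @ [(i, b)])" if ab: "a @: (A i)" "b @: (A i)" for a b ka
 using letter(3)[OF xy(1) Sj.CE_C[OF xy(2)], of "(i, a) # evl ka p" "evl ka s @ [(i, b)]" "y ka" ka ka] xy ab i by (simp add: W_Cons CEw_W Sj.CE_C)
 then show ?thesis using r rep by (auto simp: cex_def)
 next
 case alt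
 \<comment> \<open>The prefix c is already centred, the suffix v is still to be treated.\<close>
 have "EX r. cex i (c @ v) r" if "length (c @ v) = length w" "CEw (c @ v)" "map fst (c @ v) = map fst w"
 "!!ka. ALL l:set (evl ka c). fpst.cen I A (\<Phi> ka) l" for c v using that
 proof (induction v arbitrary: c)
 case Nil
 have c: "c ~= []" "distinct_adj (map fst c)" using alt Nil(1,3) by auto
 then have "fst (hd c) = fst (hd w)" "fst (List.last c) = fst (List.last w)" using Nil(3) alt(1) by (metis append_Nil2 hd_map, metis append_Nil2 last_map)
 then have c: "c ~= []" "fst (hd c) ~= i" "fst (List.last c) ~= i" "distinct_adj (map fst c)" using alt c by simp_all
 have "evl ka c ~= []" "fst (hd (evl ka c)) = fst (hd c)" "fst (List.last (evl ka c)) = fst (List.last c)" for ka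
 using c(1) by (simp_all add: evl_def hd_map last_map case_prod_beta)
 then have "mo ka ((i, a) # evl ka c @ [(i, b)]) = 0" if "a @: (A i)" "b @: (A i)" for a b ka
 using fpst.mom_centered[OF K Nil(4) _ _ _ _ i that, of ka] c by simp
 moreover have "\<Phi> ka i (a .[A i] 0[A i] .[A i] b) = 0" if "a @: (A i)" "b @: (A i)" for a b ka
 using that ring.ring_simprules(24,25)[OF S.ringA] star_state.phi_zero[OF S.S] by simp
 ultimately show ?case using S.CE_zero by (intro exI[of _ "%ka. 0[A i]"]) (simp add: cex_def)
 next
 case (Cons l v)
 obtain j u where l: "l = (j, u)" by (cases l)
 have j: "j : I" "sconv.CE (A j) u" "CEw c" "CEw v" using Cons.prems(2) l by auto
 interpret Sj: sconv "A j" "%ka. \<Phi> ka j" by (rule sc[OF j(1)])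
 define d where "d ka = \<Phi> ka j (u ka)" for ka
 have d: "cv d" "cv (%ka. - d ka)" using Sj.CE_phi[OF j(2)] by (auto simp: d_def cv_def intro: tendsto_minus)
 define u0 where "u0 ka = u ka +[A j] (- d ka) *[A j] 1[A j]" for ka
 have uC: "u ka @: (A j)" "1[A j] : carrier (A j)" for ka using j one_A by auto
 have u0: "Sj.CE u0" unfolding u0_def[abs_def] by (intro Sj.CE_add j Sj.CE_smult Sj.CE_one d)
 have "\<Phi> ka j (u0 ka) = 0" for ka unfolding u0_def using uC star_state.phi_one[OF Sj.S]
 by (simp add: star_state.phi_add[OF Sj.S] star_state.phi_smult[OF Sj.S] d_def)
 then have "fpst.cen I A (\<Phi> ka) (j, u0 ka)" for ka using fpst.cen_def[OF K] j(1) Sj.CE_C[OF u0] by simp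
 then have "EX r. cex i ((c @ [(j, u0)]) @ v) r" using Cons.prems l u0 j(1) by (intro Cons.IH) auto
 then obtain r1 where r1: "cex i (c @ (j, u0) # v) r1" by auto
 have "length (c @ v) < length w" using Cons.prems(1) by simp
 then obtain r2 where r2: "cex i (c @ v) r2" using IH[of "c @ v"] j by (auto simp del: length_append)
 have rC: "r1 ka @: (A i)" "r2 ka @: (A i)" for ka using r1 r2 by (auto simp: cex_def)
 have "mo ka ((i, a) # evl ka c @ (j, u ka) # evl ka v @ [(i, b)]) = \<Phi> ka i (a .[A i] (r1 ka +[A i] d ka *[A i] r2 ka) .[A i] b)"
 if ab: "a @: (A i)" "b @: (A i)" for a b ka
 proof -
 have W1: "(i, a) # evl ka c : W" "evl ka v @ [(i, b)] : W" using ab i j CEw_W by (auto simp: W_Cons)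
 have "mo ka ((i, a) # evl ka c @ (j, u0 ka) # evl ka v @ [(i, b)])
 = mo ka ((i, a) # evl ka c @ (j, u ka) # evl ka v @ [(i, b)]) - d ka * mo ka ((i, a) # evl ka c @ evl ka v @ [(i, b)])"
 using letter(1)[OF j(1) uC(1) W1 Sj.smultC[OF uC(2)], of ka ka "- d ka"] letter(2)[OF j(1) uC(2) W1, of ka "- d ka"]
 letter(4)[OF j(1) uC(2) W1, of ka] by (simp add: u0_def)
 then show ?thesis using r1 r2 ab rC[of ka] star_state.phi_add[OF S.S] star_state.phi_smult[OF S.S]
 by (simp add: cex_def S.A_rdist S.A_ldist S.smult_mult_left S.smult_mult_right as)
 qed
 moreover have "S.CE (%ka. r1 ka +[A i] d ka *[A i] r2 ka)" using r1 r2 d by (intro S.CE_add S.CE_smult) (auto simp: cex_def)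
 ultimately show ?case using l by (auto simp: cex_def intro!: exI[of _ "%ka. r1 ka +[A i] d ka *[A i] r2 ka"])
 qed
 from this[of "[]" w] show ?thesis using w by simp
 qed
qed

text \<open>With a and b equal to the unit, the conditional expectation of w computes its
  moment.\<close>

lemma mo_cv: "[|CEw w; i : I|] ==> cv (%ka. mo ka (evl ka w))"
proof -
 assume w: "CEw w" and i: "i : I"
 interpret S: sconv "A i" "%ka. \<Phi> ka i" by (rule sc[OF i])
 obtain r where r: "cex i w r" using cex_ex[OF w i] ..
 have o: "1[A i] : carrier (A i)" using one_A[OF i] .
 have "mo ka (evl ka w) = \<Phi> ka i (r ka)" for ka
 proof -
 have "r ka @: (A i)" using r by (auto simp: cex_def)
 then have "\<Phi> ka i (r ka) = mo ka ((i, 1[A i]) # evl ka w @ [(i, 1[A i])])"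
 using r o ring.ring_simprules(12)[OF S.ringA] ring.ring_simprules(6)[OF S.ringA]
 by (auto simp: cex_def monoid.r_one[OF ring.is_monoid[OF S.ringA]] monoid.l_one[OF ring.is_monoid[OF S.ringA]])
 also have "... = mo ka (evl ka w)"
 using fpst.mom_letter(4)[OF K i o, of "[]" "evl ka w @ [(i, 1[A i])]" ka] fpst.mom_letter(4)[OF K i o, of "evl ka w" "[]" ka]
 CEw_W[OF w] i o by (simp add: W_Cons)
 finally show ?thesis by simp
 qed
 then show ?thesis using S.CE_phi r by (simp add: cex_def)
qed

end

section \<open>Right modules spanned by finitely many words\<close>

lemma kern_length: "length w ~= length v ==> kern H w v = 0" by (induction H w v rule: kern.induct) auto

context fpst
begin

text \<open>An element of the right module over the i-th factor generated by the words
  \<open>wd t\<close>, with coordinates h t; scalars are absorbed into h.\<close>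

definition Vs :: "'i => ('t => ('i \<times> 'a) list) => 't set => ('t => 'a) => ('i, (nat => 'a) set) fp_vector" where
 "Vs i wd T h = lc P.Fs (%_. 1) (%t. opw (wd t @ [(i, h t)]) vac) T"

definition rvec :: "('i, (nat => 'a) set) fp_vector set" where
 "rvec = (%g. rho g vac) ` carrier FA"

lemma rvec_iff: "v : rvec \<longleftrightarrow> (EX g:carrier FA. v = rho g vac)" unfolding rvec_def by blast

lemma rvec_C: "v : rvec ==> v @: P.Fs" unfolding rvec_iff by (elim bexE) (simp add: vac_C)

lemma rvec_lc:
 assumes S: "finite S" "x ` S <= rvec" shows "lc P.Fs c x S : rvec"
proof (rule P.F.lc_in_subspace[OF S(1) _ _ _ _ S(2)])
 show "0[P.Fs] : rvec" unfolding rvec_iff using rho_zero[OF vac_C] FA_consts(2) by metis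
 show "v +[P.Fs] w : rvec" if "v : rvec" "w : rvec" for v w
 proof -
 from that obtain g h where "g @: FA" "v = rho g vac" "h @: FA" "w = rho h vac" unfolding rvec_iff by blast
 then show ?thesis unfolding rvec_iff by (intro bexI[of _ "g +[FA] h"]) (simp_all add: rho_add vac_C FA_closed)
 qed
 show "a *[P.Fs] v : rvec" if "v : rvec" for a v
 proof -
 from that obtain g where "g @: FA" "v = rho g vac" unfolding rvec_iff by blast
 then show ?thesis unfolding rvec_iff by (intro bexI[of _ "a *[FA] g"]) (simp_all add: rho_smult vac_C FA_closed)
 qed
 show "x ` S <= carrier P.Fs" using order_trans[OF S(2) subsetI[OF rvec_C]] .
qed

lemma rvec_opw: "w : W ==> opw w vac : rvec" unfolding rvec_iff by (rule bexI[of _ "delta w"]) (simp_all add: rho_delta vac_C)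

lemma rho_rvec_le:
 assumes f: "f @: FA" and v: "v : rvec" shows "hnorm P.Fs (rho f v) <= Psi.gn (cls f) * hnorm P.Fs v"
proof -
 obtain g where g: "g @: FA" "v = rho g vac" using v unfolding rvec_iff by blast
 then show ?thesis using Psi.gn_bound[OF cls_C[OF f] cls_C[OF g(1)]] f by (simp add: cls_ring FA_closed psi_norm rho_mult vac_C)
qed

context
 fixes i :: 'i and wd :: "'t => ('i \<times> 'a) list" and T :: "'t set" and n :: nat
 assumes T: "finite T" and i: "i : I"
 and wd: "!!t. t : T ==> (ALL l:set (wd t). cen l) & distinct_adj (map fst (wd t)) & (wd t = [] \<or> fst (last (wd t)) ~= i) & length (wd t) = n"
begin

lemma wd_W: "[|t : T; a @: (A i)|] ==> wd t @ [(i, a)] : W" using wd[of t] i by (auto simp: fp_words_def cen_def)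

lemma Vs_sub: "h : T \<rightarrow> carrier (A i) ==> (%t. opw (wd t @ [(i, h t)]) vac) ` T <= carrier P.Fs" using opw_C[OF wd_W vac_C] by (auto simp: Pi_iff)

lemma Vs_C: "h : T \<rightarrow> carrier (A i) ==> Vs i wd T h @: P.Fs" unfolding Vs_def by (intro P.F.lc_closed T Vs_sub)

lemma Vs_rvec: "h : T \<rightarrow> carrier (A i) ==> Vs i wd T h : rvec" unfolding Vs_def using wd_W by (intro rvec_lc T image_subsetI rvec_opw) auto

lemma ip_rho_Vs:
 assumes f: "f @: FA" and gh: "g : T \<rightarrow> carrier (A i)" "h : T \<rightarrow> carrier (A i)" shows "ip P.Fs (rho f (Vs i wd T g)) (rho f (Vs i wd T h))
 = (SUM s:T. SUM t:T. ip P.Fs (rho f (opw (wd s @ [(i, g s)]) vac)) (rho f (opw (wd t @ [(i, h t)]) vac)))"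
proof -
 interpret FF: ip_space2 P.Fs P.Fs by (rule ip_space2.intro) unfold_locales
 have C: "(%t. rho f (opw (wd t @ [(i, h t)]) vac)) ` T <= carrier P.Fs" if "h : T \<rightarrow> carrier (A i)" for h
 using rho_C[OF f] Vs_sub[OF that] by (simp add: image_subset_iff)
 show ?thesis unfolding Vs_def FF.blin_lc[OF blin_rho[OF f] T Vs_sub[OF gh(1)]] FF.blin_lc[OF blin_rho[OF f] T Vs_sub[OF gh(2)]]
 P.F.ip_lc_lc[OF T C[OF gh(1)] T C[OF gh(2)]] by simp
qed

text \<open>The words have equal length, so the mean and the centred part of the last letter
  contribute orthogonally, and the two contributions recombine to the GNS form of the
  factor.\<close>

lemma ip_V:
 assumes st: "s : T" "t : T" and ab: "a @: (A i)" "b @: (A i)"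
 shows "ip P.Fs (opw (wd s @ [(i, a)]) vac) (opw (wd t @ [(i, b)]) vac) = kern GH (emw (wd s)) (emw (wd t)) * gns_form (A i) (\<phi> i) a b"
proof -
 interpret S: star_state "A i" "\<phi> i" by (rule ss[OF i])
 note s = opw_snoc[of "wd s" i a] and t = opw_snoc[of "wd t" i b]
 have len: "length (emw (wd s)) = length (emw (wd t))" using wd st by (simp add: emw_def)
 have crs: "kern GH (emw (wd s)) (emw (wd t) @ [x]) = 0" "kern GH (emw (wd s) @ [x]) (emw (wd t)) = 0" for x using len by (simp_all add: kern_length)
 have "ip P.Fs (P.Ev i (em i a) []) (P.Ev i (em i b) []) = gns_form (A i) (\<phi> i) a b" using ab i by (simp add: P.ip_Ev em_C P.ns_def)
 moreover have "P.okw [(i, P.crc i (em i c))]" if "c @: (A i)" for c using that i P.okl_crc[OF i em_C] by (simp add: P.okw_Cons P.ns_def)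
 ultimately have eq: "cnj (\<phi> i a) * \<phi> i b + ip (GH i) (P.crc i (em i a)) (P.crc i (em i b)) = gns_form (A i) (\<phi> i) a b"
 using ab i by (simp add: P.Ev_def P.F.q_simps P.ip_E xi_em mult.commute)
 show ?thesis unfolding eq[symmetric] using s t wd[OF st(1)] wd[OF st(2)] i ab len crs by (simp add: P.F.q_simps P.ip_E kern_append algebra_simps)
qed

lemma hnorm_Vs:
 assumes orth: "!!s t. [|s : T; t : T|] ==> kern GH (emw (wd s)) (emw (wd t)) = (if s = t then 1 else 0)" and h: "h : T \<rightarrow> carrier (A i)"
 shows "hnorm P.Fs (Vs i wd T h) = L2_set (%t. form_norm (gns_form (A i) (\<phi> i)) (h t)) T"
proof -
 interpret S: star_state "A i" "\<phi> i" by (rule ss[OF i])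
 have "ip P.Fs (Vs i wd T h) (Vs i wd T h) = (SUM s:T. SUM t:T. if t = s then S.q (h s) (h s) else 0)"
 unfolding Vs_def P.F.ip_lc_lc[OF T Vs_sub[OF h] T Vs_sub[OF h]] by (intro sum.cong refl) (use h orth in \<open>auto simp: ip_V Pi_iff\<close>)
 also have "... = of_real (SUM t:T. (S.fn (h t))^2)" using T h by (simp add: S.C.q_self Pi_iff)
 finally show ?thesis by (simp add: form_norm_def L2_set_def S.C.fn_sq)
qed

lemma Vs_add:
 assumes g: "g : T \<rightarrow> carrier (A i)" and h: "h : T \<rightarrow> carrier (A i)"
 shows "Vs i wd T g +[P.Fs] Vs i wd T h = Vs i wd T (%t. g t +[A i] h t)"
 "c *[P.Fs] Vs i wd T g = Vs i wd T (%t. c *[A i] g t)"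
proof -
 have WW: "wd t : W" if "t : T" for t using wd_W[OF that one_A[OF i]] by simp
 have gh: "(%t. g t +[A i] h t) : T \<rightarrow> carrier (A i)" and cg: "(%t. c *[A i] g t) : T \<rightarrow> carrier (A i)"
 using g h alg_closed[OF i] by (auto simp: Pi_iff)
 have C: "opw (wd t @ [(i, g t)]) vac @: P.Fs" "opw (wd t @ [(i, h t)]) vac @: P.Fs" if "t : T" for t using Vs_sub[OF g] Vs_sub[OF h] that by auto
 have a: "opw (wd t @ [(i, g t +[A i] h t)]) vac = opw (wd t @ [(i, g t)]) vac +[P.Fs] opw (wd t @ [(i, h t)]) vac"
 and s: "opw (wd t @ [(i, c *[A i] g t)]) vac = c *[P.Fs] opw (wd t @ [(i, g t)]) vac" if "t : T" for t
 using that g h WW by (auto simp: Pi_iff intro!: opw_add opw_smult i)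
 show "Vs i wd T g +[P.Fs] Vs i wd T h = Vs i wd T (%t. g t +[A i] h t)" unfolding Vs_def[of i wd T "%t. g t +[A i] h t"]
 by (rule P.F.lc_eqI[symmetric, OF T Vs_sub[OF gh]])
 (use g h C T Vs_sub[OF g] Vs_sub[OF h] in \<open>simp_all add: a Vs_def P.F.q_add P.F.ip_lc sum.distrib\<close>)
 show "c *[P.Fs] Vs i wd T g = Vs i wd T (%t. c *[A i] g t)" unfolding Vs_def[of i wd T "%t. c *[A i] g t"] by (rule P.F.lc_eqI[symmetric, OF T Vs_sub[OF cg]])
 (use g C T Vs_sub[OF g] in \<open>simp_all add: s Vs_def P.F.q_smult P.F.ip_lc sum_distrib_left\<close>)
qed

lemma Vs_single:
 assumes t: "t : T" and a: "cen (i, a)" shows "P.E (emw (wd t) @ [(i, em i a)]) = Vs i wd T (%s. if s = t then a else 0[A i])"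
proof -
 interpret S: star_state "A i" "\<phi> i" by (rule ss[OF i])
 have aC: "a @: (A i)" using a by (simp add: cen_def)
 have z: "0[A i] : carrier (A i)" "0 *[A i] 0[A i] = 0[A i]" using S.smult_0[of "0[A i]"] by simp_all
 have h: "(%s. if s = t then a else 0[A i]) : T \<rightarrow> carrier (A i)" using aC z by auto
 have E: "opw (wd t @ [(i, a)]) vac = P.E (emw (wd t) @ [(i, em i a)])"
 using opw_snoc[of "wd t" i a] wd[OF t] a opw_E[of "wd t @ [(i, a)]" "[]"] P.crc_id[OF okl_em[OF a, simplified]] i aC by simp
 have 0: "opw (wd s @ [(i, 0[A i])]) vac = 0[P.Fs]" if "s : T" for s
 using opw_smult[OF i z(1), of "wd s" vac 0] wd_W[OF that z(1)] z opw_C[OF wd_W[OF that z(1)] vac_C] vac_C by (simp add: P.F.smult_zero)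
 show ?thesis unfolding Vs_def
 proof (rule P.F.lc_eqI[symmetric, OF T Vs_sub[OF h]])
 show C: "P.E (emw (wd t) @ [(i, em i a)]) @: P.Fs" unfolding E[symmetric] by (rule opw_C[OF wd_W[OF t aC] vac_C])
 fix v assume v: "v @: P.Fs"
 have "(SUM s:T. 1 * ip P.Fs v (opw (wd s @ [(i, if s = t then a else 0[A i])]) vac))
 = (SUM s:T. if s = t then ip P.Fs v (opw (wd t @ [(i, a)]) vac) else 0)" by (intro sum.cong refl) (auto simp: 0 v P.F.q_zero)
 then show "ip P.Fs v (P.E (emw (wd t) @ [(i, em i a)])) = (SUM s:T. 1 * ip P.Fs v (opw (wd s @ [(i, if s = t then a else 0[A i])]) vac))" using T t E by simp
 qed
qed

end

end

context fpst
begin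

text \<open>Moving \<open>rho f\<close> to one side turns Gram matrices of images into moments of
  words around star f f, which conditional expectations compute.\<close>

lemma ip_rho_opw:
 assumes f: "f @: FA" and uv: "u : W" "v : W" shows "ip P.Fs (rho f (opw u vac)) (rho f (opw v vac)) = pair (star FA f .[FA] f) (%w. mom (ws u @ w @ v))"
proof -
 have C: "opw u vac @: P.Fs" "opw v vac @: P.Fs" using uv vac_C by auto
 have sf: "star FA f @: FA" using f by (simp add: FA_closed)
 have "ip P.Fs (rho f (opw u vac)) (rho f (opw v vac)) = ip P.Fs (opw u vac) (rho (star FA f) (rho f (opw v vac)))"
 using rho_star[OF sf C(1) rho_C[OF f C(2)]] f by (simp add: FA.star_star)
 also have "... = pair (star FA f .[FA] f) (%w. ip P.Fs (opw u vac) (opw w (opw v vac)))"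
 using ip_rho[OF FA_closed(2)[OF sf f] C(2,1)] by (simp add: rho_mult sf f C)
 also have "... = pair (star FA f .[FA] f) (%w. mom (ws u @ w @ v))"
 proof (rule pair_cong)
 fix w assume "w : fsupp (star FA f .[FA] f)"
 then have w: "w : W" using FA_sub[OF FA_closed(2)[OF sf f]] by blast
 show "ip P.Fs (opw u vac) (opw w (opw v vac)) = mom (ws u @ w @ v)"
 using opw_star[of "ws u" vac "opw w (opw v vac)"] ws_W[OF uv(1)] w C vac_C by (simp add: mom_def opw_append)
 qed
 finally show ?thesis .
qed

end

context fpconv
begin

abbreviation "Fk ka == fp_space I (%i. gns_space (A i) (\<Phi> ka i)) (%i. gns_vec (A i) (\<Phi> ka i))"
abbreviation "rk ka == fpst.rho I A (\<Phi> ka)"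
abbreviation "gk ka == star_state.gn PA (fp_state I A (\<Phi> ka))"
abbreviation "Vk ka i == fpst.Vs I A (\<Phi> ka) i (evl ka)"

text \<open>The words generate a right module isometric to columns over the i-th factor. Along the
  sequence orthonormality holds only eventually, which is why the state index is a
  parameter.\<close>

definition goodT :: "nat option => 'i => nat => ('i \<times> (nat option => 'a)) list set => bool" where
 "goodT ka i n T \<longleftrightarrow>
 (ALL t:T. (ALL l:set (evl ka t). fpst.cen I A (\<Phi> ka) l) & distinct_adj (map fst t) & (t = [] \<or> fst (last t) ~= i) & length t = n) &
 (ALL s:T. ALL t:T. kern (%i. gns_space (A i) (\<Phi> ka i)) (fpst.emw A (\<Phi> ka) (evl ka s)) (fpst.emw A (\<Phi> ka) (evl ka t)) = (if s = t then 1 else 0))"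

lemma goodT_wd:
 assumes "goodT ka i n T" "t : T" shows "(ALL l:set (evl ka t). fpst.cen I A (\<Phi> ka) l) & distinct_adj (map fst (evl ka t)) &
 (evl ka t = [] \<or> fst (last (evl ka t)) ~= i) & length (evl ka t) = n"
proof -
 have "fst (last (evl ka t)) = fst (last t)" if "t ~= []" using that by (simp add: evl_def last_map case_prod_beta)
 moreover have "length (evl ka t) = length t" "evl ka t = [] \<longleftrightarrow> t = []" by (simp_all add: evl_def)
 ultimately show ?thesis using assms by (auto simp: goodT_def)
qed

definition cst :: "('i \<times> 'a) list => ('i \<times> (nat option => 'a)) list" where
 "cst w = map (%(i, a). (i, %ka. a)) w"

definition wsS :: "('i \<times> (nat option => 'a)) list => ('i \<times> (nat option => 'a)) list" where
 "wsS w = rev (map (%(i, u). (i, %ka. star (A i) (u ka))) w)"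

lemma evl_cst: "evl ka (cst w) = w" and evl_wsS: "evl ka (wsS s) = ws (evl ka s)"
 by (auto simp: evl_def cst_def wsS_def word_star_def rev_map comp_def case_prod_beta)

lemma CEw_cst: "w : W ==> CEw (cst w)" using sconv.CE_const[OF sc] by (fastforce simp: CEw_def cst_def fp_words_def)

lemma CEw_wsS: "CEw s ==> CEw (wsS s)" using sconv.CE_star[OF sc] by (fastforce simp: CEw_def wsS_def)

abbreviation "Wk ka i t a == fpst.opw I A (\<Phi> ka) (evl ka t @ [(i, a)]) (fpst.vac I A (\<Phi> ka))"

text \<open>R represents the compression of star f f to the right module as a matrix over the i-th
  factor, in all states at once.\<close>

definition gram_matrix where
 "gram_matrix i f T R \<longleftrightarrow> (ALL s:T. ALL t:T. sconv.CE (A i) (R s t)) & (ALL ka. ALL s:T. ALL t:T. ALL a:carrier (A i). ALL b:carrier (A i).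
 ip (Fk ka) (rk ka f (Wk ka i s a)) (rk ka f (Wk ka i t b)) = gns_form (A i) (\<Phi> ka i) a (R s t ka .[A i] b))"

text \<open>The entry at s, t combines the conditional expectations of star s w t over the words w
  of star f f, with the coefficients of star f f.\<close>

lemma module_matrix:
 assumes T: "finite T" "!!t. t : T ==> CEw t" and i: "i : I" and f: "f @: FA" shows "EX R. gram_matrix i f T R"
proof -
 interpret S: sconv "A i" "%ka. \<Phi> ka i" by (rule sc[OF i])
 define g where "g = star FA f .[FA] f"
 have g: "g @: FA" using f by (simp add: g_def FA_closed)
 define r where "r s t w = (SOME r. cex i (wsS s @ cst w @ t) r)" for s t w
 have r: "cex i (wsS s @ cst w @ t) (r s t w)" if "s : T" "t : T" "w : fsupp g" for s t w
 unfolding r_def using FA_sub[OF g] that CEw_wsS[OF T(2)] T(2) CEw_cst by (intro someI_ex[OF cex_ex] i) auto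
 have rC: "r s t w ka @: (A i)" if "s : T" "t : T" "w : fsupp g" for s t w ka using r[OF that] by (auto simp: cex_def)
 define R where "R s t ka = finsum (A i) (%w. g w *[A i] r s t w ka) (fsupp g)" for s t ka
 show ?thesis unfolding gram_matrix_def
 proof (intro exI[of _ R] conjI ballI allI)
 show "S.CE (R s t)" if st: "s : T" "t : T" for s t
 unfolding R_def[abs_def] using r[OF st] by (intro S.CE_finsum FA_fin[OF g] S.CE_smult) (auto simp: cex_def cv_def)
 fix ka s t a b assume st: "s : T" "t : T" and ab: "a @: (A i)" "b @: (A i)"
 interpret K: fpst I A "\<Phi> ka" by (rule K)
 have sa: "star (A i) a @: (A i)" using ab by (simp add: S.star_closed)
 have W: "evl ka s @ [(i, a)] : W" "evl ka t @ [(i, b)] : W" using CEw_W[OF T(2)[OF st(1)]] CEw_W[OF T(2)[OF st(2)]] ab i by (auto simp: W_Cons)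
 have "gns_form (A i) (\<Phi> ka i) a (R s t ka .[A i] b) = (SUM w:fsupp g. \<Phi> ka i (star (A i) a .[A i] ((g w *[A i] r s t w ka) .[A i] b)))"
 unfolding R_def gns_form_def by (rule S.finsum_lin[where L = "%x. \<Phi> ka i (star (A i) a .[A i] (x .[A i] b))"])
 (use ab sa rC[OF st] FA_fin[OF g] in \<open>auto simp: S.A_ldist S.A_rdist star_state.phi_add[OF S.S] alg_closed(2)[OF i]\<close>)
 also have "... = pair g (%w. K.mom (ws (evl ka s @ [(i, a)]) @ w @ evl ka t @ [(i, b)]))" unfolding pair_def
 proof (intro sum.cong refl)
 fix w assume w: "w : fsupp g"
 show "\<Phi> ka i (star (A i) a .[A i] ((g w *[A i] r s t w ka) .[A i] b))
 = g w * K.mom (ws (evl ka s @ [(i, a)]) @ w @ evl ka t @ [(i, b)])" using r[OF st w] rC[OF st w, of ka] ab sa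
 by (simp add: cex_def evl_cst evl_wsS S.smult_mult_left S.smult_mult_right star_state.phi_smult[OF S.S] alg_closed(2)[OF i] S.A_assoc)
 qed
 also have "... = ip (Fk ka) (rk ka f (K.opw (evl ka s @ [(i, a)]) K.vac)) (rk ka f (K.opw (evl ka t @ [(i, b)]) K.vac))"
 unfolding g_def by (rule K.ip_rho_opw[OF f W, symmetric])
 finally show "ip (Fk ka) (rk ka f (K.opw (evl ka s @ [(i, a)]) K.vac)) (rk ka f (K.opw (evl ka t @ [(i, b)]) K.vac))
 = gns_form (A i) (\<Phi> ka i) a (R s t ka .[A i] b)" by simp
 qed
qed

text \<open>In the limit state the matrix of star f f is bounded by the square of the norm of f;
  \<open>matrix_bound\<close> transports this to the sequence.\<close>

lemma module_norm:
 assumes T: "finite T" "!!t. t : T ==> CEw t" and i: "i : I" and gT: "ev (%ka. goodT ka i n T)" and f: "f @: FA" and e: "e > 0"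
 shows "\<forall>\<^sub>F k in sequentially. ALL h:T \<rightarrow> carrier (A i).
 hnorm (Fk (Some k)) (rk (Some k) f (Vk (Some k) i T h)) <= (gk None (cls f) + e) * hnorm (Fk (Some k)) (Vk (Some k) i T h)"
proof -
 interpret S: sconv "A i" "%ka. \<Phi> ka i" by (rule sc[OF i])
 interpret N: fpst I A "\<Phi> None" by (rule K)
 obtain R where R: "gram_matrix i f T R" using module_matrix[OF T i f] by blast
 have R: "S.CE (R s t)"
 "a @: (A i) ==> b @: (A i) ==>
 ip (Fk ka) (rk ka f (Wk ka i s a)) (rk ka f (Wk ka i t b)) = gns_form (A i) (\<Phi> ka i) a (R s t ka .[A i] b)" if "s : T" "t : T" for s t ka a b
 using R that unfolding gram_matrix_def by simp_all
 have ipR: "ip (Fk ka) (rk ka f (Vk ka i T g)) (rk ka f (Vk ka i T h)) = (SUM s:T. SUM t:T. gns_form (A i) (\<Phi> ka i) (g s) (R s t ka .[A i] h t))"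
 if good: "goodT ka i n T" and gh: "g : T \<rightarrow> carrier (A i)" "h : T \<rightarrow> carrier (A i)" for ka g h
 proof -
 interpret K: fpst I A "\<Phi> ka" by (rule K)
 have "ip (Fk ka) (rk ka f (Vk ka i T g)) (rk ka f (Vk ka i T h))
 = (SUM s:T. SUM t:T. ip (Fk ka) (rk ka f (Wk ka i s (g s))) (rk ka f (Wk ka i t (h t))))" by (rule K.ip_rho_Vs[OF T(1) i goodT_wd[OF good] f gh])
 also have "... = (SUM s:T. SUM t:T. S.q ka (g s) (R s t ka .[A i] h t))" by (intro sum.cong refl R(2)) (use gh in auto)
 finally show ?thesis .
 qed
 have hV: "hnorm (Fk ka) (Vk ka i T h) = L2_set (%t. S.fn ka (h t)) T" "Vk ka i T h @: (Fk ka)" "Vk ka i T h : fpst.rvec I A (\<Phi> ka)"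
 if good: "goodT ka i n T" and h: "h : T \<rightarrow> carrier (A i)" for ka h
 proof -
 interpret K: fpst I A "\<Phi> ka" by (rule K)
 note gw = goodT_wd[OF good]
 show "hnorm (Fk ka) (Vk ka i T h) = L2_set (%t. S.fn ka (h t)) T" by (rule K.hnorm_Vs[OF T(1) i gw _ h]) (use good in \<open>auto simp: goodT_def\<close>)
 show "Vk ka i T h @: (Fk ka)" "Vk ka i T h : fpst.rvec I A (\<Phi> ka)" by (rule K.Vs_C[OF T(1) i gw h] K.Vs_rvec[OF T(1) i gw h], assumption)+
 qed
 define c where "c = gk None (cls f)"
 have c: "c >= 0" unfolding c_def using f by (intro N.Psi.gn_ge0) auto
 have goodN: "goodT None i n T" using gT by (simp add: ev_def)
 have "\<forall>\<^sub>F k in sequentially. ALL h:T \<rightarrow> carrier (A i).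
 cmod (SUM s:T. SUM t:T. S.q (Some k) (h s) (R s t (Some k) .[A i] h t)) <= (c^2 + e^2) * (L2_set (%t. S.fn (Some k) (h t)) T)^2"
 \<comment> \<open>The allowance is e^2, since c^2 + e^2 is at most (c + e)^2.\<close>
 proof (rule S.matrix_bound[OF T(1) R(1)])
 fix ka s t a b assume *: "s : T" "t : T" "a @: (A i)" "b @: (A i)"
 interpret K: fpst I A "\<Phi> ka" by (rule K)
 have "evl ka s @ [(i, a)] : W" "evl ka t @ [(i, b)] : W" using CEw_W[OF T(2)[OF *(1)]] CEw_W[OF T(2)[OF *(2)]] * i by (auto simp: W_Cons)
 then have "rk ka f (K.opw (evl ka s @ [(i, a)]) K.vac) @: (Fk ka)" "rk ka f (K.opw (evl ka t @ [(i, b)]) K.vac) @: (Fk ka)" using f K.vac_C by auto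
 then show "S.q ka a (R s t ka .[A i] b) = cnj (S.q ka b (R t s ka .[A i] a))"
 unfolding R(2)[OF *, symmetric] R(2)[OF *(2,1,4,3), symmetric] by (rule K.P.F.q_sym)
 next
 fix g h assume gh: "g : T \<rightarrow> carrier (A i)" "h : T \<rightarrow> carrier (A i)"
 have b: "hnorm (Fk None) (rk None f (Vk None i T h)) <= c * L2_set (%t. S.fn None (h t)) T" if "h : T \<rightarrow> carrier (A i)" for h
 unfolding hV(1)[OF goodN that, symmetric] c_def by (rule N.rho_rvec_le[OF f hV(3)[OF goodN that]])
 have "cmod (SUM s:T. SUM t:T. S.q None (g s) (R s t None .[A i] h t)) <= hnorm (Fk None) (rk None f (Vk None i T g)) * hnorm (Fk None) (rk None f (Vk None i T h))"
 unfolding ipR[OF goodN gh, symmetric] using f hV(2)[OF goodN] gh by (intro N.P.F.CS) auto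
 also have "... <= (c * L2_set (%t. S.fn None (g t)) T) * (c * L2_set (%t. S.fn None (h t)) T)"
 using f hV(2)[OF goodN] gh c by (intro mult_mono b) (auto simp: L2_set_nonneg)
 finally show "cmod (SUM s:T. SUM t:T. S.q None (g s) (R s t None .[A i] h t)) <= c^2 * L2_set (%t. S.fn None (g t)) T * L2_set (%t. S.fn None (h t)) T"
 by (simp add: power2_eq_square mult_ac)
 qed (use e in auto)
 moreover have "\<forall>\<^sub>F k in sequentially. goodT (Some k) i n T" using gT by (simp add: ev_def)
 ultimately show ?thesis
 proof eventually_elim
 case (elim k)
 note b = elim(1) and good = elim(2)
 show ?case
 proof
 fix h assume h: "h : T \<rightarrow> carrier (A i)"
 interpret K: fpst I A "\<Phi> (Some k)" by (rule K)
 let ?v = "Vk (Some k) i T h" and ?H = "Fk (Some k)"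
 have C: "?v @: ?H" "rk (Some k) f ?v @: ?H" using hV(2)[OF good h] f by auto
 have "(hnorm ?H (rk (Some k) f ?v))^2 = cmod (ip ?H (rk (Some k) f ?v) (rk (Some k) f ?v))"
 unfolding K.P.F.q_self[OF C(2)] by (simp only: norm_of_real abs_of_nonneg zero_le_power2)
 also have "... <= (c^2 + e^2) * (hnorm ?H ?v)^2" unfolding ipR[OF good h h] hV(1)[OF good h] by (rule bspec[OF b h])
 also have "... <= ((c + e) * hnorm ?H ?v)^2" unfolding power_mult_distrib using c e by (intro mult_right_mono) (auto simp: power2_sum)
 finally show "hnorm ?H (rk (Some k) f ?v) <= (gk None (cls f) + e) * hnorm ?H ?v" unfolding c_def[symmetric] by (rule power2_le_imp_le) (use c e C in auto)
 qed
 qed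
qed

end

lemma (in ip_space) lc_dist:
 assumes "finite S" "g ` S <= carrier H" "h ` S <= carrier H" shows "hdist H (lc H c g S) (lc H c h S) <= (SUM s:S. cmod (c s) * hdist H (g s) (h s))"
 using assms
proof (induction S)
 case (insert a S)
 have "hdist H (lc H c g (insert a S)) (lc H c h (insert a S)) <= hdist H (c a \<odot> g a) (c a \<odot> h a) + hdist H (lc H c g S) (lc H c h S)"
 using insert.prems insert.hyps by (simp add: lc_insert vd_add)
 then show ?case using insert by (simp add: vd_smult)
qed simp

context fpst
begin

text \<open>Centred letters from the algebra before completion. The cyclic vectors
  \<open>rho g vac\<close> are built from them, and splitting off tracked components does not lead
  out of this set.\<close>

definition cem :: "'i => (nat => 'a) set set" where
 "cem i = {em i a | a. cen (i, a)}"

definition gspan :: "('i, (nat => 'a) set) fp_vector set" where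
 "gspan = {lc P.Fs d P.E Y | d Y. finite Y & (ALL w:Y. P.okw w & (ALL l:set w. snd l : cem (fst l)))}"

lemma gspanI: "[|finite Y; !!w. w : Y ==> P.okw w & (ALL l:set w. snd l : cem (fst l))|] ==> lc P.Fs d P.E Y : gspan" unfolding gspan_def by blast

lemma gspanE:
 assumes "v : gspan"
 obtains d Y where "finite Y" "!!w. w : Y ==> P.okw w & (ALL l:set w. snd l : cem (fst l))" "v = lc P.Fs d P.E Y" "P.E ` Y <= carrier P.Fs"
proof -
 obtain d Y where "finite Y" "ALL w:Y. P.okw w & (ALL l:set w. snd l : cem (fst l))" "v = lc P.Fs d P.E Y" using assms unfolding gspan_def by blast
 then show thesis using that[of Y d] by auto
qed

lemma gspan_C: "v : gspan ==> v @: P.Fs" by (elim gspanE) auto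

lemma gspan_E: "[|P.okw w; !!l. l : set w ==> snd l : cem (fst l)|] ==> P.E w : gspan" using gspanI[of "{w}" "%_. 1"] by (simp add: P.F.lc_sing)

lemma gspan_lin:
 assumes "v : gspan" "w : gspan" shows "a *[P.Fs] v +[P.Fs] b *[P.Fs] w : gspan"
proof -
 obtain d Y where Y: "finite Y" "!!w. w : Y ==> P.okw w & (ALL l:set w. snd l : cem (fst l))" "v = lc P.Fs d P.E Y" "P.E ` Y <= carrier P.Fs"
 using assms(1) by (rule gspanE) blast
 obtain c Z where Z: "finite Z" "!!w. w : Z ==> P.okw w & (ALL l:set w. snd l : cem (fst l))" "w = lc P.Fs c P.E Z" "P.E ` Z <= carrier P.Fs"
 using assms(2) by (rule gspanE) blast
 show ?thesis unfolding Y(3) Z(3) P.F.lc_two[OF Y(1,4) Z(1,4)] by (rule gspanI) (use Y(1,2) Z(1,2) in auto)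
qed

lemma gspan_add: "[|v : gspan; w : gspan|] ==> v +[P.Fs] w : gspan" and gspan_smult: "v : gspan ==> a *[P.Fs] v : gspan"
 using gspan_lin[of v w 1 1] gspan_lin[of v v a 0] gspan_C by (simp_all add: P.F.one_smult P.F.smult_zero P.F.add_zero)

lemma gspan_lc:
 assumes "finite S" "g ` S <= gspan" shows "lc P.Fs c g S : gspan"
proof (rule P.F.lc_in_subspace[OF assms(1) _ _ gspan_add gspan_smult assms(2)])
 show "g ` S <= carrier P.Fs" using order_trans[OF assms(2) subsetI[OF gspan_C]] .
 show "0[P.Fs] : gspan" using gspanI[of "{}"] by simp
qed

lemma crc_em:
 assumes i: "i : I" and a: "a @: (A i)" shows "P.crc i (em i a) : cem i"
proof -
 interpret S: star_state "A i" "\<phi> i" by (rule ss[OF i])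
 have o: "1[A i] : carrier (A i)" using one_A[OF i] .
 let ?b = "a +[A i] (- \<phi> i a) *[A i] 1[A i]"
 have b: "?b @: (A i)" using a o alg_closed(1)[OF i] by simp
 have "P.crc i (em i a) = em i ?b" unfolding P.crc_def xi_em[OF i a] using a o by (simp add: S.emb_add S.emb_smult gns_vec_def)
 moreover have "cen (i, ?b)" using i a o b by (simp add: cen_def S.phi_add S.phi_smult S.phi_one)
 ultimately show ?thesis unfolding cem_def by blast
qed

lemma gspan_Ev:
 assumes i: "i : I" "a @: (A i)" and w: "P.okw w" "P.ns i w" "!!l. l : set w ==> snd l : cem (fst l)" shows "P.Ev i (em i a) w : gspan"
 unfolding P.Ev_def using w crc_em[OF i] P.okl_crc[OF i(1) em_C[OF i]] by (intro gspan_add gspan_smult gspan_E) (auto simp: P.okw_Cons)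

lemma gspan_ampl:
 assumes i: "i : I" "a @: (A i)" and v: "v : gspan" shows "P.ampl i (rp i a) v : gspan"
proof -
 interpret S: star_state "A i" "\<phi> i" by (rule ss[OF i(1)])
 interpret FF: ip_space2 P.Fs P.Fs by (rule ip_space2.intro) unfold_locales
 have E: "P.ampl i (rp i a) (P.E w) : gspan" if w: "P.okw w" "!!l. l : set w ==> snd l : cem (fst l)" for w
 proof (cases "P.ns i w")
 case True
 then show ?thesis using gspan_Ev[OF i w(1) True w(2)] opw_Cons_E[OF i w(1) True] by simp
 next
 case False
 then obtain h w' where wh: "w = (i, h) # w'" by (cases w) (auto simp: P.ns_def)
 then obtain b where b: "h = em i b" "b @: (A i)" using w(2)[of "(i, h)"] by (auto simp: cem_def cen_def)
 have w': "P.okw w'" "P.ns i w'" using w(1) wh by (auto simp: P.okw_Cons)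
 have "P.ampl i (rp i a) (P.E w) = P.Ev i (em i (a .[A i] b)) w'"
 using P.ampl_props(2)[OF i(1) rp_bounded[OF i] em_C[OF i(1) b(2)] w'] P.Ev_okl[OF w(1)[unfolded wh]] i b by (simp add: wh S.gns_rep_emb)
 then show ?thesis using gspan_Ev[OF i(1) alg_closed(2)[OF i b(2)] w'] w(2) wh by simp
 qed
 obtain d Y where Y: "finite Y" "!!w. w : Y ==> P.okw w & (ALL l:set w. snd l : cem (fst l))" "v = lc P.Fs d P.E Y" "P.E ` Y <= carrier P.Fs"
 using v by (rule gspanE) blast
 have b: "blin P.Fs P.Fs (P.ampl i (rp i a))" by (rule bounded_ops_blin[OF P.ampl_props(1)[OF i(1) rp_bounded[OF i]]])
 show ?thesis unfolding Y(3) FF.blin_lc[OF b Y(1,4)] using E Y(2) by (intro gspan_lc Y(1)) auto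
qed

text \<open>The span of words with algebra letters contains the vacuum and is preserved by the
  operators of the algebras, by \<open>gspan_ampl\<close>.\<close>

lemma rvec_gspan: "v : rvec ==> v : gspan"
proof -
 assume "v : rvec"
 then obtain g where g: "g @: FA" "v = rho g vac" unfolding rvec_iff by blast
 have "opw w vac : gspan" if "w : W" for w using that
 proof (induction w)
 case Nil
 show ?case using gspan_E[of "[]"] by simp
 next
 case (Cons l w)
 then show ?case using gspan_ampl by (cases l) (auto simp: W_Cons)
 qed
 then show ?thesis unfolding g(2) rho_def using FA_sub[OF g(1)] by (intro gspan_lc FA_fin g) auto
qed

end

section \<open>Approximation by operators shifting the levels\<close>

locale fpapprox = fpconv +
 fixes I0 :: "'a set" and L :: "'a => 'b set" and N :: nat and Os :: "'a => nat => (nat option => 'b) set"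
 assumes I0: "finite I0" "I0 <= I" and lev: "i : I0 ==> levels (A i) (%ka. \<Phi> ka i) (L i) (Os i)"
begin

text \<open>Without the unit, the members of an orthonormal level are orthogonal to the unit, hence
  centred.\<close>

definition Bs :: "'a => (nat option => 'b) set" where
 "Bs i = Os i N - {%ka. 1[A i]}"

definition good :: "nat option => bool" where
 "good ka \<longleftrightarrow> (ALL i:I0. sconv.onk (A i) (%ka. \<Phi> ka i) ka (Os i N))"

definition Bword :: "('a \<times> (nat option => 'b)) list => bool" where
 "Bword t \<longleftrightarrow> (ALL l:set t. fst l : I0 & snd l : Bs (fst l)) & distinct_adj (map fst t)"

definition Tn :: "nat => 'a => ('a \<times> (nat option => 'b)) list set" where
 "Tn n i = {t. Bword t & length t = n & (t = [] \<or> fst (last t) ~= i)}"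

abbreviation "ta ka i == levels.tau (A i) (%ka. \<Phi> ka i) N (Os i) ka"
abbreviation "dl ka i == levels.del (A i) (%ka. \<Phi> ka i) N (Os i) ka"

lemma ev_good: "ev good"
proof -
 have "ev (%ka. ALL i:I0. sconv.onk (A i) (%ka. \<Phi> ka i) ka (Os i N))"
 proof (rule ev_ball[OF I0(1)])
 fix i assume i: "i : I0"
 interpret V: levels "A i" "%ka. \<Phi> ka i" "L i" N "Os i" by (rule lev[OF i])
 show "ev (%ka. V.onk ka (Os i N))" by (rule V.onfD(3)[OF V.Os_onf])
 qed
 then show ?thesis by (simp add: good_def[abs_def])
qed

lemma finite_Bs: "i : I0 ==> finite (Bs i)"
proof -
 assume i: "i : I0"
 interpret V: levels "A i" "%ka. \<Phi> ka i" "L i" N "Os i" by (rule lev[OF i])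
 show ?thesis unfolding Bs_def using V.onfD(1)[OF V.Os_onf] by simp
qed

lemma finite_Bword: "finite {t. Bword t & length t = n}"
proof (rule finite_subset)
 show "{t. Bword t & length t = n} <= {t. set t <= (SIGMA i:I0. Bs i) & length t = n}" by (auto simp: Bword_def)
 show "finite {t. set t <= (SIGMA i:I0. Bs i) & length t = n}" using I0 finite_Bs by (intro finite_lists_length_eq) auto
qed

lemma finite_Tn: "finite (Tn n i)" by (rule finite_subset[OF _ finite_Bword[of n]]) (auto simp: Tn_def)

lemma Bs_good:
 assumes g: "good ka" and i: "i : I0" and u: "u : Bs i" shows "sconv.CE (A i) u" "fpst.cen I A (\<Phi> ka) (i, u ka)"
 "v : Bs i ==> gns_form (A i) (\<Phi> ka i) (u ka) (v ka) = (if u = v then 1 else 0)"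
proof -
 interpret V: levels "A i" "%ka. \<Phi> ka i" "L i" N "Os i" by (rule lev[OF i])
 have o: "(%ka. 1[A i]) : Os i N" using V.Os_mono[of 0 N] V.Os0 by auto
 have u': "u : Os i N" "u ~= (%ka. 1[A i])" using u by (auto simp: Bs_def)
 have on: "V.onk ka (Os i N)" using g i by (simp add: good_def)
 show ce: "sconv.CE (A i) u" by (rule V.Os_CE[OF u'(1)])
 then have uC: "u ka @: (A i)" by auto
 have "\<Phi> ka i (u ka) = 0" using V.onkD[OF on o u'(1)] u'(2) star_state.q_one[OF V.S uC] by auto
 then show "fpst.cen I A (\<Phi> ka) (i, u ka)" using fpst.cen_def[OF K] uC i I0 by auto
 show "V.q ka (u ka) (v ka) = (if u = v then 1 else 0)" if "v : Bs i" using V.onkD[OF on u'(1), of v] that by (auto simp: Bs_def)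
qed

lemma Bword_CEw: "Bword t ==> CEw t" using Bs_good(1) I0 ev_good unfolding ev_def Bword_def CEw_def by blast

lemma Bword_cen:
 assumes "good ka" "Bword t" shows "ALL l:set (evl ka t). fpst.cen I A (\<Phi> ka) l"
 using Bs_good(2)[OF assms(1)] assms(2) by (fastforce simp: Bword_def evl_def)

abbreviation "EM ka t == fpst.emw A (\<Phi> ka) (evl ka t)"
abbreviation "EE ka == fpsp.E I (%i. gns_space (A i) (\<Phi> ka i)) (%i. gns_vec (A i) (\<Phi> ka i))"

lemma Bword_kern:
 assumes g: "good ka" shows "[|Bword s; Bword t|] ==> kern (%i. gns_space (A i) (\<Phi> ka i)) (EM ka s) (EM ka t) = (if s = t then 1 else 0)"
proof (induction s arbitrary: t)
 case Nil
 interpret K: fpst I A "\<Phi> ka" by (rule K)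
 show ?case by (cases t) (auto simp: K.emw_def evl_def)
next
 case (Cons l s)
 interpret K: fpst I A "\<Phi> ka" by (rule K)
 show ?case
 proof (cases t)
 case Nil
 then show ?thesis by (cases l) simp
 next
 case tc: (Cons m t')
 obtain i u where l: "l = (i, u)" by (cases l)
 obtain j v where m: "m = (j, v)" by (cases m)
 have st: "Bword s" "Bword t'" "i : I0" "u : Bs i" "j : I0" "v : Bs j" using Cons.prems by (auto simp: Bword_def tc l m distinct_adj_Cons)
 have "ip (gns_space (A i) (\<Phi> ka i)) (K.em i (u ka)) (K.em i (v ka)) = (if u = v then 1 else 0)" if "i = j"
 using that Bs_good[OF g st(3,4)] Bs_good[OF g st(5,6)] st star_state.ip_emb[OF K.ss, of i "u ka" "v ka"] by (auto simp: K.cen_def)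
 then show ?thesis using Cons.IH[OF st(1,2)] by (auto simp: tc l m)
 qed
qed

lemma good_goodT: "good ka ==> goodT ka i n (Tn n i)"
 unfolding goodT_def using Bword_cen Bword_kern by (auto simp: Tn_def Bword_def[of "_ :: ('a \<times> _) list"] intro: Bword_cen)

lemma Bword_okw: "good ka ==> Bword t ==> fpsp.okw I (%i. gns_space (A i) (\<Phi> ka i)) (%i. gns_vec (A i) (\<Phi> ka i)) (EM ka t)"
 by (rule fpst.okw_emw[OF K Bword_cen]) (auto simp: Bword_def)

definition BB :: "nat option => 'a => (nat => 'b) set set" where
 "BB ka i = (%u. completion_embed (A i) (gns_form (A i) (\<Phi> ka i)) (u ka)) ` Bs i"

text \<open>Every level contains the unit, so these vectors are orthogonal to the distinguished
  vector.\<close>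

definition WW :: "nat option => 'a => nat => (nat => 'b) set set" where
 "WW ka i m = {w : carrier (gns_space (A i) (\<Phi> ka i)). ALL u:Os i m.
 ip (gns_space (A i) (\<Phi> ka i)) (completion_embed (A i) (gns_form (A i) (\<Phi> ka i)) (u ka)) w = 0}"

lemma tau_bounded:
 assumes i: "i : I0" and a: "a : L i" shows "ta ka i a : bounded_ops (gns_space (A i) (\<Phi> ka i)) (gns_space (A i) (\<Phi> ka i))"
proof -
 interpret V: levels "A i" "%ka. \<Phi> ka i" "L i" N "Os i" by (rule lev[OF i])
 interpret S: star_state "A i" "\<Phi> ka i" by (rule V.S)
 have "blin S.G S.G (%h. gns_rep (A i) (\<Phi> ka i) a h +[S.G] V.del ka a h)"
 using V.LC a by (intro blin_add S.G.ip_space_axioms bounded_ops_blin S.gns_rep_bounded V.del_bounded) auto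
 then show ?thesis unfolding V.tau_def by (rule blin_restrict[OF S.G.semi_ip_axioms])
qed

text \<open>The remainder is the residual of a at level N. It belongs to the algebra, and it is
  centred because the level contains the unit.\<close>

lemma cem_decomp:
 assumes g: "good ka" and i: "i : I0" and h: "h : fpst.cem I A (\<Phi> ka) i" shows "EX c w. w : WW ka i N & w : fpst.cem I A (\<Phi> ka) i &
 h = lc (gns_space (A i) (\<Phi> ka i)) c (%b. b) (BB ka i) +[gns_space (A i) (\<Phi> ka i)] w"
proof -
 interpret K: fpst I A "\<Phi> ka" by (rule K)
 interpret V: levels "A i" "%ka. \<Phi> ka i" "L i" N "Os i" by (rule lev[OF i])
 interpret S: star_state "A i" "\<Phi> ka i" by (rule V.S)
 obtain a where a: "h = S.emb a" "K.cen (i, a)" using h K.cem_def by blast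
 have aC: "a @: (A i)" "\<Phi> ka i a = 0" using a(2) by (auto simp: K.cen_def)
 let ?r = "V.res (Os i N) (%ka. a)"
 have on: "V.onk ka (Os i N)" using g i by (simp add: good_def)
 have o: "(%ka. 1[A i]) : Os i N" using V.Os_mono[of 0 N] V.Os0 by auto
 note fin = V.onfD(1)[OF V.Os_onf, of N] and CE = V.Os_CE[of _ N] and ca = V.CE_const[OF aC(1)]
 have rC: "?r ka @: (A i)" by (rule V.CE_C[OF V.CE_res[OF fin CE ca]])
 have orth: "S.q (u ka) (?r ka) = 0" if "u : Os i N" for u by (rule V.q_res_orth[OF fin CE on ca that])
 have w: "S.emb (?r ka) : WW ka i N" unfolding WW_def using rC orth CE by (auto intro!: S.emb_C)
 have "\<Phi> ka i (?r ka) = 0" using orth[OF o] S.q_one[OF rC] by simp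
 then have wc: "S.emb (?r ka) : K.cem i" unfolding K.cem_def using rC i I0 by (auto simp: K.cen_def)
 let ?c = "%b. ip S.G b h"
 have uC: "u ka @: (A i)" if "u : Bs i" for u using that CE by (auto simp: Bs_def)
 \<comment> \<open>The combination runs over vectors while the level consists of families;
   orthonormality makes the passage injective.\<close>
 have inj: "inj_on (%u. S.emb (u ka)) (Bs i)"
 proof (rule inj_onI, rule ccontr)
 fix u v assume uv: "u : Bs i" "v : Bs i" "S.emb (u ka) = S.emb (v ka)" "u ~= v"
 have "S.q (u ka) (u ka) = S.q (u ka) (v ka)" using S.ip_emb[OF uC[OF uv(1)]] uC uv by metis
 then show False using Bs_good(3)[OF g i uv(1) uv(1)] Bs_good(3)[OF g i uv(1,2)] uv(4) by simp
 qed
 have BC: "finite (BB ka i)" "(%b. b) ` BB ka i <= carrier S.G" using finite_Bs[OF i] uC by (auto simp: BB_def)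
 have "h = lc S.G ?c (%b. b) (BB ka i) +[S.G] S.emb (?r ka)"
 proof (rule S.G.sep)
 show "h @: S.G" "lc S.G ?c (%b. b) (BB ka i) +[S.G] S.emb (?r ka) @: S.G" using a aC rC BC by auto
 fix z assume z: "z @: S.G"
 \<comment> \<open>The summand at the unit vanishes because a is centred.\<close>
 have "(SUM u:Os i N. S.q (u ka) a * ip S.G z (S.emb (u ka))) = (SUM u:Bs i. S.q (u ka) a * ip S.G z (S.emb (u ka)))"
 unfolding Bs_def using fin aC S.q_one[OF aC(1)] by (intro sum.mono_neutral_right) auto
 also have "... = (SUM u:Bs i. ?c (S.emb (u ka)) * ip S.G z (S.emb (u ka)))" using uC aC by (intro sum.cong refl) (simp add: a)
 also have "... = ip S.G z (lc S.G ?c (%b. b) (BB ka i))" unfolding S.G.ip_lc[OF BC z] by (simp add: BB_def sum.reindex[OF inj])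
 finally show "ip S.G z h = ip S.G z (lc S.G ?c (%b. b) (BB ka i) +[S.G] S.emb (?r ka))" using V.ip_res[OF fin CE ca z] z rC BC by (simp add: S.G.q_add a)
 qed
 then show ?thesis using w wc by blast
qed

lemma slots_good:
 assumes g: "good ka"
 shows "slots I (%i. gns_space (A i) (\<Phi> ka i)) (%i. gns_vec (A i) (\<Phi> ka i)) I0 N (BB ka) (WW ka) (fpst.cem I A (\<Phi> ka)) (ta ka) L"
proof -
 interpret K: fpst I A "\<Phi> ka" by (rule K)
 show ?thesis
 proof (intro slots.intro K.fpsp_GH slots_axioms.intro I0 tau_bounded cem_decomp[OF g])
 fix i assume i: "i : I0"
 interpret V: levels "A i" "%ka. \<Phi> ka i" "L i" N "Os i" by (rule lev[OF i])
 interpret S: star_state "A i" "\<Phi> ka i" by (rule V.S)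
 have iI: "i : I" using i I0 by auto
 show "finite (BB ka i)" unfolding BB_def using finite_Bs[OF i] by simp
 show "K.P.okl (i, b)" if "b : BB ka i" for b using that K.okl_em[OF Bs_good(2)[OF g i]] by (auto simp: BB_def)
 show "K.P.okl (i, w)" if "w : WW ka i m" for w m
 proof -
 have "(%ka. 1[A i]) : Os i m" using V.Os_mono[of 0 m] V.Os0 by auto
 then show ?thesis unfolding K.P.okl_def using that iI by (auto simp: WW_def gns_vec_def)
 qed
 show "w : WW ka i m" if "w : WW ka i (Suc m)" for w m using that V.Os_Suc[of m] by (auto simp: WW_def)
 show "ip S.G b w = 0" if "b : BB ka i" "w : WW ka i N" for b w using that by (auto simp: BB_def WW_def Bs_def)
 show "ta ka i a w : WW ka i m" if a: "a : L i" and m: "m < N" and w: "w : WW ka i (Suc m)" for a m w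
 proof -
 have on: "V.onk ka (Os i N)" using g i by (simp add: good_def)
 have w': "w @: S.G" "!!u. u : Os i (Suc m) ==> ip S.G (S.emb (u ka)) w = 0" using w by (auto simp: WW_def)
 have "ip S.G (S.emb (u ka)) (ta ka i a w) = 0" if "u : Os i m" for u by (rule V.tau_orth[OF on a m w'(1) _ that]) (rule w'(2))
 then show ?thesis unfolding WW_def using blinD(1)[OF bounded_ops_blin[OF tau_bounded[OF i a]] w'(1)] by blast
 qed
 next
 show "K.P.okl (i, h)" if "i : I" "h : K.cem i" for i h using that K.okl_em by (auto simp: K.cem_def)
 qed
qed

abbreviation "oT ka == fpsp.opT I (%i. gns_space (A i) (\<Phi> ka i)) (%i. gns_vec (A i) (\<Phi> ka i)) (ta ka)"
abbreviation "oW ka == fpst.opw I A (\<Phi> ka)"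

text \<open>Induction over the word, with a uniform bound of the unperturbed word carried along. The
  error splits into the correction of the first letter applied to the perturbed remainder, and the
  first generator applied to the error of the remainder.\<close>

lemma word_approx:
 assumes "ALL l:set s. fst l : I0 & snd l : L (fst l)"
 shows "(EX D>=0. \<forall>\<^sub>F k in sequentially. ALL v:carrier (Fk (Some k)). hnorm (Fk (Some k)) (oW (Some k) s v) <= D * hnorm (Fk (Some k)) v) &
 (ALL e>0. \<forall>\<^sub>F k in sequentially. ALL v:carrier (Fk (Some k)). hdist (Fk (Some k)) (oT (Some k) s v) (oW (Some k) s v) <= e * hnorm (Fk (Some k)) v)"
 using assms
proof (induction s)
 case Nil
 have "hdist (Fk ka) v v = 0" "0 <= hnorm (Fk ka) v" if "v @: (Fk ka)" for ka v
 proof -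
 interpret K: fpst I A "\<Phi> ka" by (rule K)
 show "hdist (Fk ka) v v = 0" "0 <= hnorm (Fk ka) v" using that by auto
 qed
 then show ?case by (auto simp: fpst.opw.simps[OF K] fpsp.opT.simps[OF fpst.fpsp_GH[OF K]] intro!: exI[of _ 1])
next
 case (Cons l s)
 obtain i a where l: "l = (i, a)" by (cases l)
 have i: "i : I0" "i : I" and a: "a : L i" using Cons.prems I0 l by auto
 interpret V: levels "A i" "%ka. \<Phi> ka i" "L i" N "Os i" by (rule lev[OF i(1)])
 have aC: "a @: (A i)" using a V.LC by blast
 have s: "ALL l:set s. fst l : I0 & snd l : L (fst l)" using Cons.prems by simp
 obtain D where D: "D >= 0" "\<forall>\<^sub>F k in sequentially. ALL v:carrier (Fk (Some k)). hnorm (Fk (Some k)) (oW (Some k) s v) <= D * hnorm (Fk (Some k)) v"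
 using Cons.IH[OF s] by blast
 \<comment> \<open>One more than the norm in the limit, hence eventually a bound of the norm along
   the sequence.\<close>
 define C where "C = V.gn None a + 1"
 have C: "C >= 0" unfolding C_def using star_state.gn_ge0[OF V.S aC, of None] by simp
 have evC: "\<forall>\<^sub>F k in sequentially. V.gn (Some k) a < C" using V.nrm[OF aC] unfolding cv_def by (rule order_tendstoD) (simp add: C_def)
 have sW: "s : W" using s I0 levels.LC[OF lev] by (fastforce simp: fp_words_def)
 have st: "oW ka (l # s) v = fp_ampliation I (%i. gns_space (A i) (\<Phi> ka i)) (%i. gns_vec (A i) (\<Phi> ka i)) i (gns_rep (A i) (\<Phi> ka i) a) (oW ka s v)"
 "oT ka (l # s) v = fp_ampliation I (%i. gns_space (A i) (\<Phi> ka i)) (%i. gns_vec (A i) (\<Phi> ka i)) i (ta ka i a) (oT ka s v)" for ka v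
 by (simp_all add: l fpst.opw.simps[OF K] fpsp.opT.simps[OF fpst.fpsp_GH[OF K]])
 have amp: "hnorm (Fk ka) (fp_ampliation I (%i. gns_space (A i) (\<Phi> ka i)) (%i. gns_vec (A i) (\<Phi> ka i)) i (gns_rep (A i) (\<Phi> ka i) a) v) <= C * hnorm (Fk ka) v"
 if gC: "V.gn ka a < C" and v: "v @: (Fk ka)" for ka v
 proof -
 interpret K: fpst I A "\<Phi> ka" by (rule K)
 interpret S: star_state "A i" "\<Phi> ka i" by (rule V.S)
 show ?thesis
 proof (rule K.P.ampl_props(3)[OF i(2) K.rp_bounded[OF i(2) aC] C _ v])
 fix h assume h: "h @: S.G"
 show "hnorm S.G (gns_rep (A i) (\<Phi> ka i) a h) <= C * hnorm S.G h"
 using S.gn_rep_bound[OF aC h] mult_right_mono[OF less_imp_le[OF gC] S.G.fn_ge0[OF h]] by linarith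
 qed
 qed
 have 1: "\<forall>\<^sub>F k in sequentially. ALL v:carrier (Fk (Some k)). hnorm (Fk (Some k)) (oW (Some k) (l # s) v) <= (C * D) * hnorm (Fk (Some k)) v"
 using D(2) evC
 proof eventually_elim
 case (elim k)
 show ?case
 proof
 fix v assume v: "v @: (Fk (Some k))"
 show "hnorm (Fk (Some k)) (oW (Some k) (l # s) v) <= (C * D) * hnorm (Fk (Some k)) v"
 unfolding st using amp[OF elim(2) fpst.opw_C[OF K sW v]] mult_left_mono[OF bspec[OF elim(1) v] C] by (simp add: mult.assoc)
 qed
 qed
 have 2: "\<forall>\<^sub>F k in sequentially. ALL v:carrier (Fk (Some k)). hdist (Fk (Some k)) (oT (Some k) (l # s) v) (oW (Some k) (l # s) v) <= e * hnorm (Fk (Some k)) v"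
 if e: "e > 0" for e
 proof -
 \<comment> \<open>Chosen so that C e1 + e2 (D + e1) is at most e: e1 bounds the error of the
   remainder, D + e1 its norm, and e2 the correction of the first letter.\<close>
 define e1 where "e1 = min 1 (e / (2 * (C + 1)))"
 define e2 where "e2 = e / (2 * (D + 1))"
 have e12: "e1 > 0" "e1 <= 1" "e2 > 0" using e C D by (auto simp: e1_def e2_def)
 have "C * e1 <= (C + 1) * (e / (2 * (C + 1)))" using C e by (intro mult_mono) (auto simp: e1_def)
 moreover have "e2 * (D + e1) <= e2 * (D + 1)" using e12 by simp
 moreover have "(C + 1) * (e / (2 * (C + 1))) = e / 2" "e2 * (D + 1) = e / 2" using C D by (simp_all add: e2_def divide_simps)
 ultimately have sm: "C * e1 + e2 * (D + e1) <= e" by linarith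
 have "\<forall>\<^sub>F k in sequentially. ALL v:carrier (Fk (Some k)). hdist (Fk (Some k)) (oT (Some k) s v) (oW (Some k) s v) <= e1 * hnorm (Fk (Some k)) v"
 using Cons.IH[OF s] e12 by blast
 from this D(2) evC V.del_small[OF a e12(3)] show ?thesis
 proof eventually_elim
 case (elim k)
 show ?case
 proof
 fix v
 define ka where "ka = Some k"
 assume "v @: (Fk (Some k))"
 note as = elim[folded ka_def] this[folded ka_def]
 interpret K: fpst I A "\<Phi> ka" by (rule K)
 interpret FF: ip_space2 "Fk ka" "Fk ka" by (rule ip_space2.intro) unfold_locales
 let ?y = "oT ka s v" and ?z = "oW ka s v" and ?R = "K.rp i a"
 have zC: "?z @: (Fk ka)" by (rule K.opw_C[OF sW as(5)])
 have yC: "?y @: (Fk ka)"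
 proof (rule blinD(1)[OF K.P.blin_opT as(5)])
 fix j b assume "(j, b) : set s"
 then show "j : I & ta ka j b : bounded_ops (gns_space (A j) (\<Phi> ka j)) (gns_space (A j) (\<Phi> ka j))" using s I0 tau_bounded by fastforce
 qed
 note bR = K.rp_bounded[OF i(2) aC] and bd = V.del_bounded[OF a, of ka]
 note bA = bounded_ops_blin[OF K.P.ampl_props(1)[OF i(2) bR]]
 have AC: "K.P.ampl i ?R ?y @: (Fk ka)" "K.P.ampl i ?R ?z @: (Fk ka)" "K.P.ampl i (V.del ka a) ?y @: (Fk ka)"
 using blinD(1)[OF bA] blinD(1)[OF bounded_ops_blin[OF K.P.ampl_props(1)[OF i(2) bd]]] yC zC by auto
 have t: "K.P.ampl i (ta ka i a) ?y = K.P.ampl i ?R ?y +[Fk ka] K.P.ampl i (V.del ka a) ?y"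
 by (rule K.P.ampl_add[OF i(2) bR bd tau_bounded[OF i(1) a] _ yC]) (simp add: V.tau_def)
 have dC: "K.P.ampl i ?R ?y +[Fk ka] K.P.ampl i (V.del ka a) ?y @: (Fk ka)" using AC by auto
 have "hdist (Fk ka) (K.P.ampl i ?R ?y +[Fk ka] K.P.ampl i (V.del ka a) ?y) (K.P.ampl i ?R ?y) <= hnorm (Fk ka) (K.P.ampl i (V.del ka a) ?y)"
 using K.P.F.vd_add[OF AC(1,3,1) K.P.F.zeroC] AC by (simp add: K.P.F.add_zero)
 moreover have "hnorm (Fk ka) (K.P.ampl i (V.del ka a) ?y) <= e2 * hnorm (Fk ka) ?y" using as(4) e12 by (intro K.P.ampl_props(3)[OF i(2) bd _ _ yC]) auto
 moreover have "hnorm (Fk ka) ?y <= (D + e1) * hnorm (Fk ka) v" using K.P.F.fn_le_vd[OF yC zC] bspec[OF as(1,5)] bspec[OF as(2,5)] by (simp add: distrib_right)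
 then have "e2 * hnorm (Fk ka) ?y <= e2 * ((D + e1) * hnorm (Fk ka) v)" using e12 by (intro mult_left_mono) auto
 moreover have "hdist (Fk ka) (K.P.ampl i ?R ?y) (K.P.ampl i ?R ?z) <= C * hdist (Fk ka) ?y ?z" by (rule FF.blin_dist[OF bA amp[OF as(3)] yC zC])
 moreover have "C * hdist (Fk ka) ?y ?z <= C * (e1 * hnorm (Fk ka) v)" using bspec[OF as(1,5)] C by (intro mult_left_mono)
 moreover note K.P.F.vd_triangle[OF dC AC(1,2)]
 ultimately have "hdist (Fk ka) (oT ka (l # s) v) (oW ka (l # s) v) <= (C * e1 + e2 * (D + e1)) * hnorm (Fk ka) v" unfolding st t by (simp add: algebra_simps)
 also have "... <= e * hnorm (Fk ka) v" using sm as(5) by (intro mult_right_mono) auto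
 finally show "hdist (Fk (Some k)) (oT (Some k) (l # s) v) (oW (Some k) (l # s) v) <= e * hnorm (Fk (Some k)) v" by (simp add: ka_def)
 qed
 qed
 qed
 show ?case using 1 2 C D(1) by (intro conjI exI[of _ "C * D"]) auto
qed

abbreviation "Xt ka f v == lc (Fk ka) f (%s. oT ka s v) (fsupp f)"

lemma rho_approx:
 assumes f: "f @: FA" and sf: "ALL s:fsupp f. ALL l:set s. fst l : I0 & snd l : L (fst l)" and e: "e > 0"
 shows "\<forall>\<^sub>F k in sequentially. ALL v:carrier (Fk (Some k)). hdist (Fk (Some k)) (Xt (Some k) f v) (rk (Some k) f v) <= e * hnorm (Fk (Some k)) v"
proof -
 define c where "c = (SUM s:fsupp f. cmod (f s)) + 1"
 have c: "c > 0" unfolding c_def by (intro add_nonneg_pos sum_nonneg) auto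
 have "\<forall>\<^sub>F k in sequentially. ALL s:fsupp f. ALL v:carrier (Fk (Some k)). hdist (Fk (Some k)) (oT (Some k) s v) (oW (Some k) s v) <= e / c * hnorm (Fk (Some k)) v"
 proof (rule eventually_ball_finite[OF FA_fin[OF f]], intro ballI)
 fix s assume "s : fsupp f"
 then have "ALL l:set s. fst l : I0 & snd l : L (fst l)" using sf by blast
 from word_approx[OF this] show "\<forall>\<^sub>F k in sequentially. ALL v:carrier (Fk (Some k)). hdist (Fk (Some k)) (oT (Some k) s v) (oW (Some k) s v) <= e / c * hnorm (Fk (Some k)) v"
 using divide_pos_pos[OF e c] by blast
 qed
 then show ?thesis
 proof eventually_elim
 case (elim k)
 show ?case
 proof
 fix v assume v: "v @: (Fk (Some k))"
 interpret K: fpst I A "\<Phi> (Some k)" by (rule K)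
 have "oT (Some k) s v @: (Fk (Some k))" if "s : fsupp f" for s using that sf I0 tau_bounded by (intro blinD(1)[OF K.P.blin_opT v]) fastforce
 then have "hdist (Fk (Some k)) (Xt (Some k) f v) (rk (Some k) f v) <= (SUM s:fsupp f. cmod (f s) * hdist (Fk (Some k)) (oT (Some k) s v) (oW (Some k) s v))"
 unfolding K.rho_def using K.rho_sub[OF f v] by (intro K.P.F.lc_dist FA_fin[OF f]) auto
 also have "... <= (SUM s:fsupp f. cmod (f s) * (e / c * hnorm (Fk (Some k)) v))" using elim v by (intro sum_mono mult_left_mono) auto
 also have "... = (SUM s:fsupp f. cmod (f s)) * (e / c * hnorm (Fk (Some k)) v)" by (simp only: sum_distrib_right)
 also have "... <= c * (e / c * hnorm (Fk (Some k)) v)" by (rule mult_right_mono) (simp add: c_def, use c e v in auto)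
 finally show "hdist (Fk (Some k)) (Xt (Some k) f v) (rk (Some k) f v) <= e * hnorm (Fk (Some k)) v" using c by simp
 qed
 qed
qed

text \<open>Lifts a word of tracked vectors in one state to a word of families, by which the right
  modules are indexed.\<close>

lemma Bw_word:
 assumes g: "good ka" and u: "ALL l:set u. fst l : I0 & snd l : BB ka (fst l)" "distinct_adj (map fst u)" shows "EX t. Bword t & EM ka t = u"
proof -
 interpret K: fpst I A "\<Phi> ka" by (rule K)
 have "EX t. (ALL l:set t. fst l : I0 & snd l : Bs (fst l)) & EM ka t = u" using u(1)
 proof (induction u)
 case Nil
 show ?case by (intro exI[of _ "[]"]) simp
 next
 case (Cons l u)
 obtain i b where l: "l = (i, b)" by (cases l)
 obtain t where t: "ALL l:set t. fst l : I0 & snd l : Bs (fst l)" "EM ka t = u" using Cons by auto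
 obtain v where v: "i : I0" "v : Bs i" "b = K.em i (v ka)" using Cons.prems l by (auto simp: BB_def)
 then show ?case using t by (intro exI[of _ "(i, v) # t"]) (simp add: l)
 qed
 then obtain t where t: "ALL l:set t. fst l : I0 & snd l : Bs (fst l)" "EM ka t = u" by blast
 moreover have "map fst t = map fst u" using arg_cong[OF t(2), of "map fst"] by simp
 ultimately show ?thesis using u(2) by (auto simp: Bword_def)
qed

definition Vset :: "nat option => nat => 'a => ('a, (nat => 'b) set) fp_vector set" where
 "Vset ka n i = Vk ka i (Tn n i) ` (Tn n i \<rightarrow> carrier (A i))"

lemma Vset_props:
 assumes g: "good ka" and i: "i : I0" shows "Vset ka n i <= carrier (Fk ka)" "0[Fk ka] : Vset ka n i"
 "x : Vset ka n i ==> y : Vset ka n i ==> x +[Fk ka] y : Vset ka n i"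
 "x : Vset ka n i ==> c *[Fk ka] x : Vset ka n i"
 "t : Tn n i ==> fpst.cen I A (\<Phi> ka) (i, a) ==>
 EE ka (EM ka t @ [(i, completion_embed (A i) (gns_form (A i) (\<Phi> ka i)) a)]) : Vset ka n i"
 "EE ka [] : Vset ka 0 i"
proof -
 interpret K: fpst I A "\<Phi> ka" by (rule K)
 have iI: "i : I" using i I0 by auto
 interpret S: star_state "A i" "\<Phi> ka i" by (rule K.ss[OF iI])
 note gw = goodT_wd[OF good_goodT[OF g]]
 show sub: "Vset ka n i <= carrier (Fk ka)" for n unfolding Vset_def by (intro image_subsetI K.Vs_C[OF finite_Tn iI gw])
 have ad: "Vk ka i (Tn n i) g +[Fk ka] Vk ka i (Tn n i) h = Vk ka i (Tn n i) (%t. g t +[A i] h t)"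
 if "g : Tn n i \<rightarrow> carrier (A i)" "h : Tn n i \<rightarrow> carrier (A i)" for g h by (rule K.Vs_add(1)[OF finite_Tn iI gw that])
 have sm: "c *[Fk ka] Vk ka i (Tn n i) g = Vk ka i (Tn n i) (%t. c *[A i] g t)" if "g : Tn n i \<rightarrow> carrier (A i)" for g c
 by (rule K.Vs_add(2)[OF finite_Tn iI gw that that])
 show "x +[Fk ka] y : Vset ka n i" if "x : Vset ka n i" "y : Vset ka n i" for x y
 using that unfolding Vset_def by (auto simp: ad Pi_iff alg_closed(1)[OF iI] intro!: imageI)
 show scl: "c *[Fk ka] x : Vset ka n i" if "x : Vset ka n i" for x c using that unfolding Vset_def by (auto simp: sm Pi_iff intro!: imageI)
 have V: "Vk ka i (Tn n i) (%t. 1[A i]) : Vset ka n i" for n using one_A[OF iI] by (auto simp: Vset_def)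
 show "0[Fk ka] : Vset ka n i" using scl[OF V, of 0] K.P.F.smult_zero(2)[OF subsetD[OF sub V]] by simp
 show "EE ka (EM ka t @ [(i, S.emb a)]) : Vset ka n i" if t: "t : Tn n i" and a: "K.cen (i, a)"
 proof -
 have "a @: (A i)" using a by (simp add: K.cen_def)
 then have "(%s. if s = t then a else 0[A i]) : Tn n i \<rightarrow> carrier (A i)" by auto
 moreover have "EE ka (EM ka t @ [(i, S.emb a)]) = Vk ka i (Tn n i) (%s. if s = t then a else 0[A i])" by (rule K.Vs_single[OF finite_Tn iI gw t a])
 ultimately show ?thesis unfolding Vset_def by blast
 qed
 have T0: "Tn 0 i = {[]}" by (auto simp: Tn_def Bword_def)
 have "Vk ka i (Tn 0 i) (%t. 1[A i]) = K.vac" unfolding K.Vs_def T0 using K.opw_one[OF iI K.vac_C, of "[]"] K.vac_C by (subst K.P.F.lc_sing) simp_all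
 then show "EE ka [] : Vset ka 0 i" using V[of 0] by simp
qed

text \<open>The span of the tracked words of length n; it contains the left factors of pieces of
  type \<open>None\<close>.\<close>

definition Bset :: "nat option => nat => ('a, (nat => 'b) set) fp_vector set" where
 "Bset ka n = {lc (Fk ka) c (%t. EE ka (EM ka t)) {t. Bword t & length t = n} | c. True}"

lemma Bset_props:
 assumes g: "good ka" shows "0[Fk ka] : Bset ka n" "Bset ka n <= carrier (Fk ka)"
 "x : Bset ka n ==> y : Bset ka n ==> x +[Fk ka] y : Bset ka n"
 "x : Bset ka n ==> c *[Fk ka] x : Bset ka n"
 "Bword t ==> length t = n ==> EE ka (EM ka t) : Bset ka n"
proof -
 interpret K: fpst I A "\<Phi> ka" by (rule K)
 let ?S = "{t. Bword t & length t = n}"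
 have C: "(%t. EE ka (EM ka t)) ` ?S <= carrier (Fk ka)" using Bword_okw[OF g] by auto
 show "Bset ka n <= carrier (Fk ka)" unfolding Bset_def using K.P.F.lc_closed[OF finite_Bword C] by auto
 show sm: "c *[Fk ka] x : Bset ka n" if "x : Bset ka n" for x c using that K.P.F.lc_smult[OF finite_Bword C] unfolding Bset_def by auto
 show "x +[Fk ka] y : Bset ka n" if "x : Bset ka n" "y : Bset ka n" for x y using that K.P.F.lc_add[OF finite_Bword C] unfolding Bset_def by auto
 have "lc (Fk ka) (%_. 1) (%t. EE ka (EM ka t)) ?S : Bset ka n" unfolding Bset_def by blast
 from sm[OF this, of 0] show "0[Fk ka] : Bset ka n" using K.P.F.smult_zero(2)[OF K.P.F.lc_closed[OF finite_Bword C]] by simp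
 show "EE ka (EM ka t) : Bset ka n" if t: "Bword t" "length t = n"
 proof -
 have "{t} <= ?S" "EE ka (EM ka t) @: (Fk ka)" using t C by auto
 then have "EE ka (EM ka t) = lc (Fk ka) (%s. if s : {t} then 1 else 0) (%t. EE ka (EM ka t)) ?S"
 using K.P.F.lc_extend[OF finite_Bword C, of "{t}" "%_. 1"] K.P.F.lc_sing[of "%t. EE ka (EM ka t)" t] by simp
 then show ?thesis unfolding Bset_def by blast
 qed
qed

text \<open>Sorted by last index, each block lies in a right module with words of length n - 1,
  where the bound M is given. The triangle inequality over the indices costs
  \<open>card I0\<close>.\<close>

lemma Bset_bound:
 assumes g: "good ka" and X: "blin (Fk ka) (Fk ka) X" and ne: "I0 ~= {}"
 and M: "!!n i x. [|n <= N; i : I0; x : Vset ka n i|] ==> hnorm (Fk ka) (X x) <= M * hnorm (Fk ka) x" and M0: "M >= 0" and n: "n <= N" and x: "x : Bset ka n"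
 shows "hnorm (Fk ka) (X x) <= real (card I0) * M * hnorm (Fk ka) x"
proof -
 interpret K: fpst I A "\<Phi> ka" by (rule K)
 interpret FF: ip_space2 "Fk ka" "Fk ka" by (rule ip_space2.intro) unfold_locales
 obtain i0 where i0: "i0 : I0" using ne by blast
 let ?S = "{t. Bword t & length t = n}" and ?E = "%t. EE ka (EM ka t)"
 \<comment> \<open>The empty word has no last index and is assigned to i0. For n = 0 the truncated
   difference n - 1 is 0, in agreement with the vacuum lying in \<open>Vset ka 0 i0\<close>.\<close>
 define lab where "lab t = (if t = [] then i0 else fst (last t))" for t :: "('a \<times> (nat option => 'b)) list"
 have C: "?E ` ?S <= carrier (Fk ka)" using Bword_okw[OF g] by auto
 obtain c where c: "x = lc (Fk ka) c ?E ?S" using x by (auto simp: Bset_def)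
 have XC: "(%t. X (?E t)) ` ?S <= carrier (Fk ka)" using C blinD(1)[OF X] by auto
 have blk: "lc (Fk ka) c ?E {t : ?S. lab t = i} : Vset ka (n - 1) i" if i: "i : I0" for i
 proof (rule K.P.F.lc_in_subspace)
 show "finite {t : ?S. lab t = i}" by (rule finite_subset[OF _ finite_Bword[of n]]) auto
 show "?E ` {t : ?S. lab t = i} <= carrier (Fk ka)" using C by auto
 show "?E ` {t : ?S. lab t = i} <= Vset ka (n - 1) i"
 proof (rule image_subsetI)
 fix t assume "t : {t : ?S. lab t = i}"
 then have t: "Bword t" "lab t = i" "n = length t" by auto
 show "?E t : Vset ka (n - 1) i"
 proof (cases t rule: rev_cases)
 case Nil
 then show ?thesis using Vset_props(6)[OF g i] t by simp
 next
 case (snoc s l)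
 obtain u where l: "l = (i, u)" using t snoc by (cases l) (auto simp: lab_def)
 have u: "u : Bs i" and s: "s : Tn (length s) i" using t(1) by (auto simp: snoc l Bword_def Tn_def distinct_adj_append_iff last_map)
 from Vset_props(5)[OF g i s Bs_good(2)[OF g i u]] show ?thesis using t by (simp add: snoc l)
 qed
 qed
 qed (use Vset_props(2-4)[OF g i] in auto)
 have "hnorm (Fk ka) (X x) = hnorm (Fk ka) (lc (Fk ka) c (%t. X (?E t)) ?S)" unfolding c FF.blin_lc[OF X finite_Bword C] ..
 also have "... <= (SUM i:I0. hnorm (Fk ka) (lc (Fk ka) c (%t. X (?E t)) {t : ?S. lab t = i}))"
 using i0 by (intro K.P.F.block_triangle finite_Bword XC I0(1)) (auto simp: lab_def Bword_def)
 also have "... <= (SUM i:I0. M * hnorm (Fk ka) x)"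
 proof (rule sum_mono)
 fix i assume i: "i : I0"
 have F: "finite {t : ?S. lab t = i}" "?E ` {t : ?S. lab t = i} <= carrier (Fk ka)"
 using finite_subset[OF _ finite_Bword[of n], of "{t : ?S. lab t = i}"] C by auto
 have "hnorm (Fk ka) (lc (Fk ka) c (%t. X (?E t)) {t : ?S. lab t = i}) = hnorm (Fk ka) (X (lc (Fk ka) c ?E {t : ?S. lab t = i}))"
 unfolding FF.blin_lc[OF X F] ..
 also have "... <= M * hnorm (Fk ka) (lc (Fk ka) c ?E {t : ?S. lab t = i})" using n by (intro M[OF _ i blk[OF i]]) simp
 also have "... <= M * hnorm (Fk ka) x" unfolding c
 proof (intro mult_left_mono K.P.F.block_le finite_Bword C M0)
 fix s t assume "s : ?S" "t : ?S" "lab s ~= lab t"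
 then show "ip (Fk ka) (?E s) (?E t) = 0" using Bword_okw[OF g] Bword_kern[OF g] by (auto simp: K.P.ip_E)
 qed
 finally show "hnorm (Fk ka) (lc (Fk ka) c (%t. X (?E t)) {t : ?S. lab t = i}) <= M * hnorm (Fk ka) x" .
 qed
 finally show ?thesis by simp
qed

text \<open>\<open>slot_bound\<close> concerns the perturbed operator, the hypotheses concern
  \<open>rho f\<close>. Their distance d enters twice: on the left factors, and again on the cyclic
  vectors.\<close>

lemma approx_bound:
 assumes g: "good ka" and ne: "I0 ~= {}" and f: "f @: FA" and sf: "ALL s:fsupp f. length s <= N & (ALL l:set s. fst l : I0 & snd l : L (fst l))"
 and M0: "M >= 0" and M: "!!n i x. [|n <= N; i : I0; x : Vset ka n i|] ==> hnorm (Fk ka) (rk ka f x) <= M * hnorm (Fk ka) x"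
 and d0: "d >= 0" and d: "!!v. v @: (Fk ka) ==> hdist (Fk ka) (Xt ka f v) (rk ka f v) <= d * hnorm (Fk ka) v"
 shows "gk ka (cls f) <= (real (N + 1) * real (card I0 + 1) * real (2 * N + 2)) * (real (card I0) * M + d) + d"
proof -
 interpret K: fpst I A "\<Phi> ka" by (rule K)
 interpret SL: slots I K.GH K.GX I0 N "BB ka" "WW ka" K.cem "ta ka" L by (rule slots_good[OF g])
 let ?M = "real (card I0) * M + d" and ?K = "real (N + 1) * real (card I0 + 1) * real (2 * N + 2)"
 \<comment> \<open>Left factors of type \<open>None\<close> are tracked words; those of type
   \<open>Some i\<close> end in a centred letter of index i and lie in a right module.\<close>
 define D where "D l = (case snd l of None => Bset ka (fst l) | Some i => Vset ka (fst l) i)" for l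
 have XtC: "Xt ka f v @: (Fk ka)" if v: "v @: (Fk ka)" for v
 proof (rule K.P.F.lc_closed[OF FA_fin[OF f]], rule image_subsetI)
 fix s assume "s : fsupp f"
 then show "oT ka s v @: (Fk ka)" using sf I0 tau_bounded by (intro blinD(1)[OF K.P.blin_opT v]) fastforce
 qed
 have c1: "1 <= real (card I0)" using ne I0(1) by (simp add: Suc_le_eq card_gt_0_iff)
 have Xb: "hnorm (Fk ka) (Xt ka f x) <= ?M * hnorm (Fk ka) x" if nl: "fst l <= N" "snd l : insert None (Some ` I0)" and x: "x : D l" for x l
 proof -
 have "x @: (Fk ka) & hnorm (Fk ka) (rk ka f x) <= real (card I0) * M * hnorm (Fk ka) x"
 proof (cases "snd l")
 case None
 then have xB: "x : Bset ka (fst l)" using x by (simp add: D_def)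
 have "hnorm (Fk ka) (rk ka f x) <= real (card I0) * M * hnorm (Fk ka) x" by (rule Bset_bound[OF g K.blin_rho[OF f] ne _ M0 nl(1) xB]) (rule M)
 then show ?thesis using Bset_props(2)[OF g] xB by blast
 next
 case (Some i)
 then have i: "i : I0" and xV: "x : Vset ka (fst l) i" using nl x by (auto simp: D_def)
 have xC: "x @: (Fk ka)" using Vset_props(1)[OF g i] xV by blast
 have "1 * (M * hnorm (Fk ka) x) <= real (card I0) * (M * hnorm (Fk ka) x)" using c1 M0 xC by (intro mult_right_mono) auto
 then show ?thesis using M[OF nl(1) i xV] xC by (simp add: mult.assoc)
 qed
 then have xC: "x @: (Fk ka)" and "hnorm (Fk ka) (rk ka f x) <= real (card I0) * M * hnorm (Fk ka) x" by auto
 then show ?thesis using K.P.F.fn_le_vd[OF XtC[OF xC] K.rho_C[OF f xC]] d[OF xC] by (simp add: distrib_right)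
 qed
 have Dp: "E : D l" if nl: "fst l <= N" "snd l : insert None (Some ` I0)" and ur: "(u, r) : SL.piece l" and E: "E = K.P.E u" for u r l E
 proof -
 have oku: "distinct_adj (map fst u)" using SL.piece_okw[OF ur] by (auto simp: K.P.okw_def)
 show ?thesis
 proof (cases "snd l")
 case None
 then have "SL.Bw u" "length u = fst l" using ur by (auto simp: SL.piece_def)
 then obtain t where t: "Bword t" "EM ka t = u" using Bw_word[OF g _ oku] by (auto simp: SL.Bw_def)
 then have "length t = fst l" using \<open>length u = fst l\<close> by (auto simp: K.emw_def evl_def)
 from Bset_props(5)[OF g t(1) this] show ?thesis using None t(2) by (simp add: D_def E)
 next
 case (Some i)
 then obtain w h where w: "i : I0" "u = w @ [(i, h)]" "SL.Bw w" "length w = fst l" "h : K.cem i" using ur by (auto simp: SL.piece_def)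
 then have dw: "distinct_adj (map fst w)" "w = [] \<or> fst (last w) ~= i" using oku by (auto simp: distinct_adj_append_iff last_map)
 obtain a where a: "h = K.em i a" "K.cen (i, a)" using w(5) by (auto simp: K.cem_def)
 obtain t where t: "Bword t" "EM ka t = w" using Bw_word[OF g _ dw(1)] w(3) by (auto simp: SL.Bw_def)
 have mt: "map fst t = map fst w" using t(2) by (metis K.emw_simps(4) evl_simps(4))
 then have "length t = fst l" "t = [] \<longleftrightarrow> w = []" using w(4) by (metis length_map, metis map_is_Nil_conv)
 moreover have "t ~= [] ==> fst (last t) = fst (last w)" using mt by (metis last_map map_is_Nil_conv)
 ultimately have "t : Tn (fst l) i" using t(1) dw(2) by (auto simp: Tn_def)
 from Vset_props(5)[OF g w(1) this a(2)] show ?thesis using Some t(2) by (simp add: D_def E w(2) a(1))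
 qed
 qed
 show ?thesis
 proof (rule K.Psi.gn_le)
 show "cls f @: PA" using f by auto
 show "0 <= ?K * ?M + d" using M0 d0 by simp
 fix x assume "x @: PA"
 then obtain h where h: "h @: FA" "x = cls h" by (auto simp: PA_carrier)
 let ?y = "rk ka h K.vac"
 have yC: "?y @: (Fk ka)" using h K.vac_C by auto
 have "?y : K.gspan" using h by (intro K.rvec_gspan) (auto simp: K.rvec_iff)
 then obtain c Y where Y: "finite Y" "!!w. w : Y ==> K.P.okw w & (ALL l:set w. snd l : K.cem (fst l))" "?y = lc (Fk ka) c K.P.E Y" by (rule K.gspanE) blast
 have "hnorm (Fk ka) (Xt ka f ?y) <= ?K * ?M * hnorm (Fk ka) ?y" unfolding Y(3)
 proof (rule SL.slot_bound[OF FA_fin[OF f] _ _ _ Y(1,2), where D = D])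
 show "SL.Lw s & length s <= N" if "s : fsupp f" for s using sf that by (auto simp: SL.Lw_def)
 show "0 <= ?M" using M0 d0 by simp
 fix l :: "nat \<times> 'a option" assume nl: "fst l <= N" "snd l : insert None (Some ` I0)"
 show "0[Fk ka] : D l & (ALL x:D l. ALL y:D l. x +[Fk ka] y : D l) & (ALL a. ALL x:D l. a *[Fk ka] x : D l) &
 (ALL u r. (u, r) : SL.piece l --> K.P.E u : D l) & (ALL x:D l. hnorm (Fk ka) (Xt ka f x) <= ?M * hnorm (Fk ka) x)"
 proof (intro conjI)
 show "0[Fk ka] : D l" "ALL x:D l. ALL y:D l. x +[Fk ka] y : D l" "ALL a. ALL x:D l. a *[Fk ka] x : D l"
 using nl(2) Bset_props(1,3,4)[OF g] Vset_props(2,3,4)[OF g] by (auto simp: D_def)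
 qed (use Dp[OF nl] Xb[OF nl] in blast)+
 qed auto
 then have "hnorm (Fk ka) (rk ka f ?y) <= (?K * ?M + d) * hnorm (Fk ka) ?y"
 using K.P.F.fn_le_vd[OF K.rho_C[OF f yC] XtC[OF yC]] d[OF yC] K.P.F.vd_sym[OF K.rho_C[OF f yC] XtC[OF yC]] by (simp add: distrib_right)
 then show "K.Psi.fn (cls f .[PA] x) <= (?K * ?M + d) * K.Psi.fn x" using f h by (simp add: cls_ring FA_closed K.psi_norm K.rho_mult K.vac_C)
 qed
qed

text \<open>Finitely many right modules occur, so their bounds hold simultaneously from some k on;
  the strict inequality below c absorbs all the errors.\<close>

lemma upper_bound:
 assumes ne: "I0 ~= {}" and f: "f @: FA" and sf: "ALL s:fsupp f. length s <= N & (ALL l:set s. fst l : I0 & snd l : L (fst l))"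
 and c: "(real (N + 1) * real (card I0 + 1) * real (2 * N + 2)) * real (card I0) * gk None (cls f) < c"
 shows "\<forall>\<^sub>F k in sequentially. gk (Some k) (cls f) < c"
proof -
 interpret N: fpst I A "\<Phi> None" by (rule K)
 let ?K = "real (N + 1) * real (card I0 + 1) * real (2 * N + 2)" and ?g = "gk None (cls f)"
 have g0: "?g >= 0" using f by auto
 \<comment> \<open>The total coefficient of e in \<open>approx_bound\<close> stands in the
   denominator, so the errors add up to half of the gap below c.\<close>
 define e where "e = (c - ?K * real (card I0) * ?g) / (2 * (?K * real (card I0) + ?K + 1))"
 have pos: "?K * real (card I0) + ?K + 1 > 0" by (intro add_nonneg_pos add_nonneg_nonneg mult_nonneg_nonneg) auto
 then have e: "e > 0" using c by (simp add: e_def)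
 have "?K * (real (card I0) * (?g + e) + e) + e = ?K * real (card I0) * ?g + (?K * real (card I0) + ?K + 1) * e" by (simp add: algebra_simps)
 also have "... = ?K * real (card I0) * ?g + (c - ?K * real (card I0) * ?g) / 2"
 proof -
 have "p * (x / (2 * p)) = x / 2" if "p > 0" for p x :: real using that by simp
 from this[OF pos] show ?thesis unfolding e_def by presburger
 qed
 also have "... < c"
 proof -
 have "x + (y - x) / 2 < y" if "x < y" for x y :: real using that by (simp add: field_simps)
 from this[OF c] show ?thesis .
 qed
 finally have lt: "?K * (real (card I0) * (?g + e) + e) + e < c" .
 have sf': "ALL s:fsupp f. ALL l:set s. fst l : I0 & snd l : L (fst l)" using sf by blast
 have "\<forall>\<^sub>F k in sequentially. ALL h:Tn n i \<rightarrow> carrier (A i).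
 hnorm (Fk (Some k)) (rk (Some k) f (Vk (Some k) i (Tn n i) h)) <= (?g + e) * hnorm (Fk (Some k)) (Vk (Some k) i (Tn n i) h)" if i: "i : I0" for i n
 proof (rule module_norm[OF finite_Tn _ _ _ f e])
 show "CEw t" if "t : Tn n i" for t using that Bword_CEw by (auto simp: Tn_def)
 show "i : I" using i I0 by auto
 show "ev (%ka. goodT ka i n (Tn n i))" by (rule ev_mono[OF ev_good good_goodT])
 qed
 then have "\<forall>\<^sub>F k in sequentially. ALL n:{..N}. ALL i:I0. ALL x:Vset (Some k) n i. hnorm (Fk (Some k)) (rk (Some k) f x) <= (?g + e) * hnorm (Fk (Some k)) x"
 using I0(1) by (simp add: eventually_ball_finite_distrib Vset_def)
 moreover have "\<forall>\<^sub>F k in sequentially. good (Some k)" using ev_good by (simp add: ev_def)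
 ultimately show ?thesis using rho_approx[OF f sf' e]
 proof eventually_elim
 case (elim k)
 have "gk (Some k) (cls f) <= ?K * (real (card I0) * (?g + e) + e) + e" by (rule approx_bound[OF elim(2) ne f sf]) (use elim g0 e in auto)
 then show ?case using lt by linarith
 qed
qed

end

section \<open>Strong convergence of free products\<close>

primrec sqpow :: "('a, 'm) star_algebra_scheme => 'a => nat => 'a" where
 "sqpow A a 0 = star A a .[A] a"
| "sqpow A a (Suc m) = sqpow A a m .[A] sqpow A a m"

lemma (in unital_star_algebra) sqpow_props:
 assumes "a @: A" shows "sqpow A a m @: A & star A (sqpow A a m) = sqpow A a m" using assms by (induction m) (simp_all add: star_closed star_mult star_star)

text \<open>The C*-identity, iterated on the power 2^m of star a a. The upper estimate serves the
  limit state and the lower one the states of the sequence.\<close>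

lemma (in star_state) gn_sqpow:
 assumes a: "a @: A" shows "(gn a) ^ (2 ^ Suc m) <= gn (sqpow A a m)" "gn (sqpow A a m) <= (gn a) ^ (2 ^ Suc m)"
proof (induction m)
 case 0
 case 1
 show ?case using gn_sq_le[OF a] by simp
 case 2
 show ?case using gn_mult[OF star_closed[OF a] a] gn_star_le[OF a] mult_right_mono[OF gn_star_le[OF a] gn_ge0[OF a]] by (simp add: power2_eq_square)
next
 case (Suc m)
 note p = sqpow_props[OF a, of m]
 have e: "x ^ (2 ^ Suc (Suc m)) = (x ^ (2 ^ Suc m))^2" for x :: real by (simp add: power_mult mult.commute flip: power_mult)
 case 1
 have "((gn a) ^ (2 ^ Suc m))^2 <= (gn (sqpow A a m))^2" using Suc(1) a by (intro power_mono) auto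
 moreover have "(gn (sqpow A a m))^2 <= gn (sqpow A a m \<otimes> sqpow A a m)" using gn_sq_le[of "sqpow A a m"] p by simp
 ultimately show ?case unfolding e sqpow.simps by (rule order_trans)
 case 2
 have "(gn (sqpow A a m))^2 <= ((gn a) ^ (2 ^ Suc m))^2" using Suc(2) p by (intro power_mono) auto
 moreover have "gn (sqpow A a m \<otimes> sqpow A a m) <= (gn (sqpow A a m))^2" using gn_mult[of "sqpow A a m" "sqpow A a m"] p by (simp add: power2_eq_square)
 ultimately show ?case unfolding e sqpow.simps by (rule order_trans[rotated])
qed

context fpalg
begin

lemma sqpow_cls: "f @: FA ==> sqpow PA (cls f) m = cls (sqpow FA f m)" using FA.sqpow_props[of f] by (induction m) (simp_all add: cls_simps)

lemma sqpow_words: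
 assumes f: "f @: FA" and d: "!!w. w : fsupp f ==> length w <= d & set w <= X" and X: "!!i a. (i, a) : X ==> (i, star (A i) a) : X"
 shows "w : fsupp (sqpow FA f m) ==> length w <= d * 2 ^ Suc m & set w <= X"
proof (induction m arbitrary: w)
 case 0
 then obtain u v where w: "w = u @ v" "u : fsupp (star FA f)" "v : fsupp f" using fsupp_conv by (force simp: FA_ops(1))
 then have "ws u : fsupp f" "u : W" by (auto simp: FA_ops fsupp_def split: if_splits)
 then have "length (ws u) <= d" "set (ws u) <= X" "u = ws (ws u)" using d ws_W by auto
 moreover have "length (ws u) = length u" by (simp add: word_star_def)
 moreover have "set (ws v) <= X" if "set v <= X" for v using that X by (auto simp: word_star_def)
 ultimately have "length u <= d" "set u <= X" by metis+
 then show ?case using d[OF w(3)] w(1) by auto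
next
 case (Suc m)
 then obtain u v where w: "w = u @ v" "u : fsupp (sqpow FA f m)" "v : fsupp (sqpow FA f m)" using fsupp_conv by (force simp: FA_ops(1))
 then show ?case using Suc.IH[OF w(2)] Suc.IH[OF w(3)] by auto
qed

end

context fpconv
begin

lemma mo_const: "mo ka [] = 1"
proof -
 interpret K: fpst I A "\<Phi> ka" by (rule K)
 show ?thesis by (simp add: K.mom_def K.P.ip_E)
qed

lemma psi_pair: "f @: FA ==> fp_state I A (\<Phi> ka) (cls f) = pair f (mo ka)"
proof -
 assume f: "f @: FA"
 interpret K: fpst I A "\<Phi> ka" by (rule K)
 show ?thesis using f by (simp add: K.psi_cls K.ip_rho K.vac_C K.mom_def[abs_def])
qed

lemma psi_cv: "f @: FA ==> cv (%ka. fp_state I A (\<Phi> ka) (cls f))"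
proof -
 assume f: "f @: FA"
 have "cv (%ka. mo ka w)" if w: "w : fsupp f" for w
 proof (cases w)
 case Nil
 then show ?thesis by (simp add: mo_const cv_def)
 next
 case (Cons l v)
 have W: "w : W" using w FA_sub[OF f] by blast
 then have "fst l : I" using Cons by (cases l) (auto simp: W_Cons)
 from mo_cv[OF CEw_cst[OF W] this] show ?thesis by (simp add: evl_cst)
 qed
 then show ?thesis unfolding cv_def psi_pair[OF f] pair_def by (intro tendsto_sum tendsto_mult tendsto_const) auto
qed

abbreviation "pn ka == form_norm (gns_form PA (fp_state I A (\<Phi> ka)))"

lemma PS: "star_state PA (fp_state I A (\<Phi> ka))" by (rule fpst.star_state_psi[OF K])

lemma pn_cv: "x @: PA ==> cv (%ka. pn ka x)"
proof -
 assume "x @: PA"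
 then obtain f where f: "f @: FA" "x = cls f" by (auto simp: PA_carrier)
 have "cv (%ka. fp_state I A (\<Phi> ka) (star PA x .[PA] x))" using psi_cv[of "star FA f .[FA] f"] f by (simp add: cls_simps)
 then show ?thesis unfolding form_norm_def gns_form_def cv_def by (intro tendsto_real_sqrt tendsto_Re)
qed

text \<open>A norm is a supremum of ratios over vectors of the algebra. One x whose ratio exceeds c
  in the limit does so eventually, since both of its seminorms converge.\<close>

lemma gk_lower:
 assumes a: "a @: PA" and c: "c < gk None a" shows "\<forall>\<^sub>F k in sequentially. c < gk (Some k) a"
proof (cases "c < 0")
 case True
 then show ?thesis using star_state.gn_ge0[OF PS a] by (intro always_eventually allI) (rule less_le_trans)
next
 case False
 then obtain x where x: "x @: PA" "c * pn None x < pn None (a .[PA] x)" using star_state.gn_le[OF PS a, of c None] c by fastforce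
 have ax: "a .[PA] x @: PA" using a x(1) by simp
 have "\<forall>\<^sub>F k in sequentially. 0 < pn (Some k) (a .[PA] x) - c * pn (Some k) x"
 using pn_cv[OF ax] pn_cv[OF x(1)] x(2) unfolding cv_def by (intro order_tendstoD(1)[OF tendsto_diff[OF _ tendsto_mult_left]]) auto
 then show ?thesis
 proof eventually_elim
 case (elim k)
 interpret S: star_state PA "fp_state I A (\<Phi> (Some k))" by (rule PS)
 have lt: "c * S.fn x < gk (Some k) a * S.fn x" using elim S.gn_bound[OF a x(1)] by linarith
 then show ?case using S.C.fn_ge0[OF x(1)] by (simp add: mult_less_cancel_right)
 qed
qed

text \<open>\<open>upper_bound\<close> is applied to a power of star f f. The norm of the power in
  the limit grows like the n-th power of a number below c, so c^n beats the polynomial factor, and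
  an n-th root gives the claim along the sequence.\<close>

lemma gk_upper:
 assumes f: "f @: FA" and c: "gk None (cls f) < c" and ne: "I ~= {}" shows "\<forall>\<^sub>F k in sequentially. gk (Some k) (cls f) < c"
proof -
 obtain i0 where i0: "i0 : I" using ne by blast
 let ?g = "gk None (cls f)"
 have g0: "?g >= 0" using star_state.gn_ge0[OF PS cls_C[OF f]] .
 define d where "d = Max (insert 0 (length ` fsupp f))"
 have dl: "length w <= d" if "w : fsupp f" for w unfolding d_def using FA_fin[OF f] that by (intro Max_ge) auto
 define X0 where "X0 = \<Union> (set ` fsupp f)"
 \<comment> \<open>Closed under star, so that the letters of all powers of star f f stay in
   X.\<close>
 define X where "X = X0 \<union> (%(i, a). (i, star (A i) a)) ` X0"
 have X0: "finite X0" "X0 <= (SIGMA i:I. carrier (A i))" using FA_fin[OF f] FA_sub[OF f] by (auto simp: X0_def fp_words_def)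
 have Xc: "finite X" "i : I & a @: (A i)" if "(i, a) : X" for i a using X0 that unital_star_algebra.star_closed[OF alg] by (auto simp: X_def)
 have finX: "finite X" using X0 by (simp add: X_def)
 have Xs: "(i, star (A i) a) : X" if "(i, a) : X" for i a using that X0 unital_star_algebra.star_star[OF alg] by (force simp: X_def)
 \<comment> \<open>The index i0 keeps \<open>I0\<close> nonempty when f involves the empty word
   only.\<close>
 define I0 where "I0 = insert i0 (fst ` X)"
 define L where "L i = {a. (i, a) : X}" for i
 have I0: "finite I0" "I0 <= I" using finX Xc i0 by (auto simp: I0_def)
 have L: "finite (L i)" "L i <= carrier (A i)" for i
 proof -
 have "L i <= snd ` X" by (force simp: L_def)
 then show "finite (L i)" using finX finite_surj by blast
 show "L i <= carrier (A i)" using Xc by (auto simp: L_def)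
 qed
 have "ALL i:I0. EX Os. levels (A i) (%ka. \<Phi> ka i) (L i) Os"
 proof
 fix i assume "i : I0"
 then have i: "i : I" using I0 by blast
 interpret S: sconv "A i" "%ka. \<Phi> ka i" by (rule sc[OF i])
 obtain Os where "Os 0 = {%ka. 1[A i]}" "ALL m. S.onf (Os m) & Os m <= Os (Suc m) & (ALL u:Os m. ALL a:L i. S.cap (Os (Suc m)) (%ka. star (A i) a .[A i] u ka))"
 using S.levels_ex[OF L] by blast
 then have "levels (A i) (%ka. \<Phi> ka i) (L i) Os" by (intro levels.intro S.sconv_axioms levels_axioms.intro L) auto
 then show "EX Os. levels (A i) (%ka. \<Phi> ka i) (L i) Os" by (rule exI[of _ Os])
 qed
 then obtain Os where Os: "!!i. i : I0 ==> levels (A i) (%ka. \<Phi> ka i) (L i) (Os i)" by metis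
 \<comment> \<open>Strictly between the limit norm and c, and positive even when that norm is 0, as
   \<open>exp_beats_poly\<close> requires.\<close>
 define g1 where "g1 = (?g + c) / 2"
 have g1: "0 < g1" "?g < g1" "g1 < c" using c g0 by (auto simp: g1_def)
 \<comment> \<open>N + 1 is at most (d + 1)(1 + n), so the constant of \<open>upper_bound\<close> is
   at most a (1 + n)^2; the factor 2 comes from 2N + 2.\<close>
 define a where "a = 2 * (real d + 1)^2 * (real (card I0) + 1) * real (card I0)"
 have cI: "card I0 > 0" using I0(1) by (simp add: I0_def card_gt_0_iff)
 have a0: "a > 0" unfolding a_def using cI by (intro mult_pos_pos add_nonneg_pos zero_less_power) auto
 obtain m0 where m0: "!!m. m >= m0 ==> (a * (1 + real m)^2) * g1 ^ m <= c ^ m" using exp_beats_poly[OF g1(1,3)] by blast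
 define n where "n = (2::nat) ^ Suc m0"
 have n: "n >= m0" "n > 0" unfolding n_def using less_exp[of "Suc m0"] by (linarith, simp)
 define N where "N = d * n"
 let ?p = "sqpow FA f m0"
 have pC: "?p @: FA" using FA.sqpow_props[OF f] by blast
 interpret AP: fpapprox I A \<Phi> I0 L N Os by (intro fpapprox.intro fpconv_axioms fpapprox_axioms.intro I0 Os)
 have "real (N + 1) <= (real d + 1) * (1 + real n)" by (simp add: N_def algebra_simps)
 then have "real (N + 1) * real (N + 1) <= ((real d + 1) * (1 + real n)) * ((real d + 1) * (1 + real n))" by (intro mult_mono) auto
 then have "(real (N + 1) * real (N + 1)) * (2 * (real (card I0) + 1) * real (card I0)) <=
 (((real d + 1) * (1 + real n)) * ((real d + 1) * (1 + real n))) * (2 * (real (card I0) + 1) * real (card I0))" by (rule mult_right_mono) simp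
 then have Kb: "(real (N + 1) * real (card I0 + 1) * real (2 * N + 2)) * real (card I0) <= a * (1 + real n)^2"
 by (simp add: a_def power2_eq_square algebra_simps)
 have "(real (N + 1) * real (card I0 + 1) * real (2 * N + 2)) * real (card I0) * gk None (cls ?p) <= (a * (1 + real n)^2) * ?g ^ n"
 using star_state.gn_sqpow(2)[OF PS cls_C[OF f], of None m0] star_state.gn_ge0[OF PS cls_C[OF pC], of None] a0
 by (intro mult_mono Kb) (simp_all add: sqpow_cls[OF f] n_def)
 also have "... < (a * (1 + real n)^2) * g1 ^ n" using g0 g1 n a0 by (intro mult_strict_left_mono power_strict_mono mult_pos_pos zero_less_power) auto
 also have "... <= c ^ n" by (rule m0[OF n(1)])
 finally have lt: "(real (N + 1) * real (card I0 + 1) * real (2 * N + 2)) * real (card I0) * gk None (cls ?p) < c ^ n" .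
 have "ALL s:fsupp ?p. length s <= N & (ALL l:set s. fst l : I0 & snd l : L (fst l))"
 proof
 fix s assume "s : fsupp ?p"
 then have "length s <= d * 2 ^ Suc m0 & set s <= X" by (rule sqpow_words[OF f _ Xs, rotated 2]) (use dl in \<open>auto simp: X_def X0_def\<close>)
 then show "length s <= N & (ALL l:set s. fst l : I0 & snd l : L (fst l))" by (auto simp: N_def n_def I0_def L_def)
 qed
 from AP.upper_bound[OF _ pC this lt] have "\<forall>\<^sub>F k in sequentially. gk (Some k) (cls ?p) < c ^ n" by (auto simp: I0_def)
 then show ?thesis
 proof eventually_elim
 case (elim k)
 have "gk (Some k) (cls f) ^ n < c ^ n" using star_state.gn_sqpow(1)[OF PS cls_C[OF f], of "Some k" m0] elim by (simp add: sqpow_cls[OF f] n_def)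
 then show ?case using c g0 by (auto intro: power_less_imp_less_base)
 qed
qed

lemma gk_cv:
 assumes x: "x @: PA" shows "cv (%ka. gk ka x)"
proof -
 obtain f where f: "f @: FA" "x = cls f" using x by (auto simp: PA_carrier)
 have "\<forall>\<^sub>F k in sequentially. gk (Some k) x < c" if c: "gk None x < c" for c
 proof (cases "I = {}")
 \<comment> \<open>Without indices the empty word is the only word, so all the states agree.\<close>
 case True
 have ps: "fp_state I A (\<Phi> ka) y = fp_state I A (\<Phi> None) y" if "y @: PA" for y ka
 proof -
 obtain g where g: "g @: FA" "y = cls g" using \<open>y @: PA\<close> by (auto simp: PA_carrier)
 have wn: "w = []" if "w : fsupp g" for w using FA_sub[OF g(1)] that True by (auto simp: fp_words_def)
 then show ?thesis unfolding g(2) psi_pair[OF g(1)] by (intro pair_cong) (use wn mo_const in metis)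
 qed
 have eq: "pn ka y = pn None y" if y: "y @: PA" for y ka
 proof -
 have "star PA y .[PA] y @: PA" using y PA.star_closed[OF y] by simp
 from ps[OF this, of ka] show ?thesis unfolding form_norm_def gns_form_def by (rule arg_cong)
 qed
 have "gk ka x <= gk None x" for ka
 proof (rule star_state.gn_le[OF PS x star_state.gn_ge0[OF PS x]])
 show "pn ka (x .[PA] y) <= gk None x * pn ka y" if "y @: PA" for y
 proof -
 have "x .[PA] y @: PA" using x that by simp
 then show ?thesis unfolding eq[OF that, of ka] using eq star_state.gn_bound[OF PS x that] by (metis (no_types))
 qed
 qed
 then show ?thesis using c by (auto intro: always_eventually le_less_trans)
 next
 case False
 then show ?thesis using gk_upper f c by simp
 qed
 then show ?thesis unfolding cv_def using gk_lower[OF x] by (intro order_tendstoI)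
qed

end
theorem theorem4p2:
  fixes I :: "'i set"
    and A :: "'i \<Rightarrow> 'a star_algebra"
    and B :: "'i \<Rightarrow> 'b normed_star_algebra"
    and j :: "'i \<Rightarrow> 'a \<Rightarrow> 'b"
    and \<phi>k :: "nat \<Rightarrow> 'i \<Rightarrow> 'a \<Rightarrow> complex"
    and \<phi> :: "'i \<Rightarrow> 'a \<Rightarrow> complex"
  assumes algebras: "\<And>i. i \<in> I \<Longrightarrow> unital_star_algebra (A i)"
    and cstar: "\<And>i. i \<in> I \<Longrightarrow> unital_cstar_algebra (B i)"
    and embedding: "\<And>i. i \<in> I \<Longrightarrow> unital_star_hom (A i) (B i) (j i)"
      "\<And>i. i \<in> I \<Longrightarrow> inj_on (j i) (carrier (A i))"
    and states: "\<And>k i. i \<in> I \<Longrightarrow> state (A i) (\<phi>k k i)"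
    and limit_states: "\<And>i. i \<in> I \<Longrightarrow> state (A i) (\<phi> i)"
    and convergence: "\<And>i. i \<in> I \<Longrightarrow> strongly_converges (A i) (\<lambda>k. \<phi>k k i) (\<phi> i)"
  shows "strongly_converges (fp_algebra I A) (\<lambda>k. fp_state I A (\<phi>k k)) (fp_state I A \<phi>)"
proof -
 \<comment> \<open>The limit states become the value at \<open>None\<close>, so that limit and
   sequence fall under the same lemmas.\<close>
 define \<Phi> where "\<Phi> ka = (case ka of None => \<phi> | Some k => \<phi>k k)" for ka
 have P: "\<Phi> None = \<phi>" "\<Phi> (Some k) = \<phi>k k" for k by (simp_all add: \<Phi>_def)
 have "sconv (A i) (%ka. \<Phi> ka i)" if i: "i : I" for i
 proof (intro sconv.intro sconv_axioms.intro algebras[OF i])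
 show st: "state (A i) (\<Phi> ka i)" for ka using states[OF i] limit_states[OF i] by (cases ka) (simp_all add: P)
 fix c assume c: "c @: (A i)"
 show "cv (%ka. \<Phi> ka i c)" "cv (%ka. star_state.gn (A i) (\<Phi> ka i) c)"
 using convergence[OF i] c star_state.gn_def[OF star_state.intro[OF algebras[OF i] star_state_axioms.intro[OF st]]]
 by (simp_all add: strongly_converges_def cv_def P)
 qed
 then interpret fpconv I A \<Phi> by (intro fpconv.intro fpalg.intro algebras fpconv_axioms.intro)
 show ?thesis unfolding strongly_converges_def
 proof (intro conjI allI ballI)
 show "state (fp_algebra I A) (fp_state I A (\<phi>k k))" for k using star_state.state[OF PS, of "Some k"] by (simp add: P)
 show "state (fp_algebra I A) (fp_state I A \<phi>)" using star_state.state[OF PS, of None] by (simp add: P)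
 fix c assume c: "c @: (fp_algebra I A)"
 then obtain f where "f @: FA" "c = cls f" by (auto simp: PA_carrier)
 then show "(%k. fp_state I A (\<phi>k k) c) ----> fp_state I A \<phi> c" using psi_cv by (auto simp: cv_def P)
 show "(%k. op_norm (gns_space (fp_algebra I A) (fp_state I A (\<phi>k k))) (gns_rep (fp_algebra I A) (fp_state I A (\<phi>k k)) c))
 ----> op_norm (gns_space (fp_algebra I A) (fp_state I A \<phi>)) (gns_rep (fp_algebra I A) (fp_state I A \<phi>) c)"
 using gk_cv[OF c] by (simp add: cv_def P star_state.gn_def[OF PS])
 qed
qed

end
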